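(* Let $N$ be a finite-dimensional smooth manifold and $p:H\to N$ a field of Hilbert spaces. Let $\{U_i\}_{i\in I}$ be an open cover of $N$ and $\{\mathcal H_i\}_{i\in I}$ a family of Hilbert spaces, and assume that for each $\lambda\in U_i$ there is a unitary operator $T_i(\lambda):\mathcal H(\lambda)\to\mathcal H_i$. Let $\tau_{ij}:U_i\cap U_j\to\mathcal B(\mathcal H_i,\mathcal H_j)$ be given by $\tau_{ij}(\lambda)=T_j(\lambda)T_i^*(\lambda)$. The following statements are equivalent: a) There exists a Banach manifold structure on $H$ such that the open cover $\{U_i\}_{i\in I}$ together with the Hilbert spaces $\{\mathcal H_i\}_{i\in I}$ and the unitary operators $T_i(\lambda)$ defines a smooth Hilbert bundle structure on $p:H\to N$. b) Each $\tau_{ij}$ is strongly smooth, i.e. the map $\lambda\mapsto\tau_{ij}(\lambda)x$ belongs to $C^\infty(U_i\cap U_j,\mathcal H_j)$ for each $x\in\mathcal H_i$. c) Each $\tau_{ij}$ belongs to $\mathfrak A^\infty(P^\infty(U_i\cap U_j,\mathcal H_i),P^\infty(U_i\cap U_j,\mathcal H_j))$.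
   Context: A field of Hilbert spaces is a surjective map $p:H\to N$ such that each $\mathcal H(\lambda)=p^{-1}(\lambda)$ is a complex Hilbert space. The family $(U_i,\mathcal H_i,T_i)_{i\in I}$ defines a smooth Hilbert bundle structure on $p:H\to N$ if $H$ is a Banach manifold, $p$ is smooth and every map $\mathcal T_i:p^{-1}(U_i)\to U_i\times\mathcal H_i$, $\mathcal T_i(x)=(p(x),T_i(p(x))x)$, is a diffeomorphism. For an open $U\subseteq N$ and a Hilbert space $\mathcal K$, $P^\infty(U,\mathcal K)$ is the space of functions $f\in C^\infty(U,\mathcal K)$ of the form $f(\lambda)=\sum_{l=1}^n a_l(\lambda)x_l$ with $a_l\in C^\infty(U)$ (complex-valued) and $x_l\in\mathcal K$. For a field of bounded operators $A(\lambda):\mathcal K_1\to\mathcal K_2$, $\lambda\in U$, write $(Af)(\lambda)=A(\lambda)f(\lambda)$ and $(A^*g)(\lambda)=A(\lambda)^*g(\lambda)$; then $A\in\mathfrak A^\infty(P^\infty(U,\mathcal K_1),P^\infty(U,\mathcal K_2))$ means that $A$ maps $P^\infty(U,\mathcal K_1)$ into $C^\infty(U,\mathcal K_2)$ and $A^*$ maps $P^\infty(U,\mathcal K_2)$ into $C^\infty(U,\mathcal K_1)$. *)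

theory Defs
  imports "HOL-Analysis.Analysis" "HOL-Algebra.Algebraic_Closure_Type"
begin

text \<open>
  The fibres of a field of Hilbert spaces, the typical fibres and the model spaces of a Banach
  manifold form families of pairwise different spaces, so spaces are carrier-based. A vector space
  is a module of HOL-Algebra over the ring of a scalar type; the record fields \<open>mult\<close> and
  \<open>one\<close>, inherited from rings, have no meaning here.
\<close>

section \<open>Banach spaces and Hilbert spaces\<close>

record 'a nspace = "(real, 'a) module" +
  nrm :: "'a \<Rightarrow> real"

record 'a hspace = "(complex, 'a) module" +
  cinner :: "'a \<Rightarrow> 'a \<Rightarrow> complex"

text \<open>The value 0 outside the carrier is there because \<^locale>\<open>Metric_space\<close> wants
  a distance that is nonnegative and symmetric on the whole type.\<close>

definition vdist :: "'a nspace \<Rightarrow> 'a \<Rightarrow> 'a \<Rightarrow> real" where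
  "vdist E x y = (if x \<in> carrier E \<and> y \<in> carrier E then nrm E (x \<ominus>\<^bsub>E\<^esub> y) else 0)"

definition vtop :: "'a nspace \<Rightarrow> 'a topology" where
  "vtop E = Metric_space.mtopology (carrier E) (vdist E)"

definition banach_space :: "'a nspace \<Rightarrow> bool" where
  "banach_space E \<longleftrightarrow>
     module (ring_of_type_algebra :: real ring) E \<and>
     (\<forall>x\<in>carrier E. 0 \<le> nrm E x \<and> (nrm E x = 0 \<longleftrightarrow> x = \<zero>\<^bsub>E\<^esub>)) \<and>
     (\<forall>c. \<forall>x\<in>carrier E. nrm E (c \<odot>\<^bsub>E\<^esub> x) = \<bar>c\<bar> * nrm E x) \<and>
     (\<forall>x\<in>carrier E. \<forall>y\<in>carrier E. nrm E (x \<oplus>\<^bsub>E\<^esub> y) \<le> nrm E x + nrm E y) \<and>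
     Metric_space.mcomplete (carrier E) (vdist E)"

definition realify :: "'a hspace \<Rightarrow> 'a nspace" where
  "realify K = \<lparr>carrier = carrier K, mult = undefined, one = undefined, zero = \<zero>\<^bsub>K\<^esub>,
     add = add K, smult = (\<lambda>r x. complex_of_real r \<odot>\<^bsub>K\<^esub> x),
     nrm = (\<lambda>x. sqrt (Re (cinner K x x)))\<rparr>"

text \<open>The inner product is linear in its first argument.\<close>

definition hilbert_space :: "'a hspace \<Rightarrow> bool" where
  "hilbert_space K \<longleftrightarrow>
     module (ring_of_type_algebra :: complex ring) K \<and>
     (\<forall>x\<in>carrier K. \<forall>y\<in>carrier K. \<forall>z\<in>carrier K.
        cinner K (x \<oplus>\<^bsub>K\<^esub> y) z = cinner K x z + cinner K y z) \<and>
     (\<forall>c. \<forall>x\<in>carrier K. \<forall>y\<in>carrier K. cinner K (c \<odot>\<^bsub>K\<^esub> x) y = c * cinner K x y) \<and>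
     (\<forall>x\<in>carrier K. \<forall>y\<in>carrier K. cinner K y x = cnj (cinner K x y)) \<and>
     (\<forall>x\<in>carrier K. 0 \<le> Re (cinner K x x) \<and> (cinner K x x = 0 \<longrightarrow> x = \<zero>\<^bsub>K\<^esub>)) \<and>
     Metric_space.mcomplete (carrier K) (vdist (realify K))"

definition complex_hspace :: "complex hspace" where
  "complex_hspace = \<lparr>carrier = UNIV, mult = undefined, one = undefined, zero = 0,
     add = (+), smult = (*), cinner = (\<lambda>z w. z * cnj w)\<rparr>"

definition Rn :: "nat \<Rightarrow> (nat \<Rightarrow> real) nspace" where
  "Rn n = \<lparr>carrier = topspace (Euclidean_space n), mult = undefined, one = undefined,
     zero = (\<lambda>_. 0), add = (\<lambda>x y i. x i + y i), smult = (\<lambda>c x i. c * x i),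
     nrm = (\<lambda>x. L2_set x {..<n})\<rparr>"

definition prod_space :: "'a nspace \<Rightarrow> 'b nspace \<Rightarrow> ('a \<times> 'b) nspace" where
  "prod_space E F = \<lparr>carrier = carrier E \<times> carrier F, mult = undefined, one = undefined,
     zero = (\<zero>\<^bsub>E\<^esub>, \<zero>\<^bsub>F\<^esub>),
     add = (\<lambda>(x, y) (x', y'). (x \<oplus>\<^bsub>E\<^esub> x', y \<oplus>\<^bsub>F\<^esub> y')),
     smult = (\<lambda>c (x, y). (c \<odot>\<^bsub>E\<^esub> x, c \<odot>\<^bsub>F\<^esub> y)),
     nrm = (\<lambda>(x, y). sqrt ((nrm E x)\<^sup>2 + (nrm F y)\<^sup>2))\<rparr>"

definition bounded_operator :: "'a hspace \<Rightarrow> 'b hspace \<Rightarrow> ('a \<Rightarrow> 'b) \<Rightarrow> bool" where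
  "bounded_operator K L A \<longleftrightarrow>
     A \<in> carrier K \<rightarrow> carrier L \<and>
     (\<forall>x\<in>carrier K. \<forall>y\<in>carrier K. A (x \<oplus>\<^bsub>K\<^esub> y) = A x \<oplus>\<^bsub>L\<^esub> A y) \<and>
     (\<forall>c. \<forall>x\<in>carrier K. A (c \<odot>\<^bsub>K\<^esub> x) = c \<odot>\<^bsub>L\<^esub> A x) \<and>
     (\<exists>C. \<forall>x\<in>carrier K. nrm (realify L) (A x) \<le> C * nrm (realify K) x)"

definition adjoint_op :: "'a hspace \<Rightarrow> 'b hspace \<Rightarrow> ('a \<Rightarrow> 'b) \<Rightarrow> 'b \<Rightarrow> 'a" where
  "adjoint_op K L A y =
     (THE x. x \<in> carrier K \<and> (\<forall>z\<in>carrier K. cinner L (A z) y = cinner K z x))"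

definition unitary_operator :: "'a hspace \<Rightarrow> 'b hspace \<Rightarrow> ('a \<Rightarrow> 'b) \<Rightarrow> bool" where
  "unitary_operator K L A \<longleftrightarrow>
     bounded_operator K L A \<and> bij_betw A (carrier K) (carrier L) \<and>
     (\<forall>x\<in>carrier K. \<forall>y\<in>carrier K. cinner L (A x) (A y) = cinner K x y)"

section \<open>Smooth maps between open subsets of Banach spaces\<close>

text \<open>A \<open>k\<close>-linear map is a function on the lists of length \<open>k\<close>.\<close>

definition bounded_multilinear :: "'a nspace \<Rightarrow> 'b nspace \<Rightarrow> nat \<Rightarrow> ('a list \<Rightarrow> 'b) \<Rightarrow> bool" where
  "bounded_multilinear E F k m \<longleftrightarrow>
     (\<forall>vs\<in>lists (carrier E). length vs = k \<longrightarrow> m vs \<in> carrier F) \<and>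
     (\<forall>us\<in>lists (carrier E). \<forall>ws\<in>lists (carrier E). \<forall>x\<in>carrier E. \<forall>y\<in>carrier E.
        length us + 1 + length ws = k \<longrightarrow>
          m (us @ (x \<oplus>\<^bsub>E\<^esub> y) # ws) = m (us @ x # ws) \<oplus>\<^bsub>F\<^esub> m (us @ y # ws) \<and>
          (\<forall>c. m (us @ (c \<odot>\<^bsub>E\<^esub> x) # ws) = c \<odot>\<^bsub>F\<^esub> m (us @ x # ws))) \<and>
     (\<exists>C. \<forall>vs\<in>lists (carrier E). length vs = k \<longrightarrow>
        nrm F (m vs) \<le> C * prod_list (map (nrm E) vs))"

text \<open>
  Infinite Frechet differentiability: \<open>D x\<close> restricted to lists of length \<open>k\<close> is the \<open>k\<close>-th
  derivative at \<open>x\<close>, and the derivative of order \<open>k + 1\<close> is the Frechet derivative of the one of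
  order \<open>k\<close> for the operator norm on bounded \<open>k\<close>-linear maps, with \<open>D (k+1) x (h, v1, ..., vk)\<close>
  stored as \<open>D x (h # [v1, ..., vk])\<close>. All orders live in the one type of functions on lists,
  whereas iterating \<open>E \<mapsto> L(E, F)\<close> would change the type at each order.
\<close>

definition smooth_on :: "'a nspace \<Rightarrow> 'b nspace \<Rightarrow> 'a set \<Rightarrow> ('a \<Rightarrow> 'b) \<Rightarrow> bool" where
  "smooth_on E F U f \<longleftrightarrow>
     openin (vtop E) U \<and>
     (\<exists>D. (\<forall>x\<in>U. D x [] = f x) \<and>
        (\<forall>k. \<forall>x\<in>U. bounded_multilinear E F k (D x) \<and>
           (\<forall>\<epsilon>>0. \<exists>\<delta>>0. \<forall>h\<in>carrier E. nrm E h < \<delta> \<and> x \<oplus>\<^bsub>E\<^esub> h \<in> U \<longrightarrow>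
              (\<forall>vs\<in>lists (carrier E). length vs = k \<longrightarrow>
                 nrm F ((D (x \<oplus>\<^bsub>E\<^esub> h) vs \<ominus>\<^bsub>F\<^esub> D x vs) \<ominus>\<^bsub>F\<^esub> D x (h # vs))
                   \<le> \<epsilon> * nrm E h * prod_list (map (nrm E) vs)))))"

section \<open>Banach manifolds\<close>

text \<open>A chart is a triple of its domain, the coordinate map and the model space. The smooth
  structure is the one generated by the atlas; atlases need not be maximal.\<close>

record ('x, 'm) mfd =
  mtop :: "'x topology"
  atlas :: "('x set \<times> ('x \<Rightarrow> 'm) \<times> 'm nspace) set"

definition banach_manifold :: "('x, 'm) mfd \<Rightarrow> bool" where
  "banach_manifold M \<longleftrightarrow>
     Hausdorff_space (mtop M) \<and>
     (\<Union>(W, \<phi>, E)\<in>atlas M. W) = topspace (mtop M) \<and>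
     (\<forall>(W, \<phi>, E)\<in>atlas M.
        banach_space E \<and> openin (mtop M) W \<and> openin (vtop E) (\<phi> ` W) \<and>
        homeomorphic_map (subtopology (mtop M) W) (subtopology (vtop E) (\<phi> ` W)) \<phi>) \<and>
     (\<forall>(W, \<phi>, E)\<in>atlas M. \<forall>(W', \<phi>', E')\<in>atlas M.
        smooth_on E E' (\<phi> ` (W \<inter> W')) (\<phi>' \<circ> inv_into W \<phi>))"

definition smooth_manifold :: "nat \<Rightarrow> ('x, nat \<Rightarrow> real) mfd \<Rightarrow> bool" where
  "smooth_manifold n N \<longleftrightarrow>
     banach_manifold N \<and> second_countable (mtop N) \<and> (\<forall>(W, \<phi>, E)\<in>atlas N. E = Rn n)"

definition open_submfd :: "('x, 'm) mfd \<Rightarrow> 'x set \<Rightarrow> ('x, 'm) mfd" where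
  "open_submfd M U = \<lparr>mtop = subtopology (mtop M) U,
     atlas = (\<lambda>(W, \<phi>, E). (W \<inter> U, \<phi>, E)) ` atlas M\<rparr>"

definition prod_mfd :: "('x, 'a) mfd \<Rightarrow> ('y, 'b) mfd \<Rightarrow> ('x \<times> 'y, 'a \<times> 'b) mfd" where
  "prod_mfd M N = \<lparr>mtop = prod_topology (mtop M) (mtop N),
     atlas = {(W \<times> V, map_prod \<phi> \<psi>, prod_space E F) | W \<phi> E V \<psi> F.
                (W, \<phi>, E) \<in> atlas M \<and> (V, \<psi>, F) \<in> atlas N}\<rparr>"

definition space_mfd :: "'a nspace \<Rightarrow> ('a, 'a) mfd" where
  "space_mfd E = \<lparr>mtop = vtop E, atlas = {(carrier E, id, E)}\<rparr>"

definition smooth_map :: "('x, 'a) mfd \<Rightarrow> ('y, 'b) mfd \<Rightarrow> ('x \<Rightarrow> 'y) \<Rightarrow> bool" where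
  "smooth_map M M' f \<longleftrightarrow>
     continuous_map (mtop M) (mtop M') f \<and>
     (\<forall>(W, \<phi>, E)\<in>atlas M. \<forall>(W', \<phi>', E')\<in>atlas M'.
        smooth_on E E' (\<phi> ` (W \<inter> f -` W')) (\<phi>' \<circ> f \<circ> inv_into W \<phi>))"

definition diffeomorphism :: "('x, 'a) mfd \<Rightarrow> ('y, 'b) mfd \<Rightarrow> ('x \<Rightarrow> 'y) \<Rightarrow> bool" where
  "diffeomorphism M M' f \<longleftrightarrow>
     bij_betw f (topspace (mtop M)) (topspace (mtop M')) \<and>
     smooth_map M M' f \<and> smooth_map M' M (inv_into (topspace (mtop M)) f)"

section \<open>Fields of Hilbert spaces, Hilbert bundles and fields of operators\<close>

definition hilbert_field :: "'h set \<Rightarrow> 'n set \<Rightarrow> ('h \<Rightarrow> 'n) \<Rightarrow> ('n \<Rightarrow> 'h hspace) \<Rightarrow> bool" where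
  "hilbert_field H N p \<H> \<longleftrightarrow>
     p ` H = N \<and>
     (\<forall>q\<in>N. hilbert_space (\<H> q) \<and> carrier (\<H> q) = {x \<in> H. p x = q})"

text \<open>
  The model spaces of \<open>M\<close> may be arbitrary Banach spaces with points in the type \<open>'m\<close>. As HOL
  has no quantifier over types, a statement that such an \<open>M\<close> exists has to fix \<open>'m\<close>, and it
  is meaningful once \<open>'m\<close> is large enough to contain copies of the spaces
  \<open>Rn n \<times> \<K> i\<close>; this is ensured by an injection from the type \<open>(nat \<Rightarrow> real) \<times> 'k\<close> into \<open>'m\<close>.
\<close>

definition smooth_hilbert_bundle ::
  "('h, 'm) mfd \<Rightarrow> ('n, nat \<Rightarrow> real) mfd \<Rightarrow> 'h set \<Rightarrow> ('h \<Rightarrow> 'n) \<Rightarrow>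
   'i set \<Rightarrow> ('i \<Rightarrow> 'n set) \<Rightarrow> ('i \<Rightarrow> 'k hspace) \<Rightarrow> ('i \<Rightarrow> 'n \<Rightarrow> 'h \<Rightarrow> 'k) \<Rightarrow> bool" where
  "smooth_hilbert_bundle M N H p I U \<K> T \<longleftrightarrow>
     banach_manifold M \<and> topspace (mtop M) = H \<and> smooth_map M N p \<and>
     (\<forall>i\<in>I. diffeomorphism (open_submfd M {x \<in> H. p x \<in> U i})
        (prod_mfd (open_submfd N (U i)) (space_mfd (realify (\<K> i))))
        (\<lambda>x. (p x, T i (p x) x)))"

definition transition ::
  "('n \<Rightarrow> 'h hspace) \<Rightarrow> ('i \<Rightarrow> 'k hspace) \<Rightarrow> ('i \<Rightarrow> 'n \<Rightarrow> 'h \<Rightarrow> 'k) \<Rightarrow> 'i \<Rightarrow> 'i \<Rightarrow> 'n \<Rightarrow> 'k \<Rightarrow> 'k" where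
  "transition \<H> \<K> T i j q = T j q \<circ> adjoint_op (\<H> q) (\<K> i) (T i q)"

text \<open>Functions on \<open>U\<close> are total functions of which only the values on \<open>U\<close> matter.\<close>

definition Cinf :: "('n, 'm) mfd \<Rightarrow> 'n set \<Rightarrow> 'k hspace \<Rightarrow> ('n \<Rightarrow> 'k) set" where
  "Cinf N U K = {f. smooth_map (open_submfd N U) (space_mfd (realify K)) f}"

definition Pinf :: "('n, 'm) mfd \<Rightarrow> 'n set \<Rightarrow> 'k hspace \<Rightarrow> ('n \<Rightarrow> 'k) set" where
  "Pinf N U K = {f \<in> Cinf N U K. \<exists>(n::nat) a x.
     (\<forall>l\<in>{1..n}. a l \<in> Cinf N U complex_hspace \<and> x l \<in> carrier K) \<and>
     (\<forall>q\<in>U. f q = (\<Oplus>\<^bsub>K\<^esub>l\<in>{1..n}. a l q \<odot>\<^bsub>K\<^esub> x l))}"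

definition Ainf ::
  "('n, 'm) mfd \<Rightarrow> 'n set \<Rightarrow> 'k hspace \<Rightarrow> 'l hspace \<Rightarrow> ('n \<Rightarrow> 'k \<Rightarrow> 'l) set" where
  "Ainf N U K L = {A. (\<forall>q\<in>U. bounded_operator K L (A q)) \<and>
     (\<forall>f\<in>Pinf N U K. (\<lambda>q. A q (f q)) \<in> Cinf N U L) \<and>
     (\<forall>g\<in>Pinf N U L. (\<lambda>q. adjoint_op K L (A q) (g q)) \<in> Cinf N U K)}"

end

theory Submission
  imports Defs
begin

text \<open>
  In two trivialisations the same vector of \<open>H\<close> has coordinates \<open>(q, k)\<close> and \<open>(q, \<tau>\<^sub>i\<^sub>j(q) k)\<close>. So a bundle
  structure exists if and only if the maps \<open>(q, k) \<mapsto> (q, \<tau>\<^sub>i\<^sub>j(q) k)\<close> are smooth: then they glue the cylinders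
  \<open>U\<^sub>i \<times> \<K>\<^sub>i\<close> to a Banach manifold. The theorem says that this joint smoothness already follows from smoothness
  in \<open>q\<close> for each fixed \<open>k\<close>.

  From a bundle to strong smoothness (\<open>strongly_smooth_if_bundle\<close>) one fixes \<open>k\<close> and composes an inverse
  trivialisation with another trivialisation. The composition passes through a chart of the total space, whose
  model is an arbitrary Banach space, and hence uses the chain rule for all orders between Banach spaces
  (\<open>smooth_on_comp\<close>), which is the formula of Faa di Bruno.

  The converse rests on \<open>smooth_on_eval\<close>: if \<open>A y\<close> are bounded operators and \<open>y \<mapsto> A y k\<close> is smooth for each \<open>k\<close>,
  then \<open>(y, k) \<mapsto> A y k\<close> is smooth. The derivatives of \<open>y \<mapsto> A y k\<close> are linear in \<open>k\<close>. As pointwise limits of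
  difference quotients they are bounded in \<open>k\<close>, and by the uniform boundedness principle they are so with a
  constant that is uniform near each point. Taylor's formula with a remainder of second order then shows that they
  are differentiable for the operator norm, and differentiation in \<open>k\<close> only adds terms in which \<open>k\<close> is replaced
  by one of the directions. Given this, the total space gets the topology for which the trivialisations are
  homeomorphisms, and charts that combine a trivialisation with a chart of \<open>N\<close>; the locale
  \<open>bundle_construction\<close> checks that their transitions, the projection and the trivialisations are smooth.

  For the condition with \<open>P\<^sup>\<infinity>\<close>, the function \<open>q \<mapsto> \<tau>\<^sub>i\<^sub>j(q) f(q)\<close> is a composition of \<open>q \<mapsto> (q, f(q))\<close> with the evaluation
  map, and the adjoint of \<open>\<tau>\<^sub>i\<^sub>j(q)\<close> is its inverse \<open>\<tau>\<^sub>j\<^sub>i(q)\<close>. Conversely, \<open>P\<^sup>\<infinity>\<close> contains the constant functions.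

  Two devices keep the estimates short. An element of a Hilbert space is tested against all vectors of that
  space (\<open>nrm_leI\<close>), so that sums of error terms become sums of real numbers. And multilinearity of derivatives
  has to be verified in the first vector only (\<open>smooth_derivsI\<close>), since it is inherited from lower orders.
\<close>

section \<open>Banach spaces\<close>

lemma ring_of_type_algebra_simps [simp]:
  "carrier ring_of_type_algebra = UNIV" "add ring_of_type_algebra = (+)"
  "mult ring_of_type_algebra = (*)" "one ring_of_type_algebra = 1" "zero ring_of_type_algebra = 0"
  by (simp_all add: ring_of_type_algebra_def)

locale Normed = module "ring_of_type_algebra :: real ring" E for E :: "'a nspace" (structure) +
  assumes nrm_nonneg [simp]: "x \<in> carrier E \<Longrightarrow> 0 \<le> nrm E x"
    and nrm_eq_0: "x \<in> carrier E \<Longrightarrow> nrm E x = 0 \<longleftrightarrow> x = \<zero>"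
    and nrm_smult [simp]: "x \<in> carrier E \<Longrightarrow> nrm E (c \<odot> x) = \<bar>c\<bar> * nrm E x"
    and nrm_triangle: "x \<in> carrier E \<Longrightarrow> y \<in> carrier E \<Longrightarrow> nrm E (x \<oplus> y) \<le> nrm E x + nrm E y"

locale Banach = Normed +
  assumes mcomplete: "Metric_space.mcomplete (carrier E) (vdist E)"

lemma banach_space_iff: "banach_space E \<longleftrightarrow> Banach E"
  unfolding banach_space_def Banach_def Normed_def Banach_axioms_def Normed_axioms_def by blast

context Normed
begin

lemma smult_add_left: "x \<in> carrier E \<Longrightarrow> (a + b) \<odot> x = a \<odot> x \<oplus> b \<odot> x"
  using smult_l_distr[of a b x] by simp

lemma smult_add_right: "x \<in> carrier E \<Longrightarrow> y \<in> carrier E \<Longrightarrow> a \<odot> (x \<oplus> y) = a \<odot> x \<oplus> a \<odot> y"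
  using smult_r_distr[of a x y] by simp

lemma smult_smult: "x \<in> carrier E \<Longrightarrow> a \<odot> (b \<odot> x) = (a * b) \<odot> x"
  using smult_assoc1[of a b x] by simp

lemma smult_1 [simp]: "x \<in> carrier E \<Longrightarrow> 1 \<odot> x = x"
  using smult_one[of x] by simp

lemma smult_0 [simp]: "x \<in> carrier E \<Longrightarrow> 0 \<odot> x = \<zero>"
  using smult_l_null[of x] by simp

lemma smult_zero [simp]: "c \<odot> \<zero> = \<zero>"
  using smult_r_null[of c] by simp

lemma minus_eq_smult: "x \<in> carrier E \<Longrightarrow> \<ominus> x = (-1) \<odot> x"
proof -
  assume x: "x \<in> carrier E"
  have "(-1) \<odot> x \<oplus> x = (-1 + 1) \<odot> x"
    using x by (simp only: smult_add_left smult_1)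
  then have "(-1) \<odot> x \<oplus> x = \<zero>" using x by simp
  then show ?thesis using x minus_equality by simp
qed

lemma smult_minus: "x \<in> carrier E \<Longrightarrow> c \<odot> (\<ominus> x) = \<ominus> (c \<odot> x)"
  by (simp add: minus_eq_smult smult_smult)

lemma smult_diff_right: "x \<in> carrier E \<Longrightarrow> y \<in> carrier E \<Longrightarrow> a \<odot> (x \<ominus> y) = a \<odot> x \<ominus> a \<odot> y"
  by (simp add: a_minus_def smult_add_right smult_minus)

lemma nrm_zero [simp]: "nrm E \<zero> = 0"
  using nrm_eq_0 by blast

lemma nrm_neg [simp]: "x \<in> carrier E \<Longrightarrow> nrm E (\<ominus> x) = nrm E x"
  by (simp add: minus_eq_smult)

lemma diff_eq_zero_iff: "x \<in> carrier E \<Longrightarrow> y \<in> carrier E \<Longrightarrow> x \<ominus> y = \<zero> \<longleftrightarrow> x = y"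
  by (metis M.r_neg M.minus_eq M.minus_equality M.minus_minus a_inv_closed)

lemma neg_diff: "x \<in> carrier E \<Longrightarrow> y \<in> carrier E \<Longrightarrow> \<ominus> (x \<ominus> y) = y \<ominus> x"
  by (simp add: minus_eq minus_add a_ac)

lemma nrm_diff_commute: "x \<in> carrier E \<Longrightarrow> y \<in> carrier E \<Longrightarrow> nrm E (x \<ominus> y) = nrm E (y \<ominus> x)"
  by (metis neg_diff nrm_neg minus_closed)

lemma nrm_diff_triangle: "x \<in> carrier E \<Longrightarrow> y \<in> carrier E \<Longrightarrow> nrm E (x \<ominus> y) \<le> nrm E x + nrm E y"
  using nrm_triangle[of x "\<ominus> y"] by (simp add: minus_eq)

lemma add_diff_cancel: "x \<in> carrier E \<Longrightarrow> y \<in> carrier E \<Longrightarrow> x \<oplus> (y \<ominus> x) = y"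
  by (metis M.r_neg1 a_comm a_inv_closed minus_closed minus_eq)

lemma add_diff_cancel_left: "x \<in> carrier E \<Longrightarrow> h \<in> carrier E \<Longrightarrow> (x \<oplus> h) \<ominus> x = h"
  by (metis M.r_neg1 M.r_neg2 a_comm a_inv_closed add.m_closed minus_eq)

lemma diff_telescope:
  assumes "x \<in> carrier E" "y \<in> carrier E" "z \<in> carrier E"
  shows "x \<ominus> z = (x \<ominus> y) \<oplus> (y \<ominus> z)"
proof -
  have "(x \<ominus> y) \<oplus> (y \<ominus> z) = x \<oplus> (\<ominus> y \<oplus> (y \<oplus> \<ominus> z))"
    using assms by (simp add: minus_eq a_assoc)
  also have "\<dots> = x \<ominus> z"
    using assms by (simp add: r_neg1 minus_eq)
  finally show ?thesis by simp
qed

lemma diff_diff_same: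
  assumes "x \<in> carrier E" "y \<in> carrier E" "z \<in> carrier E"
  shows "(x \<ominus> y) \<ominus> (x \<ominus> z) = z \<ominus> y"
  using assms diff_telescope[of z x y] by (simp add: minus_eq minus_add a_ac)

lemma diff_add_rearrange:
  assumes "a \<in> carrier E" "b \<in> carrier E" "c \<in> carrier E" "d \<in> carrier E"
  shows "(a \<oplus> b) \<ominus> (c \<oplus> d) = (a \<ominus> c) \<oplus> (b \<ominus> d)"
  using assms by (simp add: minus_eq minus_add a_ac)

lemma nrm_le_add_diff: "x \<in> carrier E \<Longrightarrow> y \<in> carrier E \<Longrightarrow> nrm E x \<le> nrm E y + nrm E (x \<ominus> y)"
  using nrm_triangle[of y "x \<ominus> y"] by (simp add: add_diff_cancel)

lemma Metric_space_vdist: "Metric_space (carrier E) (vdist E)"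
proof
  fix x y z
  show "0 \<le> vdist E x y" by (simp add: vdist_def)
  show "vdist E x y = vdist E y x" by (simp add: vdist_def nrm_diff_commute)
  assume xy: "x \<in> carrier E" "y \<in> carrier E"
  show "(vdist E x y = 0) = (x = y)"
    using xy by (simp add: vdist_def nrm_eq_0 diff_eq_zero_iff)
  assume z: "z \<in> carrier E"
  show "vdist E x z \<le> vdist E x y + vdist E y z"
    using xy z nrm_triangle[of "x \<ominus> y" "y \<ominus> z"] by (simp add: vdist_def diff_telescope[of x y z])
qed

end

sublocale Normed \<subseteq> metric: Metric_space "carrier E" "vdist E"
  by (rule Metric_space_vdist)

context Normed
begin

lemma topspace_vtop [simp]: "topspace (vtop E) = carrier E"
  by (simp add: vtop_def)

lemma vdist_add: "x \<in> carrier E \<Longrightarrow> h \<in> carrier E \<Longrightarrow> vdist E x (x \<oplus> h) = nrm E h"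
  by (simp add: vdist_def add_diff_cancel_left nrm_diff_commute[of x])

text \<open>Smoothness is formulated with increments \<open>x + h\<close>, so open sets are described by increments, too.\<close>

lemma openin_vtop:
  "openin (vtop E) U \<longleftrightarrow>
     U \<subseteq> carrier E \<and> (\<forall>x\<in>U. \<exists>\<delta>>0. \<forall>h\<in>carrier E. nrm E h < \<delta> \<longrightarrow> x \<oplus> h \<in> U)"
proof -
  have *: "(metric.mball x r \<subseteq> U) = (\<forall>h\<in>carrier E. nrm E h < r \<longrightarrow> x \<oplus> h \<in> U)"
    if "x \<in> carrier E" for x r
  proof
    assume *: "metric.mball x r \<subseteq> U"
    show "\<forall>h\<in>carrier E. nrm E h < r \<longrightarrow> x \<oplus> h \<in> U"
    proof (intro ballI impI)
      fix h assume "h \<in> carrier E" "nrm E h < r"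
      then have "x \<oplus> h \<in> metric.mball x r"
        using that by (simp add: vdist_add)
      with * show "x \<oplus> h \<in> U" by blast
    qed
  next
    assume *: "\<forall>h\<in>carrier E. nrm E h < r \<longrightarrow> x \<oplus> h \<in> U"
    show "metric.mball x r \<subseteq> U"
    proof
      fix y assume y: "y \<in> metric.mball x r"
      then have "nrm E (y \<ominus> x) < r" "y \<in> carrier E"
        using that by (auto simp: vdist_def nrm_diff_commute)
      then have "x \<oplus> (y \<ominus> x) \<in> U" using * that by simp
      then show "y \<in> U" using that \<open>y \<in> carrier E\<close> by (simp add: add_diff_cancel)
    qed
  qed
  show ?thesis
    unfolding vtop_def metric.openin_mtopology Ball_def[of U]
    by (intro conj_cong refl all_cong1 imp_cong ex_cong1) (use * in blast)
qed

lemma openin_carrier [simp]: "openin (vtop E) (carrier E)"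
  by (metis topspace_vtop openin_topspace)

lemma Hausdorff_vtop: "Hausdorff_space (vtop E)"
  unfolding vtop_def by (rule metric.Hausdorff_space_mtopology)

end

lemma NormedI:
  fixes E :: "'a nspace" (structure)
  assumes zero: "\<zero> \<in> carrier E"
    and add: "\<And>x y. x \<in> carrier E \<Longrightarrow> y \<in> carrier E \<Longrightarrow> x \<oplus> y \<in> carrier E"
    and assoc: "\<And>x y z. x \<in> carrier E \<Longrightarrow> y \<in> carrier E \<Longrightarrow> z \<in> carrier E \<Longrightarrow> (x \<oplus> y) \<oplus> z = x \<oplus> (y \<oplus> z)"
    and comm: "\<And>x y. x \<in> carrier E \<Longrightarrow> y \<in> carrier E \<Longrightarrow> x \<oplus> y = y \<oplus> x"
    and neutral: "\<And>x. x \<in> carrier E \<Longrightarrow> \<zero> \<oplus> x = x"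
    and inverse: "\<And>x. x \<in> carrier E \<Longrightarrow> (-1) \<odot> x \<oplus> x = \<zero>"
    and sc: "\<And>c x. x \<in> carrier E \<Longrightarrow> c \<odot> x \<in> carrier E"
    and sl: "\<And>a b x. x \<in> carrier E \<Longrightarrow> (a + b) \<odot> x = a \<odot> x \<oplus> b \<odot> x"
    and sr: "\<And>a x y. x \<in> carrier E \<Longrightarrow> y \<in> carrier E \<Longrightarrow> a \<odot> (x \<oplus> y) = a \<odot> x \<oplus> a \<odot> y"
    and sa: "\<And>a b x. x \<in> carrier E \<Longrightarrow> (a * b) \<odot> x = a \<odot> (b \<odot> x)"
    and s1: "\<And>x. x \<in> carrier E \<Longrightarrow> 1 \<odot> x = x"
    and n0: "\<And>x. x \<in> carrier E \<Longrightarrow> 0 \<le> nrm E x"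
    and nz: "\<And>x. x \<in> carrier E \<Longrightarrow> nrm E x = 0 \<longleftrightarrow> x = \<zero>"
    and ns: "\<And>c x. x \<in> carrier E \<Longrightarrow> nrm E (c \<odot> x) = \<bar>c\<bar> * nrm E x"
    and nt: "\<And>x y. x \<in> carrier E \<Longrightarrow> y \<in> carrier E \<Longrightarrow> nrm E (x \<oplus> y) \<le> nrm E x + nrm E y"
  shows "Normed E"
proof -
  have grp: "abelian_group E"
  proof (rule abelian_groupI)
    show "\<exists>y\<in>carrier E. y \<oplus> x = \<zero>" if "x \<in> carrier E" for x
      using inverse[OF that] sc[OF that, of "-1"] by blast
  qed (fact zero add assoc comm neutral)+
  have "module (ring_of_type_algebra :: real ring) E"
    by (rule moduleI[OF comm_ring_1_class.cring_from_type_algebra grp])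
      (simp_all only: ring_of_type_algebra_simps sc sl sr sa s1)
  then show ?thesis
    using n0 nz ns nt unfolding Normed_def Normed_axioms_def by blast
qed

text \<open>The distance \<^const>\<open>vdist\<close> of a product agrees with the product of the distances on the carrier
  only, and this suffices to transfer its topology and its completeness.\<close>

lemma mtopology_cong:
  assumes M: "Metric_space M d" "Metric_space M d'" and eq: "\<And>x y. x \<in> M \<Longrightarrow> y \<in> M \<Longrightarrow> d x y = d' x y"
  shows "Metric_space.mtopology M d = Metric_space.mtopology M d'"
proof -
  interpret A: Metric_space M d by fact
  interpret B: Metric_space M d' by fact
  have "A.mball x r = B.mball x r" for x r
    using eq by (auto simp: A.mball_def B.mball_def)
  then show ?thesis
    by (simp add: topology_eq A.openin_mtopology B.openin_mtopology)
qed

lemma mcomplete_cong: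
  assumes M: "Metric_space M d" "Metric_space M d'" and eq: "\<And>x y. x \<in> M \<Longrightarrow> y \<in> M \<Longrightarrow> d x y = d' x y"
  shows "Metric_space.mcomplete M d = Metric_space.mcomplete M d'"
proof -
  interpret A: Metric_space M d by fact
  interpret B: Metric_space M d' by fact
  have "A.MCauchy \<sigma> = B.MCauchy \<sigma>" for \<sigma>
    unfolding A.MCauchy_def B.MCauchy_def by (metis eq range_subsetD)
  moreover have "A.mtopology = B.mtopology" using mtopology_cong[OF assms] .
  ultimately show ?thesis
    by (simp add: A.mcomplete_def B.mcomplete_def)
qed

section \<open>Hilbert spaces\<close>

locale hilbert =
  fixes K :: "'a hspace" (structure)
  assumes hilbert: "hilbert_space K"

lemma realify_simps [simp]:
  "carrier (realify K) = carrier K" "add (realify K) = add K" "zero (realify K) = zero K"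
  "r \<odot>\<^bsub>realify K\<^esub> x = complex_of_real r \<odot>\<^bsub>K\<^esub> x"
  by (simp_all add: realify_def)

lemma nrm_realify_cinner: "nrm (realify K) x = sqrt (Re (cinner K x x))"
  by (simp add: realify_def)

lemma realify_minus [simp]: "x \<ominus>\<^bsub>realify K\<^esub> y = x \<ominus>\<^bsub>K\<^esub> y" "\<ominus>\<^bsub>realify K\<^esub> y = \<ominus>\<^bsub>K\<^esub> y"
  by (simp_all add: a_minus_def a_inv_def m_inv_def)

sublocale hilbert \<subseteq> module "ring_of_type_algebra :: complex ring" K
  using hilbert by (simp add: hilbert_space_def)

context hilbert
begin

definition rinner :: "'a \<Rightarrow> 'a \<Rightarrow> real" where
  "rinner x y = Re (cinner K x y)"

lemma cinner_add_left: "x \<in> carrier K \<Longrightarrow> y \<in> carrier K \<Longrightarrow> z \<in> carrier K \<Longrightarrow>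
    cinner K (x \<oplus> y) z = cinner K x z + cinner K y z"
  using hilbert unfolding hilbert_space_def by blast

lemma cinner_smult_left: "x \<in> carrier K \<Longrightarrow> y \<in> carrier K \<Longrightarrow> cinner K (c \<odot> x) y = c * cinner K x y"
  using hilbert unfolding hilbert_space_def by blast

lemma cinner_commute: "x \<in> carrier K \<Longrightarrow> y \<in> carrier K \<Longrightarrow> cinner K y x = cnj (cinner K x y)"
  using hilbert unfolding hilbert_space_def by blast

lemma rinner_add_left: "x \<in> carrier K \<Longrightarrow> y \<in> carrier K \<Longrightarrow> z \<in> carrier K \<Longrightarrow>
    rinner (x \<oplus> y) z = rinner x z + rinner y z"
  by (simp add: rinner_def cinner_add_left)

lemma rinner_smult_left: "x \<in> carrier K \<Longrightarrow> y \<in> carrier K \<Longrightarrow>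
    rinner (complex_of_real c \<odot> x) y = c * rinner x y"
  by (simp add: rinner_def cinner_smult_left)

lemma rinner_commute: "x \<in> carrier K \<Longrightarrow> y \<in> carrier K \<Longrightarrow> rinner y x = rinner x y"
  by (simp add: rinner_def cinner_commute[of x y])

lemma rinner_add_right: "x \<in> carrier K \<Longrightarrow> y \<in> carrier K \<Longrightarrow> z \<in> carrier K \<Longrightarrow>
    rinner z (x \<oplus> y) = rinner z x + rinner z y"
  by (simp add: rinner_commute[of _ z] rinner_add_left)

lemma rinner_smult_right: "x \<in> carrier K \<Longrightarrow> y \<in> carrier K \<Longrightarrow>
    rinner y (complex_of_real c \<odot> x) = c * rinner y x"
  by (simp add: rinner_commute[of _ y] rinner_smult_left)

lemma rinner_self_nonneg: "x \<in> carrier K \<Longrightarrow> 0 \<le> rinner x x"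
  using hilbert unfolding hilbert_space_def rinner_def by blast

lemma rinner_self_eq_0:
  assumes x: "x \<in> carrier K"
  shows "rinner x x = 0 \<longleftrightarrow> x = \<zero>"
proof
  have im: "Im (cinner K x x) = 0"
    using cinner_commute[OF x x] by (metis cnj.simps(2) equal_neg_zero)
  assume "rinner x x = 0"
  then have "cinner K x x = 0" using im by (simp add: rinner_def complex_eq_iff)
  then show "x = \<zero>" using hilbert x unfolding hilbert_space_def by blast
next
  assume "x = \<zero>"
  have "rinner (\<zero> \<oplus> \<zero>) x = rinner \<zero> x + rinner \<zero> x" using x by (intro rinner_add_left) auto
  then show "rinner x x = 0" using \<open>x = \<zero>\<close> by simp
qed

lemma rinner_zero_left [simp]: "x \<in> carrier K \<Longrightarrow> rinner \<zero> x = 0"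
  using rinner_add_left[of \<zero> \<zero> x] by simp

lemma rinner_neg_left: "x \<in> carrier K \<Longrightarrow> y \<in> carrier K \<Longrightarrow> rinner (\<ominus> x) y = - rinner x y"
  using rinner_add_left[of "\<ominus> x" x y] by (simp add: l_neg)

lemma rinner_diff_left: "x \<in> carrier K \<Longrightarrow> y \<in> carrier K \<Longrightarrow> z \<in> carrier K \<Longrightarrow>
    rinner (x \<ominus> y) z = rinner x z - rinner y z"
  by (simp add: minus_eq rinner_add_left rinner_neg_left)

lemma Cauchy_Schwarz_rinner:
  assumes x: "x \<in> carrier K" and y: "y \<in> carrier K"
  shows "\<bar>rinner x y\<bar> \<le> sqrt (rinner x x) * sqrt (rinner y y)"
proof (cases "rinner y y = 0")
  case True
  then have "y = \<zero>" using y rinner_self_eq_0 by blast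
  then show ?thesis using x y by simp (simp add: rinner_commute[of \<zero> x])
next
  case False
  then have pos: "rinner y y > 0" using rinner_self_nonneg[OF y] by simp
  \<comment> \<open>the value of \<open>t\<close> at which the norm of \<open>x + t y\<close> is minimal\<close>
  define t where "t = - rinner x y / rinner y y"
  have "0 \<le> rinner (x \<oplus> complex_of_real t \<odot> y) (x \<oplus> complex_of_real t \<odot> y)"
    using x y by (intro rinner_self_nonneg) auto
  also have "\<dots> = rinner x x + 2 * t * rinner x y + t\<^sup>2 * rinner y y"
    using x y by (simp add: rinner_add_left rinner_add_right rinner_smult_left rinner_smult_right
        rinner_commute[of x y] algebra_simps power2_eq_square)
  also have "\<dots> = rinner x x - (rinner x y)\<^sup>2 / rinner y y"
    using pos by (simp add: t_def field_simps power2_eq_square)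
  finally have "(rinner x y)\<^sup>2 \<le> rinner x x * rinner y y"
    using pos by (simp add: field_simps)
  then have "sqrt ((rinner x y)\<^sup>2) \<le> sqrt (rinner x x * rinner y y)"
    by (rule real_sqrt_le_mono)
  then show ?thesis by (simp add: real_sqrt_mult)
qed

lemma nrm_realify: "nrm (realify K) x = sqrt (rinner x x)"
  by (simp add: rinner_def nrm_realify_cinner)

lemma nrm_realify_nonneg [simp]: "x \<in> carrier K \<Longrightarrow> 0 \<le> nrm (realify K) x"
  by (simp add: nrm_realify rinner_self_nonneg)

lemma Normed_realify: "Normed (realify K)"
proof (rule NormedI)
  fix x assume "x \<in> carrier (realify K)"
  then have x: "x \<in> carrier K" by simp
  have "(- 1 + 1) \<odot> x = (-1) \<odot> x \<oplus> 1 \<odot> x"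
    using smult_l_distr[of "-1" 1 x] x by (simp del: smult_one)
  then show "(-1) \<odot>\<^bsub>realify K\<^esub> x \<oplus>\<^bsub>realify K\<^esub> x = \<zero>\<^bsub>realify K\<^esub>"
    using x smult_one[of x] smult_l_null[of x] by simp
next
  fix x y z assume "x \<in> carrier (realify K)" "y \<in> carrier (realify K)" "z \<in> carrier (realify K)"
  then show "(x \<oplus>\<^bsub>realify K\<^esub> y) \<oplus>\<^bsub>realify K\<^esub> z = x \<oplus>\<^bsub>realify K\<^esub> (y \<oplus>\<^bsub>realify K\<^esub> z)"
    by (simp add: a_assoc)
next
  fix x y assume "x \<in> carrier (realify K)" "y \<in> carrier (realify K)"
  then show "x \<oplus>\<^bsub>realify K\<^esub> y = y \<oplus>\<^bsub>realify K\<^esub> x"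
    by (simp add: a_comm)
next
  fix x y assume "x \<in> carrier (realify K)" "y \<in> carrier (realify K)"
  then have x: "x \<in> carrier K" and y: "y \<in> carrier K" by simp_all
  have "rinner (x \<oplus> y) (x \<oplus> y) = rinner x x + 2 * rinner x y + rinner y y"
    using x y by (simp add: rinner_add_left rinner_add_right rinner_commute[of x y])
  also have "\<dots> \<le> rinner x x + 2 * (sqrt (rinner x x) * sqrt (rinner y y)) + rinner y y"
    using Cauchy_Schwarz_rinner[OF x y] by linarith
  also have "\<dots> = (sqrt (rinner x x) + sqrt (rinner y y))\<^sup>2"
    using rinner_self_nonneg[OF x] rinner_self_nonneg[OF y] by (simp add: power2_sum)
  finally have "sqrt (rinner (x \<oplus> y) (x \<oplus> y)) \<le> \<bar>sqrt (rinner x x) + sqrt (rinner y y)\<bar>"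
    by (metis real_sqrt_abs real_sqrt_le_mono)
  then show "nrm (realify K) (x \<oplus>\<^bsub>realify K\<^esub> y) \<le> nrm (realify K) x + nrm (realify K) y"
    using rinner_self_nonneg[OF x] rinner_self_nonneg[OF y] by (simp add: nrm_realify)
next
  fix c x assume "x \<in> carrier (realify K)"
  then have x: "x \<in> carrier K" by simp
  have "rinner (complex_of_real c \<odot> x) (complex_of_real c \<odot> x) = c\<^sup>2 * rinner x x"
    using x by (simp add: rinner_smult_left rinner_smult_right power2_eq_square)
  then show "nrm (realify K) (c \<odot>\<^bsub>realify K\<^esub> x) = \<bar>c\<bar> * nrm (realify K) x"
    by (simp add: nrm_realify real_sqrt_mult)
qed (use rinner_self_nonneg rinner_self_eq_0 smult_l_distr smult_r_distr smult_assoc1 smult_one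
     in \<open>auto simp: nrm_realify\<close>)

lemma Banach_realify: "Banach (realify K)"
  using Normed_realify hilbert unfolding hilbert_space_def Banach_def Banach_axioms_def realify_simps by blast

end

sublocale hilbert \<subseteq> real: Banach "realify K"
  by (rule Banach_realify)

context hilbert
begin

lemma rinner_le: "x \<in> carrier K \<Longrightarrow> y \<in> carrier K \<Longrightarrow>
    \<bar>rinner x y\<bar> \<le> nrm (realify K) x * nrm (realify K) y"
  unfolding nrm_realify by (rule Cauchy_Schwarz_rinner)

text \<open>Testing against all vectors turns an estimate of a norm into estimates of real numbers, where
  the arithmetic is that of a field.\<close>

lemma nrm_leI:
  assumes x: "x \<in> carrier K" and c: "0 \<le> c"
    and le: "\<And>w. w \<in> carrier K \<Longrightarrow> \<bar>rinner x w\<bar> \<le> c * nrm (realify K) w"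
  shows "nrm (realify K) x \<le> c"
proof (cases "nrm (realify K) x = 0")
  case False
  then have pos: "nrm (realify K) x > 0"
    using nrm_realify_nonneg[OF x] by linarith
  have "nrm (realify K) x * nrm (realify K) x = rinner x x"
    unfolding nrm_realify using rinner_self_nonneg[OF x] by simp
  also have "\<dots> \<le> c * nrm (realify K) x" using le[OF x] by linarith
  finally show ?thesis using pos by (rule mult_right_le_imp_le)
qed (use c in simp)

lemma eq_by_rinner:
  assumes x: "x \<in> carrier K" and y: "y \<in> carrier K"
    and eq: "\<And>w. w \<in> carrier K \<Longrightarrow> rinner x w = rinner y w"
  shows "x = y"
proof -
  have "rinner (x \<ominus> y) (x \<ominus> y) = 0"
    using x y eq by (simp add: rinner_diff_left)
  then have "x \<ominus> y = \<zero>" using x y rinner_self_eq_0 by simp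
  then show ?thesis using x y real.diff_eq_zero_iff by simp
qed

end


lemma hilbert_complex: "hilbert complex_hspace"
proof -
  have simps [simp]: "carrier complex_hspace = UNIV" "add complex_hspace = (+)" "zero complex_hspace = 0"
    "smult complex_hspace = (*)" "cinner complex_hspace = (\<lambda>z w. z * cnj w)"
    by (simp_all add: complex_hspace_def)
  have grp: "abelian_group complex_hspace"
  proof (rule abelian_groupI)
    show "\<exists>y\<in>carrier complex_hspace. y \<oplus>\<^bsub>complex_hspace\<^esub> x = \<zero>\<^bsub>complex_hspace\<^esub>" for x
      by (rule bexI[of _ "- x"]) simp_all
  qed simp_all
  then interpret abelian_group complex_hspace .
  have mod: "module (ring_of_type_algebra :: complex ring) complex_hspace"
    by (rule moduleI[OF comm_ring_1_class.cring_from_type_algebra grp]) (simp_all add: algebra_simps)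
  have neg: "\<ominus>\<^bsub>complex_hspace\<^esub> y = - y" for y
    by (rule minus_equality) simp_all
  have dist: "vdist (realify complex_hspace) x y = dist x y" for x y
    by (simp add: vdist_def nrm_realify_cinner minus_eq neg dist_norm cmod_def complex_mult_cnj power2_eq_square
        flip: complex_cnj_diff)
  have "Metric_space.mcomplete (UNIV :: complex set) dist"
    unfolding Met_TC.mcomplete_def by (simp add: Cauchy_convergent_iff convergent_def)
  moreover have "vdist (realify complex_hspace) = dist" by (intro ext dist)
  ultimately have "Metric_space.mcomplete (carrier complex_hspace) (vdist (realify complex_hspace))" by simp
  then have "hilbert_space complex_hspace"
    using mod unfolding hilbert_space_def by (auto simp: algebra_simps)
  then show ?thesis by unfold_locales
qed

section \<open>Coordinate spaces, products and copies of Banach spaces\<close>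

lemma Rn_simps [simp]:
  "carrier (Rn n) = {x. \<forall>i\<ge>n. x i = 0}" "x \<oplus>\<^bsub>Rn n\<^esub> y = (\<lambda>i. x i + y i)"
  "c \<odot>\<^bsub>Rn n\<^esub> x = (\<lambda>i. c * x i)" "\<zero>\<^bsub>Rn n\<^esub> = (\<lambda>_. 0)" "nrm (Rn n) x = L2_set x {..<n}"
  by (simp_all add: Rn_def topspace_Euclidean_space)

lemma Normed_Rn: "Normed (Rn n)"
proof (rule NormedI)
  fix x :: "nat \<Rightarrow> real" assume "x \<in> carrier (Rn n)"
  then show "nrm (Rn n) x = 0 \<longleftrightarrow> x = \<zero>\<^bsub>Rn n\<^esub>"
    by (auto simp: L2_set_eq_0_iff fun_eq_iff) (metis leI lessThan_iff)
next
  fix c and x :: "nat \<Rightarrow> real"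
  show "nrm (Rn n) (c \<odot>\<^bsub>Rn n\<^esub> x) = \<bar>c\<bar> * nrm (Rn n) x"
    by (simp add: L2_set_def power_mult_distrib real_sqrt_mult flip: sum_distrib_left)
qed (auto simp: algebra_simps L2_set_triangle_ineq)

lemma Banach_Rn: "Banach (Rn n)"
proof -
  interpret Normed "Rn n" by (rule Normed_Rn)
  have neg: "\<ominus>\<^bsub>Rn n\<^esub> y = (\<lambda>i. - y i)" if "y \<in> carrier (Rn n)" for y
    using that by (simp add: minus_eq_smult)
  have dist: "vdist (Rn n) x y = L2_set (\<lambda>i. x i - y i) {..<n}"
    if "x \<in> carrier (Rn n)" "y \<in> carrier (Rn n)" for x y
    using that neg[OF that(2)] by (simp add: vdist_def minus_eq)
  have "metric.mcomplete"
    unfolding metric.mcomplete_def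
  proof (intro allI impI)
    fix \<sigma> assume \<sigma>: "metric.MCauchy \<sigma>"
    have in_Rn: "\<sigma> k \<in> carrier (Rn n)" for k
      using \<sigma>      unfolding metric.MCauchy_def by blast
    have "Cauchy (\<lambda>k. \<sigma> k i)" for i
    proof (rule CauchyI)
      fix e :: real assume "e > 0"
      then obtain N where N: "\<And>k l. N \<le> k \<Longrightarrow> N \<le> l \<Longrightarrow> vdist (Rn n) (\<sigma> k) (\<sigma> l) < e"
        using \<sigma> by (meson metric.MCauchy_def)
      have "norm (\<sigma> k i - \<sigma> l i) < e" if "N \<le> k" "N \<le> l" for k l
      proof (cases "i < n")
        case True
        have "\<bar>\<sigma> k i - \<sigma> l i\<bar> \<le> L2_set (\<lambda>i. \<bar>\<sigma> k i - \<sigma> l i\<bar>) {..<n}"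
          using True by (intro member_le_L2_set) auto
        also have "\<dots> = vdist (Rn n) (\<sigma> k) (\<sigma> l)"
          using in_Rn by (simp only: dist) (simp add: L2_set_def)
        finally show ?thesis using N[OF that] by simp
      next
        case False
        then show ?thesis using in_Rn \<open>e > 0\<close> by simp
      qed
      then show "\<exists>M. \<forall>k\<ge>M. \<forall>l\<ge>M. norm (\<sigma> k i - \<sigma> l i) < e" by blast
    qed
    then have "\<forall>i. \<exists>l. (\<lambda>k. \<sigma> k i) \<longlonglongrightarrow> l"
      by (simp add: real_Cauchy_convergent flip: convergent_def)
    then obtain L where L: "\<And>i. (\<lambda>k. \<sigma> k i) \<longlonglongrightarrow> L i" by metis
    have L_in: "L \<in> carrier (Rn n)"
    proof -
      have "L i = 0" if "i \<ge> n" for i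
        using L[of i] in_Rn that by (simp add: LIMSEQ_const_iff)
      then show ?thesis by simp
    qed
    have "(\<lambda>k. \<Sum>i<n. \<bar>\<sigma> k i - L i\<bar>) \<longlonglongrightarrow> (\<Sum>i<n. \<bar>L i - L i\<bar>)"
      by (intro tendsto_intros L)
    then have lim: "(\<lambda>k. \<Sum>i<n. \<bar>\<sigma> k i - L i\<bar>) \<longlonglongrightarrow> 0" by simp
    have "limitin metric.mtopology \<sigma> L sequentially"
      unfolding metric.limit_metric_sequentially
    proof (intro conjI allI impI L_in)
      fix e :: real assume "e > 0"
      then obtain N where N: "\<And>k. k \<ge> N \<Longrightarrow> (\<Sum>i<n. \<bar>\<sigma> k i - L i\<bar>) < e"
        using order_tendstoD(2)[OF lim] unfolding eventually_sequentially by blast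
      have "vdist (Rn n) (\<sigma> k) L < e" if "k \<ge> N" for k
        using N[OF that] L2_set_le_sum_abs[of "\<lambda>i. \<sigma> k i - L i" "{..<n}"]
        unfolding dist[OF in_Rn L_in] by linarith
      then show "\<exists>N. \<forall>k\<ge>N. \<sigma> k \<in> carrier (Rn n) \<and> vdist (Rn n) (\<sigma> k) L < e"
        using in_Rn by blast
    qed
    then show "\<exists>x. limitin metric.mtopology \<sigma> x sequentially" by (rule exI[of _ L])
  qed
  then show ?thesis by unfold_locales
qed

lemma prod_space_simps [simp]:
  "carrier (prod_space E F) = carrier E \<times> carrier F"
  "(x, y) \<oplus>\<^bsub>prod_space E F\<^esub> (x', y') = (x \<oplus>\<^bsub>E\<^esub> x', y \<oplus>\<^bsub>F\<^esub> y')"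
  "c \<odot>\<^bsub>prod_space E F\<^esub> (x, y) = (c \<odot>\<^bsub>E\<^esub> x, c \<odot>\<^bsub>F\<^esub> y)"
  "\<zero>\<^bsub>prod_space E F\<^esub> = (\<zero>\<^bsub>E\<^esub>, \<zero>\<^bsub>F\<^esub>)"
  "nrm (prod_space E F) (x, y) = sqrt ((nrm E x)\<^sup>2 + (nrm F y)\<^sup>2)"
  by (simp_all add: prod_space_def)

locale Banach2 = E: Banach E + F: Banach F
  for E :: "'a nspace" and F :: "'b nspace"
begin

lemma nrm_prod_le: "x \<in> carrier E \<Longrightarrow> y \<in> carrier F \<Longrightarrow> nrm (prod_space E F) (x, y) \<le> nrm E x + nrm F y"
  by (simp add: sqrt_sum_squares_le_sum)

lemma nrm_fst_le: "nrm E x \<le> nrm (prod_space E F) (x, y)"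
  and nrm_snd_le: "nrm F y \<le> nrm (prod_space E F) (x, y)"
  by simp_all

lemma Normed_prod: "Normed (prod_space E F)"
proof (rule NormedI)
  fix z w assume "z \<in> carrier (prod_space E F)" "w \<in> carrier (prod_space E F)"
  then obtain x y x' y' where [simp]: "z = (x, y)" "w = (x', y')"
    and c: "x \<in> carrier E" "y \<in> carrier F" "x' \<in> carrier E" "y' \<in> carrier F" by auto
  have "sqrt ((nrm E (x \<oplus>\<^bsub>E\<^esub> x'))\<^sup>2 + (nrm F (y \<oplus>\<^bsub>F\<^esub> y'))\<^sup>2)
      \<le> sqrt ((nrm E x + nrm E x')\<^sup>2 + (nrm F y + nrm F y')\<^sup>2)"
    using c by (intro real_sqrt_le_mono add_mono power_mono E.nrm_triangle F.nrm_triangle) auto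
  also have "\<dots> \<le> sqrt ((nrm E x)\<^sup>2 + (nrm F y)\<^sup>2) + sqrt ((nrm E x')\<^sup>2 + (nrm F y')\<^sup>2)"
    by (rule real_sqrt_sum_squares_triangle_ineq)
  finally show "nrm (prod_space E F) (z \<oplus>\<^bsub>prod_space E F\<^esub> w) \<le> nrm (prod_space E F) z + nrm (prod_space E F) w"
    by simp
next
  fix c z assume "z \<in> carrier (prod_space E F)"
  then obtain x y where [simp]: "z = (x, y)" and "x \<in> carrier E" "y \<in> carrier F" by auto
  then have "(\<bar>c\<bar> * nrm E x)\<^sup>2 + (\<bar>c\<bar> * nrm F y)\<^sup>2 = c\<^sup>2 * ((nrm E x)\<^sup>2 + (nrm F y)\<^sup>2)"
    by (simp add: power_mult_distrib algebra_simps)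
  then show "nrm (prod_space E F) (c \<odot>\<^bsub>prod_space E F\<^esub> z) = \<bar>c\<bar> * nrm (prod_space E F) z"
    using \<open>x \<in> carrier E\<close> \<open>y \<in> carrier F\<close> by (simp add: real_sqrt_mult)
next
  fix z assume "z \<in> carrier (prod_space E F)"
  then obtain x y where [simp]: "z = (x, y)" and c: "x \<in> carrier E" "y \<in> carrier F" by auto
  show "0 \<le> nrm (prod_space E F) z" by simp
  show "nrm (prod_space E F) z = 0 \<longleftrightarrow> z = \<zero>\<^bsub>prod_space E F\<^esub>"
    using c by (simp add: E.nrm_eq_0 F.nrm_eq_0 sum_power2_eq_zero_iff)
  show "(-1) \<odot>\<^bsub>prod_space E F\<^esub> z \<oplus>\<^bsub>prod_space E F\<^esub> z = \<zero>\<^bsub>prod_space E F\<^esub>"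
    using c E.l_neg F.l_neg by (simp flip: E.minus_eq_smult F.minus_eq_smult)
qed (auto simp: E.a_ac F.a_ac E.smult_add_left F.smult_add_left
    E.smult_add_right F.smult_add_right E.smult_smult F.smult_smult)

sublocale P: Normed "prod_space E F"
  by (rule Normed_prod)

lemma prod_neg: "y \<in> carrier F \<Longrightarrow> x \<in> carrier E \<Longrightarrow>
    \<ominus>\<^bsub>prod_space E F\<^esub> (x, y) = (\<ominus>\<^bsub>E\<^esub> x, \<ominus>\<^bsub>F\<^esub> y)"
  by (simp add: P.minus_eq_smult E.minus_eq_smult F.minus_eq_smult)

lemma prod_diff: "x \<in> carrier E \<Longrightarrow> y \<in> carrier F \<Longrightarrow> x' \<in> carrier E \<Longrightarrow> y' \<in> carrier F \<Longrightarrow>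
    (x, y) \<ominus>\<^bsub>prod_space E F\<^esub> (x', y') = (x \<ominus>\<^bsub>E\<^esub> x', y \<ominus>\<^bsub>F\<^esub> y')"
  by (simp add: P.minus_eq prod_neg E.minus_eq F.minus_eq)

sublocale M: Metric_space12 "carrier E" "vdist E" "carrier F" "vdist F"
  by unfold_locales

lemma vdist_prod:
  assumes "z \<in> carrier E \<times> carrier F" "w \<in> carrier E \<times> carrier F"
  shows "vdist (prod_space E F) z w = prod_dist (vdist E) (vdist F) z w"
  using assms by (auto simp: vdist_def prod_dist_def prod_diff)

lemma vtop_prod: "vtop (prod_space E F) = prod_topology (vtop E) (vtop F)"
  using mtopology_cong[OF P.Metric_space_vdist[unfolded prod_space_simps] M.prod_metric vdist_prod]
  by (simp add: vtop_def M.mtopology_prod_metric)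

lemma Banach_prod: "Banach (prod_space E F)"
proof -
  have "Metric_space.mcomplete (carrier (prod_space E F)) (vdist (prod_space E F))"
    using mcomplete_cong[OF P.Metric_space_vdist[unfolded prod_space_simps] M.prod_metric vdist_prod]
      E.mcomplete F.mcomplete
    by (simp add: M.mcomplete_prod_metric)
  then show ?thesis by unfold_locales
qed

end

sublocale Banach2 \<subseteq> P: Banach "prod_space E F"
  by (rule Banach_prod)

text \<open>A copy of a Banach space along an injection: the charts of the total space need model spaces
  whose points lie in the prescribed type \<open>'m\<close>.\<close>

definition push :: "('a \<Rightarrow> 'b) \<Rightarrow> 'a nspace \<Rightarrow> 'b nspace" where
  "push e E = \<lparr>carrier = e ` carrier E, mult = undefined, one = undefined, zero = e \<zero>\<^bsub>E\<^esub>,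
     add = (\<lambda>a b. e (inv_into UNIV e a \<oplus>\<^bsub>E\<^esub> inv_into UNIV e b)), smult = (\<lambda>c a. e (c \<odot>\<^bsub>E\<^esub> inv_into UNIV e a)),
     nrm = (\<lambda>a. nrm E (inv_into UNIV e a))\<rparr>"

locale pushed_Banach = Banach E for E :: "'a nspace" +
  fixes e :: "'a \<Rightarrow> 'b"
  assumes inj: "inj e"
begin

lemma push_simps [simp]:
  "carrier (push e E) = e ` carrier E"
  "e x \<oplus>\<^bsub>push e E\<^esub> e y = e (x \<oplus>\<^bsub>E\<^esub> y)"
  "c \<odot>\<^bsub>push e E\<^esub> e x = e (c \<odot>\<^bsub>E\<^esub> x)"
  "\<zero>\<^bsub>push e E\<^esub> = e \<zero>\<^bsub>E\<^esub>"
  "nrm (push e E) (e x) = nrm E x"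
  using inj by (simp_all add: push_def)

lemma Normed_push: "Normed (push e E)"
  by (rule NormedI)
    (use inj in \<open>auto simp: a_ac smult_add_left smult_add_right smult_smult nrm_eq_0
      nrm_triangle inj_eq l_neg r_neg simp flip: minus_eq_smult\<close>)

sublocale P: Normed "push e E"
  by (rule Normed_push)

lemma push_diff: "x \<in> carrier E \<Longrightarrow> y \<in> carrier E \<Longrightarrow> e x \<ominus>\<^bsub>push e E\<^esub> e y = e (x \<ominus>\<^bsub>E\<^esub> y)"
  by (simp add: P.minus_eq P.minus_eq_smult minus_eq minus_eq_smult)

lemma vdist_push: "x \<in> carrier E \<Longrightarrow> y \<in> carrier E \<Longrightarrow> vdist (push e E) (e x) (e y) = vdist E x y"
  by (simp add: vdist_def push_diff)

lemma Banach_push: "Banach (push e E)"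
proof -
  have "P.metric.mcomplete"
    unfolding P.metric.mcomplete_def
  proof (intro allI impI)
    fix \<sigma> assume \<sigma>: "P.metric.MCauchy \<sigma>"
    define \<tau> where "\<tau> k = inv_into UNIV e (\<sigma> k)" for k
    have \<tau>: "\<sigma> k = e (\<tau> k)" "\<tau> k \<in> carrier E" for k
    proof -
      have "range \<sigma> \<subseteq> carrier (push e E)" using \<sigma> unfolding P.metric.MCauchy_def by blast
      then have "\<sigma> k \<in> e ` carrier E" by auto
      then show "\<sigma> k = e (\<tau> k)" "\<tau> k \<in> carrier E" using inj by (auto simp: \<tau>_def)
    qed
    have d: "vdist (push e E) (\<sigma> k) (\<sigma> l) = vdist E (\<tau> k) (\<tau> l)" for k l
      using \<tau> by (simp add: vdist_push)
    have "metric.MCauchy \<tau>"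
      using \<sigma> \<tau>(2) unfolding metric.MCauchy_def P.metric.MCauchy_def d by blast
    then obtain x where x: "limitin metric.mtopology \<tau> x sequentially"
      using mcomplete by (auto simp: metric.mcomplete_def)
    have "limitin P.metric.mtopology \<sigma> (e x) sequentially"
      using x \<tau> unfolding metric.limit_metric_sequentially P.metric.limit_metric_sequentially
      by (simp add: vdist_push)
    then show "\<exists>x. limitin P.metric.mtopology \<sigma> x sequentially" ..
  qed
  then show ?thesis by unfold_locales
qed

lemma openin_push: "openin (vtop (push e E)) (e ` S) \<longleftrightarrow> openin (vtop E) S" if "S \<subseteq> carrier E"
  using that inj by (auto simp: P.openin_vtop openin_vtop inj_image_subset_iff inj_image_mem_iff)

end

section \<open>Derivatives\<close>

abbreviation prodnrm :: "'a nspace \<Rightarrow> 'a list \<Rightarrow> real" where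
  "prodnrm E vs \<equiv> prod_list (map (nrm E) vs)"

text \<open>Neighbourhoods of zero. As a filter they allow the estimates for several derivatives to be combined
  without naming the radii.\<close>

definition small :: "'a nspace \<Rightarrow> 'a filter" where
  "small E = (INF d\<in>{0<..}. principal {h \<in> carrier E. nrm E h < d})"

lemma eventually_small:
  "eventually P (small E) \<longleftrightarrow> (\<exists>\<delta>>0. \<forall>h\<in>carrier E. nrm E h < \<delta> \<longrightarrow> P h)"
proof -
  have "eventually P (small E) \<longleftrightarrow> (\<exists>d\<in>{0<..}. eventually P (principal {h \<in> carrier E. nrm E h < d}))"
    unfolding small_def
  proof (rule eventually_INF_base)
    fix a b :: real assume "a \<in> {0<..}" "b \<in> {0<..}"
    then show "\<exists>x\<in>{0<..}. principal {h \<in> carrier E. nrm E h < x} \<le>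
        inf (principal {h \<in> carrier E. nrm E h < a}) (principal {h \<in> carrier E. nrm E h < b})"
      by (intro bexI[of _ "min a b"]) auto
  qed auto
  then show ?thesis by (auto simp: eventually_principal)
qed

lemma eventually_small_carrier: "\<forall>\<^sub>F h in small E. h \<in> carrier E"
  unfolding eventually_small by (rule exI[of _ 1]) simp

lemma eventually_small_less: "0 < d \<Longrightarrow> \<forall>\<^sub>F h in small E. nrm E h < d"
  unfolding eventually_small by auto

context Normed
begin

lemma eventually_small_open:
  assumes "openin (vtop E) U" "x \<in> U"
  shows "\<forall>\<^sub>F h in small E. x \<oplus> h \<in> U"
  using assms by (auto simp: openin_vtop eventually_small)

lemma filterlim_smult_small:
  assumes h: "h \<in> carrier E"
  shows "filterlim (\<lambda>t. t \<odot> h) (small E) (at 0)"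
  unfolding filterlim_iff eventually_small
proof (intro allI impI, elim exE conjE)
  fix P and d :: real assume d: "d > 0" and P: "\<forall>h\<in>carrier E. nrm E h < d \<longrightarrow> P h"
  have "((\<lambda>t. \<bar>t\<bar> * nrm E h) \<longlongrightarrow> \<bar>0\<bar> * nrm E h) (at 0)"
    by (intro tendsto_intros)
  then have "\<forall>\<^sub>F t in at 0. \<bar>t\<bar> * nrm E h < d"
    using d by (intro order_tendstoD(2)) auto
  then show "\<forall>\<^sub>F t in at 0. P (t \<odot> h)"
    by eventually_elim (use h P in auto)
qed

lemma filterlim_smult_small_right:
  "h \<in> carrier E \<Longrightarrow> filterlim (\<lambda>t. t \<odot> h) (small E) (at_right 0)"
  using filterlim_smult_small by (simp add: filterlim_at_split)

lemma prodnrm_nonneg [simp]: "vs \<in> lists (carrier E) \<Longrightarrow> 0 \<le> prodnrm E vs"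
  by (induction vs) auto

end

definition list_deriv ::
  "'a nspace \<Rightarrow> 'b nspace \<Rightarrow> 'a set \<Rightarrow> nat \<Rightarrow> ('a \<Rightarrow> 'a list \<Rightarrow> 'b) \<Rightarrow> 'a \<Rightarrow> bool" where
  "list_deriv E F U k D x \<longleftrightarrow>
     (\<forall>\<epsilon>>0. \<forall>\<^sub>F h in small E. x \<oplus>\<^bsub>E\<^esub> h \<in> U \<longrightarrow> (\<forall>vs\<in>lists (carrier E). length vs = k \<longrightarrow>
        nrm F ((D (x \<oplus>\<^bsub>E\<^esub> h) vs \<ominus>\<^bsub>F\<^esub> D x vs) \<ominus>\<^bsub>F\<^esub> D x (h # vs)) \<le> \<epsilon> * nrm E h * prodnrm E vs))"

definition smooth_derivs :: "'a nspace \<Rightarrow> 'b nspace \<Rightarrow> 'a set \<Rightarrow> ('a \<Rightarrow> 'a list \<Rightarrow> 'b) \<Rightarrow> bool" where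
  "smooth_derivs E F U D \<longleftrightarrow>
     (\<forall>k. \<forall>x\<in>U. bounded_multilinear E F k (D x) \<and> list_deriv E F U k D x)"

lemma smooth_on_iff:
  "smooth_on E F U f \<longleftrightarrow>
     openin (vtop E) U \<and> (\<exists>D. (\<forall>x\<in>U. D x [] = f x) \<and> smooth_derivs E F U D)"
  unfolding smooth_on_def smooth_derivs_def list_deriv_def eventually_small imp_conjL ..

lemma smooth_onE:
  assumes "smooth_on E F U f"
  obtains D where "openin (vtop E) U" "\<And>x. x \<in> U \<Longrightarrow> D x [] = f x" "smooth_derivs E F U D"
  using assms unfolding smooth_on_iff by blast

lemma smooth_on_cong: "smooth_on E F U f \<Longrightarrow> (\<And>x. x \<in> U \<Longrightarrow> f x = g x) \<Longrightarrow> smooth_on E F U g"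
  unfolding smooth_on_iff by metis

lemma smooth_derivs_subset: "smooth_derivs E F U D \<Longrightarrow> V \<subseteq> U \<Longrightarrow> smooth_derivs E F V D"
  unfolding smooth_derivs_def list_deriv_def
  by (blast intro: eventually_mono)

lemma smooth_on_subset: "smooth_on E F U f \<Longrightarrow> openin (vtop E) V \<Longrightarrow> V \<subseteq> U \<Longrightarrow> smooth_on E F V f"
  unfolding smooth_on_iff using smooth_derivs_subset by blast

lemma smooth_derivs_closed:
  "smooth_derivs E F U D \<Longrightarrow> x \<in> U \<Longrightarrow> vs \<in> lists (carrier E) \<Longrightarrow> D x vs \<in> carrier F"
  unfolding smooth_derivs_def bounded_multilinear_def by blast

lemma smooth_derivs_add:
  assumes "smooth_derivs E F U D" "x \<in> U" "us \<in> lists (carrier E)" "ws \<in> lists (carrier E)"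
    "a \<in> carrier E" "b \<in> carrier E"
  shows "D x (us @ (a \<oplus>\<^bsub>E\<^esub> b) # ws) = D x (us @ a # ws) \<oplus>\<^bsub>F\<^esub> D x (us @ b # ws)"
proof -
  have "bounded_multilinear E F (length us + 1 + length ws) (D x)"
    using assms unfolding smooth_derivs_def by blast
  then show ?thesis using assms unfolding bounded_multilinear_def by blast
qed

lemma smooth_derivs_smult:
  assumes "smooth_derivs E F U D" "x \<in> U" "us \<in> lists (carrier E)" "ws \<in> lists (carrier E)"
    "a \<in> carrier E"
  shows "D x (us @ (c \<odot>\<^bsub>E\<^esub> a) # ws) = c \<odot>\<^bsub>F\<^esub> D x (us @ a # ws)"
proof -
  have "bounded_multilinear E F (length us + 1 + length ws) (D x)"
    using assms unfolding smooth_derivs_def by blast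
  then show ?thesis using assms unfolding bounded_multilinear_def by blast
qed

lemma smooth_derivs_deriv:
  assumes "smooth_derivs E F U D" "x \<in> U" "\<epsilon> > 0"
  shows "\<forall>\<^sub>F h in small E. x \<oplus>\<^bsub>E\<^esub> h \<in> U \<longrightarrow> (\<forall>vs\<in>lists (carrier E). length vs = k \<longrightarrow>
        nrm F ((D (x \<oplus>\<^bsub>E\<^esub> h) vs \<ominus>\<^bsub>F\<^esub> D x vs) \<ominus>\<^bsub>F\<^esub> D x (h # vs)) \<le> \<epsilon> * nrm E h * prodnrm E vs)"
  using assms unfolding smooth_derivs_def list_deriv_def by blast

text \<open>Right-sided directional derivatives determine all derivatives, so they are the tool for
  uniqueness.\<close>

definition dir_deriv :: "'a nspace \<Rightarrow> 'b nspace \<Rightarrow> ('a \<Rightarrow> 'b) \<Rightarrow> 'a \<Rightarrow> 'a \<Rightarrow> 'b \<Rightarrow> bool" where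
  "dir_deriv E F u x h d \<longleftrightarrow>
     (\<forall>\<epsilon>>0. \<forall>\<^sub>F t in at_right 0.
        nrm F ((u (x \<oplus>\<^bsub>E\<^esub> t \<odot>\<^bsub>E\<^esub> h) \<ominus>\<^bsub>F\<^esub> u x) \<ominus>\<^bsub>F\<^esub> t \<odot>\<^bsub>F\<^esub> d) \<le> \<epsilon> * t)"

locale Banach_maps = E: Banach E + F: Banach F
  for E :: "'a nspace" and F :: "'b nspace" +
  fixes U :: "'a set"
  assumes U: "openin (vtop E) U"
begin

lemma U_carrier: "x \<in> U \<Longrightarrow> x \<in> carrier E"
  using U E.openin_vtop by blast

lemma smooth_derivs_bound:
  assumes D: "smooth_derivs E F U D" and x: "x \<in> U"
  obtains C where "C > 0" "\<And>vs. vs \<in> lists (carrier E) \<Longrightarrow> length vs = k \<Longrightarrow> nrm F (D x vs) \<le> C * prodnrm E vs"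
proof -
  obtain C where C: "\<forall>vs\<in>lists (carrier E). length vs = k \<longrightarrow> nrm F (D x vs) \<le> C * prodnrm E vs"
  proof -
    have "bounded_multilinear E F k (D x)" using assms by (simp add: smooth_derivs_def)
    then show thesis using that unfolding bounded_multilinear_def by blast
  qed
  have "nrm F (D x vs) \<le> (\<bar>C\<bar> + 1) * prodnrm E vs" if vs: "vs \<in> lists (carrier E)" "length vs = k" for vs
  proof -
    have "C * prodnrm E vs \<le> (\<bar>C\<bar> + 1) * prodnrm E vs"
      using vs by (intro mult_right_mono) auto
    then show ?thesis using C vs by force
  qed
  then show thesis by (intro that[of "\<bar>C\<bar> + 1"]) auto
qed

lemma eventually_in_U:
  assumes x: "x \<in> U" and h: "h \<in> carrier E"
  shows "\<forall>\<^sub>F t in at_right 0. x \<oplus>\<^bsub>E\<^esub> t \<odot>\<^bsub>E\<^esub> h \<in> U"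
  using E.filterlim_smult_small_right[OF h] E.eventually_small_open[OF U x] unfolding filterlim_iff by blast

text \<open>In the applications \<open>u y\<close> is a derivative of order \<open>k\<close> at fixed vectors and \<open>c\<close> is the product of
  their norms.\<close>

lemma dir_derivI:
  assumes est: "\<And>\<epsilon>. \<epsilon> > 0 \<Longrightarrow> \<forall>\<^sub>F k in small E. x \<oplus>\<^bsub>E\<^esub> k \<in> U \<longrightarrow>
      nrm F ((u (x \<oplus>\<^bsub>E\<^esub> k) \<ominus>\<^bsub>F\<^esub> u x) \<ominus>\<^bsub>F\<^esub> L k) \<le> \<epsilon> * nrm E k * c"
    and L: "\<And>t. L (t \<odot>\<^bsub>E\<^esub> h) = t \<odot>\<^bsub>F\<^esub> L h" and c: "c \<ge> 0" and x: "x \<in> U" and h: "h \<in> carrier E"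
  shows "dir_deriv E F u x h (L h)"
  unfolding dir_deriv_def
proof (intro allI impI)
  fix \<epsilon> :: real assume "\<epsilon> > 0"
  define \<epsilon>' where "\<epsilon>' = \<epsilon> / (1 + nrm E h * c)"
  have pos: "1 + nrm E h * c > 0" using c h by (simp add: add_pos_nonneg)
  then have "\<epsilon>' > 0" using \<open>\<epsilon> > 0\<close> by (simp add: \<epsilon>'_def)
  from est[OF this] have "\<forall>\<^sub>F t in at_right 0. x \<oplus>\<^bsub>E\<^esub> t \<odot>\<^bsub>E\<^esub> h \<in> U \<longrightarrow>
      nrm F ((u (x \<oplus>\<^bsub>E\<^esub> t \<odot>\<^bsub>E\<^esub> h) \<ominus>\<^bsub>F\<^esub> u x) \<ominus>\<^bsub>F\<^esub> L (t \<odot>\<^bsub>E\<^esub> h)) \<le> \<epsilon>' * nrm E (t \<odot>\<^bsub>E\<^esub> h) * c"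
    using E.filterlim_smult_small_right[OF h] unfolding filterlim_iff by blast
  with eventually_in_U[OF x h] eventually_at_right_less[of 0]
  show "\<forall>\<^sub>F t in at_right 0. nrm F ((u (x \<oplus>\<^bsub>E\<^esub> t \<odot>\<^bsub>E\<^esub> h) \<ominus>\<^bsub>F\<^esub> u x) \<ominus>\<^bsub>F\<^esub> t \<odot>\<^bsub>F\<^esub> L h) \<le> \<epsilon> * t"
  proof eventually_elim
    case (elim t)
    have "\<epsilon>' * nrm E (t \<odot>\<^bsub>E\<^esub> h) * c = t * (\<epsilon>' * (nrm E h * c))"
      using elim h by simp
    also have "\<dots> \<le> t * (\<epsilon>' * (1 + nrm E h * c))"
      using elim \<open>\<epsilon>' > 0\<close> by (intro mult_left_mono) auto
    also have "\<dots> = \<epsilon> * t" using pos by (simp add: \<epsilon>'_def)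
    finally show ?case using elim by (simp add: L)
  qed
qed

lemma dir_deriv_unique:
  assumes d: "dir_deriv E F u x h d" and d': "dir_deriv E F u x h d'"
    and u: "\<And>y. y \<in> U \<Longrightarrow> u y \<in> carrier F" and x: "x \<in> U" and h: "h \<in> carrier E"
    and c: "d \<in> carrier F" "d' \<in> carrier F"
  shows "d = d'"
proof -
  have "nrm F (d' \<ominus>\<^bsub>F\<^esub> d) \<le> 0"
  proof (rule field_le_epsilon)
    fix \<epsilon> :: real assume "\<epsilon> > 0"
    then have "\<forall>\<^sub>F t in at_right 0. nrm F ((u (x \<oplus>\<^bsub>E\<^esub> t \<odot>\<^bsub>E\<^esub> h) \<ominus>\<^bsub>F\<^esub> u x) \<ominus>\<^bsub>F\<^esub> t \<odot>\<^bsub>F\<^esub> d) \<le> \<epsilon> / 2 * t"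
      "\<forall>\<^sub>F t in at_right 0. nrm F ((u (x \<oplus>\<^bsub>E\<^esub> t \<odot>\<^bsub>E\<^esub> h) \<ominus>\<^bsub>F\<^esub> u x) \<ominus>\<^bsub>F\<^esub> t \<odot>\<^bsub>F\<^esub> d') \<le> \<epsilon> / 2 * t"
      using d d' unfolding dir_deriv_def by (meson half_gt_zero)+
    with eventually_in_U[OF x h] eventually_at_right_less[of 0]
    have "\<forall>\<^sub>F t::real in at_right 0. nrm F (d' \<ominus>\<^bsub>F\<^esub> d) \<le> \<epsilon>"
    proof eventually_elim
      case (elim t)
      let ?X = "u (x \<oplus>\<^bsub>E\<^esub> t \<odot>\<^bsub>E\<^esub> h) \<ominus>\<^bsub>F\<^esub> u x"
      have X: "?X \<in> carrier F" using u elim x by simp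
      have "t * nrm F (d' \<ominus>\<^bsub>F\<^esub> d) = nrm F (t \<odot>\<^bsub>F\<^esub> d' \<ominus>\<^bsub>F\<^esub> t \<odot>\<^bsub>F\<^esub> d)"
        using elim c by (simp flip: F.smult_diff_right)
      also have "\<dots> = nrm F ((?X \<ominus>\<^bsub>F\<^esub> t \<odot>\<^bsub>F\<^esub> d) \<ominus>\<^bsub>F\<^esub> (?X \<ominus>\<^bsub>F\<^esub> t \<odot>\<^bsub>F\<^esub> d'))"
        using c X by (simp add: F.diff_diff_same)
      also have "\<dots> \<le> nrm F (?X \<ominus>\<^bsub>F\<^esub> t \<odot>\<^bsub>F\<^esub> d) + nrm F (?X \<ominus>\<^bsub>F\<^esub> t \<odot>\<^bsub>F\<^esub> d')"
        using c X by (intro F.nrm_diff_triangle) auto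
      also have "\<dots> \<le> \<epsilon> / 2 * t + \<epsilon> / 2 * t"
        by (intro add_mono elim)
      finally show ?case using elim by (simp add: mult.commute)
    qed
    then show "nrm F (d' \<ominus>\<^bsub>F\<^esub> d) \<le> 0 + \<epsilon>"
      by (simp add: eventually_const)
  qed
  then have "nrm F (d' \<ominus>\<^bsub>F\<^esub> d) = 0"
    using c by (simp add: antisym)
  then have "d' \<ominus>\<^bsub>F\<^esub> d = \<zero>\<^bsub>F\<^esub>"
    using c by (simp add: F.nrm_eq_0)
  then show ?thesis using c by (simp add: F.diff_eq_zero_iff)
qed

lemma dir_deriv_cong:
  assumes d: "dir_deriv E F u x h d" and eq: "\<And>y. y \<in> U \<Longrightarrow> u y = v y"
    and x: "x \<in> U" and h: "h \<in> carrier E"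
  shows "dir_deriv E F v x h d"
  unfolding dir_deriv_def
proof (intro allI impI)
  fix \<epsilon> :: real assume "\<epsilon> > 0"
  with d have "\<forall>\<^sub>F t in at_right 0. nrm F ((u (x \<oplus>\<^bsub>E\<^esub> t \<odot>\<^bsub>E\<^esub> h) \<ominus>\<^bsub>F\<^esub> u x) \<ominus>\<^bsub>F\<^esub> t \<odot>\<^bsub>F\<^esub> d) \<le> \<epsilon> * t"
    by (simp add: dir_deriv_def)
  with eventually_in_U[OF x h]
  show "\<forall>\<^sub>F t in at_right 0. nrm F ((v (x \<oplus>\<^bsub>E\<^esub> t \<odot>\<^bsub>E\<^esub> h) \<ominus>\<^bsub>F\<^esub> v x) \<ominus>\<^bsub>F\<^esub> t \<odot>\<^bsub>F\<^esub> d) \<le> \<epsilon> * t"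
    by eventually_elim (simp add: eq x)
qed

lemma dir_deriv_add:
  assumes d: "dir_deriv E F u x h d" and e: "dir_deriv E F v x h e"
    and u: "\<And>y. y \<in> U \<Longrightarrow> u y \<in> carrier F" and v: "\<And>y. y \<in> U \<Longrightarrow> v y \<in> carrier F"
    and x: "x \<in> U" and h: "h \<in> carrier E" and c: "d \<in> carrier F" "e \<in> carrier F"
  shows "dir_deriv E F (\<lambda>y. u y \<oplus>\<^bsub>F\<^esub> v y) x h (d \<oplus>\<^bsub>F\<^esub> e)"
  unfolding dir_deriv_def
proof (intro allI impI)
  fix \<epsilon> :: real assume "\<epsilon> > 0"
  then have "\<forall>\<^sub>F t in at_right 0. nrm F ((u (x \<oplus>\<^bsub>E\<^esub> t \<odot>\<^bsub>E\<^esub> h) \<ominus>\<^bsub>F\<^esub> u x) \<ominus>\<^bsub>F\<^esub> t \<odot>\<^bsub>F\<^esub> d) \<le> \<epsilon> / 2 * t"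
    "\<forall>\<^sub>F t in at_right 0. nrm F ((v (x \<oplus>\<^bsub>E\<^esub> t \<odot>\<^bsub>E\<^esub> h) \<ominus>\<^bsub>F\<^esub> v x) \<ominus>\<^bsub>F\<^esub> t \<odot>\<^bsub>F\<^esub> e) \<le> \<epsilon> / 2 * t"
    using d e unfolding dir_deriv_def by (meson half_gt_zero)+
  with eventually_in_U[OF x h]
  show "\<forall>\<^sub>F t in at_right 0. nrm F (((u (x \<oplus>\<^bsub>E\<^esub> t \<odot>\<^bsub>E\<^esub> h) \<oplus>\<^bsub>F\<^esub> v (x \<oplus>\<^bsub>E\<^esub> t \<odot>\<^bsub>E\<^esub> h)) \<ominus>\<^bsub>F\<^esub>
      (u x \<oplus>\<^bsub>F\<^esub> v x)) \<ominus>\<^bsub>F\<^esub> t \<odot>\<^bsub>F\<^esub> (d \<oplus>\<^bsub>F\<^esub> e)) \<le> \<epsilon> * t"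
  proof eventually_elim
    case (elim t)
    let ?y = "x \<oplus>\<^bsub>E\<^esub> t \<odot>\<^bsub>E\<^esub> h"
    have "((u ?y \<oplus>\<^bsub>F\<^esub> v ?y) \<ominus>\<^bsub>F\<^esub> (u x \<oplus>\<^bsub>F\<^esub> v x)) \<ominus>\<^bsub>F\<^esub> t \<odot>\<^bsub>F\<^esub> (d \<oplus>\<^bsub>F\<^esub> e)
        = ((u ?y \<ominus>\<^bsub>F\<^esub> u x) \<ominus>\<^bsub>F\<^esub> t \<odot>\<^bsub>F\<^esub> d) \<oplus>\<^bsub>F\<^esub> ((v ?y \<ominus>\<^bsub>F\<^esub> v x) \<ominus>\<^bsub>F\<^esub> t \<odot>\<^bsub>F\<^esub> e)"
      using u v elim x c by (simp add: F.smult_add_right F.diff_add_rearrange)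
    also have "nrm F \<dots> \<le> \<epsilon> / 2 * t + \<epsilon> / 2 * t"
      using u v elim x c by (intro order_trans[OF F.nrm_triangle] add_mono) auto
    finally show ?case by simp
  qed
qed

lemma dir_deriv_smult:
  assumes d: "dir_deriv E F u x h d" and u: "\<And>y. y \<in> U \<Longrightarrow> u y \<in> carrier F"
    and x: "x \<in> U" and h: "h \<in> carrier E" and c: "d \<in> carrier F"
  shows "dir_deriv E F (\<lambda>y. r \<odot>\<^bsub>F\<^esub> u y) x h (r \<odot>\<^bsub>F\<^esub> d)"
  unfolding dir_deriv_def
proof (intro allI impI)
  fix \<epsilon> :: real assume "\<epsilon> > 0"
  then have "\<epsilon> / (1 + \<bar>r\<bar>) > 0" by (simp add: add_pos_nonneg)
  then have "\<forall>\<^sub>F t in at_right 0. nrm F ((u (x \<oplus>\<^bsub>E\<^esub> t \<odot>\<^bsub>E\<^esub> h) \<ominus>\<^bsub>F\<^esub> u x) \<ominus>\<^bsub>F\<^esub> t \<odot>\<^bsub>F\<^esub> d) \<le> \<epsilon> / (1 + \<bar>r\<bar>) * t"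
    using d unfolding dir_deriv_def by blast
  with eventually_in_U[OF x h] eventually_at_right_less[of 0]
  show "\<forall>\<^sub>F t in at_right 0. nrm F ((r \<odot>\<^bsub>F\<^esub> u (x \<oplus>\<^bsub>E\<^esub> t \<odot>\<^bsub>E\<^esub> h) \<ominus>\<^bsub>F\<^esub> r \<odot>\<^bsub>F\<^esub> u x) \<ominus>\<^bsub>F\<^esub>
       t \<odot>\<^bsub>F\<^esub> (r \<odot>\<^bsub>F\<^esub> d)) \<le> \<epsilon> * t"
  proof eventually_elim
    case (elim t)
    let ?y = "x \<oplus>\<^bsub>E\<^esub> t \<odot>\<^bsub>E\<^esub> h"
    have "(r \<odot>\<^bsub>F\<^esub> u ?y \<ominus>\<^bsub>F\<^esub> r \<odot>\<^bsub>F\<^esub> u x) \<ominus>\<^bsub>F\<^esub> t \<odot>\<^bsub>F\<^esub> (r \<odot>\<^bsub>F\<^esub> d)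
        = r \<odot>\<^bsub>F\<^esub> ((u ?y \<ominus>\<^bsub>F\<^esub> u x) \<ominus>\<^bsub>F\<^esub> t \<odot>\<^bsub>F\<^esub> d)"
      using u elim x c by (simp add: F.smult_diff_right F.smult_smult mult.commute)
    also have "nrm F \<dots> = \<bar>r\<bar> * nrm F ((u ?y \<ominus>\<^bsub>F\<^esub> u x) \<ominus>\<^bsub>F\<^esub> t \<odot>\<^bsub>F\<^esub> d)"
      using u elim x c by simp
    also have "\<dots> \<le> (1 + \<bar>r\<bar>) * (\<epsilon> / (1 + \<bar>r\<bar>) * t)"
      using u elim x c \<open>\<epsilon> > 0\<close> by (intro mult_mono) auto
    also have "\<dots> = \<epsilon> * t" by (simp add: field_simps)
    finally show ?case .
  qed
qed

lemma smooth_derivs_dir: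
  assumes D: "smooth_derivs E F U D" and x: "x \<in> U" and h: "h \<in> carrier E"
    and vs: "vs \<in> lists (carrier E)"
  shows "dir_deriv E F (\<lambda>y. D y vs) x h (D x (h # vs))"
proof (rule dir_derivI[where L = "\<lambda>h. D x (h # vs)" and c = "prodnrm E vs"])
  show "D x (t \<odot>\<^bsub>E\<^esub> h # vs) = t \<odot>\<^bsub>F\<^esub> D x (h # vs)" for t
    using smooth_derivs_smult[OF D x, of "[]" vs h t] h vs by simp
  show "\<forall>\<^sub>F k in small E. x \<oplus>\<^bsub>E\<^esub> k \<in> U \<longrightarrow>
      nrm F ((D (x \<oplus>\<^bsub>E\<^esub> k) vs \<ominus>\<^bsub>F\<^esub> D x vs) \<ominus>\<^bsub>F\<^esub> D x (k # vs)) \<le> \<epsilon> * nrm E k * prodnrm E vs"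
    if "\<epsilon> > 0" for \<epsilon>
    using smooth_derivs_deriv[OF D x that, of "length vs"] by eventually_elim (use vs in blast)
qed (use vs x h in auto)

text \<open>Each order determines the next one through directional derivatives.\<close>

lemma smooth_derivs_unique:
  assumes D: "smooth_derivs E F U D" and D': "smooth_derivs E F U D'"
    and eq: "\<And>x. x \<in> U \<Longrightarrow> D x [] = D' x []"
    and vs: "vs \<in> lists (carrier E)"
  shows "x \<in> U \<Longrightarrow> D x vs = D' x vs"
  using vs
proof (induction vs arbitrary: x)
  case (Cons h vs)
  note closed = smooth_derivs_closed[OF D] smooth_derivs_closed[OF D']
  show ?case
  proof (rule dir_deriv_unique)
    show "dir_deriv E F (\<lambda>y. D y vs) x h (D x (h # vs))"
      using Cons by (intro smooth_derivs_dir[OF D]) auto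
    show "dir_deriv E F (\<lambda>y. D y vs) x h (D' x (h # vs))"
      using Cons by (intro dir_deriv_cong[OF smooth_derivs_dir[OF D']]) auto
  qed (use Cons closed in auto)
qed (use eq in simp)

text \<open>Only linearity in the first vector has to be checked: in the later ones it is inherited from
  the derivatives of lower order, because the derivative of a sum is unique.\<close>

lemma smooth_derivsI:
  assumes closed: "\<And>x vs. x \<in> U \<Longrightarrow> vs \<in> lists (carrier E) \<Longrightarrow> D x vs \<in> carrier F"
    and add: "\<And>x a b vs. x \<in> U \<Longrightarrow> a \<in> carrier E \<Longrightarrow> b \<in> carrier E \<Longrightarrow> vs \<in> lists (carrier E) \<Longrightarrow>
        D x ((a \<oplus>\<^bsub>E\<^esub> b) # vs) = D x (a # vs) \<oplus>\<^bsub>F\<^esub> D x (b # vs)"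
    and smult: "\<And>x a c vs. x \<in> U \<Longrightarrow> a \<in> carrier E \<Longrightarrow> vs \<in> lists (carrier E) \<Longrightarrow>
        D x ((c \<odot>\<^bsub>E\<^esub> a) # vs) = c \<odot>\<^bsub>F\<^esub> D x (a # vs)"
    and bound: "\<And>k x. x \<in> U \<Longrightarrow> \<exists>C. \<forall>vs\<in>lists (carrier E). length vs = k \<longrightarrow> nrm F (D x vs) \<le> C * prodnrm E vs"
    and deriv: "\<And>k x \<epsilon>. x \<in> U \<Longrightarrow> \<epsilon> > 0 \<Longrightarrow> \<forall>\<^sub>F h in small E. x \<oplus>\<^bsub>E\<^esub> h \<in> U \<longrightarrow>
        (\<forall>vs\<in>lists (carrier E). length vs = k \<longrightarrow>
        nrm F ((D (x \<oplus>\<^bsub>E\<^esub> h) vs \<ominus>\<^bsub>F\<^esub> D x vs) \<ominus>\<^bsub>F\<^esub> D x (h # vs)) \<le> \<epsilon> * nrm E h * prodnrm E vs)"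
  shows "smooth_derivs E F U D"
proof -
  have dir: "dir_deriv E F (\<lambda>y. D y vs) x h (D x (h # vs))"
    if x: "x \<in> U" and h: "h \<in> carrier E" and vs: "vs \<in> lists (carrier E)" for x h vs
  proof (rule dir_derivI[where L = "\<lambda>h. D x (h # vs)" and c = "prodnrm E vs"])
    show "\<forall>\<^sub>F k in small E. x \<oplus>\<^bsub>E\<^esub> k \<in> U \<longrightarrow>
        nrm F ((D (x \<oplus>\<^bsub>E\<^esub> k) vs \<ominus>\<^bsub>F\<^esub> D x vs) \<ominus>\<^bsub>F\<^esub> D x (k # vs)) \<le> \<epsilon> * nrm E k * prodnrm E vs"
      if "\<epsilon> > 0" for \<epsilon>
      using deriv[OF x that, of "length vs"] by eventually_elim (use vs in blast)
  qed (use vs x h smult in auto)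
  have add': "D x (us @ (a \<oplus>\<^bsub>E\<^esub> b) # ws) = D x (us @ a # ws) \<oplus>\<^bsub>F\<^esub> D x (us @ b # ws)"
    if "x \<in> U" "us \<in> lists (carrier E)" "ws \<in> lists (carrier E)" "a \<in> carrier E" "b \<in> carrier E" for us ws x a b
    using that
  proof (induction us arbitrary: x)
    case Nil
    then show ?case using add by simp
  next
    case (Cons h us)
    have l: "us @ (a \<oplus>\<^bsub>E\<^esub> b) # ws \<in> lists (carrier E)" "us @ a # ws \<in> lists (carrier E)"
      "us @ b # ws \<in> lists (carrier E)" "h \<in> carrier E" "us \<in> lists (carrier E)" using Cons.prems by auto
    show ?case
    proof (rule dir_deriv_unique)
      show "dir_deriv E F (\<lambda>y. D y (us @ (a \<oplus>\<^bsub>E\<^esub> b) # ws)) x h (D x ((h # us) @ (a \<oplus>\<^bsub>E\<^esub> b) # ws))"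
        using l Cons.prems by (simp add: dir)
      have "dir_deriv E F (\<lambda>y. D y (us @ a # ws) \<oplus>\<^bsub>F\<^esub> D y (us @ b # ws)) x h
          (D x ((h # us) @ a # ws) \<oplus>\<^bsub>F\<^esub> D x ((h # us) @ b # ws))"
        using l Cons.prems closed by (intro dir_deriv_add) (auto simp: dir)
      then show "dir_deriv E F (\<lambda>y. D y (us @ (a \<oplus>\<^bsub>E\<^esub> b) # ws)) x h
          (D x ((h # us) @ a # ws) \<oplus>\<^bsub>F\<^esub> D x ((h # us) @ b # ws))"
        by (rule dir_deriv_cong) (use Cons l in auto)
    qed (use l Cons.prems closed in auto)
  qed
  have smult': "D x (us @ (c \<odot>\<^bsub>E\<^esub> a) # ws) = c \<odot>\<^bsub>F\<^esub> D x (us @ a # ws)"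
    if "x \<in> U" "us \<in> lists (carrier E)" "ws \<in> lists (carrier E)" "a \<in> carrier E" for us ws x a c
    using that
  proof (induction us arbitrary: x)
    case Nil
    then show ?case using smult by simp
  next
    case (Cons h us)
    have l: "us @ (c \<odot>\<^bsub>E\<^esub> a) # ws \<in> lists (carrier E)" "us @ a # ws \<in> lists (carrier E)"
       "h \<in> carrier E" "us \<in> lists (carrier E)" using Cons.prems by auto
    show ?case
    proof (rule dir_deriv_unique)
      show "dir_deriv E F (\<lambda>y. D y (us @ (c \<odot>\<^bsub>E\<^esub> a) # ws)) x h (D x ((h # us) @ (c \<odot>\<^bsub>E\<^esub> a) # ws))"
        using l Cons.prems by (simp add: dir)
      have "dir_deriv E F (\<lambda>y. c \<odot>\<^bsub>F\<^esub> D y (us @ a # ws)) x h (c \<odot>\<^bsub>F\<^esub> D x ((h # us) @ a # ws))"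
        using l Cons.prems closed by (intro dir_deriv_smult) (auto simp: dir)
      then show "dir_deriv E F (\<lambda>y. D y (us @ (c \<odot>\<^bsub>E\<^esub> a) # ws)) x h (c \<odot>\<^bsub>F\<^esub> D x ((h # us) @ a # ws))"
        by (rule dir_deriv_cong) (use Cons l in auto)
    qed (use l Cons.prems closed in auto)
  qed
  show ?thesis
    unfolding smooth_derivs_def list_deriv_def bounded_multilinear_def
    by (intro allI ballI conjI impI) (rule closed add' smult' bound deriv; assumption)+
qed

lemma smooth_onI:
  assumes "smooth_derivs E F U D" "\<And>x. x \<in> U \<Longrightarrow> D x [] = f x"
  shows "smooth_on E F U f"
  using assms U unfolding smooth_on_iff by blast

text \<open>The increment of the derivative of order \<open>k\<close> is controlled by the derivative of order \<open>k + 1\<close>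
  at the centre, which gives one bound for all nearby points.\<close>

lemma smooth_derivs_local_bound:
  assumes D: "smooth_derivs E F U D" and x: "x \<in> U"
  obtains C where "C > 0" "\<forall>\<^sub>F h in small E. x \<oplus>\<^bsub>E\<^esub> h \<in> U \<longrightarrow> (\<forall>vs\<in>lists (carrier E). length vs = k \<longrightarrow>
      nrm F (D (x \<oplus>\<^bsub>E\<^esub> h) vs) \<le> C * prodnrm E vs)"
proof -
  obtain C0 where C0: "C0 > 0" "\<And>vs. vs \<in> lists (carrier E) \<Longrightarrow> length vs = k \<Longrightarrow> nrm F (D x vs) \<le> C0 * prodnrm E vs"
    by (rule smooth_derivs_bound[OF D x, of k]) blast
  obtain C1 where C1: "C1 > 0" "\<And>vs. vs \<in> lists (carrier E) \<Longrightarrow> length vs = Suc k \<Longrightarrow> nrm F (D x vs) \<le> C1 * prodnrm E vs"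
    by (rule smooth_derivs_bound[OF D x, of "Suc k"]) blast
  have "\<forall>\<^sub>F h in small E. x \<oplus>\<^bsub>E\<^esub> h \<in> U \<longrightarrow> (\<forall>vs\<in>lists (carrier E). length vs = k \<longrightarrow>
      nrm F (D (x \<oplus>\<^bsub>E\<^esub> h) vs) \<le> (C0 + C1 + 1) * prodnrm E vs)"
    using smooth_derivs_deriv[OF D x zero_less_one, of k] eventually_small_less[OF zero_less_one]
      eventually_small_carrier
  proof eventually_elim
    case (elim h)
    show ?case
    proof (intro impI ballI)
      fix vs assume xh: "x \<oplus>\<^bsub>E\<^esub> h \<in> U" and vs: "vs \<in> lists (carrier E)" "length vs = k"
      let ?a = "D (x \<oplus>\<^bsub>E\<^esub> h) vs" and ?b = "D x vs" and ?c = "D x (h # vs)"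
      have [simp]: "?a \<in> carrier F" "?b \<in> carrier F" "?c \<in> carrier F"
        using vs xh x elim by (auto intro!: smooth_derivs_closed[OF D])
      have "nrm F ?a \<le> nrm F ?b + nrm F (?a \<ominus>\<^bsub>F\<^esub> ?b)" by (simp add: F.nrm_le_add_diff)
      moreover have "nrm F (?a \<ominus>\<^bsub>F\<^esub> ?b) \<le> nrm F ?c + nrm F ((?a \<ominus>\<^bsub>F\<^esub> ?b) \<ominus>\<^bsub>F\<^esub> ?c)"
        by (simp add: F.nrm_le_add_diff)
      moreover have "nrm F ((?a \<ominus>\<^bsub>F\<^esub> ?b) \<ominus>\<^bsub>F\<^esub> ?c) \<le> 1 * prodnrm E vs"
      proof -
        have "nrm F ((?a \<ominus>\<^bsub>F\<^esub> ?b) \<ominus>\<^bsub>F\<^esub> ?c) \<le> 1 * nrm E h * prodnrm E vs" using elim xh vs by blast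
        also have "\<dots> \<le> 1 * prodnrm E vs" using elim vs by (intro mult_right_mono) auto
        finally show ?thesis .
      qed
      moreover have "nrm F ?c \<le> C1 * prodnrm E vs"
      proof -
        have "nrm F ?c \<le> C1 * (nrm E h * prodnrm E vs)" using C1(2)[of "h # vs"] elim vs by simp
        also have "\<dots> \<le> C1 * (1 * prodnrm E vs)" using elim vs C1 by (intro mult_left_mono mult_right_mono) auto
        finally show ?thesis by simp
      qed
      moreover have "nrm F ?b \<le> C0 * prodnrm E vs" using C0 vs by blast
      ultimately show "nrm F (D (x \<oplus>\<^bsub>E\<^esub> h) vs) \<le> (C0 + C1 + 1) * prodnrm E vs"
        by (simp add: algebra_simps)
    qed
  qed
  then show thesis using C0 C1 by (intro that[of "C0 + C1 + 1"]) auto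
qed

end

section \<open>Operations on smooth maps\<close>

text \<open>The local derivatives fit together because they are unique on intersections. This is what makes
  it possible to choose a chart of the target near each point separately.\<close>

lemma smooth_on_local:
  assumes E: "Banach E" and F: "Banach F"
    and loc: "\<And>x. x \<in> U \<Longrightarrow> \<exists>V. x \<in> V \<and> V \<subseteq> U \<and> smooth_on E F V f"
  shows "smooth_on E F U f"
proof -
  interpret E: Banach E by fact
  define P where "P x V D \<longleftrightarrow> x \<in> V \<and> V \<subseteq> U \<and> openin (vtop E) V \<and>
      (\<forall>y\<in>V. D y [] = f y) \<and> smooth_derivs E F V D" for x V D
  have "\<forall>x\<in>U. \<exists>V D. P x V D"
  proof
    fix x assume "x \<in> U"
    then obtain V where V: "x \<in> V" "V \<subseteq> U" "smooth_on E F V f" using loc by blast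
    from V(3) obtain D where "openin (vtop E) V" "\<And>x. x \<in> V \<Longrightarrow> D x [] = f x" "smooth_derivs E F V D"
      using smooth_onE[OF V(3)] by blast
    then have "P x V D" using V unfolding P_def by simp
    then show "\<exists>V D. P x V D" by blast
  qed
  then obtain V D where "\<And>x. x \<in> U \<Longrightarrow> P x (V x) (D x)" by metis
  then have V: "\<And>x. x \<in> U \<Longrightarrow> x \<in> V x" "\<And>x. x \<in> U \<Longrightarrow> V x \<subseteq> U"
      "\<And>x. x \<in> U \<Longrightarrow> openin (vtop E) (V x)"
    and D: "\<And>x y. x \<in> U \<Longrightarrow> y \<in> V x \<Longrightarrow> D x y [] = f y" "\<And>x. x \<in> U \<Longrightarrow> smooth_derivs E F (V x) (D x)"
    unfolding P_def by blast+
  have agree: "D y z vs = D x z vs"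
    if "x \<in> U" "y \<in> U" "z \<in> V x" "z \<in> V y" "vs \<in> lists (carrier E)" for x y z vs
  proof -
    have "Banach_maps E F (V x \<inter> V y)"
      using E F V that unfolding Banach_maps_def Banach_maps_axioms_def by (auto intro: openin_Int)
    then show ?thesis
      by (rule Banach_maps.smooth_derivs_unique[where D = "D y" and D' = "D x"])
        (use that D in \<open>auto intro: smooth_derivs_subset\<close>)
  qed
  have "smooth_derivs E F U (\<lambda>x. D x x)"
    unfolding smooth_derivs_def
  proof (intro allI ballI conjI)
    fix k x assume x: "x \<in> U"
    show "bounded_multilinear E F k (D x x)"
      using D(2)[OF x] V(1)[OF x] unfolding smooth_derivs_def by blast
    show "list_deriv E F U k (\<lambda>x. D x x) x"
      unfolding list_deriv_def
    proof (intro allI impI)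
      fix \<epsilon> :: real assume "\<epsilon> > 0"
      from smooth_derivs_deriv[OF D(2)[OF x] V(1)[OF x] this, of k]
        E.eventually_small_open[OF V(3)[OF x] V(1)[OF x]] eventually_small_carrier[of E]
      show "\<forall>\<^sub>F h in small E. x \<oplus>\<^bsub>E\<^esub> h \<in> U \<longrightarrow> (\<forall>vs\<in>lists (carrier E). length vs = k \<longrightarrow>
          nrm F ((D (x \<oplus>\<^bsub>E\<^esub> h) (x \<oplus>\<^bsub>E\<^esub> h) vs \<ominus>\<^bsub>F\<^esub> D x x vs) \<ominus>\<^bsub>F\<^esub> D x x (h # vs)) \<le> \<epsilon> * nrm E h * prodnrm E vs)"
        by eventually_elim (use agree[OF x] V(1) in auto)
    qed
  qed
  moreover have "openin (vtop E) (\<Union>x\<in>U. V x)"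
    using V(3) by (intro openin_Union) auto
  moreover have "(\<Union>x\<in>U. V x) = U" using V(1,2) by blast
  moreover have "\<forall>x\<in>U. D x x [] = f x" using D(1) V(1) by blast
  ultimately show ?thesis
    unfolding smooth_on_iff by (intro conjI exI[of _ "\<lambda>x. D x x"]) simp_all
qed

lemma smooth_on_const:
  assumes E: "Banach E" and F: "Banach F" and U: "openin (vtop E) U" and c: "c \<in> carrier F"
  shows "smooth_on E F U (\<lambda>_. c)"
proof -
  interpret Banach_maps E F U using E F U by (simp add: Banach_maps_def Banach_maps_axioms_def)
  define D where "D = (\<lambda>(x::'a) (vs :: 'a list). if vs = [] then c else \<zero>\<^bsub>F\<^esub>)"
  have zz: "\<zero>\<^bsub>F\<^esub> \<ominus>\<^bsub>F\<^esub> \<zero>\<^bsub>F\<^esub> = \<zero>\<^bsub>F\<^esub>" "c \<ominus>\<^bsub>F\<^esub> c = \<zero>\<^bsub>F\<^esub>"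
    using F.diff_eq_zero_iff c by simp_all
  have "smooth_derivs E F U D"
  proof (rule smooth_derivsI)
    fix k x
    have "nrm F (D x vs) \<le> nrm F c * prodnrm E vs" if "vs \<in> lists (carrier E)" for vs
      using that c E.prodnrm_nonneg[OF that] by (cases vs) (auto simp: D_def)
    then show "\<exists>C. \<forall>vs\<in>lists (carrier E). length vs = k \<longrightarrow> nrm F (D x vs) \<le> C * prodnrm E vs" by blast
  next
    fix k x and \<epsilon> :: real assume "\<epsilon> > 0"
    then have "nrm F ((D (x \<oplus>\<^bsub>E\<^esub> h) vs \<ominus>\<^bsub>F\<^esub> D x vs) \<ominus>\<^bsub>F\<^esub> D x (h # vs)) \<le> \<epsilon> * nrm E h * prodnrm E vs"
      if "h \<in> carrier E" "vs \<in> lists (carrier E)" for h vs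
      using that zz by (auto simp: D_def intro!: mult_nonneg_nonneg E.prodnrm_nonneg)
    then show "\<forall>\<^sub>F h in small E. x \<oplus>\<^bsub>E\<^esub> h \<in> U \<longrightarrow> (\<forall>vs\<in>lists (carrier E). length vs = k \<longrightarrow>
        nrm F ((D (x \<oplus>\<^bsub>E\<^esub> h) vs \<ominus>\<^bsub>F\<^esub> D x vs) \<ominus>\<^bsub>F\<^esub> D x (h # vs)) \<le> \<epsilon> * nrm E h * prodnrm E vs)"
      by (intro eventually_mono[OF eventually_small_carrier]) blast
  qed (use c in \<open>auto simp: D_def\<close>)
  then show ?thesis by (rule smooth_onI) (simp add: D_def)
qed

definition bounded_lin :: "'a nspace \<Rightarrow> 'b nspace \<Rightarrow> ('a \<Rightarrow> 'b) \<Rightarrow> bool" where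
  "bounded_lin E F A \<longleftrightarrow>
     (\<forall>x\<in>carrier E. A x \<in> carrier F) \<and>
     (\<forall>x\<in>carrier E. \<forall>y\<in>carrier E. A (x \<oplus>\<^bsub>E\<^esub> y) = A x \<oplus>\<^bsub>F\<^esub> A y) \<and>
     (\<forall>c. \<forall>x\<in>carrier E. A (c \<odot>\<^bsub>E\<^esub> x) = c \<odot>\<^bsub>F\<^esub> A x) \<and>
     (\<exists>C>0. \<forall>x\<in>carrier E. nrm F (A x) \<le> C * nrm E x)"

lemma bounded_linD:
  assumes "bounded_lin E F A"
  shows "x \<in> carrier E \<Longrightarrow> A x \<in> carrier F"
    "x \<in> carrier E \<Longrightarrow> y \<in> carrier E \<Longrightarrow> A (x \<oplus>\<^bsub>E\<^esub> y) = A x \<oplus>\<^bsub>F\<^esub> A y"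
    "x \<in> carrier E \<Longrightarrow> A (c \<odot>\<^bsub>E\<^esub> x) = c \<odot>\<^bsub>F\<^esub> A x"
  using assms unfolding bounded_lin_def by blast+

lemma bounded_lin_bound:
  assumes "bounded_lin E F A"
  obtains C where "C > 0" "\<And>x. x \<in> carrier E \<Longrightarrow> nrm F (A x) \<le> C * nrm E x"
  using assms unfolding bounded_lin_def by blast

lemma bounded_lin_diff:
  assumes E: "Banach E" and F: "Banach F" and A: "bounded_lin E F A" and x: "x \<in> carrier E" and y: "y \<in> carrier E"
  shows "A (x \<ominus>\<^bsub>E\<^esub> y) = A x \<ominus>\<^bsub>F\<^esub> A y"
proof -
  interpret E: Banach E by fact
  interpret F: Banach F by fact
  show ?thesis
    using x y bounded_linD[OF A] by (simp add: E.minus_eq F.minus_eq E.minus_eq_smult F.minus_eq_smult)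
qed

lemma smooth_on_bounded_lin_comp:
  assumes E: "Banach E" and F: "Banach F" and G: "Banach G"
    and f: "smooth_on E F U f" and A: "bounded_lin F G A"
  shows "smooth_on E G U (\<lambda>x. A (f x))"
proof -
  obtain D where U: "openin (vtop E) U" and D0: "\<And>x. x \<in> U \<Longrightarrow> D x [] = f x" and D: "smooth_derivs E F U D"
    using smooth_onE[OF f] by blast
  interpret EF: Banach_maps E F U using E F U by (simp add: Banach_maps_def Banach_maps_axioms_def)
  interpret EG: Banach_maps E G U using E G U by (simp add: Banach_maps_def Banach_maps_axioms_def)
  obtain C where C: "C > 0" "\<And>y. y \<in> carrier F \<Longrightarrow> nrm G (A y) \<le> C * nrm F y"
    using bounded_lin_bound[OF A] by blast
  note closed = smooth_derivs_closed[OF D]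
  have "smooth_derivs E G U (\<lambda>x vs. A (D x vs))"
  proof (rule EG.smooth_derivsI)
    fix x a b vs assume "x \<in> U" "a \<in> carrier E" "b \<in> carrier E" "vs \<in> lists (carrier E)"
    then show "A (D x ((a \<oplus>\<^bsub>E\<^esub> b) # vs)) = A (D x (a # vs)) \<oplus>\<^bsub>G\<^esub> A (D x (b # vs))"
      using smooth_derivs_add[OF D, of x "[]" vs a b] closed by (simp add: bounded_linD[OF A])
  next
    fix x a c vs assume "x \<in> U" "a \<in> carrier E" "vs \<in> lists (carrier E)"
    then show "A (D x ((c \<odot>\<^bsub>E\<^esub> a) # vs)) = c \<odot>\<^bsub>G\<^esub> A (D x (a # vs))"
      using smooth_derivs_smult[OF D, of x "[]" vs a c] closed by (simp add: bounded_linD[OF A])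
  next
    fix k x assume x: "x \<in> U"
    obtain C1 where C1: "\<And>vs. vs \<in> lists (carrier E) \<Longrightarrow> length vs = k \<Longrightarrow> nrm F (D x vs) \<le> C1 * prodnrm E vs"
      by (rule EF.smooth_derivs_bound[OF D x, of k]) blast
    have "nrm G (A (D x vs)) \<le> C * C1 * prodnrm E vs" if "vs \<in> lists (carrier E)" "length vs = k" for vs
    proof -
      have "nrm G (A (D x vs)) \<le> C * nrm F (D x vs)" using that closed x by (intro C) auto
      also have "\<dots> \<le> C * (C1 * prodnrm E vs)" using that C1 C by (intro mult_left_mono) auto
      finally show ?thesis by simp
    qed
    then show "\<exists>C. \<forall>vs\<in>lists (carrier E). length vs = k \<longrightarrow> nrm G (A (D x vs)) \<le> C * prodnrm E vs" by blast
  next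
    fix k x and \<epsilon> :: real assume x: "x \<in> U" and \<epsilon>: "\<epsilon> > 0"
    then have "\<epsilon> / C > 0" using C by simp
    from smooth_derivs_deriv[OF D x this, of k] eventually_small_carrier[of E]
    show "\<forall>\<^sub>F h in small E. x \<oplus>\<^bsub>E\<^esub> h \<in> U \<longrightarrow> (\<forall>vs\<in>lists (carrier E). length vs = k \<longrightarrow>
        nrm G ((A (D (x \<oplus>\<^bsub>E\<^esub> h) vs) \<ominus>\<^bsub>G\<^esub> A (D x vs)) \<ominus>\<^bsub>G\<^esub> A (D x (h # vs))) \<le> \<epsilon> * nrm E h * prodnrm E vs)"
    proof eventually_elim
      case (elim h)
      show ?case
      proof (intro impI ballI)
        fix vs assume xh: "x \<oplus>\<^bsub>E\<^esub> h \<in> U" and vs: "vs \<in> lists (carrier E)" "length vs = k"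
        have [simp]: "D (x \<oplus>\<^bsub>E\<^esub> h) vs \<in> carrier F" "D x vs \<in> carrier F" "D x (h # vs) \<in> carrier F"
          using xh vs x elim by (auto intro!: closed)
        have "nrm G ((A (D (x \<oplus>\<^bsub>E\<^esub> h) vs) \<ominus>\<^bsub>G\<^esub> A (D x vs)) \<ominus>\<^bsub>G\<^esub> A (D x (h # vs)))
            = nrm G (A ((D (x \<oplus>\<^bsub>E\<^esub> h) vs \<ominus>\<^bsub>F\<^esub> D x vs) \<ominus>\<^bsub>F\<^esub> D x (h # vs)))"
          by (simp add: bounded_lin_diff[OF F G A])
        also have "\<dots> \<le> C * nrm F ((D (x \<oplus>\<^bsub>E\<^esub> h) vs \<ominus>\<^bsub>F\<^esub> D x vs) \<ominus>\<^bsub>F\<^esub> D x (h # vs))"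
          by (intro C) auto
        also have "\<dots> \<le> C * (\<epsilon> / C * nrm E h * prodnrm E vs)"
          using elim xh vs C by (intro mult_left_mono) auto
        finally show "nrm G ((A (D (x \<oplus>\<^bsub>E\<^esub> h) vs) \<ominus>\<^bsub>G\<^esub> A (D x vs)) \<ominus>\<^bsub>G\<^esub> A (D x (h # vs)))
            \<le> \<epsilon> * nrm E h * prodnrm E vs"
          using C by simp
      qed
    qed
  qed (use closed bounded_linD(1)[OF A] in blast)
  then show ?thesis by (rule EG.smooth_onI) (simp add: D0)
qed

lemma smooth_on_comp_affine:
  assumes E': "Banach E'" and E: "Banach E" and F: "Banach F"
    and f: "smooth_on E F U f" and A: "bounded_lin E' E A" and U': "openin (vtop E') U'"
    and a: "\<And>x. x \<in> U' \<Longrightarrow> a x \<in> U"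
    and affine: "\<And>x h. x \<in> U' \<Longrightarrow> h \<in> carrier E' \<Longrightarrow> x \<oplus>\<^bsub>E'\<^esub> h \<in> U' \<Longrightarrow> a (x \<oplus>\<^bsub>E'\<^esub> h) = a x \<oplus>\<^bsub>E\<^esub> A h"
  shows "smooth_on E' F U' (\<lambda>x. f (a x))"
proof -
  obtain D where U: "openin (vtop E) U" and D0: "\<And>x. x \<in> U \<Longrightarrow> D x [] = f x" and D: "smooth_derivs E F U D"
    using smooth_onE[OF f] by blast
  interpret EF: Banach_maps E F U using E F U by (simp add: Banach_maps_def Banach_maps_axioms_def)
  interpret EG: Banach_maps E' F U' using E' F U' by (simp add: Banach_maps_def Banach_maps_axioms_def)
  obtain C where C: "C > 0" "\<And>y. y \<in> carrier E' \<Longrightarrow> nrm E (A y) \<le> C * nrm E' y"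
    using bounded_lin_bound[OF A] by blast
  note closed = smooth_derivs_closed[OF D]
  have mapA: "map A vs \<in> lists (carrier E)" if "vs \<in> lists (carrier E')" for vs
    using that bounded_linD(1)[OF A] by (induction vs) auto
  have prodnrm_map: "prodnrm E (map A vs) \<le> C ^ length vs * prodnrm E' vs" if "vs \<in> lists (carrier E')" for vs
    using that
  proof (induction vs)
    case (Cons v vs)
    have "0 \<le> prodnrm E (map A vs)" using Cons mapA[of vs] EF.E.prodnrm_nonneg[of "map A vs"] by simp
    then have "nrm E (A v) * prodnrm E (map A vs) \<le> (C * nrm E' v) * (C ^ length vs * prodnrm E' vs)"
      using Cons C bounded_linD(1)[OF A] by (intro mult_mono) auto
    then show ?case by (simp add: algebra_simps)
  qed auto
  have "smooth_derivs E' F U' (\<lambda>x vs. D (a x) (map A vs))"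
  proof (rule EG.smooth_derivsI)
    fix x u v vs assume *: "x \<in> U'" "u \<in> carrier E'" "v \<in> carrier E'" "vs \<in> lists (carrier E')"
    then show "D (a x) (map A ((u \<oplus>\<^bsub>E'\<^esub> v) # vs)) = D (a x) (map A (u # vs)) \<oplus>\<^bsub>F\<^esub> D (a x) (map A (v # vs))"
      using smooth_derivs_add[OF D a[OF *(1)], of "[]" "map A vs" "A u" "A v"] mapA bounded_linD(1)[OF A]
      by (simp add: bounded_linD[OF A])
  next
    fix x u c vs assume *: "x \<in> U'" "u \<in> carrier E'" "vs \<in> lists (carrier E')"
    then show "D (a x) (map A ((c \<odot>\<^bsub>E'\<^esub> u) # vs)) = c \<odot>\<^bsub>F\<^esub> D (a x) (map A (u # vs))"
      using smooth_derivs_smult[OF D a[OF *(1)], of "[]" "map A vs" "A u" c] mapA bounded_linD(1)[OF A]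
      by (simp add: bounded_linD[OF A])
  next
    fix k x assume x: "x \<in> U'"
    obtain C1 where C1: "C1 > 0" "\<And>vs. vs \<in> lists (carrier E) \<Longrightarrow> length vs = k \<Longrightarrow> nrm F (D (a x) vs) \<le> C1 * prodnrm E vs"
      by (rule EF.smooth_derivs_bound[OF D a[OF x], of k]) blast
    have "nrm F (D (a x) (map A vs)) \<le> C1 * C ^ k * prodnrm E' vs" if "vs \<in> lists (carrier E')" "length vs = k" for vs
    proof -
      have "nrm F (D (a x) (map A vs)) \<le> C1 * prodnrm E (map A vs)" using that mapA by (intro C1) auto
      also have "\<dots> \<le> C1 * (C ^ k * prodnrm E' vs)" using that C1 prodnrm_map by (intro mult_left_mono) auto
      finally show ?thesis by simp
    qed
    then show "\<exists>C. \<forall>vs\<in>lists (carrier E'). length vs = k \<longrightarrow> nrm F (D (a x) (map A vs)) \<le> C * prodnrm E' vs" by blast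
  next
    fix k x and \<epsilon> :: real assume x: "x \<in> U'" and \<epsilon>: "\<epsilon> > 0"
    then have "\<epsilon> / (C * C ^ k) > 0" using C by simp
    from smooth_derivs_deriv[OF D a[OF x] this, of k]
    obtain \<delta> where "\<delta> > 0" and \<delta>: "\<And>h vs. h \<in> carrier E \<Longrightarrow> nrm E h < \<delta> \<Longrightarrow> a x \<oplus>\<^bsub>E\<^esub> h \<in> U \<Longrightarrow>
        vs \<in> lists (carrier E) \<Longrightarrow> length vs = k \<Longrightarrow>
        nrm F ((D (a x \<oplus>\<^bsub>E\<^esub> h) vs \<ominus>\<^bsub>F\<^esub> D (a x) vs) \<ominus>\<^bsub>F\<^esub> D (a x) (h # vs)) \<le> \<epsilon> / (C * C ^ k) * nrm E h * prodnrm E vs"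
      unfolding eventually_small by blast
    have "\<delta> / C > 0" using \<open>\<delta> > 0\<close> C by simp
    from eventually_small_less[OF this, of E'] eventually_small_carrier[of E']
    show "\<forall>\<^sub>F h in small E'. x \<oplus>\<^bsub>E'\<^esub> h \<in> U' \<longrightarrow> (\<forall>vs\<in>lists (carrier E'). length vs = k \<longrightarrow>
        nrm F ((D (a (x \<oplus>\<^bsub>E'\<^esub> h)) (map A vs) \<ominus>\<^bsub>F\<^esub> D (a x) (map A vs)) \<ominus>\<^bsub>F\<^esub> D (a x) (map A (h # vs)))
          \<le> \<epsilon> * nrm E' h * prodnrm E' vs)"
    proof eventually_elim
      case (elim h)
      show ?case
      proof (intro impI ballI)
        fix vs assume xh: "x \<oplus>\<^bsub>E'\<^esub> h \<in> U'" and vs: "vs \<in> lists (carrier E')" "length vs = k"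
        have Ah: "A h \<in> carrier E" "nrm E (A h) \<le> C * nrm E' h" using elim C bounded_linD(1)[OF A] by auto
        have "C * nrm E' h < \<delta>" using elim C by (simp add: field_simps)
        then have less: "nrm E (A h) < \<delta>" using Ah by linarith
        have eq: "a (x \<oplus>\<^bsub>E'\<^esub> h) = a x \<oplus>\<^bsub>E\<^esub> A h" using affine x elim xh by blast
        have "nrm F ((D (a (x \<oplus>\<^bsub>E'\<^esub> h)) (map A vs) \<ominus>\<^bsub>F\<^esub> D (a x) (map A vs)) \<ominus>\<^bsub>F\<^esub> D (a x) (map A (h # vs)))
           \<le> \<epsilon> / (C * C ^ k) * nrm E (A h) * prodnrm E (map A vs)"
          using \<delta>[OF Ah(1) less _ mapA[OF vs(1)]] vs a[OF xh] by (simp add: eq)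
        also have "\<dots> \<le> \<epsilon> / (C * C ^ k) * (C * nrm E' h) * (C ^ k * prodnrm E' vs)"
        proof (rule mult_mono)
          show "\<epsilon> / (C * C ^ k) * nrm E (A h) \<le> \<epsilon> / (C * C ^ k) * (C * nrm E' h)"
            using Ah(2) \<open>\<epsilon> / (C * C ^ k) > 0\<close> by (intro mult_left_mono) auto
          show "prodnrm E (map A vs) \<le> C ^ k * prodnrm E' vs" using prodnrm_map[OF vs(1)] vs by simp
          show "0 \<le> \<epsilon> / (C * C ^ k) * (C * nrm E' h)"
            using \<epsilon> C elim by (intro mult_nonneg_nonneg divide_nonneg_nonneg) auto
          show "0 \<le> prodnrm E (map A vs)" by (rule EF.E.prodnrm_nonneg[OF mapA[OF vs(1)]])
        qed
        also have "\<dots> = \<epsilon> * nrm E' h * prodnrm E' vs" using C by simp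
        finally show "nrm F ((D (a (x \<oplus>\<^bsub>E'\<^esub> h)) (map A vs) \<ominus>\<^bsub>F\<^esub> D (a x) (map A vs)) \<ominus>\<^bsub>F\<^esub> D (a x) (map A (h # vs)))
            \<le> \<epsilon> * nrm E' h * prodnrm E' vs" .
      qed
    qed
  qed (use closed a mapA in blast)
  then show ?thesis by (rule EG.smooth_onI) (simp add: D0 a)
qed

lemma smooth_on_Pair:
  assumes E: "Banach E" and F: "Banach F" and G: "Banach G"
    and f: "smooth_on E F U f" and g: "smooth_on E G U g"
  shows "smooth_on E (prod_space F G) U (\<lambda>x. (f x, g x))"
proof -
  obtain D where U: "openin (vtop E) U" and D0: "\<And>x. x \<in> U \<Longrightarrow> D x [] = f x" and D: "smooth_derivs E F U D"
    using smooth_onE[OF f] by blast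
  obtain D' where D0': "\<And>x. x \<in> U \<Longrightarrow> D' x [] = g x" and D': "smooth_derivs E G U D'"
    using smooth_onE[OF g] by blast
  interpret FG: Banach2 F G using F G by (simp add: Banach2_def)
  interpret EF: Banach_maps E F U using E F U by (simp add: Banach_maps_def Banach_maps_axioms_def)
  interpret EG: Banach_maps E G U using E G U by (simp add: Banach_maps_def Banach_maps_axioms_def)
  interpret EP: Banach_maps E "prod_space F G" U using E FG.Banach_prod U by (simp add: Banach_maps_def Banach_maps_axioms_def)
  note closed = smooth_derivs_closed[OF D] smooth_derivs_closed[OF D']
  have "smooth_derivs E (prod_space F G) U (\<lambda>x vs. (D x vs, D' x vs))"
  proof (rule EP.smooth_derivsI)
    fix x a b vs assume "x \<in> U" "a \<in> carrier E" "b \<in> carrier E" "vs \<in> lists (carrier E)"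
    then show "(D x ((a \<oplus>\<^bsub>E\<^esub> b) # vs), D' x ((a \<oplus>\<^bsub>E\<^esub> b) # vs)) =
        (D x (a # vs), D' x (a # vs)) \<oplus>\<^bsub>prod_space F G\<^esub> (D x (b # vs), D' x (b # vs))"
      using smooth_derivs_add[OF D, of x "[]" vs a b] smooth_derivs_add[OF D', of x "[]" vs a b] by simp
  next
    fix x a c vs assume "x \<in> U" "a \<in> carrier E" "vs \<in> lists (carrier E)"
    then show "(D x ((c \<odot>\<^bsub>E\<^esub> a) # vs), D' x ((c \<odot>\<^bsub>E\<^esub> a) # vs)) = c \<odot>\<^bsub>prod_space F G\<^esub> (D x (a # vs), D' x (a # vs))"
      using smooth_derivs_smult[OF D, of x "[]" vs a c] smooth_derivs_smult[OF D', of x "[]" vs a c] by simp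
  next
    fix k x assume x: "x \<in> U"
    obtain C1 where C1: "\<And>vs. vs \<in> lists (carrier E) \<Longrightarrow> length vs = k \<Longrightarrow> nrm F (D x vs) \<le> C1 * prodnrm E vs"
      by (rule EF.smooth_derivs_bound[OF D x, of k]) blast
    obtain C2 where C2: "\<And>vs. vs \<in> lists (carrier E) \<Longrightarrow> length vs = k \<Longrightarrow> nrm G (D' x vs) \<le> C2 * prodnrm E vs"
      by (rule EG.smooth_derivs_bound[OF D' x, of k]) blast
    have "nrm (prod_space F G) (D x vs, D' x vs) \<le> (C1 + C2) * prodnrm E vs"
      if vs: "vs \<in> lists (carrier E)" "length vs = k" for vs
      using FG.nrm_prod_le[OF closed(1)[OF x vs(1)] closed(2)[OF x vs(1)]] C1[OF vs] C2[OF vs]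
      unfolding distrib_right by linarith
    then show "\<exists>C. \<forall>vs\<in>lists (carrier E). length vs = k \<longrightarrow>
        nrm (prod_space F G) (D x vs, D' x vs) \<le> C * prodnrm E vs" by blast
  next
    fix k x and \<epsilon> :: real assume x: "x \<in> U" and \<epsilon>: "\<epsilon> > 0"
    then have "\<epsilon> / 2 > 0" by simp
    from smooth_derivs_deriv[OF D x this, of k] smooth_derivs_deriv[OF D' x this, of k] eventually_small_carrier[of E]
    show "\<forall>\<^sub>F h in small E. x \<oplus>\<^bsub>E\<^esub> h \<in> U \<longrightarrow> (\<forall>vs\<in>lists (carrier E). length vs = k \<longrightarrow>
        nrm (prod_space F G) (((D (x \<oplus>\<^bsub>E\<^esub> h) vs, D' (x \<oplus>\<^bsub>E\<^esub> h) vs) \<ominus>\<^bsub>prod_space F G\<^esub> (D x vs, D' x vs))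
          \<ominus>\<^bsub>prod_space F G\<^esub> (D x (h # vs), D' x (h # vs))) \<le> \<epsilon> * nrm E h * prodnrm E vs)"
    proof eventually_elim
      case (elim h)
      show ?case
      proof (intro impI ballI)
        fix vs assume xh: "x \<oplus>\<^bsub>E\<^esub> h \<in> U" and vs: "vs \<in> lists (carrier E)" "length vs = k"
        let ?r = "(D (x \<oplus>\<^bsub>E\<^esub> h) vs \<ominus>\<^bsub>F\<^esub> D x vs) \<ominus>\<^bsub>F\<^esub> D x (h # vs)"
        let ?s = "(D' (x \<oplus>\<^bsub>E\<^esub> h) vs \<ominus>\<^bsub>G\<^esub> D' x vs) \<ominus>\<^bsub>G\<^esub> D' x (h # vs)"
        have [simp]: "D (x \<oplus>\<^bsub>E\<^esub> h) vs \<in> carrier F" "D x vs \<in> carrier F" "D x (h # vs) \<in> carrier F"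
          "D' (x \<oplus>\<^bsub>E\<^esub> h) vs \<in> carrier G" "D' x vs \<in> carrier G" "D' x (h # vs) \<in> carrier G"
          using xh vs x elim by (auto intro!: closed)
        have "nrm F ?r \<le> \<epsilon> / 2 * nrm E h * prodnrm E vs" "nrm G ?s \<le> \<epsilon> / 2 * nrm E h * prodnrm E vs"
          using elim xh vs by blast+
        moreover have "nrm (prod_space F G) (?r, ?s) \<le> nrm F ?r + nrm G ?s"
          by (rule FG.nrm_prod_le) auto
        ultimately have "nrm (prod_space F G) (?r, ?s) \<le> \<epsilon> * nrm E h * prodnrm E vs" by simp
        then show "nrm (prod_space F G) (((D (x \<oplus>\<^bsub>E\<^esub> h) vs, D' (x \<oplus>\<^bsub>E\<^esub> h) vs) \<ominus>\<^bsub>prod_space F G\<^esub> (D x vs, D' x vs))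
          \<ominus>\<^bsub>prod_space F G\<^esub> (D x (h # vs), D' x (h # vs))) \<le> \<epsilon> * nrm E h * prodnrm E vs"
          by (simp only: FG.prod_diff FG.E.minus_closed FG.F.minus_closed
              \<open>D (x \<oplus>\<^bsub>E\<^esub> h) vs \<in> carrier F\<close> \<open>D x vs \<in> carrier F\<close> \<open>D x (h # vs) \<in> carrier F\<close>
              \<open>D' (x \<oplus>\<^bsub>E\<^esub> h) vs \<in> carrier G\<close> \<open>D' x vs \<in> carrier G\<close> \<open>D' x (h # vs) \<in> carrier G\<close>)
      qed
    qed
  qed (use closed in auto)
  then show ?thesis by (rule EP.smooth_onI) (simp add: D0 D0')
qed

section \<open>The chain rule\<close>

text \<open>The derivatives of \<open>g \<circ> f\<close> are sums of terms
  \<open>D\<^sup>mg (f x) (D f x B\<^sub>1, \<dots>, D f x B\<^sub>m)\<close>, one for each partition of the list of vectors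
  into blocks \<open>B\<^sub>1, \<dots>, B\<^sub>m\<close> (Faa di Bruno). Differentiating once more in direction \<open>h\<close> either
  opens the new block \<open>[h]\<close> or puts \<open>h\<close> into one of the blocks, which is \<open>into_block\<close>.\<close>

fun into_block :: "'a \<Rightarrow> 'a list list \<Rightarrow> 'a list list list" where
  "into_block h [] = []"
| "into_block h (B # \<pi>) = ((h # B) # \<pi>) # map ((#) B) (into_block h \<pi>)"

fun blocks :: "'a list \<Rightarrow> 'a list list list" where
  "blocks [] = [[]]"
| "blocks (h # vs) = concat (map (\<lambda>\<pi>. ([h] # \<pi>) # into_block h \<pi>) (blocks vs))"

lemma into_block_map: "into_block (g h) (map (map g) \<pi>) = map (map (map g)) (into_block h \<pi>)"
  by (induction \<pi>) (auto simp: comp_def)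

lemma blocks_map: "blocks (map g vs) = map (map (map g)) (blocks vs)"
  by (induction vs) (auto simp: map_concat comp_def into_block_map)

text \<open>How close to \<open>x\<close> an estimate for a term holds may depend on the lengths of its blocks, but not
  on the vectors in them. Only finitely many lengths occur for lists of a given length.\<close>

definition shapes :: "nat \<Rightarrow> nat list set" where
  "shapes k = map length ` set (blocks (replicate k ()))"

lemma blocks_shape: "\<pi> \<in> set (blocks vs) \<Longrightarrow> map length \<pi> \<in> shapes (length vs)"
proof -
  assume "\<pi> \<in> set (blocks vs)"
  then have "map (map (\<lambda>_. ())) \<pi> \<in> set (blocks (map (\<lambda>_. ()) vs))"
    by (auto simp: blocks_map)
  moreover have "map length \<pi> = map length (map (map (\<lambda>_. ())) \<pi>)"
    by simp
  ultimately show ?thesis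
    unfolding shapes_def by (metis image_eqI map_replicate_const)
qed

lemma length_blocks: "length (blocks vs) = length (blocks (replicate (length vs) ()))"
  by (metis blocks_map length_map map_replicate_const)

lemma finite_shapes: "finite (shapes k)"
  by (simp add: shapes_def)

lemma into_block_lists: "\<pi>' \<in> set (into_block h \<pi>) \<Longrightarrow> h \<in> A \<Longrightarrow> \<pi> \<in> lists (lists A) \<Longrightarrow> \<pi>' \<in> lists (lists A)"
proof (induction \<pi> arbitrary: \<pi>')
  case (Cons B \<pi>)
  then have "\<pi>' = (h # B) # \<pi> \<or> (\<exists>\<sigma>\<in>set (into_block h \<pi>). \<pi>' = B # \<sigma>)" by auto
  then show ?case using Cons by (elim disjE bexE) (simp_all del: in_lists_conv_set)
qed simp

lemma blocks_lists: "\<pi> \<in> set (blocks vs) \<Longrightarrow> vs \<in> lists A \<Longrightarrow> \<pi> \<in> lists (lists A)"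
proof (induction vs arbitrary: \<pi>)
  case (Cons h vs)
  then obtain \<sigma> where \<sigma>: "\<sigma> \<in> set (blocks vs)" "\<pi> = [h] # \<sigma> \<or> \<pi> \<in> set (into_block h \<sigma>)"
    by auto
  moreover have "\<sigma> \<in> lists (lists A)" using Cons \<sigma> by simp
  ultimately show ?case using Cons.prems into_block_lists[of \<pi> h \<sigma> A] by auto
qed simp

abbreviation blocksnrm :: "'a nspace \<Rightarrow> 'a list list \<Rightarrow> real" where
  "blocksnrm E \<pi> \<equiv> prod_list (map (prodnrm E) \<pi>)"

lemma blocksnrm_into_block: "\<pi>' \<in> set (into_block h \<pi>) \<Longrightarrow> blocksnrm E \<pi>' = nrm E h * blocksnrm E \<pi>"
  by (induction \<pi> arbitrary: \<pi>') auto

lemma blocksnrm_blocks: "\<pi> \<in> set (blocks vs) \<Longrightarrow> blocksnrm E \<pi> = prodnrm E vs"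
proof (induction vs arbitrary: \<pi>)
  case (Cons h vs)
  then obtain \<sigma> where "\<sigma> \<in> set (blocks vs)" "\<pi> = [h] # \<sigma> \<or> \<pi> \<in> set (into_block h \<sigma>)"
    by auto
  then show ?case using Cons blocksnrm_into_block[of \<pi> h \<sigma> E] by auto
qed simp

definition list_sum :: "'b nspace \<Rightarrow> 'b list \<Rightarrow> 'b" where
  "list_sum F ys = foldr (add F) ys \<zero>\<^bsub>F\<^esub>"

context hilbert
begin

lemma list_sum_closed: "set ys \<subseteq> carrier K \<Longrightarrow> list_sum (realify K) ys \<in> carrier K"
  by (induction ys) (auto simp: list_sum_def)

lemma rinner_list_sum:
  "set ys \<subseteq> carrier K \<Longrightarrow> w \<in> carrier K \<Longrightarrow> rinner (list_sum (realify K) ys) w = (\<Sum>y\<leftarrow>ys. rinner y w)"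
proof (induction ys)
  case (Cons y ys)
  have "list_sum (realify K) (y # ys) = y \<oplus> list_sum (realify K) ys" by (simp add: list_sum_def)
  then show ?case using Cons list_sum_closed[of ys] by (simp add: rinner_add_left)
qed (simp add: list_sum_def)

end

lemma abs_sum_list_le: "(\<And>x. x \<in> set xs \<Longrightarrow> \<bar>f x\<bar> \<le> (c::real)) \<Longrightarrow> \<bar>\<Sum>x\<leftarrow>xs. f x\<bar> \<le> real (length xs) * c"
proof (induction xs)
  case (Cons x xs)
  have "\<bar>f x\<bar> \<le> c" "\<bar>\<Sum>x\<leftarrow>xs. f x\<bar> \<le> real (length xs) * c" using Cons by auto
  then show ?case by (simp add: algebra_simps)
qed simp

lemma sum_list_diff: "(\<Sum>x\<leftarrow>xs. f x) - (\<Sum>x\<leftarrow>xs. g x) = (\<Sum>x\<leftarrow>xs. f x - (g x :: real))"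
  by (induction xs) auto

lemma sum_list_concat_Cons:
  "(\<Sum>x\<leftarrow>concat (map (\<lambda>y. a y # b y) ys). f x) = (\<Sum>y\<leftarrow>ys. f (a y) + (\<Sum>x\<leftarrow>b y. f x :: real))"
  by (induction ys) auto

locale composition = A: Banach_maps E F U + B: Banach_maps F "realify L" V + hilbert L
  for E :: "'a nspace" and F :: "'b nspace" and L :: "'c hspace" and U :: "'a set" and V :: "'b set" +
  fixes Df :: "'a \<Rightarrow> 'a list \<Rightarrow> 'b" and Dg :: "'b \<Rightarrow> 'b list \<Rightarrow> 'c"
  assumes Df: "smooth_derivs E F U Df" and Dg: "smooth_derivs F (realify L) V Dg"
    and f_V: "x \<in> U \<Longrightarrow> Df x [] \<in> V"
begin

text \<open>All estimates are made for the scalar functions \<open>\<langle>Dg z ws, w\<rangle>\<close>.\<close>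

definition G :: "'b \<Rightarrow> 'b list \<Rightarrow> 'c \<Rightarrow> real" where
  "G z ws w = rinner (Dg z ws) w"

lemma Dg_closed: "z \<in> V \<Longrightarrow> ws \<in> lists (carrier F) \<Longrightarrow> Dg z ws \<in> carrier L"
  using smooth_derivs_closed[OF Dg] by simp

lemmas Df_closed = smooth_derivs_closed[OF Df]

lemma G_add:
  assumes "z \<in> V" "us \<in> lists (carrier F)" "ws \<in> lists (carrier F)" "a \<in> carrier F" "b \<in> carrier F" "w \<in> carrier L"
  shows "G z (us @ (a \<oplus>\<^bsub>F\<^esub> b) # ws) w = G z (us @ a # ws) w + G z (us @ b # ws) w"
  unfolding G_def smooth_derivs_add[OF Dg assms(1-5)] using assms Dg_closed by (simp add: rinner_add_left)

lemma G_smult: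
  assumes "z \<in> V" "us \<in> lists (carrier F)" "ws \<in> lists (carrier F)" "a \<in> carrier F" "w \<in> carrier L"
  shows "G z (us @ (c \<odot>\<^bsub>F\<^esub> a) # ws) w = c * G z (us @ a # ws) w"
  unfolding G_def smooth_derivs_smult[OF Dg assms(1-4)] using assms Dg_closed by (simp add: rinner_smult_left)

lemma G_bound:
  assumes z: "z \<in> V"
  obtains C where "C > 0" "\<And>ws w. ws \<in> lists (carrier F) \<Longrightarrow> length ws = k \<Longrightarrow> w \<in> carrier L \<Longrightarrow>
      \<bar>G z ws w\<bar> \<le> C * prodnrm F ws * nrm (realify L) w"
proof -
  obtain C where C: "C > 0" "\<And>ws. ws \<in> lists (carrier F) \<Longrightarrow> length ws = k \<Longrightarrow> nrm (realify L) (Dg z ws) \<le> C * prodnrm F ws"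
    by (rule B.smooth_derivs_bound[OF Dg z, of k]) blast
  have "\<bar>G z ws w\<bar> \<le> C * prodnrm F ws * nrm (realify L) w"
    if "ws \<in> lists (carrier F)" "length ws = k" "w \<in> carrier L" for ws w
  proof -
    have "\<bar>G z ws w\<bar> \<le> nrm (realify L) (Dg z ws) * nrm (realify L) w"
      unfolding G_def using that z by (intro rinner_le Dg_closed)
    also have "\<dots> \<le> C * prodnrm F ws * nrm (realify L) w"
      using that C by (intro mult_right_mono nrm_realify_nonneg) auto
    finally show ?thesis .
  qed
  then show thesis using C that by blast
qed

lemma G_deriv:
  assumes z: "z \<in> V" and \<epsilon>: "\<epsilon> > 0"
  obtains \<delta> where "\<delta> > 0" "\<And>l ws w. l \<in> carrier F \<Longrightarrow> nrm F l < \<delta> \<Longrightarrow> z \<oplus>\<^bsub>F\<^esub> l \<in> V \<Longrightarrow>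
      ws \<in> lists (carrier F) \<Longrightarrow> length ws = k \<Longrightarrow> w \<in> carrier L \<Longrightarrow>
      \<bar>G (z \<oplus>\<^bsub>F\<^esub> l) ws w - G z ws w - G z (l # ws) w\<bar> \<le> \<epsilon> * nrm F l * prodnrm F ws * nrm (realify L) w"
proof -
  obtain \<delta> where "\<delta> > 0" and \<delta>: "\<And>l ws. l \<in> carrier F \<Longrightarrow> nrm F l < \<delta> \<Longrightarrow> z \<oplus>\<^bsub>F\<^esub> l \<in> V \<Longrightarrow>
      ws \<in> lists (carrier F) \<Longrightarrow> length ws = k \<Longrightarrow>
      nrm (realify L) ((Dg (z \<oplus>\<^bsub>F\<^esub> l) ws \<ominus>\<^bsub>realify L\<^esub> Dg z ws) \<ominus>\<^bsub>realify L\<^esub> Dg z (l # ws)) \<le> \<epsilon> * nrm F l * prodnrm F ws"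
    using smooth_derivs_deriv[OF Dg z \<epsilon>, of k] unfolding eventually_small by blast
  have "\<bar>G (z \<oplus>\<^bsub>F\<^esub> l) ws w - G z ws w - G z (l # ws) w\<bar> \<le> \<epsilon> * nrm F l * prodnrm F ws * nrm (realify L) w"
    if l: "l \<in> carrier F" "nrm F l < \<delta>" "z \<oplus>\<^bsub>F\<^esub> l \<in> V" and ws: "ws \<in> lists (carrier F)" "length ws = k"
      and w: "w \<in> carrier L" for l ws w
  proof -
    have [simp]: "Dg (z \<oplus>\<^bsub>F\<^esub> l) ws \<in> carrier L" "Dg z ws \<in> carrier L" "Dg z (l # ws) \<in> carrier L"
      using l ws z by (auto intro!: Dg_closed)
    have "G (z \<oplus>\<^bsub>F\<^esub> l) ws w - G z ws w - G z (l # ws) w = rinner ((Dg (z \<oplus>\<^bsub>F\<^esub> l) ws \<ominus>\<^bsub>L\<^esub> Dg z ws) \<ominus>\<^bsub>L\<^esub> Dg z (l # ws)) w"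
      using w by (simp add: G_def rinner_diff_left)
    also have "\<bar>\<dots>\<bar> \<le> nrm (realify L) ((Dg (z \<oplus>\<^bsub>F\<^esub> l) ws \<ominus>\<^bsub>L\<^esub> Dg z ws) \<ominus>\<^bsub>L\<^esub> Dg z (l # ws)) * nrm (realify L) w"
      using w by (intro rinner_le) auto
    also have "\<dots> \<le> \<epsilon> * nrm F l * prodnrm F ws * nrm (realify L) w"
      using \<delta>[OF l ws] w by (intro mult_right_mono nrm_realify_nonneg) auto
    finally show ?thesis .
  qed
  then show thesis using \<open>\<delta> > 0\<close> that by blast
qed

text \<open>The term that belongs to the blocks \<open>\<pi>\<close>. The vectors \<open>ws\<close> are fixed arguments of the derivative
  of \<open>g\<close>; in an induction over \<open>\<pi>\<close> the blocks are moved there one after the other.\<close>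

definition fterm :: "'a \<Rightarrow> 'b list \<Rightarrow> 'a list list \<Rightarrow> 'c \<Rightarrow> real" where
  "fterm x ws \<pi> w = G (Df x []) (ws @ map (Df x) \<pi>) w"

text \<open>The derivative of \<^const>\<open>fterm\<close> in direction \<open>h\<close>, by the product rule.\<close>

definition dterm :: "'a \<Rightarrow> 'a \<Rightarrow> 'b list \<Rightarrow> 'a list list \<Rightarrow> 'c \<Rightarrow> real" where
  "dterm x h ws \<pi> w =
     G (Df x []) (Df x [h] # ws @ map (Df x) \<pi>) w + (\<Sum>\<pi>'\<leftarrow>into_block h \<pi>. fterm x ws \<pi>' w)"

lemma fterm_Cons: "fterm x ws (B # \<pi>) w = fterm x (ws @ [Df x B]) \<pi> w"
  by (simp add: fterm_def)

lemma dterm_Nil: "dterm x h ws [] w = G (Df x []) (Df x [h] # ws) w"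
  by (simp add: dterm_def)

lemma dterm_Cons: "dterm x h ws (B # \<pi>) w = dterm x h (ws @ [Df x B]) \<pi> w + fterm x (ws @ [Df x (h # B)]) \<pi> w"
  by (simp add: dterm_def fterm_Cons comp_def)

lemma map_Df: "x \<in> U \<Longrightarrow> \<pi> \<in> lists (lists (carrier E)) \<Longrightarrow> map (Df x) \<pi> \<in> lists (carrier F)"
  using Df_closed by (induction \<pi>) auto

lemma fterm_add:
  assumes "x \<in> U" "ws \<in> lists (carrier F)" "a \<in> carrier F" "b \<in> carrier F" "\<pi> \<in> lists (lists (carrier E))" "w \<in> carrier L"
  shows "fterm x (ws @ [a \<oplus>\<^bsub>F\<^esub> b]) \<pi> w = fterm x (ws @ [a]) \<pi> w + fterm x (ws @ [b]) \<pi> w"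
  using G_add[of "Df x []" ws "map (Df x) \<pi>" a b w] assms f_V map_Df by (simp add: fterm_def)

lemma fterm_smult:
  assumes "x \<in> U" "ws \<in> lists (carrier F)" "a \<in> carrier F" "\<pi> \<in> lists (lists (carrier E))" "w \<in> carrier L"
  shows "fterm x (ws @ [c \<odot>\<^bsub>F\<^esub> a]) \<pi> w = c * fterm x (ws @ [a]) \<pi> w"
  using G_smult[of "Df x []" ws "map (Df x) \<pi>" a w] assms f_V map_Df by (simp add: fterm_def)

lemma dterm_add:
  assumes "x \<in> U" "a \<in> carrier E" "b \<in> carrier E" "w \<in> carrier L" "\<pi> \<in> lists (lists (carrier E))" "ws \<in> lists (carrier F)"
  shows "dterm x (a \<oplus>\<^bsub>E\<^esub> b) ws \<pi> w = dterm x a ws \<pi> w + dterm x b ws \<pi> w"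
  using assms
proof (induction \<pi> arbitrary: ws)
  case Nil
  have "Df x [a \<oplus>\<^bsub>E\<^esub> b] = Df x [a] \<oplus>\<^bsub>F\<^esub> Df x [b]"
    using smooth_derivs_add[OF Df, of x "[]" "[]" a b] Nil by simp
  then show ?case
    using G_add[of "Df x []" "[]" ws "Df x [a]" "Df x [b]" w] Nil f_V Df_closed by (simp add: dterm_Nil)
next
  case (Cons B \<pi>)
  have B: "B \<in> lists (carrier E)" "\<pi> \<in> lists (lists (carrier E))" using Cons.prems by simp_all
  have "Df x ((a \<oplus>\<^bsub>E\<^esub> b) # B) = Df x (a # B) \<oplus>\<^bsub>F\<^esub> Df x (b # B)"
    using smooth_derivs_add[OF Df, of x "[]" B a b] Cons B by simp
  moreover have "Df x (a # B) \<in> carrier F" "Df x (b # B) \<in> carrier F" "Df x B \<in> carrier F"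
    using Cons B by (auto intro!: Df_closed)
  ultimately show ?case
    using Cons B by (simp add: dterm_Cons fterm_add)
qed

lemma dterm_smult:
  assumes "x \<in> U" "a \<in> carrier E" "w \<in> carrier L" "\<pi> \<in> lists (lists (carrier E))" "ws \<in> lists (carrier F)"
  shows "dterm x (c \<odot>\<^bsub>E\<^esub> a) ws \<pi> w = c * dterm x a ws \<pi> w"
  using assms
proof (induction \<pi> arbitrary: ws)
  case Nil
  have "Df x [c \<odot>\<^bsub>E\<^esub> a] = c \<odot>\<^bsub>F\<^esub> Df x [a]"
    using smooth_derivs_smult[OF Df, of x "[]" "[]" a c] Nil by simp
  then show ?case
    using G_smult[of "Df x []" "[]" ws "Df x [a]" w c] Nil f_V Df_closed by (simp add: dterm_Nil)
next
  case (Cons B \<pi>)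
  have B: "B \<in> lists (carrier E)" "\<pi> \<in> lists (lists (carrier E))" using Cons.prems by simp_all
  have "Df x ((c \<odot>\<^bsub>E\<^esub> a) # B) = c \<odot>\<^bsub>F\<^esub> Df x (a # B)"
    using smooth_derivs_smult[OF Df, of x "[]" B a c] Cons B by simp
  moreover have "Df x (a # B) \<in> carrier F" "Df x B \<in> carrier F"
    using Cons B by (auto intro!: Df_closed)
  ultimately show ?case
    using Cons B by (simp add: dterm_Cons fterm_smult algebra_simps)
qed

text \<open>The lists over which the estimates are uniform.\<close>

definition args :: "nat \<Rightarrow> nat list \<Rightarrow> ('b list \<times> 'a list list \<times> 'c) set" where
  "args q ls = {(ws, \<pi>, w). ws \<in> lists (carrier F) \<and> length ws = q \<and> \<pi> \<in> lists (lists (carrier E)) \<and>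
     map length \<pi> = ls \<and> w \<in> carrier L}"

definition weight :: "'b list \<Rightarrow> 'a list list \<Rightarrow> 'c \<Rightarrow> real" where
  "weight ws \<pi> w = prodnrm F ws * blocksnrm E \<pi> * nrm (realify L) w"

lemma blocksnrm_nonneg: "\<pi> \<in> lists (lists (carrier E)) \<Longrightarrow> 0 \<le> blocksnrm E \<pi>"
  by (induction \<pi>) (auto intro!: mult_nonneg_nonneg A.E.prodnrm_nonneg)

lemma weight_nonneg: "(ws, \<pi>, w) \<in> args q ls \<Longrightarrow> 0 \<le> weight ws \<pi> w"
  unfolding weight_def args_def
  by (intro mult_nonneg_nonneg A.F.prodnrm_nonneg blocksnrm_nonneg nrm_realify_nonneg) auto

text \<open>The step of the induction on the blocks: it moves a vector \<open>a\<close> of norm at most \<open>c\<close> times that of a block into the list of fixed vectors.\<close>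

lemma weight_snoc:
  assumes "(ws, B # \<pi>, w) \<in> args q (l # ls)" "a \<in> carrier F" "nrm F a \<le> c * prodnrm E B"
  shows "(ws @ [a], \<pi>, w) \<in> args (Suc q) ls" "weight (ws @ [a]) \<pi> w \<le> c * weight ws (B # \<pi>) w"
proof -
  show "(ws @ [a], \<pi>, w) \<in> args (Suc q) ls" using assms by (auto simp: args_def)
  have "0 \<le> weight ws \<pi> w" by (rule weight_nonneg[of _ _ _ q ls]) (use assms in \<open>auto simp: args_def\<close>)
  then have "nrm F a * weight ws \<pi> w \<le> (c * prodnrm E B) * weight ws \<pi> w"
    using assms by (intro mult_right_mono)
  then show "weight (ws @ [a]) \<pi> w \<le> c * weight ws (B # \<pi>) w"
    by (simp add: weight_def algebra_simps)
qed

lemma Df_bound: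
  assumes "x \<in> U"
  obtains C where "C > 0" "\<And>B. B \<in> lists (carrier E) \<Longrightarrow> length B = k \<Longrightarrow> nrm F (Df x B) \<le> C * prodnrm E B"
  by (rule A.smooth_derivs_bound[OF Df assms, of k]) blast

lemma fterm_bound:
  assumes x: "x \<in> U"
  shows "\<exists>C>0. \<forall>(ws, \<pi>, w)\<in>args q ls. \<bar>fterm x ws \<pi> w\<bar> \<le> C * weight ws \<pi> w"
proof (induction ls arbitrary: q)
  case Nil
  obtain C where C: "C > 0" "\<And>ws w. ws \<in> lists (carrier F) \<Longrightarrow> length ws = q \<Longrightarrow> w \<in> carrier L \<Longrightarrow>
      \<bar>G (Df x []) ws w\<bar> \<le> C * prodnrm F ws * nrm (realify L) w"
    by (rule G_bound[OF f_V[OF x], of q]) blast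
  have "\<bar>fterm x ws \<pi> w\<bar> \<le> C * weight ws \<pi> w" if a: "(ws, \<pi>, w) \<in> args q []" for ws \<pi> w
    using C(2)[of ws w] a by (simp add: args_def weight_def fterm_def mult.assoc)
  then show ?case using C(1) by (intro exI[of _ C]) auto
next
  case (Cons l ls)
  obtain C where C: "C > 0" and le: "\<And>ws \<pi> w. (ws, \<pi>, w) \<in> args (Suc q) ls \<Longrightarrow> \<bar>fterm x ws \<pi> w\<bar> \<le> C * weight ws \<pi> w"
    using Cons[of "Suc q"] by blast
  obtain C1 where C1: "C1 > 0" "\<And>B. B \<in> lists (carrier E) \<Longrightarrow> length B = l \<Longrightarrow> nrm F (Df x B) \<le> C1 * prodnrm E B"
    by (rule Df_bound[OF x, of l]) blast
  have "\<bar>fterm x ws \<pi> w\<bar> \<le> C * C1 * weight ws \<pi> w" if a: "(ws, \<pi>, w) \<in> args q (l # ls)" for ws \<pi> w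
  proof -
    obtain B \<pi>' where \<pi>: "\<pi> = B # \<pi>'" using a by (cases \<pi>) (auto simp: args_def)
    have B: "B \<in> lists (carrier E)" "length B = l" using a by (auto simp: args_def \<pi>)
    note ws = weight_snoc[OF a[unfolded \<pi>] Df_closed[OF x B(1)] C1(2)[OF B]]
    have "\<bar>fterm x ws \<pi> w\<bar> \<le> C * weight (ws @ [Df x B]) \<pi>' w"
      unfolding \<pi> fterm_Cons by (rule le[OF ws(1)])
    also have "\<dots> \<le> C * (C1 * weight ws (B # \<pi>') w)"
      using ws(2) C by (intro mult_left_mono) auto
    finally show ?thesis by (simp add: \<pi>)
  qed
  then show ?case using C C1 by (intro exI[of _ "C * C1"]) auto
qed

lemma dterm_bound:
  assumes x: "x \<in> U"
  shows "\<exists>C>0. \<forall>h\<in>carrier E. \<forall>(ws, \<pi>, w)\<in>args q ls. \<bar>dterm x h ws \<pi> w\<bar> \<le> C * nrm E h * weight ws \<pi> w"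
proof (induction ls arbitrary: q)
  case Nil
  obtain C where C: "C > 0" "\<And>ws w. ws \<in> lists (carrier F) \<Longrightarrow> length ws = Suc q \<Longrightarrow> w \<in> carrier L \<Longrightarrow>
      \<bar>G (Df x []) ws w\<bar> \<le> C * prodnrm F ws * nrm (realify L) w"
    by (rule G_bound[OF f_V[OF x], of "Suc q"]) blast
  obtain C1 where C1: "C1 > 0" "\<And>B. B \<in> lists (carrier E) \<Longrightarrow> length B = 1 \<Longrightarrow> nrm F (Df x B) \<le> C1 * prodnrm E B"
    by (rule Df_bound[OF x, of 1]) blast
  have "\<bar>dterm x h ws \<pi> w\<bar> \<le> C * C1 * nrm E h * weight ws \<pi> w"
    if h: "h \<in> carrier E" and a: "(ws, \<pi>, w) \<in> args q []" for h ws \<pi> w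
  proof -
    have \<pi>: "\<pi> = []" and ws: "ws \<in> lists (carrier F)" "length ws = q" and w: "w \<in> carrier L"
      using a by (auto simp: args_def)
    have "Df x [h] \<in> carrier F" using h by (intro Df_closed[OF x]) auto
    then have "\<bar>dterm x h ws \<pi> w\<bar> \<le> C * (nrm F (Df x [h]) * prodnrm F ws) * nrm (realify L) w"
      using C(2)[of "Df x [h] # ws" w] ws w by (simp add: \<pi> dterm_Nil)
    also have "\<dots> \<le> C * ((C1 * nrm E h) * prodnrm F ws) * nrm (realify L) w"
      using C1(2)[of "[h]"] C h ws w
      by (intro mult_right_mono mult_left_mono nrm_realify_nonneg A.F.prodnrm_nonneg) auto
    finally show ?thesis by (simp add: weight_def \<pi> algebra_simps)
  qed
  then show ?case using C C1 by (intro exI[of _ "C * C1"]) auto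
next
  case (Cons l ls)
  obtain C where C: "C > 0" and le: "\<And>h ws \<pi> w. h \<in> carrier E \<Longrightarrow> (ws, \<pi>, w) \<in> args (Suc q) ls \<Longrightarrow>
      \<bar>dterm x h ws \<pi> w\<bar> \<le> C * nrm E h * weight ws \<pi> w"
    using Cons[of "Suc q"] by blast
  obtain C' where C': "C' > 0" and le': "\<And>ws \<pi> w. (ws, \<pi>, w) \<in> args (Suc q) ls \<Longrightarrow> \<bar>fterm x ws \<pi> w\<bar> \<le> C' * weight ws \<pi> w"
    using fterm_bound[OF x, of "Suc q" ls] by blast
  obtain C1 where C1: "C1 > 0" "\<And>B. B \<in> lists (carrier E) \<Longrightarrow> length B = l \<Longrightarrow> nrm F (Df x B) \<le> C1 * prodnrm E B"
    by (rule Df_bound[OF x, of l]) blast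
  obtain C2 where C2: "C2 > 0" "\<And>B. B \<in> lists (carrier E) \<Longrightarrow> length B = Suc l \<Longrightarrow> nrm F (Df x B) \<le> C2 * prodnrm E B"
    by (rule Df_bound[OF x, of "Suc l"]) blast
  have "\<bar>dterm x h ws \<pi> w\<bar> \<le> (C * C1 + C' * C2) * nrm E h * weight ws \<pi> w"
    if h: "h \<in> carrier E" and a: "(ws, \<pi>, w) \<in> args q (l # ls)" for h ws \<pi> w
  proof -
    obtain B \<pi>' where \<pi>: "\<pi> = B # \<pi>'" using a by (cases \<pi>) (auto simp: args_def)
    have B: "B \<in> lists (carrier E)" "length B = l" using a by (auto simp: args_def \<pi>)
    note ws = weight_snoc[OF a[unfolded \<pi>] Df_closed[OF x B(1)] C1(2)[OF B]]
    have hB: "h # B \<in> lists (carrier E)" using h B by simp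
    have "nrm F (Df x (h # B)) \<le> (C2 * nrm E h) * prodnrm E B"
      using C2(2)[OF hB] B by simp
    note ws' = weight_snoc[OF a[unfolded \<pi>] Df_closed[OF x hB] this]
    have "\<bar>dterm x h ws \<pi> w\<bar> \<le> C * nrm E h * weight (ws @ [Df x B]) \<pi>' w + C' * weight (ws @ [Df x (h # B)]) \<pi>' w"
      unfolding \<pi> dterm_Cons by (intro order_trans[OF abs_triangle_ineq] add_mono le[OF h ws(1)] le'[OF ws'(1)])
    also have "\<dots> \<le> C * nrm E h * (C1 * weight ws (B # \<pi>') w) + C' * ((C2 * nrm E h) * weight ws (B # \<pi>') w)"
      using ws(2) ws'(2) C C' h by (intro add_mono mult_left_mono) auto
    finally show ?thesis by (simp add: \<pi> algebra_simps)
  qed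
  moreover have "C * C1 + C' * C2 > 0" using C C1 C' C2 by (intro add_pos_pos) auto
  ultimately show ?case by (intro exI[of _ "C * C1 + C' * C2"]) auto
qed

definition fterm_estimate :: "'a \<Rightarrow> nat \<Rightarrow> nat list \<Rightarrow> real \<Rightarrow> 'a \<Rightarrow> bool" where
  "fterm_estimate x q ls \<epsilon> h \<longleftrightarrow> (\<forall>(ws, \<pi>, w)\<in>args q ls.
     \<bar>fterm (x \<oplus>\<^bsub>E\<^esub> h) ws \<pi> w - fterm x ws \<pi> w - dterm x h ws \<pi> w\<bar> \<le> \<epsilon> * nrm E h * weight ws \<pi> w)"

lemma Df_step:
  assumes x: "x \<in> U" and \<epsilon>: "\<epsilon> > 0"
  shows "\<forall>\<^sub>F h in small E. \<forall>B\<in>lists (carrier E). length B = k \<longrightarrow>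
      (\<exists>r\<in>carrier F. Df (x \<oplus>\<^bsub>E\<^esub> h) B = Df x B \<oplus>\<^bsub>F\<^esub> (Df x (h # B) \<oplus>\<^bsub>F\<^esub> r) \<and> nrm F r \<le> (\<epsilon> * nrm E h) * prodnrm E B)"
  using smooth_derivs_deriv[OF Df x \<epsilon>, of k] A.E.eventually_small_open[OF A.U x] eventually_small_carrier
proof eventually_elim
  case (elim h)
  show ?case
  proof (intro ballI impI)
    fix B assume B: "B \<in> lists (carrier E)" "length B = k"
    have [simp]: "Df (x \<oplus>\<^bsub>E\<^esub> h) B \<in> carrier F" "Df x B \<in> carrier F" "Df x (h # B) \<in> carrier F"
      using elim B x by (auto intro!: Df_closed)
    let ?r = "(Df (x \<oplus>\<^bsub>E\<^esub> h) B \<ominus>\<^bsub>F\<^esub> Df x B) \<ominus>\<^bsub>F\<^esub> Df x (h # B)"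
    have "Df (x \<oplus>\<^bsub>E\<^esub> h) B = Df x B \<oplus>\<^bsub>F\<^esub> (Df x (h # B) \<oplus>\<^bsub>F\<^esub> ?r)"
      by (simp add: A.F.add_diff_cancel)
    moreover have "nrm F ?r \<le> (\<epsilon> * nrm E h) * prodnrm E B" using elim B by blast
    ultimately show "\<exists>r\<in>carrier F. Df (x \<oplus>\<^bsub>E\<^esub> h) B = Df x B \<oplus>\<^bsub>F\<^esub> (Df x (h # B) \<oplus>\<^bsub>F\<^esub> r) \<and> nrm F r \<le> (\<epsilon> * nrm E h) * prodnrm E B"
      by (intro bexI[of _ ?r]) auto
  qed
qed

text \<open>The chain rule of first order: with \<open>f (x + h) = f x + l\<close> the increment \<open>l\<close> is \<open>Df x [h]\<close> up to an
  error \<open>r\<close>, and the derivative of \<open>g\<close> is used at \<open>l\<close>.\<close>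

lemma fterm_deriv_Nil:
  assumes x: "x \<in> U" and \<epsilon>: "\<epsilon> > 0"
  shows "\<forall>\<^sub>F h in small E. fterm_estimate x q [] \<epsilon> h"
proof -
  let ?z = "Df x []"
  have z: "?z \<in> V" "?z \<in> carrier F" using f_V[OF x] Df_closed[OF x] by auto
  obtain C where C: "C > 0" "\<And>ws w. ws \<in> lists (carrier F) \<Longrightarrow> length ws = Suc q \<Longrightarrow> w \<in> carrier L \<Longrightarrow>
      \<bar>G ?z ws w\<bar> \<le> C * prodnrm F ws * nrm (realify L) w"
    by (rule G_bound[OF z(1), of "Suc q"]) blast
  obtain C1 where C1: "C1 > 0" "\<And>B. B \<in> lists (carrier E) \<Longrightarrow> length B = 1 \<Longrightarrow> nrm F (Df x B) \<le> C1 * prodnrm E B"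
    by (rule Df_bound[OF x, of 1]) blast
  define \<epsilon>1 where "\<epsilon>1 = min 1 (\<epsilon> / (2 * C))"
  define \<epsilon>2 where "\<epsilon>2 = \<epsilon> / (2 * (C1 + 1))"
  have \<epsilon>1: "\<epsilon>1 > 0" "\<epsilon>1 \<le> 1" "C * \<epsilon>1 \<le> \<epsilon> / 2" and \<epsilon>2: "\<epsilon>2 > 0" "\<epsilon>2 * (C1 + 1) = \<epsilon> / 2"
    using \<epsilon> C(1) C1(1) by (auto simp: \<epsilon>1_def \<epsilon>2_def min_def field_simps)
  obtain \<delta> where "\<delta> > 0" and \<delta>: "\<And>l ws w. l \<in> carrier F \<Longrightarrow> nrm F l < \<delta> \<Longrightarrow> ?z \<oplus>\<^bsub>F\<^esub> l \<in> V \<Longrightarrow>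
      ws \<in> lists (carrier F) \<Longrightarrow> length ws = q \<Longrightarrow> w \<in> carrier L \<Longrightarrow>
      \<bar>G (?z \<oplus>\<^bsub>F\<^esub> l) ws w - G ?z ws w - G ?z (l # ws) w\<bar> \<le> \<epsilon>2 * nrm F l * prodnrm F ws * nrm (realify L) w"
    by (rule G_deriv[OF z(1) \<epsilon>2(1), of q]) blast
  have "\<delta> / (C1 + 1) > 0" using \<open>\<delta> > 0\<close> C1 by simp
  from Df_step[OF x \<epsilon>1(1), of 0] eventually_small_carrier eventually_small_less[OF this, of E]
    A.E.eventually_small_open[OF A.U x]
  show ?thesis
  proof eventually_elim
    case (elim h)
    then obtain r where r: "r \<in> carrier F" "Df (x \<oplus>\<^bsub>E\<^esub> h) [] = ?z \<oplus>\<^bsub>F\<^esub> (Df x [h] \<oplus>\<^bsub>F\<^esub> r)" "nrm F r \<le> \<epsilon>1 * nrm E h"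
      by auto
    define l where "l = Df x [h] \<oplus>\<^bsub>F\<^esub> r"
    have Dh: "Df x [h] \<in> carrier F" using elim by (intro Df_closed[OF x]) auto
    have l: "l \<in> carrier F" using Dh r by (simp add: l_def)
    have "nrm F l \<le> nrm F (Df x [h]) + nrm F r" unfolding l_def using Dh r by (intro A.F.nrm_triangle)
    also have "\<dots> \<le> C1 * nrm E h + 1 * nrm E h"
      using C1(2)[of "[h]"] elim r \<epsilon>1 by (intro add_mono order_trans[OF r(3)] mult_right_mono) auto
    finally have l_le: "nrm F l \<le> (C1 + 1) * nrm E h" by (simp add: algebra_simps)
    have l_less: "nrm F l < \<delta>"
      using l_le elim C1 by (simp add: field_simps)
    have xl: "Df (x \<oplus>\<^bsub>E\<^esub> h) [] = ?z \<oplus>\<^bsub>F\<^esub> l" using r by (simp add: l_def)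
    then have zl: "?z \<oplus>\<^bsub>F\<^esub> l \<in> V" using f_V elim by metis
    show ?case
      unfolding fterm_estimate_def
    proof safe
      fix ws \<pi> w assume a: "(ws, \<pi>, w) \<in> args q []"
      have \<pi>: "\<pi> = []" and ws: "ws \<in> lists (carrier F)" "length ws = q" and w: "w \<in> carrier L"
        using a by (auto simp: args_def)
      have wt: "weight ws \<pi> w = prodnrm F ws * nrm (realify L) w" by (simp add: weight_def \<pi>)
      have wt0: "0 \<le> weight ws \<pi> w" using weight_nonneg[OF a] .
      have "G ?z (l # ws) w = G ?z (Df x [h] # ws) w + G ?z (r # ws) w"
        using G_add[OF z(1), of "[]" ws "Df x [h]" r w] Dh r ws w by (simp add: l_def)
      then have "\<bar>fterm (x \<oplus>\<^bsub>E\<^esub> h) ws \<pi> w - fterm x ws \<pi> w - dterm x h ws \<pi> w\<bar>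
          \<le> \<bar>G (?z \<oplus>\<^bsub>F\<^esub> l) ws w - G ?z ws w - G ?z (l # ws) w\<bar> + \<bar>G ?z (r # ws) w\<bar>"
        by (simp add: \<pi> fterm_def dterm_Nil xl)
      also have "\<dots> \<le> \<epsilon>2 * nrm F l * weight ws \<pi> w + C * nrm F r * weight ws \<pi> w"
        using \<delta>[OF l l_less zl ws w] C(2)[of "r # ws" w] r ws w
        by (intro add_mono) (simp_all add: wt mult.assoc)
      also have "\<dots> \<le> \<epsilon>2 * ((C1 + 1) * nrm E h) * weight ws \<pi> w + C * (\<epsilon>1 * nrm E h) * weight ws \<pi> w"
        using l_le r(3) C(1) \<epsilon>2(1) wt0 by (intro add_mono mult_right_mono mult_left_mono) auto
      also have "\<dots> = (\<epsilon>2 * (C1 + 1) + C * \<epsilon>1) * (nrm E h * weight ws \<pi> w)"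
        by (simp add: algebra_simps)
      also have "\<dots> \<le> (\<epsilon> / 2 + \<epsilon> / 2) * (nrm E h * weight ws \<pi> w)"
        using \<epsilon>1 \<epsilon>2 wt0 elim by (intro mult_right_mono mult_nonneg_nonneg) auto
      finally show "\<bar>fterm (x \<oplus>\<^bsub>E\<^esub> h) ws \<pi> w - fterm x ws \<pi> w - dterm x h ws \<pi> w\<bar> \<le> \<epsilon> * nrm E h * weight ws \<pi> w"
        by simp
    qed
  qed
qed

text \<open>Writing \<open>Df (x + h) B = Df x B + Df x (h # B) + r\<close> for the first block \<open>B\<close> splits the term at \<open>x + h\<close>
  into three. The first one is differentiable by induction, the second one differs from its value
  at \<open>x\<close> by an amount of second order, and the third one is as small as \<open>r\<close>.\<close>

lemma fterm_deriv:
  assumes x: "x \<in> U"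
  shows "\<epsilon> > 0 \<Longrightarrow> \<forall>\<^sub>F h in small E. fterm_estimate x q ls \<epsilon> h"
proof (induction ls arbitrary: q \<epsilon>)
  case Nil
  then show ?case using fterm_deriv_Nil[OF x] by blast
next
  case (Cons l ls)
  obtain C where C: "C > 0" and le: "\<And>h ws \<pi> w. h \<in> carrier E \<Longrightarrow> (ws, \<pi>, w) \<in> args (Suc q) ls \<Longrightarrow>
      \<bar>dterm x h ws \<pi> w\<bar> \<le> C * nrm E h * weight ws \<pi> w"
    using dterm_bound[OF x, of "Suc q" ls] by blast
  obtain C' where C': "C' > 0" and le': "\<And>ws \<pi> w. (ws, \<pi>, w) \<in> args (Suc q) ls \<Longrightarrow> \<bar>fterm x ws \<pi> w\<bar> \<le> C' * weight ws \<pi> w"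
    using fterm_bound[OF x, of "Suc q" ls] by blast
  obtain C1 where C1: "C1 > 0" "\<And>B. B \<in> lists (carrier E) \<Longrightarrow> length B = l \<Longrightarrow> nrm F (Df x B) \<le> C1 * prodnrm E B"
    by (rule Df_bound[OF x, of l]) blast
  obtain C2 where C2: "C2 > 0" "\<And>B. B \<in> lists (carrier E) \<Longrightarrow> length B = Suc l \<Longrightarrow> nrm F (Df x B) \<le> C2 * prodnrm E B"
    by (rule Df_bound[OF x, of "Suc l"]) blast
  define \<epsilon>1 where "\<epsilon>1 = \<epsilon> / (3 * C1)"
  define \<epsilon>2 where "\<epsilon>2 = \<epsilon> / (3 * (C' + C + 1))"
  define \<delta> where "\<delta> = min 1 (\<epsilon> / (3 * ((C + 1) * C2)))"
  have \<epsilon>1: "\<epsilon>1 > 0" "\<epsilon>1 * C1 = \<epsilon> / 3" and \<epsilon>2: "\<epsilon>2 > 0" "(C' + C + 1) * \<epsilon>2 = \<epsilon> / 3"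
    using Cons.prems C C1 C' by (auto simp: \<epsilon>1_def \<epsilon>2_def field_simps)
  have \<delta>: "\<delta> > 0" "\<delta> \<le> 1" "(C + 1) * C2 * \<delta> \<le> \<epsilon> / 3"
  proof -
    have K: "(C + 1) * C2 > 0" using C C2 by simp
    have cancel: "k * (\<epsilon> / (3 * k)) = \<epsilon> / 3" if "k > 0" for k :: real using that by simp
    show "\<delta> > 0" "\<delta> \<le> 1" using Cons.prems K by (auto simp: \<delta>_def)
    have "(C + 1) * C2 * \<delta> \<le> (C + 1) * C2 * (\<epsilon> / (3 * ((C + 1) * C2)))"
      using K unfolding \<delta>_def by (intro mult_left_mono) auto
    also have "\<dots> = \<epsilon> / 3" by (rule cancel[OF K])
    finally show "(C + 1) * C2 * \<delta> \<le> \<epsilon> / 3" .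
  qed
  from Cons.IH[OF \<epsilon>1(1), of "Suc q"] Cons.IH[OF zero_less_one, of "Suc q"] Df_step[OF x \<epsilon>2(1), of l]
    eventually_small_carrier eventually_small_less[OF \<delta>(1), of E] A.E.eventually_small_open[OF A.U x]
  show ?case
  proof eventually_elim
    case (elim h)
    then have h: "h \<in> carrier E" and h\<delta>: "nrm E h < \<delta>" and xh: "x \<oplus>\<^bsub>E\<^esub> h \<in> U" by auto
    \<comment> \<open>Both bounds come from the induction hypothesis with \<open>1\<close> in place of \<open>\<epsilon>\<close>.\<close>
    have lip: "\<bar>fterm (x \<oplus>\<^bsub>E\<^esub> h) ws \<pi> w - fterm x ws \<pi> w\<bar> \<le> (C + 1) * nrm E h * weight ws \<pi> w"
      if a: "(ws, \<pi>, w) \<in> args (Suc q) ls" for ws \<pi> w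
    proof -
      have "\<bar>fterm (x \<oplus>\<^bsub>E\<^esub> h) ws \<pi> w - fterm x ws \<pi> w - dterm x h ws \<pi> w\<bar> \<le> 1 * nrm E h * weight ws \<pi> w"
        using elim a unfolding fterm_estimate_def by blast
      then show ?thesis using le[OF h a] by (simp add: algebra_simps)
    qed
    have bnd: "\<bar>fterm (x \<oplus>\<^bsub>E\<^esub> h) ws \<pi> w\<bar> \<le> (C' + C + 1) * weight ws \<pi> w"
      if a: "(ws, \<pi>, w) \<in> args (Suc q) ls" for ws \<pi> w
    proof -
      have "(C + 1) * nrm E h * weight ws \<pi> w \<le> (C + 1) * 1 * weight ws \<pi> w"
        using C h\<delta> \<delta> weight_nonneg[OF a] by (intro mult_right_mono mult_left_mono) auto
      then show ?thesis using lip[OF a] le'[OF a] by (simp add: algebra_simps)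
    qed
    show ?case
      unfolding fterm_estimate_def
    proof safe
      fix ws \<pi> w assume a: "(ws, \<pi>, w) \<in> args q (l # ls)"
      obtain B \<pi>' where \<pi>: "\<pi> = B # \<pi>'" using a by (cases \<pi>) (auto simp: args_def)
      have B: "B \<in> lists (carrier E)" "length B = l" using a by (auto simp: args_def \<pi>)
      have wsc: "ws \<in> lists (carrier F)" "\<pi>' \<in> lists (lists (carrier E))" "w \<in> carrier L"
        using a by (auto simp: args_def \<pi>)
      have hB: "h # B \<in> lists (carrier E)" using h B by simp
      from elim B obtain r where r: "r \<in> carrier F"
          "Df (x \<oplus>\<^bsub>E\<^esub> h) B = Df x B \<oplus>\<^bsub>F\<^esub> (Df x (h # B) \<oplus>\<^bsub>F\<^esub> r)" "nrm F r \<le> (\<epsilon>2 * nrm E h) * prodnrm E B"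
        by blast
      note w1 = weight_snoc[OF a[unfolded \<pi>] Df_closed[OF x B(1)] C1(2)[OF B]]
      have "nrm F (Df x (h # B)) \<le> (C2 * nrm E h) * prodnrm E B"
        using C2(2)[OF hB] B by simp
      note w2 = weight_snoc[OF a[unfolded \<pi>] Df_closed[OF x hB] this]
      note w3 = weight_snoc[OF a[unfolded \<pi>] r(1) r(3)]
      have wt0: "0 \<le> weight ws \<pi> w" using weight_nonneg[OF a] .
      let ?t = "\<lambda>a. fterm (x \<oplus>\<^bsub>E\<^esub> h) (ws @ [a]) \<pi>' w"
      have split: "fterm (x \<oplus>\<^bsub>E\<^esub> h) ws \<pi> w = ?t (Df x B) + (?t (Df x (h # B)) + ?t r)"
        using r Df_closed[OF x B(1)] Df_closed[OF x hB] xh wsc by (simp add: \<pi> fterm_Cons fterm_add)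
      have "\<bar>?t (Df x B) - fterm x ws \<pi> w - dterm x h (ws @ [Df x B]) \<pi>' w\<bar> \<le> \<epsilon>1 * nrm E h * weight (ws @ [Df x B]) \<pi>' w"
        using elim w1(1) unfolding fterm_estimate_def \<pi> fterm_Cons by blast
      also have "\<dots> \<le> \<epsilon>1 * nrm E h * (C1 * weight ws (B # \<pi>') w)"
        using w1(2) \<epsilon>1 h by (intro mult_left_mono) auto
      also have "\<dots> = \<epsilon> / 3 * (nrm E h * weight ws \<pi> w)" by (simp add: \<pi> flip: \<epsilon>1(2))
      finally have e1: "\<bar>?t (Df x B) - fterm x ws \<pi> w - dterm x h (ws @ [Df x B]) \<pi>' w\<bar> \<le> \<epsilon> / 3 * (nrm E h * weight ws \<pi> w)" .
      have "\<bar>?t (Df x (h # B)) - fterm x (ws @ [Df x (h # B)]) \<pi>' w\<bar> \<le> (C + 1) * nrm E h * weight (ws @ [Df x (h # B)]) \<pi>' w"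
        by (rule lip[OF w2(1)])
      also have "\<dots> \<le> (C + 1) * \<delta> * (C2 * nrm E h * weight ws (B # \<pi>') w)"
        using w2(2) weight_nonneg[OF w2(1)] h\<delta> C h \<delta> by (intro mult_mono) auto
      also have "\<dots> = ((C + 1) * C2 * \<delta>) * (nrm E h * weight ws \<pi> w)" by (simp add: \<pi>)
      also have "\<dots> \<le> \<epsilon> / 3 * (nrm E h * weight ws \<pi> w)"
        using \<delta>(3) wt0 h by (intro mult_right_mono) auto
      finally have e2: "\<bar>?t (Df x (h # B)) - fterm x (ws @ [Df x (h # B)]) \<pi>' w\<bar> \<le> \<epsilon> / 3 * (nrm E h * weight ws \<pi> w)" .
      have "\<bar>?t r\<bar> \<le> (C' + C + 1) * weight (ws @ [r]) \<pi>' w" by (rule bnd[OF w3(1)])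
      also have "\<dots> \<le> (C' + C + 1) * (\<epsilon>2 * nrm E h * weight ws (B # \<pi>') w)"
        using w3(2) C C' by (intro mult_left_mono) auto
      also have "\<dots> = ((C' + C + 1) * \<epsilon>2) * (nrm E h * weight ws \<pi> w)" by (simp add: \<pi>)
      also have "\<dots> = \<epsilon> / 3 * (nrm E h * weight ws \<pi> w)" by (simp only: \<epsilon>2(2))
      finally have e3: "\<bar>?t r\<bar> \<le> \<epsilon> / 3 * (nrm E h * weight ws \<pi> w)" .
      have "dterm x h ws \<pi> w = dterm x h (ws @ [Df x B]) \<pi>' w + fterm x (ws @ [Df x (h # B)]) \<pi>' w"
        by (simp add: \<pi> dterm_Cons)
      then have "\<bar>fterm (x \<oplus>\<^bsub>E\<^esub> h) ws \<pi> w - fterm x ws \<pi> w - dterm x h ws \<pi> w\<bar> \<le> \<epsilon> * (nrm E h * weight ws \<pi> w)"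
        using e1 e2 e3 unfolding split by argo
      then show "\<bar>fterm (x \<oplus>\<^bsub>E\<^esub> h) ws \<pi> w - fterm x ws \<pi> w - dterm x h ws \<pi> w\<bar> \<le> \<epsilon> * nrm E h * weight ws \<pi> w"
        by simp
    qed
  qed
qed

definition Dgf :: "'a \<Rightarrow> 'a list \<Rightarrow> 'c" where
  "Dgf x vs = list_sum (realify L) (map (\<lambda>\<pi>. Dg (Df x []) (map (Df x) \<pi>)) (blocks vs))"

lemma Dgf_terms_closed:
  assumes "x \<in> U" "vs \<in> lists (carrier E)"
  shows "set (map (\<lambda>\<pi>. Dg (Df x []) (map (Df x) \<pi>)) (blocks vs)) \<subseteq> carrier L"
  using assms Dg_closed[OF f_V] map_Df blocks_lists by fastforce

lemma Dgf_closed: "x \<in> U \<Longrightarrow> vs \<in> lists (carrier E) \<Longrightarrow> Dgf x vs \<in> carrier L"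
  unfolding Dgf_def by (intro list_sum_closed Dgf_terms_closed)

lemma rinner_Dgf:
  assumes "x \<in> U" "vs \<in> lists (carrier E)" "w \<in> carrier L"
  shows "rinner (Dgf x vs) w = (\<Sum>\<pi>\<leftarrow>blocks vs. fterm x [] \<pi> w)"
  using rinner_list_sum[OF Dgf_terms_closed[OF assms(1,2)] assms(3)]
  by (simp add: Dgf_def fterm_def G_def comp_def)

lemma rinner_Dgf_Cons:
  assumes "x \<in> U" "h \<in> carrier E" "vs \<in> lists (carrier E)" "w \<in> carrier L"
  shows "rinner (Dgf x (h # vs)) w = (\<Sum>\<pi>\<leftarrow>blocks vs. dterm x h [] \<pi> w)"
proof -
  have "rinner (Dgf x (h # vs)) w = (\<Sum>\<pi>\<leftarrow>blocks (h # vs). fterm x [] \<pi> w)"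
    using assms by (intro rinner_Dgf) auto
  also have "\<dots> = (\<Sum>\<pi>\<leftarrow>blocks vs. fterm x [] ([h] # \<pi>) w + (\<Sum>\<pi>'\<leftarrow>into_block h \<pi>. fterm x [] \<pi>' w))"
    by (simp add: sum_list_concat_Cons)
  also have "\<dots> = (\<Sum>\<pi>\<leftarrow>blocks vs. dterm x h [] \<pi> w)"
    by (simp add: dterm_def fterm_def)
  finally show ?thesis .
qed

lemma blocks_args:
  assumes "\<pi> \<in> set (blocks vs)" "vs \<in> lists (carrier E)" "w \<in> carrier L"
  shows "([], \<pi>, w) \<in> args 0 (map length \<pi>)" "weight [] \<pi> w = prodnrm E vs * nrm (realify L) w"
  using assms blocks_lists[OF assms(1,2)] by (auto simp: args_def weight_def blocksnrm_blocks)

lemma smooth_derivs_Dgf: "smooth_derivs E (realify L) U Dgf"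
proof -
  interpret C: Banach_maps E "realify L" U by unfold_locales (rule A.U)
  show ?thesis
  proof (rule C.smooth_derivsI)
    fix x vs assume "x \<in> U" "vs \<in> lists (carrier E)"
    then show "Dgf x vs \<in> carrier (realify L)" using Dgf_closed by simp
  next
    fix x a b vs assume *: "x \<in> U" "a \<in> carrier E" "b \<in> carrier E" "vs \<in> lists (carrier E)"
    have "Dgf x ((a \<oplus>\<^bsub>E\<^esub> b) # vs) = Dgf x (a # vs) \<oplus>\<^bsub>L\<^esub> Dgf x (b # vs)"
    proof (rule eq_by_rinner)
      fix w assume w: "w \<in> carrier L"
      have "(\<Sum>\<pi>\<leftarrow>blocks vs. dterm x (a \<oplus>\<^bsub>E\<^esub> b) [] \<pi> w) = (\<Sum>\<pi>\<leftarrow>blocks vs. dterm x a [] \<pi> w + dterm x b [] \<pi> w)"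
        by (intro arg_cong[where f = sum_list] map_cong refl dterm_add)
          (use * w in \<open>simp_all add: blocks_lists[OF _ *(4)] del: in_lists_conv_set\<close>)
      then show "rinner (Dgf x ((a \<oplus>\<^bsub>E\<^esub> b) # vs)) w = rinner (Dgf x (a # vs) \<oplus>\<^bsub>L\<^esub> Dgf x (b # vs)) w"
        using * w Dgf_closed by (simp add: rinner_Dgf_Cons rinner_add_left sum_list_addf)
    qed (use * Dgf_closed in auto)
    then show "Dgf x ((a \<oplus>\<^bsub>E\<^esub> b) # vs) = Dgf x (a # vs) \<oplus>\<^bsub>realify L\<^esub> Dgf x (b # vs)" by simp
  next
    fix x a c vs assume *: "x \<in> U" "a \<in> carrier E" "vs \<in> lists (carrier E)"
    have "Dgf x ((c \<odot>\<^bsub>E\<^esub> a) # vs) = complex_of_real c \<odot>\<^bsub>L\<^esub> Dgf x (a # vs)"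
    proof (rule eq_by_rinner)
      fix w assume w: "w \<in> carrier L"
      have "(\<Sum>\<pi>\<leftarrow>blocks vs. dterm x (c \<odot>\<^bsub>E\<^esub> a) [] \<pi> w) = (\<Sum>\<pi>\<leftarrow>blocks vs. c * dterm x a [] \<pi> w)"
        by (intro arg_cong[where f = sum_list] map_cong refl dterm_smult)
          (use * w in \<open>simp_all add: blocks_lists[OF _ *(3)] del: in_lists_conv_set\<close>)
      then show "rinner (Dgf x ((c \<odot>\<^bsub>E\<^esub> a) # vs)) w = rinner (complex_of_real c \<odot>\<^bsub>L\<^esub> Dgf x (a # vs)) w"
        using * w Dgf_closed by (simp add: rinner_Dgf_Cons rinner_smult_left sum_list_const_mult)
    qed (use * Dgf_closed in auto)
    then show "Dgf x ((c \<odot>\<^bsub>E\<^esub> a) # vs) = c \<odot>\<^bsub>realify L\<^esub> Dgf x (a # vs)" by simp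
  next
    fix k x assume x: "x \<in> U"
    have "\<forall>ls. \<exists>C>0. \<forall>(ws, \<pi>, w)\<in>args 0 ls. \<bar>fterm x ws \<pi> w\<bar> \<le> C * weight ws \<pi> w"
      using fterm_bound[OF x] by blast
    then obtain C where C: "\<And>ls. C ls > 0" and le: "\<And>ls ws \<pi> w. (ws, \<pi>, w) \<in> args 0 ls \<Longrightarrow> \<bar>fterm x ws \<pi> w\<bar> \<le> C ls * weight ws \<pi> w"
      by (metis (no_types, lifting) case_prodD)
    define c where "c = (\<Sum>ls\<in>shapes k. C ls)"
    have c: "C ls \<le> c" if "ls \<in> shapes k" for ls
      unfolding c_def using that C finite_shapes by (intro member_le_sum) (auto simp: less_imp_le)
    have c0: "c \<ge> 0" unfolding c_def using C by (intro sum_nonneg) (auto simp: less_imp_le)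
    define n where "n = length (blocks (replicate k ()))"
    have "nrm (realify L) (Dgf x vs) \<le> real n * c * prodnrm E vs" if vs: "vs \<in> lists (carrier E)" "length vs = k" for vs
    proof (rule nrm_leI)
      fix w assume w: "w \<in> carrier L"
      have "\<bar>\<Sum>\<pi>\<leftarrow>blocks vs. fterm x [] \<pi> w\<bar> \<le> real (length (blocks vs)) * (c * (prodnrm E vs * nrm (realify L) w))"
      proof (rule abs_sum_list_le)
        fix \<pi> assume \<pi>: "\<pi> \<in> set (blocks vs)"
        note a = blocks_args[OF \<pi> vs(1) w]
        have "\<bar>fterm x [] \<pi> w\<bar> \<le> C (map length \<pi>) * weight [] \<pi> w" by (rule le[OF a(1)])
        also have "\<dots> \<le> c * weight [] \<pi> w"
          using c blocks_shape[OF \<pi>] vs weight_nonneg[OF a(1)] by (intro mult_right_mono) auto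
        finally show "\<bar>fterm x [] \<pi> w\<bar> \<le> c * (prodnrm E vs * nrm (realify L) w)" unfolding a(2) .
      qed
      then show "\<bar>rinner (Dgf x vs) w\<bar> \<le> real n * c * prodnrm E vs * nrm (realify L) w"
        using rinner_Dgf[OF x vs(1) w] length_blocks[of vs] vs(2) by (simp add: n_def mult.assoc)
    qed (use vs x Dgf_closed c0 in auto)
    then show "\<exists>C. \<forall>vs\<in>lists (carrier E). length vs = k \<longrightarrow> nrm (realify L) (Dgf x vs) \<le> C * prodnrm E vs" by blast
  next
    fix k x and \<epsilon> :: real assume x: "x \<in> U" and \<epsilon>: "\<epsilon> > 0"
    define n where "n = length (blocks (replicate k ()))"
    define \<epsilon>' where "\<epsilon>' = \<epsilon> / (real n + 1)"
    have \<epsilon>': "\<epsilon>' > 0" using \<epsilon> by (simp add: \<epsilon>'_def)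
    have n\<epsilon>': "real n * \<epsilon>' \<le> \<epsilon>" using \<epsilon> by (simp add: \<epsilon>'_def field_simps)
    have "\<forall>\<^sub>F h in small E. \<forall>ls\<in>shapes k. fterm_estimate x 0 ls \<epsilon>' h"
      using finite_shapes fterm_deriv[OF x \<epsilon>'] by (intro eventually_ball_finite) auto
    then show "\<forall>\<^sub>F h in small E. x \<oplus>\<^bsub>E\<^esub> h \<in> U \<longrightarrow> (\<forall>vs\<in>lists (carrier E). length vs = k \<longrightarrow>
        nrm (realify L) ((Dgf (x \<oplus>\<^bsub>E\<^esub> h) vs \<ominus>\<^bsub>realify L\<^esub> Dgf x vs) \<ominus>\<^bsub>realify L\<^esub> Dgf x (h # vs)) \<le> \<epsilon> * nrm E h * prodnrm E vs)"
      using eventually_small_carrier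
    proof eventually_elim
      case (elim h)
      show ?case
      proof (intro impI ballI)
        fix vs assume xh: "x \<oplus>\<^bsub>E\<^esub> h \<in> U" and vs: "vs \<in> lists (carrier E)" "length vs = k"
        have [simp]: "Dgf (x \<oplus>\<^bsub>E\<^esub> h) vs \<in> carrier L" "Dgf x vs \<in> carrier L" "Dgf x (h # vs) \<in> carrier L"
          using xh x vs elim by (auto intro!: Dgf_closed)
        have "nrm (realify L) ((Dgf (x \<oplus>\<^bsub>E\<^esub> h) vs \<ominus>\<^bsub>L\<^esub> Dgf x vs) \<ominus>\<^bsub>L\<^esub> Dgf x (h # vs)) \<le> \<epsilon> * nrm E h * prodnrm E vs"
        proof (rule nrm_leI)
          show "0 \<le> \<epsilon> * nrm E h * prodnrm E vs"
            using \<epsilon> elim vs by (intro mult_nonneg_nonneg) auto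
          fix w assume w: "w \<in> carrier L"
          let ?d = "\<lambda>\<pi>. fterm (x \<oplus>\<^bsub>E\<^esub> h) [] \<pi> w - fterm x [] \<pi> w - dterm x h [] \<pi> w"
          have "rinner ((Dgf (x \<oplus>\<^bsub>E\<^esub> h) vs \<ominus>\<^bsub>L\<^esub> Dgf x vs) \<ominus>\<^bsub>L\<^esub> Dgf x (h # vs)) w = (\<Sum>\<pi>\<leftarrow>blocks vs. ?d \<pi>)"
            using w rinner_Dgf[OF x vs(1) w] rinner_Dgf[OF xh vs(1) w] rinner_Dgf_Cons[OF x _ vs(1) w, of h] elim
            by (simp add: rinner_diff_left sum_list_diff)
          also have "\<bar>\<dots>\<bar> \<le> real (length (blocks vs)) * (\<epsilon>' * nrm E h * (prodnrm E vs * nrm (realify L) w))"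
          proof (rule abs_sum_list_le)
            fix \<pi> assume \<pi>: "\<pi> \<in> set (blocks vs)"
            note a = blocks_args[OF \<pi> vs(1) w]
            have "fterm_estimate x 0 (map length \<pi>) \<epsilon>' h" using elim blocks_shape[OF \<pi>] vs by simp
            then have "\<bar>?d \<pi>\<bar> \<le> \<epsilon>' * nrm E h * weight [] \<pi> w"
              using a(1) unfolding fterm_estimate_def by blast
            then show "\<bar>?d \<pi>\<bar> \<le> \<epsilon>' * nrm E h * (prodnrm E vs * nrm (realify L) w)" unfolding a(2) .
          qed
          also have "\<dots> = (real n * \<epsilon>') * (nrm E h * (prodnrm E vs * nrm (realify L) w))"
            using length_blocks[of vs] vs by (simp add: n_def)
          also have "\<dots> \<le> \<epsilon> * (nrm E h * (prodnrm E vs * nrm (realify L) w))"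
            using n\<epsilon>' elim vs w by (intro mult_right_mono mult_nonneg_nonneg A.E.prodnrm_nonneg nrm_realify_nonneg) auto
          finally show "\<bar>rinner ((Dgf (x \<oplus>\<^bsub>E\<^esub> h) vs \<ominus>\<^bsub>L\<^esub> Dgf x vs) \<ominus>\<^bsub>L\<^esub> Dgf x (h # vs)) w\<bar> \<le> \<epsilon> * nrm E h * prodnrm E vs * nrm (realify L) w"
            by (simp add: mult.assoc)
        qed auto
        then show "nrm (realify L) ((Dgf (x \<oplus>\<^bsub>E\<^esub> h) vs \<ominus>\<^bsub>realify L\<^esub> Dgf x vs) \<ominus>\<^bsub>realify L\<^esub> Dgf x (h # vs)) \<le> \<epsilon> * nrm E h * prodnrm E vs"
          by simp
      qed
    qed
  qed
qed

end

text \<open>The target is a Hilbert space, so that sums of terms can be handled as sums of real numbers; the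
  space in the middle is arbitrary, as a model space of a Banach manifold is.\<close>

theorem smooth_on_comp:
  assumes E: "Banach E" and F: "Banach F" and L: "hilbert L"
    and f: "smooth_on E F U f" and g: "smooth_on F (realify L) V g" and fUV: "\<And>x. x \<in> U \<Longrightarrow> f x \<in> V"
  shows "smooth_on E (realify L) U (\<lambda>x. g (f x))"
proof -
  obtain Df where U: "openin (vtop E) U" and Df0: "\<And>x. x \<in> U \<Longrightarrow> Df x [] = f x" and Df: "smooth_derivs E F U Df"
    using smooth_onE[OF f] by blast
  obtain Dg where V: "openin (vtop F) V" and Dg0: "\<And>x. x \<in> V \<Longrightarrow> Dg x [] = g x" and Dg: "smooth_derivs F (realify L) V Dg"
    using smooth_onE[OF g] by blast
  interpret L: hilbert L by fact
  interpret composition E F L U V Df Dg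
    using E F L U V Df Dg L.Banach_realify fUV Df0
    by (simp add: composition_def composition_axioms_def Banach_maps_def Banach_maps_axioms_def)
  have "Banach_maps E (realify L) U"
    using E L.Banach_realify U by (simp add: Banach_maps_def Banach_maps_axioms_def)
  then show ?thesis
  proof (rule Banach_maps.smooth_onI[OF _ smooth_derivs_Dgf])
    fix x assume x: "x \<in> U"
    have "Dg (f x) [] \<in> carrier L" using fUV[OF x] by (intro Dg_closed) auto
    then show "Dgf x [] = g (f x)"
      using x fUV[OF x] by (simp add: Dgf_def list_sum_def Df0 Dg0)
  qed
qed

section \<open>Strongly smooth families of operators\<close>

text \<open>The principle is stated for a family of seminorms, which are norms of operators in the applications.
  By Baire one of the closed sets on which all members are bounded by \<open>m\<close> contains a ball.\<close>

theorem (in Banach) uniform_boundedness: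
  fixes p :: "'i \<Rightarrow> 'a \<Rightarrow> real"
  assumes sub: "\<And>i x y. i \<in> S \<Longrightarrow> x \<in> carrier E \<Longrightarrow> y \<in> carrier E \<Longrightarrow> p i (x \<oplus> y) \<le> p i x + p i y"
    and hom: "\<And>i c x. i \<in> S \<Longrightarrow> x \<in> carrier E \<Longrightarrow> p i (c \<odot> x) = \<bar>c\<bar> * p i x"
    and bounded: "\<And>i. i \<in> S \<Longrightarrow> \<exists>C. \<forall>x\<in>carrier E. p i x \<le> C * nrm E x"
    and pointwise: "\<And>x. x \<in> carrier E \<Longrightarrow> \<exists>B. \<forall>i\<in>S. p i x \<le> B"
  shows "\<exists>C>0. \<forall>i\<in>S. \<forall>x\<in>carrier E. p i x \<le> C * nrm E x"
proof -
  define T where "T m = {x \<in> carrier E. \<forall>i\<in>S. p i x \<le> real m}" for m :: nat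
  have neg: "p i (\<ominus> x) = p i x" if "i \<in> S" "x \<in> carrier E" for i x
    using hom[OF that, of "-1"] that by (simp add: minus_eq_smult)
  have closed: "closedin (vtop E) (T m)" for m
    unfolding closedin_def
  proof (intro conjI)
    show "T m \<subseteq> topspace (vtop E)" by (auto simp: T_def)
    show "openin (vtop E) (topspace (vtop E) - T m)"
      unfolding openin_vtop
    proof (intro conjI ballI)
      fix x assume x: "x \<in> topspace (vtop E) - T m"
      then have xE: "x \<in> carrier E" by simp
      from x obtain i where i: "i \<in> S" "p i x > real m" by (auto simp: T_def not_le)
      obtain C where C: "\<And>h. h \<in> carrier E \<Longrightarrow> p i h \<le> C * nrm E h" using bounded[OF i(1)] by blast
      define \<delta> where "\<delta> = (p i x - real m) / (\<bar>C\<bar> + 1)"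
      have "\<delta> > 0" using i by (simp add: \<delta>_def)
      moreover have "x \<oplus> h \<in> topspace (vtop E) - T m" if h: "h \<in> carrier E" "nrm E h < \<delta>" for h
      proof -
        have "p i x = p i ((x \<oplus> h) \<oplus> \<ominus> h)"
          using xE h by (simp add: a_assoc r_neg)
        also have "\<dots> \<le> p i (x \<oplus> h) + p i h"
          using sub[OF i(1), of "x \<oplus> h" "\<ominus> h"] neg[OF i(1) h(1)] xE h by simp
        finally have 1: "p i x \<le> p i (x \<oplus> h) + p i h" .
        have "p i h \<le> C * nrm E h" by (rule C[OF h(1)])
        also have "\<dots> \<le> (\<bar>C\<bar> + 1) * nrm E h" using h by (intro mult_right_mono) auto
        also have "\<dots> < (\<bar>C\<bar> + 1) * \<delta>" using h by (intro mult_strict_left_mono) auto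
        also have "\<dots> = p i x - real m" by (simp add: \<delta>_def)
        finally have "p i (x \<oplus> h) > real m" using 1 by simp
        then show ?thesis using i xE h by (auto simp: T_def not_le)
      qed
      ultimately show "\<exists>\<delta>>0. \<forall>h\<in>carrier E. nrm E h < \<delta> \<longrightarrow> x \<oplus> h \<in> topspace (vtop E) - T m" by blast
    qed auto
  qed
  have "(\<Union>m. T m) = carrier E"
  proof (intro equalityI subsetI)
    fix x assume x: "x \<in> carrier E"
    obtain B where B: "\<And>i. i \<in> S \<Longrightarrow> p i x \<le> B" using pointwise[OF x] by blast
    obtain m where "B \<le> real m" using real_arch_simple by blast
    then have "x \<in> T m" using x B by (force simp: T_def)
    then show "x \<in> (\<Union>m. T m)" by blast
  qed (auto simp: T_def)
  have "\<exists>m. vtop E interior_of T m \<noteq> {}"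
  proof (rule ccontr)
    assume "\<not> ?thesis"
    then have "\<And>A. A \<in> range T \<Longrightarrow> closedin metric.mtopology A \<and> metric.mtopology interior_of A = {}"
      using closed by (auto simp: vtop_def)
    from metric.metric_Baire_category_alt[OF mcomplete _ this]
    have "metric.mtopology interior_of \<Union>(range T) = {}" by simp
    moreover have "metric.mtopology interior_of (carrier E) = carrier E"
      using interior_of_topspace[of metric.mtopology] by simp
    ultimately show False using \<open>(\<Union>m. T m) = carrier E\<close> zero_closed by auto
  qed
  then obtain m x0 where "x0 \<in> vtop E interior_of T m" by blast
  then obtain O' where O': "openin (vtop E) O'" "x0 \<in> O'" "O' \<subseteq> T m" by (auto simp: interior_of_def)
  then obtain r where r: "r > 0" "\<And>h. h \<in> carrier E \<Longrightarrow> nrm E h < r \<Longrightarrow> x0 \<oplus> h \<in> O'"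
    unfolding openin_vtop by blast
  have x0: "x0 \<in> carrier E" "x0 \<in> T m" using O' by (auto simp: T_def)
  have "p i x \<le> (4 * real m / r + 1) * nrm E x" if i: "i \<in> S" and x: "x \<in> carrier E" for i x
  proof (cases "x = \<zero>")
    case True
    then show ?thesis using hom[OF i x, of 0] x by simp
  next
    case False
    then have pos: "nrm E x > 0" using x nrm_eq_0[OF x] nrm_nonneg[OF x] by linarith
    \<comment> \<open>The vector \<open>t x\<close> has half the radius of the ball around \<open>x0\<close>, and \<open>t x = (x0 + t x) - x0\<close>.\<close>
    define t where "t = r / (2 * nrm E x)"
    have t: "t > 0" using pos r by (simp add: t_def)
    have h: "t \<odot> x \<in> carrier E" "nrm E (t \<odot> x) < r" using x pos r t by (simp_all add: t_def)
    have "x0 \<oplus> t \<odot> x \<in> T m" using r(2)[OF h] O' by blast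
    then have "p i (x0 \<oplus> t \<odot> x) \<le> real m" using i by (simp add: T_def)
    moreover have "p i x0 \<le> real m" using x0 i by (simp add: T_def)
    moreover have "p i (t \<odot> x) \<le> p i (x0 \<oplus> t \<odot> x) + p i x0"
    proof -
      have "t \<odot> x = (x0 \<oplus> t \<odot> x) \<oplus> \<ominus> x0"
        using add_diff_cancel_left[OF x0(1) h(1)] by (simp add: minus_eq)
      then show ?thesis
        using sub[OF i, of "x0 \<oplus> t \<odot> x" "\<ominus> x0"] neg[OF i x0(1)] x0 h by simp
    qed
    ultimately have "t * p i x \<le> 2 * real m" using hom[OF i x, of t] t by simp
    then have "p i x \<le> 2 * real m / t" using t by (simp add: field_simps)
    also have "\<dots> = 4 * real m / r * nrm E x" using pos r by (simp add: t_def field_simps)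
    also have "\<dots> \<le> (4 * real m / r + 1) * nrm E x" using pos by (simp add: distrib_right)
    finally show ?thesis .
  qed
  moreover have "4 * real m / r + 1 > 0" using r by (simp add: add_nonneg_pos)
  ultimately show ?thesis by blast
qed

lemma eventually_bounded_imp_bounded:
  fixes s :: "nat \<Rightarrow> real"
  assumes "\<forall>\<^sub>F j in sequentially. s j \<le> c"
  shows "\<exists>B. \<forall>j. s j \<le> B"
proof -
  obtain J where J: "\<And>j. j \<ge> J \<Longrightarrow> s j \<le> c" using assms unfolding eventually_sequentially by blast
  have "s j \<le> Max (insert c (s ` {..<J}))" for j
  proof (cases "j < J")
    case True
    then show ?thesis by (intro Max_ge) auto
  next
    case False
    then have "s j \<le> c" using J by simp
    also have "\<dots> \<le> Max (insert c (s ` {..<J}))" by (intro Max_ge) auto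
    finally show ?thesis .
  qed
  then show ?thesis by blast
qed

text \<open>The operators \<open>A y\<close> are strongly smooth in \<open>y\<close>: for each \<open>k\<close> the derivatives of \<open>y \<mapsto> A y k\<close> are \<open>D k\<close>.
  The aim is smoothness of \<open>(y, k) \<mapsto> A y k\<close>.\<close>

locale evaluation = Q: Banach Q + B: Banach_maps E "realify L" U + hilbert L
  for Q :: "'q nspace" and E :: "'e nspace" and L :: "'l hspace" and U :: "'e set" +
  fixes A :: "'e \<Rightarrow> 'q \<Rightarrow> 'l" and D :: "'q \<Rightarrow> 'e \<Rightarrow> 'e list \<Rightarrow> 'l"
  assumes A: "y \<in> U \<Longrightarrow> bounded_lin Q (realify L) (A y)"
    and D: "k \<in> carrier Q \<Longrightarrow> smooth_derivs E (realify L) U (D k)"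
    and D_Nil: "k \<in> carrier Q \<Longrightarrow> y \<in> U \<Longrightarrow> D k y [] = A y k"
begin

lemma D_closed: "k \<in> carrier Q \<Longrightarrow> y \<in> U \<Longrightarrow> vs \<in> lists (carrier E) \<Longrightarrow> D k y vs \<in> carrier L"
  using smooth_derivs_closed[OF D] by simp

text \<open>Linearity in \<open>k\<close> passes to the derivatives because they are unique.\<close>

lemma D_add:
  "y \<in> U \<Longrightarrow> k \<in> carrier Q \<Longrightarrow> l \<in> carrier Q \<Longrightarrow> vs \<in> lists (carrier E) \<Longrightarrow>
    D (k \<oplus>\<^bsub>Q\<^esub> l) y vs = D k y vs \<oplus>\<^bsub>L\<^esub> D l y vs"
proof (induction vs arbitrary: y)
  case Nil
  then show ?case using bounded_linD(2)[OF A] by (simp add: D_Nil)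
next
  case (Cons h vs)
  then have y: "y \<in> U" and h: "h \<in> carrier E" and vs: "vs \<in> lists (carrier E)"
    and k: "k \<in> carrier Q" and l: "l \<in> carrier Q" by simp_all
  show ?case
  proof (rule B.dir_deriv_unique)
    show "dir_deriv E (realify L) (\<lambda>y. D (k \<oplus>\<^bsub>Q\<^esub> l) y vs) y h (D (k \<oplus>\<^bsub>Q\<^esub> l) y (h # vs))"
      using Cons by (intro B.smooth_derivs_dir[OF D]) auto
    have "dir_deriv E (realify L) (\<lambda>y. D k y vs \<oplus>\<^bsub>realify L\<^esub> D l y vs) y h (D k y (h # vs) \<oplus>\<^bsub>realify L\<^esub> D l y (h # vs))"
      by (rule B.dir_deriv_add[OF B.smooth_derivs_dir[OF D[OF k] y h vs] B.smooth_derivs_dir[OF D[OF l] y h vs]])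
        (use y h vs k l D_closed in \<open>simp_all del: in_lists_conv_set\<close>)
    then have "dir_deriv E (realify L) (\<lambda>y. D (k \<oplus>\<^bsub>Q\<^esub> l) y vs) y h (D k y (h # vs) \<oplus>\<^bsub>realify L\<^esub> D l y (h # vs))"
      by (rule B.dir_deriv_cong) (use Cons.IH k l vs y h in simp_all)
    then show "dir_deriv E (realify L) (\<lambda>y. D (k \<oplus>\<^bsub>Q\<^esub> l) y vs) y h (D k y (h # vs) \<oplus>\<^bsub>L\<^esub> D l y (h # vs))"
      by simp
  qed (use Cons.prems D_closed in auto)
qed

lemma D_smult:
  "y \<in> U \<Longrightarrow> k \<in> carrier Q \<Longrightarrow> vs \<in> lists (carrier E) \<Longrightarrow>
    D (c \<odot>\<^bsub>Q\<^esub> k) y vs = complex_of_real c \<odot>\<^bsub>L\<^esub> D k y vs"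
proof (induction vs arbitrary: y)
  case Nil
  then show ?case using bounded_linD(3)[OF A] by (simp add: D_Nil)
next
  case (Cons h vs)
  then have y: "y \<in> U" and h: "h \<in> carrier E" and vs: "vs \<in> lists (carrier E)"
    and k: "k \<in> carrier Q" by simp_all
  show ?case
  proof (rule B.dir_deriv_unique)
    show "dir_deriv E (realify L) (\<lambda>y. D (c \<odot>\<^bsub>Q\<^esub> k) y vs) y h (D (c \<odot>\<^bsub>Q\<^esub> k) y (h # vs))"
      using Cons by (intro B.smooth_derivs_dir[OF D]) auto
    have "dir_deriv E (realify L) (\<lambda>y. c \<odot>\<^bsub>realify L\<^esub> D k y vs) y h (c \<odot>\<^bsub>realify L\<^esub> D k y (h # vs))"
      by (rule B.dir_deriv_smult[OF B.smooth_derivs_dir[OF D[OF k] y h vs]])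
        (use y h vs k D_closed in \<open>simp_all del: in_lists_conv_set\<close>)
    then have "dir_deriv E (realify L) (\<lambda>y. D (c \<odot>\<^bsub>Q\<^esub> k) y vs) y h (c \<odot>\<^bsub>realify L\<^esub> D k y (h # vs))"
      by (rule B.dir_deriv_cong) (use Cons.IH k vs y h in simp_all)
    then show "dir_deriv E (realify L) (\<lambda>y. D (c \<odot>\<^bsub>Q\<^esub> k) y vs) y h (complex_of_real c \<odot>\<^bsub>L\<^esub> D k y (h # vs))"
      by simp
  qed (use Cons.prems D_closed in auto)
qed

lemma nrm_D_add:
  assumes "y \<in> U" "k \<in> carrier Q" "l \<in> carrier Q" "vs \<in> lists (carrier E)"
  shows "nrm (realify L) (D (k \<oplus>\<^bsub>Q\<^esub> l) y vs) \<le> nrm (realify L) (D k y vs) + nrm (realify L) (D l y vs)"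
  using B.F.nrm_triangle[of "D k y vs" "D l y vs"] D_closed assms by (simp add: D_add)

lemma nrm_D_smult:
  assumes "y \<in> U" "k \<in> carrier Q" "vs \<in> lists (carrier E)"
  shows "nrm (realify L) (D (c \<odot>\<^bsub>Q\<^esub> k) y vs) = \<bar>c\<bar> * nrm (realify L) (D k y vs)"
  using B.F.nrm_smult[of "D k y vs" c] D_closed assms by (simp add: D_smult)

text \<open>A derivative is a pointwise limit of difference quotients, so it inherits boundedness in \<open>k\<close>
  from lower orders by the uniform boundedness principle.\<close>

lemma D_bounded:
  "y \<in> U \<Longrightarrow> vs \<in> lists (carrier E) \<Longrightarrow>
    \<exists>C. \<forall>k\<in>carrier Q. nrm (realify L) (D k y vs) \<le> C * nrm Q k"
proof (induction vs arbitrary: y)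
  case Nil
  then show ?case using A[OF Nil(1)] by (auto simp: D_Nil bounded_lin_def)
next
  case (Cons h vs)
  have y: "y \<in> U" and h: "h \<in> carrier E" and vs: "vs \<in> lists (carrier E)" using Cons.prems by simp_all
  obtain b where b: "b > 0" "\<And>t. 0 < t \<Longrightarrow> t < b \<Longrightarrow> y \<oplus>\<^bsub>E\<^esub> t \<odot>\<^bsub>E\<^esub> h \<in> U"
    using B.eventually_in_U[OF y h] unfolding eventually_at_right_field by auto
  define t where "t j = b / 2 * inverse (real (Suc j))" for j
  have t: "t j > 0" "t j < b" for j
  proof -
    have "b / 2 * inverse (real (Suc j)) \<le> b / 2 * 1"
      using b by (intro mult_left_mono) (auto simp: field_simps)
    then show "t j > 0" "t j < b" using b by (auto simp: t_def)
  qed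
  have "t \<longlonglongrightarrow> b / 2 * 0"
    unfolding t_def by (intro tendsto_mult_left LIMSEQ_inverse_real_of_nat)
  then have t_lim: "filterlim t (at_right 0) sequentially"
    using t by (intro tendsto_imp_filterlim_at_right) auto
  have yt: "y \<oplus>\<^bsub>E\<^esub> t j \<odot>\<^bsub>E\<^esub> h \<in> U" for j using b t by blast
  define incr where "incr = (\<lambda>j k. D k (y \<oplus>\<^bsub>E\<^esub> t j \<odot>\<^bsub>E\<^esub> h) vs \<ominus>\<^bsub>L\<^esub> D k y vs)"
  define p where "p j k = nrm (realify L) (incr j k) / t j" for j k
  have incr: "incr j k \<in> carrier L" if "k \<in> carrier Q" for j k
    using D_closed that y yt vs by (simp add: incr_def)
  have near: "\<forall>\<^sub>F j in sequentially. \<bar>p j k - nrm (realify L) (D k y (h # vs))\<bar> \<le> \<epsilon>"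
    if k: "k \<in> carrier Q" and \<epsilon>: "\<epsilon> > 0" for k \<epsilon>
  proof -
    let ?d = "D k y (h # vs)"
    have d: "?d \<in> carrier L" using D_closed[OF k y Cons.prems(2)] .
    have "dir_deriv E (realify L) (\<lambda>y. D k y vs) y h ?d"
      by (rule B.smooth_derivs_dir[OF D[OF k] y h vs])
    then have "\<forall>\<^sub>F s in at_right 0. nrm (realify L) ((D k (y \<oplus>\<^bsub>E\<^esub> s \<odot>\<^bsub>E\<^esub> h) vs \<ominus>\<^bsub>realify L\<^esub> D k y vs)
        \<ominus>\<^bsub>realify L\<^esub> s \<odot>\<^bsub>realify L\<^esub> ?d) \<le> \<epsilon> * s"
      using \<epsilon> unfolding dir_deriv_def by blast
    then have "\<forall>\<^sub>F j in sequentially. nrm (realify L) (incr j k \<ominus>\<^bsub>realify L\<^esub> t j \<odot>\<^bsub>realify L\<^esub> ?d) \<le> \<epsilon> * t j"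
      using t_lim unfolding filterlim_iff incr_def realify_minus by blast
    then show ?thesis
    proof eventually_elim
      case (elim j)
      have td: "t j \<odot>\<^bsub>realify L\<^esub> ?d \<in> carrier (realify L)" "incr j k \<in> carrier (realify L)" using d incr[OF k] by auto
      have "\<bar>nrm (realify L) (incr j k) - t j * nrm (realify L) ?d\<bar> \<le> \<epsilon> * t j"
        using elim B.F.nrm_le_add_diff[OF td(2,1)] B.F.nrm_le_add_diff[OF td] B.F.nrm_diff_commute[OF td]
          B.F.nrm_smult[of ?d "t j"] d t[of j] by (simp del: realify_simps(4))
      moreover have "nrm (realify L) (incr j k) - t j * nrm (realify L) ?d = t j * (p j k - nrm (realify L) ?d)"
        using t[of j] by (simp add: p_def field_simps)
      ultimately show ?case using t[of j] by (simp add: abs_mult mult.commute)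
    qed
  qed
  have "\<exists>C>0. \<forall>j\<in>UNIV. \<forall>k\<in>carrier Q. p j k \<le> C * nrm Q k"
  proof (rule Q.uniform_boundedness)
    fix j k l assume k: "k \<in> carrier Q" and l: "l \<in> carrier Q"
    have "incr j (k \<oplus>\<^bsub>Q\<^esub> l) = incr j k \<oplus>\<^bsub>realify L\<^esub> incr j l"
      using B.F.diff_add_rearrange D_closed k l y yt vs by (simp add: incr_def D_add)
    then have "nrm (realify L) (incr j (k \<oplus>\<^bsub>Q\<^esub> l)) \<le> nrm (realify L) (incr j k) + nrm (realify L) (incr j l)"
      using B.F.nrm_triangle incr k l by simp
    then show "p j (k \<oplus>\<^bsub>Q\<^esub> l) \<le> p j k + p j l"
      using t[of j] by (simp add: p_def divide_right_mono flip: add_divide_distrib)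
  next
    fix j c k assume k: "k \<in> carrier Q"
    have "incr j (c \<odot>\<^bsub>Q\<^esub> k) = c \<odot>\<^bsub>realify L\<^esub> incr j k"
      using B.F.smult_diff_right D_closed k y yt vs by (simp add: incr_def D_smult)
    then show "p j (c \<odot>\<^bsub>Q\<^esub> k) = \<bar>c\<bar> * p j k"
      using B.F.nrm_smult incr k by (simp add: p_def)
  next
    fix j
    obtain C1 where C1: "\<And>k. k \<in> carrier Q \<Longrightarrow> nrm (realify L) (D k (y \<oplus>\<^bsub>E\<^esub> t j \<odot>\<^bsub>E\<^esub> h) vs) \<le> C1 * nrm Q k"
      using Cons.IH[OF yt vs] by blast
    obtain C2 where C2: "\<And>k. k \<in> carrier Q \<Longrightarrow> nrm (realify L) (D k y vs) \<le> C2 * nrm Q k"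
      using Cons.IH[OF y vs] by blast
    have "p j k \<le> (C1 + C2) / t j * nrm Q k" if k: "k \<in> carrier Q" for k
    proof -
      have "nrm (realify L) (incr j k) \<le> C1 * nrm Q k + C2 * nrm Q k"
        using B.F.nrm_diff_triangle[of "D k (y \<oplus>\<^bsub>E\<^esub> t j \<odot>\<^bsub>E\<^esub> h) vs" "D k y vs"] C1[OF k] C2[OF k] D_closed k y yt vs
        by (simp add: incr_def)
      then show ?thesis using t[of j] by (simp add: p_def field_simps)
    qed
    then show "\<exists>C. \<forall>k\<in>carrier Q. p j k \<le> C * nrm Q k" by blast
  next
    fix k assume k: "k \<in> carrier Q"
    have "\<forall>\<^sub>F j in sequentially. p j k \<le> nrm (realify L) (D k y (h # vs)) + 1"
      using near[OF k zero_less_one] by eventually_elim linarith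
    then show "\<exists>B. \<forall>j\<in>UNIV. p j k \<le> B" using eventually_bounded_imp_bounded[of "\<lambda>j. p j k"] by blast
  qed
  then obtain C where C: "\<And>j k. k \<in> carrier Q \<Longrightarrow> p j k \<le> C * nrm Q k" by blast
  have "nrm (realify L) (D k y (h # vs)) \<le> C * nrm Q k" if k: "k \<in> carrier Q" for k
  proof (rule field_le_epsilon)
    fix \<epsilon> :: real assume "\<epsilon> > 0"
    from near[OF k this] obtain j where "\<bar>p j k - nrm (realify L) (D k y (h # vs))\<bar> \<le> \<epsilon>"
      using eventually_happens'[OF sequentially_bot] by blast
    then show "nrm (realify L) (D k y (h # vs)) \<le> C * nrm Q k + \<epsilon>" using C[OF k, of j] by linarith
  qed
  then show ?case by blast
qed

text \<open>Otherwise there are \<open>h j\<close> tending to zero and directions \<open>vs j\<close> for which the operators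
  \<open>k \<mapsto> D k (y + h j) (vs j)\<close>, divided by the norms of the directions, are unbounded. But each \<open>D k\<close> is locally
  bounded at \<open>y\<close>, so these operators are bounded pointwise and hence uniformly.\<close>

lemma D_local_bound:
  assumes y: "y \<in> U"
  shows "\<exists>C>0. \<forall>\<^sub>F h in small E. y \<oplus>\<^bsub>E\<^esub> h \<in> U \<longrightarrow> (\<forall>vs\<in>lists (carrier E). length vs = m \<longrightarrow>
      (\<forall>k\<in>carrier Q. nrm (realify L) (D k (y \<oplus>\<^bsub>E\<^esub> h) vs) \<le> C * prodnrm E vs * nrm Q k))"
proof (rule ccontr)
  assume contr: "\<not> ?thesis"
  define bad where "bad C h vs k \<longleftrightarrow> y \<oplus>\<^bsub>E\<^esub> h \<in> U \<and> vs \<in> lists (carrier E) \<and> length vs = m \<and> k \<in> carrier Q \<and>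
    nrm (realify L) (D k (y \<oplus>\<^bsub>E\<^esub> h) vs) > C * prodnrm E vs * nrm Q k" for C h vs k
  have "\<exists>h vs k. h \<in> carrier E \<and> nrm E h < \<delta> \<and> bad C h vs k" if "C > 0" "\<delta> > 0" for C \<delta>
  proof (rule ccontr)
    assume none: "\<not> ?thesis"
    have "\<forall>\<^sub>F h in small E. y \<oplus>\<^bsub>E\<^esub> h \<in> U \<longrightarrow> (\<forall>vs\<in>lists (carrier E). length vs = m \<longrightarrow>
      (\<forall>k\<in>carrier Q. nrm (realify L) (D k (y \<oplus>\<^bsub>E\<^esub> h) vs) \<le> C * prodnrm E vs * nrm Q k))"
      unfolding eventually_small
    proof (intro exI[of _ \<delta>] conjI ballI impI)
      fix h vs k assume h: "h \<in> carrier E" "nrm E h < \<delta>" "y \<oplus>\<^bsub>E\<^esub> h \<in> U"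
        and vs: "vs \<in> lists (carrier E)" "length vs = m" and k: "k \<in> carrier Q"
      have "\<not> bad C h vs k" using none h by blast
      then show "nrm (realify L) (D k (y \<oplus>\<^bsub>E\<^esub> h) vs) \<le> C * prodnrm E vs * nrm Q k"
        using h vs k by (simp add: bad_def del: in_lists_conv_set)
    qed (rule that)
    then show False using contr \<open>C > 0\<close> by blast
  qed
  then have "\<forall>j. \<exists>h vs k. h \<in> carrier E \<and> nrm E h < inverse (real (Suc j)) \<and> bad (real (Suc j)) h vs k"
    by simp
  then obtain h vs k where h: "\<And>j. h j \<in> carrier E" "\<And>j. nrm E (h j) < inverse (real (Suc j))"
    and bad: "\<And>j. bad (real (Suc j)) (h j) (vs j) (k j)" by metis
  have yh: "y \<oplus>\<^bsub>E\<^esub> h j \<in> U" and vs: "vs j \<in> lists (carrier E)" "length (vs j) = m" and k: "k j \<in> carrier Q" for j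
    using bad[of j] unfolding bad_def by auto
  have pos: "prodnrm E (vs j) > 0" for j
  proof (rule ccontr)
    assume "\<not> ?thesis"
    then have 0: "prodnrm E (vs j) = 0" using B.E.prodnrm_nonneg[OF vs(1)[of j]] by linarith
    obtain C where "\<And>us. us \<in> lists (carrier E) \<Longrightarrow> length us = m \<Longrightarrow>
        nrm (realify L) (D (k j) (y \<oplus>\<^bsub>E\<^esub> h j) us) \<le> C * prodnrm E us"
      by (rule B.smooth_derivs_bound[OF D[OF k] yh, of m]) blast
    from this[OF vs(1)[of j] vs(2)[of j]] bad[of j] show False unfolding bad_def 0 by simp
  qed
  \<comment> \<open>The vectors are normalised by dividing by the product of their norms.\<close>
  define p where "p j x = nrm (realify L) (D x (y \<oplus>\<^bsub>E\<^esub> h j) (vs j)) / prodnrm E (vs j)" for j x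
  have "\<exists>C>0. \<forall>j\<in>UNIV. \<forall>x\<in>carrier Q. p j x \<le> C * nrm Q x"
  proof (rule Q.uniform_boundedness)
    fix j x z assume "x \<in> carrier Q" "z \<in> carrier Q"
    then show "p j (x \<oplus>\<^bsub>Q\<^esub> z) \<le> p j x + p j z"
      using nrm_D_add[OF yh _ _ vs(1)] pos[of j]
      by (simp add: p_def divide_right_mono flip: add_divide_distrib)
  next
    fix j c x assume "x \<in> carrier Q"
    then show "p j (c \<odot>\<^bsub>Q\<^esub> x) = \<bar>c\<bar> * p j x"
      using nrm_D_smult[OF yh _ vs(1)] by (simp add: p_def)
  next
    fix j
    obtain C where C: "\<And>x. x \<in> carrier Q \<Longrightarrow> nrm (realify L) (D x (y \<oplus>\<^bsub>E\<^esub> h j) (vs j)) \<le> C * nrm Q x"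
      using D_bounded[OF yh vs(1)] by blast
    have "p j x \<le> C / prodnrm E (vs j) * nrm Q x" if "x \<in> carrier Q" for x
      using C[OF that] pos[of j] by (simp add: p_def divide_right_mono)
    then show "\<exists>C. \<forall>x\<in>carrier Q. p j x \<le> C * nrm Q x" by blast
  next
    fix x assume x: "x \<in> carrier Q"
    obtain C where C: "\<forall>\<^sub>F h in small E. y \<oplus>\<^bsub>E\<^esub> h \<in> U \<longrightarrow> (\<forall>vs\<in>lists (carrier E). length vs = m \<longrightarrow>
        nrm (realify L) (D x (y \<oplus>\<^bsub>E\<^esub> h) vs) \<le> C * prodnrm E vs)"
      by (rule B.smooth_derivs_local_bound[OF D[OF x] y, of m]) blast
    then obtain \<delta> where \<delta>: "\<delta> > 0" "\<And>h vs. h \<in> carrier E \<Longrightarrow> nrm E h < \<delta> \<Longrightarrow> y \<oplus>\<^bsub>E\<^esub> h \<in> U \<Longrightarrow> vs \<in> lists (carrier E) \<Longrightarrow>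
        length vs = m \<Longrightarrow> nrm (realify L) (D x (y \<oplus>\<^bsub>E\<^esub> h) vs) \<le> C * prodnrm E vs"
      unfolding eventually_small by blast
    have "\<forall>\<^sub>F j in sequentially. inverse (real (Suc j)) < \<delta>"
      using order_tendstoD(2)[OF LIMSEQ_inverse_real_of_nat \<delta>(1)] .
    then have "\<forall>\<^sub>F j in sequentially. p j x \<le> C"
    proof eventually_elim
      case (elim j)
      have "nrm (realify L) (D x (y \<oplus>\<^bsub>E\<^esub> h j) (vs j)) \<le> C * prodnrm E (vs j)"
        using elim h(2)[of j] by (intro \<delta>(2) h yh vs) linarith
      then show ?case using pos[of j] by (simp add: p_def field_simps)
    qed
    then show "\<exists>B. \<forall>j\<in>UNIV. p j x \<le> B" using eventually_bounded_imp_bounded[of "\<lambda>j. p j x" C] by blast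
  qed
  then obtain C where C: "\<And>j x. x \<in> carrier Q \<Longrightarrow> p j x \<le> C * nrm Q x" by blast
  obtain j where "C \<le> real j" using real_arch_simple by blast
  have "p j (k j) \<le> C * nrm Q (k j)" by (rule C[OF k])
  also have "\<dots> \<le> real (Suc j) * nrm Q (k j)"
    using \<open>C \<le> real j\<close> k by (intro mult_right_mono) auto
  also have "\<dots> < p j (k j)"
    using bad[of j] pos[of j] by (simp add: bad_def p_def field_simps)
  finally show False by simp
qed

lemma rinner_D_curve:
  assumes k: "k \<in> carrier Q" and z: "y \<oplus>\<^bsub>E\<^esub> t \<odot>\<^bsub>E\<^esub> h \<in> U" and y: "y \<in> carrier E"
    and h: "h \<in> carrier E" and vs: "vs \<in> lists (carrier E)" and w: "w \<in> carrier L"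
  shows "((\<lambda>t. rinner (D k (y \<oplus>\<^bsub>E\<^esub> t \<odot>\<^bsub>E\<^esub> h) vs) w) has_real_derivative
      rinner (D k (y \<oplus>\<^bsub>E\<^esub> t \<odot>\<^bsub>E\<^esub> h) (h # vs)) w) (at t)"
  unfolding DERIV_def
proof (rule tendstoI)
  fix \<epsilon> :: real assume \<epsilon>: "\<epsilon> > 0"
  let ?z = "y \<oplus>\<^bsub>E\<^esub> t \<odot>\<^bsub>E\<^esub> h" and ?w = "nrm (realify L) w"
  define c where "c = nrm E h * (prodnrm E vs * ?w)"
  have c: "c \<ge> 0" unfolding c_def using h vs w by (intro mult_nonneg_nonneg B.E.prodnrm_nonneg nrm_realify_nonneg) auto
  define \<epsilon>' where "\<epsilon>' = \<epsilon> / (c + 1)"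
  have \<epsilon>': "\<epsilon>' > 0" "\<epsilon>' * c < \<epsilon>" using \<epsilon> c by (auto simp: \<epsilon>'_def field_simps)
  have "\<forall>\<^sub>F s in at 0. ?z \<oplus>\<^bsub>E\<^esub> s \<odot>\<^bsub>E\<^esub> h \<in> U \<longrightarrow> (\<forall>us\<in>lists (carrier E). length us = length vs \<longrightarrow>
      nrm (realify L) ((D k (?z \<oplus>\<^bsub>E\<^esub> s \<odot>\<^bsub>E\<^esub> h) us \<ominus>\<^bsub>realify L\<^esub> D k ?z us) \<ominus>\<^bsub>realify L\<^esub> D k ?z (s \<odot>\<^bsub>E\<^esub> h # us))
        \<le> \<epsilon>' * nrm E (s \<odot>\<^bsub>E\<^esub> h) * prodnrm E us)"
    using smooth_derivs_deriv[OF D[OF k] z \<epsilon>'(1), of "length vs"] B.E.filterlim_smult_small[OF h]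
    unfolding filterlim_iff by blast
  moreover have "\<forall>\<^sub>F s in at 0. ?z \<oplus>\<^bsub>E\<^esub> s \<odot>\<^bsub>E\<^esub> h \<in> U"
    using B.E.eventually_small_open[OF B.U z] B.E.filterlim_smult_small[OF h] unfolding filterlim_iff by blast
  moreover have "\<forall>\<^sub>F s::real in at 0. s \<noteq> 0" by (rule eventually_neq_at_within)
  ultimately show "\<forall>\<^sub>F s in at 0. dist ((rinner (D k (y \<oplus>\<^bsub>E\<^esub> (t + s) \<odot>\<^bsub>E\<^esub> h) vs) w - rinner (D k ?z vs) w) / s)
      (rinner (D k ?z (h # vs)) w) < \<epsilon>"
  proof eventually_elim
    case (elim s)
    have zs: "y \<oplus>\<^bsub>E\<^esub> (t + s) \<odot>\<^bsub>E\<^esub> h = ?z \<oplus>\<^bsub>E\<^esub> s \<odot>\<^bsub>E\<^esub> h"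
      using y h by (simp add: B.E.smult_add_left B.E.a_assoc)
    let ?a = "D k (?z \<oplus>\<^bsub>E\<^esub> s \<odot>\<^bsub>E\<^esub> h) vs" and ?b = "D k ?z vs" and ?d = "D k ?z (h # vs)"
    have cl: "?a \<in> carrier L" "?b \<in> carrier L" "?d \<in> carrier L"
      using D_closed[OF k] z elim h vs by simp_all
    have d: "D k ?z (s \<odot>\<^bsub>E\<^esub> h # vs) = complex_of_real s \<odot>\<^bsub>L\<^esub> ?d"
      using smooth_derivs_smult[OF D[OF k] z, of "[]" vs h s] h vs by simp
    have "rinner ((?a \<ominus>\<^bsub>L\<^esub> ?b) \<ominus>\<^bsub>L\<^esub> complex_of_real s \<odot>\<^bsub>L\<^esub> ?d) w = rinner ?a w - rinner ?b w - s * rinner ?d w"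
      using cl w by (simp add: rinner_diff_left rinner_smult_left)
    then have "\<bar>rinner ?a w - rinner ?b w - s * rinner ?d w\<bar>
        \<le> nrm (realify L) ((?a \<ominus>\<^bsub>L\<^esub> ?b) \<ominus>\<^bsub>L\<^esub> complex_of_real s \<odot>\<^bsub>L\<^esub> ?d) * ?w"
      using rinner_le[of "(?a \<ominus>\<^bsub>L\<^esub> ?b) \<ominus>\<^bsub>L\<^esub> complex_of_real s \<odot>\<^bsub>L\<^esub> ?d" w] cl w by simp
    also have "\<dots> \<le> \<epsilon>' * nrm E (s \<odot>\<^bsub>E\<^esub> h) * prodnrm E vs * ?w"
    proof (rule mult_right_mono)
      show "nrm (realify L) ((?a \<ominus>\<^bsub>L\<^esub> ?b) \<ominus>\<^bsub>L\<^esub> complex_of_real s \<odot>\<^bsub>L\<^esub> ?d) \<le> \<epsilon>' * nrm E (s \<odot>\<^bsub>E\<^esub> h) * prodnrm E vs"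
      proof -
        have "nrm (realify L) ((?a \<ominus>\<^bsub>realify L\<^esub> ?b) \<ominus>\<^bsub>realify L\<^esub> D k ?z (s \<odot>\<^bsub>E\<^esub> h # vs)) \<le> \<epsilon>' * nrm E (s \<odot>\<^bsub>E\<^esub> h) * prodnrm E vs"
          using elim(1,2) vs by blast
        then show ?thesis unfolding d by simp
      qed
    qed (use w in simp)
    also have "\<dots> = \<bar>s\<bar> * (\<epsilon>' * c)" using h by (simp add: c_def)
    finally have "\<bar>rinner ?a w - rinner ?b w - s * rinner ?d w\<bar> \<le> \<bar>s\<bar> * (\<epsilon>' * c)" .
    moreover have "rinner ?a w - rinner ?b w - s * rinner ?d w = s * ((rinner ?a w - rinner ?b w) / s - rinner ?d w)"
      using elim by (simp add: field_simps)
    ultimately have "\<bar>(rinner ?a w - rinner ?b w) / s - rinner ?d w\<bar> \<le> \<epsilon>' * c"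
      using elim by (simp add: abs_mult)
    then show ?case unfolding zs dist_real_def using \<epsilon>' by simp
  qed
qed

text \<open>Taylor's formula for the scalar functions \<open>t \<mapsto> Re \<langle>D k (y + t h) vs, w\<rangle>\<close> gives a remainder of second
  order with a constant that is uniform in \<open>k\<close>, which turns strong into norm differentiability.\<close>

lemma D_taylor:
  assumes y: "y \<in> U"
  shows "\<exists>C>0. \<forall>\<^sub>F h in small E. y \<oplus>\<^bsub>E\<^esub> h \<in> U \<and> (\<forall>vs\<in>lists (carrier E). length vs = m \<longrightarrow>
      (\<forall>k\<in>carrier Q. nrm (realify L) ((D k (y \<oplus>\<^bsub>E\<^esub> h) vs \<ominus>\<^bsub>L\<^esub> D k y vs) \<ominus>\<^bsub>L\<^esub> D k y (h # vs))
        \<le> C * (nrm E h)\<^sup>2 * prodnrm E vs * nrm Q k))"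
proof -
  have yE: "y \<in> carrier E" by (rule B.U_carrier[OF y])
  obtain C where C: "C > 0" and ev: "\<forall>\<^sub>F h in small E. y \<oplus>\<^bsub>E\<^esub> h \<in> U \<longrightarrow> (\<forall>vs\<in>lists (carrier E). length vs = m + 2 \<longrightarrow>
      (\<forall>k\<in>carrier Q. nrm (realify L) (D k (y \<oplus>\<^bsub>E\<^esub> h) vs) \<le> C * prodnrm E vs * nrm Q k))"
    using D_local_bound[OF y, of "m + 2"] by blast
  from eventually_conj[OF ev B.E.eventually_small_open[OF B.U y]]
  obtain \<delta> where \<delta>: "\<delta> > 0" "\<And>h. h \<in> carrier E \<Longrightarrow> nrm E h < \<delta> \<Longrightarrow> y \<oplus>\<^bsub>E\<^esub> h \<in> U"
    and le: "\<And>h vs k. h \<in> carrier E \<Longrightarrow> nrm E h < \<delta> \<Longrightarrow> vs \<in> lists (carrier E) \<Longrightarrow> length vs = m + 2 \<Longrightarrow>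
      k \<in> carrier Q \<Longrightarrow> nrm (realify L) (D k (y \<oplus>\<^bsub>E\<^esub> h) vs) \<le> C * prodnrm E vs * nrm Q k"
    unfolding eventually_small by blast
  have main: "nrm (realify L) ((D k (y \<oplus>\<^bsub>E\<^esub> h) vs \<ominus>\<^bsub>L\<^esub> D k y vs) \<ominus>\<^bsub>L\<^esub> D k y (h # vs))
        \<le> C * (nrm E h)\<^sup>2 * prodnrm E vs * nrm Q k"
    if h: "h \<in> carrier E" "nrm E h < \<delta>" and vs: "vs \<in> lists (carrier E)" "length vs = m" and k: "k \<in> carrier Q" for h vs k
  proof (rule nrm_leI)
    have th: "nrm E (t \<odot>\<^bsub>E\<^esub> h) < \<delta>" "y \<oplus>\<^bsub>E\<^esub> t \<odot>\<^bsub>E\<^esub> h \<in> U" if "0 \<le> t" "t \<le> 1" for t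
    proof -
      have "\<bar>t\<bar> * nrm E h \<le> 1 * nrm E h" using that h by (intro mult_right_mono) auto
      then show "nrm E (t \<odot>\<^bsub>E\<^esub> h) < \<delta>" using h by simp
      then show "y \<oplus>\<^bsub>E\<^esub> t \<odot>\<^bsub>E\<^esub> h \<in> U" using h by (intro \<delta>) auto
    qed
    have yh: "y \<oplus>\<^bsub>E\<^esub> h \<in> U" using \<delta> h by blast
    have cl: "D k (y \<oplus>\<^bsub>E\<^esub> h) vs \<in> carrier L" "D k y vs \<in> carrier L" "D k y (h # vs) \<in> carrier L"
      using D_closed[OF k] yh y h vs by simp_all
    then show "(D k (y \<oplus>\<^bsub>E\<^esub> h) vs \<ominus>\<^bsub>L\<^esub> D k y vs) \<ominus>\<^bsub>L\<^esub> D k y (h # vs) \<in> carrier L" by simp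
    show "0 \<le> C * (nrm E h)\<^sup>2 * prodnrm E vs * nrm Q k"
      using C h vs k by (intro mult_nonneg_nonneg B.E.prodnrm_nonneg) auto
    fix w assume w: "w \<in> carrier L"
    define \<phi> where "\<phi> j t = rinner (D k (y \<oplus>\<^bsub>E\<^esub> t \<odot>\<^bsub>E\<^esub> h) (replicate j h @ vs)) w" for j t
    have "\<exists>t::real. (if 1 < (0::real) then 1 < t \<and> t < 0 else 0 < t \<and> t < 1) \<and>
        \<phi> 0 1 = (\<Sum>j<2. (\<phi> j 0 / fact j) * (1 - 0) ^ j) + (\<phi> 2 t / fact 2) * (1 - 0) ^ 2"
    proof (rule Taylor[where a = 0 and b = 1])
      show "\<forall>j t. j < 2 \<and> 0 \<le> t \<and> t \<le> 1 \<longrightarrow> DERIV (\<phi> j) t :> \<phi> (Suc j) t"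
      proof (intro allI impI)
        fix j :: nat and t assume t: "j < 2 \<and> 0 \<le> t \<and> t \<le> (1::real)"
        have "replicate j h @ vs \<in> lists (carrier E)" using h vs by auto
        then show "DERIV (\<phi> j) t :> \<phi> (Suc j) t"
          using rinner_D_curve[OF k th(2) yE h(1) _ w] t by (simp add: \<phi>_def[abs_def])
      qed
    qed auto
    then obtain t where t: "0 < t" "t < 1" "\<phi> 0 1 = \<phi> 0 0 + \<phi> 1 0 + \<phi> 2 t / 2"
      by (auto simp: numeral_2_eq_2)
    have "\<phi> 0 1 = rinner (D k (y \<oplus>\<^bsub>E\<^esub> h) vs) w" "\<phi> 0 0 = rinner (D k y vs) w" "\<phi> 1 0 = rinner (D k y (h # vs)) w"
      using h yE by (simp_all add: \<phi>_def)
    then have "rinner ((D k (y \<oplus>\<^bsub>E\<^esub> h) vs \<ominus>\<^bsub>L\<^esub> D k y vs) \<ominus>\<^bsub>L\<^esub> D k y (h # vs)) w = \<phi> 2 t / 2"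
      using t(3) cl w by (simp add: rinner_diff_left)
    also have "\<bar>\<phi> 2 t / 2\<bar> \<le> \<bar>\<phi> 2 t\<bar>" by simp
    also have "\<bar>\<phi> 2 t\<bar> \<le> nrm (realify L) (D k (y \<oplus>\<^bsub>E\<^esub> t \<odot>\<^bsub>E\<^esub> h) (h # h # vs)) * nrm (realify L) w"
    proof -
      have "replicate 2 h @ vs = h # h # vs" by (simp add: numeral_2_eq_2)
      then show ?thesis
        unfolding \<phi>_def using th[of t] t h vs w by (auto intro!: rinner_le D_closed[OF k])
    qed
    also have "\<dots> \<le> C * prodnrm E (h # h # vs) * nrm Q k * nrm (realify L) w"
      using th[of t] t h vs w by (intro mult_right_mono le k) auto
    also have "\<dots> = C * (nrm E h)\<^sup>2 * prodnrm E vs * nrm Q k * nrm (realify L) w"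
      by (simp add: power2_eq_square)
    finally show "\<bar>rinner ((D k (y \<oplus>\<^bsub>E\<^esub> h) vs \<ominus>\<^bsub>L\<^esub> D k y vs) \<ominus>\<^bsub>L\<^esub> D k y (h # vs)) w\<bar>
        \<le> C * (nrm E h)\<^sup>2 * prodnrm E vs * nrm Q k * nrm (realify L) w" .
  qed
  have "\<forall>\<^sub>F h in small E. y \<oplus>\<^bsub>E\<^esub> h \<in> U \<and> (\<forall>vs\<in>lists (carrier E). length vs = m \<longrightarrow>
      (\<forall>k\<in>carrier Q. nrm (realify L) ((D k (y \<oplus>\<^bsub>E\<^esub> h) vs \<ominus>\<^bsub>L\<^esub> D k y vs) \<ominus>\<^bsub>L\<^esub> D k y (h # vs))
        \<le> C * (nrm E h)\<^sup>2 * prodnrm E vs * nrm Q k))"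
    unfolding eventually_small by (intro exI[of _ \<delta>] conjI ballI impI \<delta> main)
  then show ?thesis using C by blast
qed

text \<open>\<open>slot_sum y us vs\<close> is the sum over the entries \<open>(h\<^sub>j, l\<^sub>j)\<close> of \<open>vs\<close> of the derivative of
  \<open>y \<mapsto> A y l\<^sub>j\<close> in the directions \<open>us\<close> and all \<open>h\<^sub>i\<close> with \<open>i \<noteq> j\<close>. Since \<open>A y k\<close> is linear in
  \<open>k\<close>, at most one of the directions of a derivative of \<open>(y, k) \<mapsto> A y k\<close> can act on \<open>k\<close>.\<close>

fun slot_sum :: "'e \<Rightarrow> 'e list \<Rightarrow> ('e \<times> 'q) list \<Rightarrow> 'l" where
  "slot_sum y us [] = \<zero>\<^bsub>L\<^esub>"
| "slot_sum y us ((h, l) # vs) = D l y (us @ map fst vs) \<oplus>\<^bsub>L\<^esub> slot_sum y (us @ [h]) vs"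

definition eval_deriv :: "'e \<times> 'q \<Rightarrow> ('e \<times> 'q) list \<Rightarrow> 'l" where
  "eval_deriv z vs = D (snd z) (fst z) (map fst vs) \<oplus>\<^bsub>L\<^esub> slot_sum (fst z) [] vs"

sublocale P: Banach2 E Q
  by unfold_locales

abbreviation EQ :: "('e \<times> 'q) nspace" where
  "EQ \<equiv> prod_space E Q"

lemma map_fst_lists: "vs \<in> lists (carrier EQ) \<Longrightarrow> map fst vs \<in> lists (carrier E)"
  by (induction vs) auto

lemma slot_sum_closed:
  "y \<in> U \<Longrightarrow> us \<in> lists (carrier E) \<Longrightarrow> vs \<in> lists (carrier EQ) \<Longrightarrow> slot_sum y us vs \<in> carrier L"
proof (induction vs arbitrary: us)
  case (Cons v vs)
  obtain h l where v: "v = (h, l)" by (cases v)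
  have c: "l \<in> carrier Q" "vs \<in> lists (carrier EQ)" "us @ map fst vs \<in> lists (carrier E)" "us @ [h] \<in> lists (carrier E)"
    using Cons.prems v map_fst_lists[of vs] by auto
  show ?case using D_closed[OF c(1) _ c(3)] Cons.IH[OF _ c(4,2)] Cons.prems by (simp add: v)
qed simp

lemma prodnrm_map_fst: "vs \<in> lists (carrier EQ) \<Longrightarrow> prodnrm E (map fst vs) \<le> prodnrm EQ vs"
proof (induction vs)
  case (Cons v vs)
  obtain h l where v: "v = (h, l)" by (cases v)
  have "0 \<le> prodnrm E (map fst vs)" using Cons map_fst_lists[of vs] by (intro B.E.prodnrm_nonneg) simp
  then show ?case using Cons v P.nrm_fst_le[of h l] by (auto intro!: mult_mono simp del: prod_space_simps(5))
qed simp

lemma prodnrm_fst_snd: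
  assumes "vs \<in> lists (carrier EQ)" "l \<in> carrier Q" "h \<in> carrier E"
  shows "prodnrm E (map fst vs) * nrm Q l \<le> prodnrm EQ ((h, l) # vs)"
proof -
  have "prodnrm E (map fst vs) * nrm Q l \<le> prodnrm EQ vs * nrm EQ (h, l)"
    using assms prodnrm_map_fst[OF assms(1)] P.nrm_snd_le[of l h] P.P.prodnrm_nonneg[OF assms(1)]
    by (intro mult_mono) auto
  then show ?thesis by (simp add: mult.commute)
qed

lemma slot_sum_add:
  assumes "y \<in> U" "a \<in> carrier E" "b \<in> carrier E" "us \<in> lists (carrier E)" "ws \<in> lists (carrier E)" "vs \<in> lists (carrier EQ)"
  shows "slot_sum y (us @ (a \<oplus>\<^bsub>E\<^esub> b) # ws) vs = slot_sum y (us @ a # ws) vs \<oplus>\<^bsub>L\<^esub> slot_sum y (us @ b # ws) vs"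
  using assms
proof (induction vs arbitrary: ws)
  case (Cons v vs)
  obtain h l where v: "v = (h, l)" by (cases v)
  have c: "l \<in> carrier Q" "h \<in> carrier E" "vs \<in> lists (carrier EQ)" "ws @ map fst vs \<in> lists (carrier E)" "ws @ [h] \<in> lists (carrier E)"
    using Cons.prems v map_fst_lists[of vs] by auto
  note D' = smooth_derivs_add[OF D[OF c(1)] Cons.prems(1,4) c(4) Cons.prems(2,3)]
  have cl: "D l y (us @ a # ws @ map fst vs) \<in> carrier L" "D l y (us @ b # ws @ map fst vs) \<in> carrier L"
    using Cons.prems c by (auto intro!: D_closed)
  have cl': "slot_sum y (us @ a # ws @ [h]) vs \<in> carrier L" "slot_sum y (us @ b # ws @ [h]) vs \<in> carrier L"
    using Cons.prems c by (auto intro!: slot_sum_closed)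
  show ?case
    using Cons.IH[OF Cons.prems(1-4) c(5,3)] D' cl cl' by (simp add: v a_ac)
qed simp

lemma slot_sum_smult:
  assumes "y \<in> U" "a \<in> carrier E" "us \<in> lists (carrier E)" "ws \<in> lists (carrier E)" "vs \<in> lists (carrier EQ)"
  shows "slot_sum y (us @ (c \<odot>\<^bsub>E\<^esub> a) # ws) vs = complex_of_real c \<odot>\<^bsub>L\<^esub> slot_sum y (us @ a # ws) vs"
  using assms
proof (induction vs arbitrary: ws)
  case Nil
  then show ?case using B.F.smult_zero[of c] by simp
next
  case (Cons v vs)
  obtain h l where v: "v = (h, l)" by (cases v)
  have c: "l \<in> carrier Q" "h \<in> carrier E" "vs \<in> lists (carrier EQ)" "ws @ map fst vs \<in> lists (carrier E)" "ws @ [h] \<in> lists (carrier E)"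
    using Cons.prems v map_fst_lists[of vs] by auto
  note D' = smooth_derivs_smult[OF D[OF c(1)] Cons.prems(1,3) c(4) Cons.prems(2)]
  have cl: "D l y (us @ a # ws @ map fst vs) \<in> carrier L" using Cons.prems c by (auto intro!: D_closed)
  have cl': "slot_sum y (us @ a # ws @ [h]) vs \<in> carrier L" using Cons.prems c by (auto intro!: slot_sum_closed)
  show ?case
    using Cons.IH[OF Cons.prems(1-3) c(5,3)] D' cl cl' B.F.smult_add_right[OF _ _, of _ _ c] by (simp add: v)
qed

lemma D_bound:
  assumes y: "y \<in> U"
  shows "\<exists>C>0. \<forall>vs\<in>lists (carrier E). length vs = m \<longrightarrow>
      (\<forall>k\<in>carrier Q. nrm (realify L) (D k y vs) \<le> C * prodnrm E vs * nrm Q k)"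
proof -
  obtain C where C: "C > 0" and "\<forall>\<^sub>F h in small E. y \<oplus>\<^bsub>E\<^esub> h \<in> U \<longrightarrow> (\<forall>vs\<in>lists (carrier E). length vs = m \<longrightarrow>
      (\<forall>k\<in>carrier Q. nrm (realify L) (D k (y \<oplus>\<^bsub>E\<^esub> h) vs) \<le> C * prodnrm E vs * nrm Q k))"
    using D_local_bound[OF y, of m] by blast
  then obtain \<delta> where "\<delta> > 0" and *: "\<forall>h\<in>carrier E. nrm E h < \<delta> \<longrightarrow> y \<oplus>\<^bsub>E\<^esub> h \<in> U \<longrightarrow> (\<forall>vs\<in>lists (carrier E). length vs = m \<longrightarrow>
      (\<forall>k\<in>carrier Q. nrm (realify L) (D k (y \<oplus>\<^bsub>E\<^esub> h) vs) \<le> C * prodnrm E vs * nrm Q k))"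
    unfolding eventually_small by blast
  have "y \<oplus>\<^bsub>E\<^esub> \<zero>\<^bsub>E\<^esub> = y" using B.U_carrier[OF y] by simp
  then show ?thesis using *[rule_format, of "\<zero>\<^bsub>E\<^esub>"] \<open>\<delta> > 0\<close> y C by auto
qed

lemma slot_sum_bound:
  assumes y: "y \<in> U" and C: "\<And>vs k. vs \<in> lists (carrier E) \<Longrightarrow> length vs = m \<Longrightarrow> k \<in> carrier Q \<Longrightarrow>
      nrm (realify L) (D k y vs) \<le> C * prodnrm E vs * nrm Q k" and C0: "C \<ge> 0"
  shows "vs \<in> lists (carrier EQ) \<Longrightarrow> us \<in> lists (carrier E) \<Longrightarrow> length us + length vs = Suc m \<Longrightarrow>
    nrm (realify L) (slot_sum y us vs) \<le> real (length vs) * (C * (prodnrm E us * prodnrm EQ vs))"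
proof (induction vs arbitrary: us)
  case Nil
  then show ?case using B.F.nrm_zero by simp
next
  case (Cons v vs)
  obtain h l where v: "v = (h, l)" by (cases v)
  have c: "l \<in> carrier Q" "h \<in> carrier E" "vs \<in> lists (carrier EQ)" "us @ map fst vs \<in> lists (carrier E)" "us @ [h] \<in> lists (carrier E)"
    using Cons.prems v map_fst_lists[of vs] by auto
  have us0: "0 \<le> prodnrm E us" using Cons.prems by simp
  have "nrm (realify L) (D l y (us @ map fst vs)) \<le> C * prodnrm E (us @ map fst vs) * nrm Q l"
    using c Cons.prems by (intro C) auto
  also have "\<dots> = C * (prodnrm E us * (prodnrm E (map fst vs) * nrm Q l))" by simp
  also have "\<dots> \<le> C * (prodnrm E us * prodnrm EQ (v # vs))"
    unfolding v by (intro mult_left_mono prodnrm_fst_snd c C0 us0)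
  finally have 1: "nrm (realify L) (D l y (us @ map fst vs)) \<le> C * (prodnrm E us * prodnrm EQ (v # vs))" .
  have "nrm (realify L) (slot_sum y (us @ [h]) vs) \<le> real (length vs) * (C * (prodnrm E (us @ [h]) * prodnrm EQ vs))"
    using c Cons.prems by (intro Cons.IH) auto
  also have "\<dots> = real (length vs) * (C * (prodnrm E us * (nrm E h * prodnrm EQ vs)))" by simp
  also have "\<dots> \<le> real (length vs) * (C * (prodnrm E us * prodnrm EQ (v # vs)))"
    using P.P.prodnrm_nonneg[OF c(3)] P.nrm_fst_le[of h l] us0 C0 unfolding v
    by (intro mult_left_mono) (auto intro!: mult_right_mono simp del: prod_space_simps(5))
  finally have 2: "nrm (realify L) (slot_sum y (us @ [h]) vs) \<le> real (length vs) * (C * (prodnrm E us * prodnrm EQ (v # vs)))" .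
  have "nrm (realify L) (slot_sum y us (v # vs)) \<le> nrm (realify L) (D l y (us @ map fst vs)) + nrm (realify L) (slot_sum y (us @ [h]) vs)"
    using B.F.nrm_triangle[of "D l y (us @ map fst vs)" "slot_sum y (us @ [h]) vs"] D_closed[OF c(1) y c(4)]
      slot_sum_closed[OF y c(5,3)] by (simp add: v)
  then show ?case using 1 2 by (simp add: algebra_simps)
qed

lemma slot_sum_taylor:
  assumes y: "y \<in> U" and h: "h \<in> carrier E" and yh: "y \<oplus>\<^bsub>E\<^esub> h \<in> U"
    and C: "\<And>vs k. vs \<in> lists (carrier E) \<Longrightarrow> length vs = m \<Longrightarrow> k \<in> carrier Q \<Longrightarrow>
      nrm (realify L) ((D k (y \<oplus>\<^bsub>E\<^esub> h) vs \<ominus>\<^bsub>L\<^esub> D k y vs) \<ominus>\<^bsub>L\<^esub> D k y (h # vs)) \<le> C * prodnrm E vs * nrm Q k"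
    and C0: "C \<ge> 0"
  shows "vs \<in> lists (carrier EQ) \<Longrightarrow> us \<in> lists (carrier E) \<Longrightarrow> length us + length vs = Suc m \<Longrightarrow>
    nrm (realify L) ((slot_sum (y \<oplus>\<^bsub>E\<^esub> h) us vs \<ominus>\<^bsub>L\<^esub> slot_sum y us vs) \<ominus>\<^bsub>L\<^esub> slot_sum y (h # us) vs)
      \<le> real (length vs) * (C * (prodnrm E us * prodnrm EQ vs))"
proof (induction vs arbitrary: us)
  case Nil
  have "(\<zero>\<^bsub>L\<^esub> \<ominus>\<^bsub>L\<^esub> \<zero>\<^bsub>L\<^esub>) \<ominus>\<^bsub>L\<^esub> \<zero>\<^bsub>L\<^esub> = \<zero>\<^bsub>L\<^esub>" using B.F.diff_eq_zero_iff[of "\<zero>\<^bsub>L\<^esub>" "\<zero>\<^bsub>L\<^esub>"] by simp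
  then show ?case using B.F.nrm_zero by simp
next
  case (Cons v vs)
  obtain g l where v: "v = (g, l)" by (cases v)
  have c: "l \<in> carrier Q" "g \<in> carrier E" "vs \<in> lists (carrier EQ)" "us @ map fst vs \<in> lists (carrier E)" "us @ [g] \<in> lists (carrier E)"
    using Cons.prems v map_fst_lists[of vs] by auto
  have us0: "0 \<le> prodnrm E us" using Cons.prems by simp
  let ?d = "(D l (y \<oplus>\<^bsub>E\<^esub> h) (us @ map fst vs) \<ominus>\<^bsub>L\<^esub> D l y (us @ map fst vs)) \<ominus>\<^bsub>L\<^esub> D l y (h # us @ map fst vs)"
  let ?s = "(slot_sum (y \<oplus>\<^bsub>E\<^esub> h) (us @ [g]) vs \<ominus>\<^bsub>L\<^esub> slot_sum y (us @ [g]) vs) \<ominus>\<^bsub>L\<^esub> slot_sum y (h # us @ [g]) vs"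
  have cl: "D l (y \<oplus>\<^bsub>E\<^esub> h) (us @ map fst vs) \<in> carrier L" "D l y (us @ map fst vs) \<in> carrier L" "D l y (h # us @ map fst vs) \<in> carrier L"
    "slot_sum (y \<oplus>\<^bsub>E\<^esub> h) (us @ [g]) vs \<in> carrier L" "slot_sum y (us @ [g]) vs \<in> carrier L" "slot_sum y (h # us @ [g]) vs \<in> carrier L"
    using y yh c h D_closed[OF c(1)] slot_sum_closed[OF _ _ c(3)] by auto
  have "nrm (realify L) ?d \<le> C * prodnrm E (us @ map fst vs) * nrm Q l"
    using c Cons.prems by (intro C) auto
  also have "\<dots> = C * (prodnrm E us * (prodnrm E (map fst vs) * nrm Q l))" by simp
  also have "\<dots> \<le> C * (prodnrm E us * prodnrm EQ (v # vs))"
    unfolding v by (intro mult_left_mono prodnrm_fst_snd c C0 us0)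
  finally have 1: "nrm (realify L) ?d \<le> C * (prodnrm E us * prodnrm EQ (v # vs))" .
  have "nrm (realify L) ?s \<le> real (length vs) * (C * (prodnrm E (us @ [g]) * prodnrm EQ vs))"
    using c Cons.prems by (intro Cons.IH) auto
  also have "\<dots> = real (length vs) * (C * (prodnrm E us * (nrm E g * prodnrm EQ vs)))" by simp
  also have "\<dots> \<le> real (length vs) * (C * (prodnrm E us * prodnrm EQ (v # vs)))"
    using P.P.prodnrm_nonneg[OF c(3)] P.nrm_fst_le[of g l] us0 C0 unfolding v
    by (intro mult_left_mono) (auto intro!: mult_right_mono simp del: prod_space_simps(5))
  finally have 2: "nrm (realify L) ?s \<le> real (length vs) * (C * (prodnrm E us * prodnrm EQ (v # vs)))" .
  have "(slot_sum (y \<oplus>\<^bsub>E\<^esub> h) us (v # vs) \<ominus>\<^bsub>L\<^esub> slot_sum y us (v # vs)) \<ominus>\<^bsub>L\<^esub> slot_sum y (h # us) (v # vs) = ?d \<oplus>\<^bsub>L\<^esub> ?s"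
    using cl by (simp add: v minus_eq minus_add a_ac)
  moreover have "nrm (realify L) (?d \<oplus>\<^bsub>L\<^esub> ?s) \<le> nrm (realify L) ?d + nrm (realify L) ?s"
    using B.F.nrm_triangle[of ?d ?s] cl by simp
  ultimately show ?case using 1 2 by (simp add: algebra_simps)
qed

lemma slot_sum_bounded:
  assumes y: "y \<in> U"
  shows "\<exists>C. \<forall>vs\<in>lists (carrier EQ). length vs = m \<longrightarrow> nrm (realify L) (slot_sum y [] vs) \<le> C * prodnrm EQ vs"
proof (cases m)
  case 0
  then show ?thesis using B.F.nrm_zero by (intro exI[of _ 0]) simp
next
  case (Suc m')
  obtain C where C: "C > 0" "\<And>vs k. vs \<in> lists (carrier E) \<Longrightarrow> length vs = m' \<Longrightarrow> k \<in> carrier Q \<Longrightarrow>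
      nrm (realify L) (D k y vs) \<le> C * prodnrm E vs * nrm Q k"
    using D_bound[OF y, of m'] by blast
  have "nrm (realify L) (slot_sum y [] vs) \<le> real m * C * prodnrm EQ vs"
    if "vs \<in> lists (carrier EQ)" "length vs = m" for vs
    using slot_sum_bound[where us = "[]" and m = m' and vs = vs and C = C, OF y C(2)] C(1) that Suc
    by (simp add: mult.assoc)
  then show ?thesis by blast
qed

lemma slot_sum_taylor_estimate:
  assumes y: "y \<in> U"
  shows "\<exists>C>0. \<forall>\<^sub>F h in small E. y \<oplus>\<^bsub>E\<^esub> h \<in> U \<and> (\<forall>vs\<in>lists (carrier EQ). length vs = m \<longrightarrow>
    nrm (realify L) ((slot_sum (y \<oplus>\<^bsub>E\<^esub> h) [] vs \<ominus>\<^bsub>L\<^esub> slot_sum y [] vs) \<ominus>\<^bsub>L\<^esub> slot_sum y [h] vs) \<le> C * (nrm E h)\<^sup>2 * prodnrm EQ vs)"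
proof (cases m)
  case 0
  have "(\<zero>\<^bsub>L\<^esub> \<ominus>\<^bsub>L\<^esub> \<zero>\<^bsub>L\<^esub>) \<ominus>\<^bsub>L\<^esub> \<zero>\<^bsub>L\<^esub> = \<zero>\<^bsub>L\<^esub>" using B.F.diff_eq_zero_iff[of "\<zero>\<^bsub>L\<^esub>" "\<zero>\<^bsub>L\<^esub>"] by simp
  then show ?thesis
    using B.F.nrm_zero B.E.eventually_small_open[OF B.U y] 0 by (intro exI[of _ 1]) simp
next
  case (Suc m')
  obtain C where C: "C > 0" and ev: "\<forall>\<^sub>F h in small E. y \<oplus>\<^bsub>E\<^esub> h \<in> U \<and> (\<forall>vs\<in>lists (carrier E). length vs = m' \<longrightarrow>
      (\<forall>k\<in>carrier Q. nrm (realify L) ((D k (y \<oplus>\<^bsub>E\<^esub> h) vs \<ominus>\<^bsub>L\<^esub> D k y vs) \<ominus>\<^bsub>L\<^esub> D k y (h # vs))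
        \<le> C * (nrm E h)\<^sup>2 * prodnrm E vs * nrm Q k))"
    using D_taylor[OF y, of m'] by blast
  from ev eventually_small_carrier
  have "\<forall>\<^sub>F h in small E. y \<oplus>\<^bsub>E\<^esub> h \<in> U \<and> (\<forall>vs\<in>lists (carrier EQ). length vs = m \<longrightarrow>
    nrm (realify L) ((slot_sum (y \<oplus>\<^bsub>E\<^esub> h) [] vs \<ominus>\<^bsub>L\<^esub> slot_sum y [] vs) \<ominus>\<^bsub>L\<^esub> slot_sum y [h] vs)
      \<le> real m * C * (nrm E h)\<^sup>2 * prodnrm EQ vs)"
  proof eventually_elim
    case (elim h)
    have "nrm (realify L) ((slot_sum (y \<oplus>\<^bsub>E\<^esub> h) [] vs \<ominus>\<^bsub>L\<^esub> slot_sum y [] vs) \<ominus>\<^bsub>L\<^esub> slot_sum y [h] vs)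
      \<le> real m * C * (nrm E h)\<^sup>2 * prodnrm EQ vs"
      if vs: "vs \<in> lists (carrier EQ)" "length vs = m" for vs
    proof -
      have "nrm (realify L) ((slot_sum (y \<oplus>\<^bsub>E\<^esub> h) [] vs \<ominus>\<^bsub>L\<^esub> slot_sum y [] vs) \<ominus>\<^bsub>L\<^esub> slot_sum y [h] vs)
          \<le> real (length vs) * ((C * (nrm E h)\<^sup>2) * (prodnrm E [] * prodnrm EQ vs))"
        by (rule slot_sum_taylor[OF y, where m = m']) (use elim vs Suc C in auto)
      then show ?thesis using vs by (simp add: mult.assoc)
    qed
    then show ?case using elim by blast
  qed
  then show ?thesis using C Suc by (intro exI[of _ "real m * C"]) simp
qed

lemma smooth_derivs_eval: "smooth_derivs EQ (realify L) (U \<times> carrier Q) eval_deriv"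
proof -
  have "openin (vtop EQ) (U \<times> carrier Q)"
    unfolding P.vtop_prod using B.U Q.openin_carrier by (simp add: openin_prod_Times_iff)
  then interpret C: Banach_maps EQ "realify L" "U \<times> carrier Q" by unfold_locales
  have closed: "eval_deriv (y, k) vs \<in> carrier L" if "y \<in> U" "k \<in> carrier Q" "vs \<in> lists (carrier EQ)" for y k vs
    using D_closed[OF that(2,1) map_fst_lists[OF that(3)]] slot_sum_closed[OF that(1) _ that(3), of "[]"]
    by (simp add: eval_deriv_def)
  show ?thesis
  proof (rule C.smooth_derivsI)
    fix z vs assume "z \<in> U \<times> carrier Q" "vs \<in> lists (carrier EQ)"
    then show "eval_deriv z vs \<in> carrier (realify L)" using closed by (cases z) simp
  next
    fix z a b vs assume "z \<in> U \<times> carrier Q" "a \<in> carrier EQ" "b \<in> carrier EQ" and vs: "vs \<in> lists (carrier EQ)"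
    then obtain y k h1 l1 h2 l2 where z: "z = (y, k)" "a = (h1, l1)" "b = (h2, l2)"
      and y: "y \<in> U" and k: "k \<in> carrier Q" and h: "h1 \<in> carrier E" "h2 \<in> carrier E" and l: "l1 \<in> carrier Q" "l2 \<in> carrier Q"
      by auto
    note F = map_fst_lists[OF vs]
    have cl: "D k y (h1 # map fst vs) \<in> carrier L" "D k y (h2 # map fst vs) \<in> carrier L"
      "D l1 y (map fst vs) \<in> carrier L" "D l2 y (map fst vs) \<in> carrier L"
      "slot_sum y [h1] vs \<in> carrier L" "slot_sum y [h2] vs \<in> carrier L"
      using y k h l F D_closed slot_sum_closed[OF y _ vs] by simp_all
    show "eval_deriv z ((a \<oplus>\<^bsub>EQ\<^esub> b) # vs) = eval_deriv z (a # vs) \<oplus>\<^bsub>realify L\<^esub> eval_deriv z (b # vs)"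
      using smooth_derivs_add[OF D[OF k] y _ F h, of "[]"] D_add[OF y l F] slot_sum_add[OF y h _ _ vs, of "[]" "[]"] cl
      by (simp add: eval_deriv_def z a_ac)
  next
    fix z a c vs assume "z \<in> U \<times> carrier Q" "a \<in> carrier EQ" and vs: "vs \<in> lists (carrier EQ)"
    then obtain y k h l where z: "z = (y, k)" "a = (h, l)"
      and y: "y \<in> U" and k: "k \<in> carrier Q" and h: "h \<in> carrier E" and l: "l \<in> carrier Q"
      by auto
    note F = map_fst_lists[OF vs]
    have cl: "D k y (h # map fst vs) \<in> carrier L" "D l y (map fst vs) \<in> carrier L" "slot_sum y [h] vs \<in> carrier L"
      using y k h l F D_closed slot_sum_closed[OF y _ vs] by simp_all
    show "eval_deriv z ((c \<odot>\<^bsub>EQ\<^esub> a) # vs) = c \<odot>\<^bsub>realify L\<^esub> eval_deriv z (a # vs)"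
      using smooth_derivs_smult[OF D[OF k] y _ F h, of "[]" c] D_smult[OF y l F, of c] slot_sum_smult[OF y h _ _ vs, of "[]" "[]" c] cl
        B.F.smult_add_right[of _ _ c]
      by (simp add: eval_deriv_def z)
  next
    fix m z assume "z \<in> U \<times> carrier Q"
    then obtain y k where z: "z = (y, k)" and y: "y \<in> U" and k: "k \<in> carrier Q" by auto
    obtain C1 where C1: "C1 > 0" "\<And>vs k. vs \<in> lists (carrier E) \<Longrightarrow> length vs = m \<Longrightarrow> k \<in> carrier Q \<Longrightarrow>
        nrm (realify L) (D k y vs) \<le> C1 * prodnrm E vs * nrm Q k"
      using D_bound[OF y, of m] by blast
    obtain C2 where C2: "\<And>vs. vs \<in> lists (carrier EQ) \<Longrightarrow> length vs = m \<Longrightarrow>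
        nrm (realify L) (slot_sum y [] vs) \<le> C2 * prodnrm EQ vs"
      using slot_sum_bounded[OF y, of m] by blast
    have "nrm (realify L) (eval_deriv z vs) \<le> (C1 * nrm Q k + C2) * prodnrm EQ vs"
      if vs: "vs \<in> lists (carrier EQ)" "length vs = m" for vs
    proof -
      note F = map_fst_lists[OF vs(1)]
      have "nrm (realify L) (D k y (map fst vs)) \<le> C1 * prodnrm E (map fst vs) * nrm Q k"
        using F vs k by (intro C1) auto
      also have "\<dots> \<le> C1 * prodnrm EQ vs * nrm Q k"
        using prodnrm_map_fst[OF vs(1)] C1 k by (intro mult_left_mono mult_right_mono) auto
      finally have "nrm (realify L) (D k y (map fst vs)) \<le> C1 * prodnrm EQ vs * nrm Q k" .
      moreover have "nrm (realify L) (eval_deriv z vs) \<le> nrm (realify L) (D k y (map fst vs)) + nrm (realify L) (slot_sum y [] vs)"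
        using B.F.nrm_triangle[of "D k y (map fst vs)" "slot_sum y [] vs"] D_closed[OF k y F] slot_sum_closed[OF y _ vs(1), of "[]"]
        by (simp add: eval_deriv_def z)
      ultimately show ?thesis using C2[OF vs] by (simp add: algebra_simps)
    qed
    then show "\<exists>C. \<forall>vs\<in>lists (carrier EQ). length vs = m \<longrightarrow> nrm (realify L) (eval_deriv z vs) \<le> C * prodnrm EQ vs" by blast
  next
    fix m z and \<epsilon> :: real assume "z \<in> U \<times> carrier Q" and \<epsilon>: "\<epsilon> > 0"
    then obtain y k where z: "z = (y, k)" and y: "y \<in> U" and k: "k \<in> carrier Q" by auto
    obtain C1 where C1: "C1 > 0" "\<And>vs k. vs \<in> lists (carrier E) \<Longrightarrow> length vs = Suc m \<Longrightarrow> k \<in> carrier Q \<Longrightarrow>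
        nrm (realify L) (D k y vs) \<le> C1 * prodnrm E vs * nrm Q k"
      using D_bound[OF y, of "Suc m"] by blast
    obtain C2 where C2: "C2 > 0" and ev2: "\<forall>\<^sub>F h in small E. y \<oplus>\<^bsub>E\<^esub> h \<in> U \<and> (\<forall>vs\<in>lists (carrier E). length vs = m \<longrightarrow>
        (\<forall>k\<in>carrier Q. nrm (realify L) ((D k (y \<oplus>\<^bsub>E\<^esub> h) vs \<ominus>\<^bsub>L\<^esub> D k y vs) \<ominus>\<^bsub>L\<^esub> D k y (h # vs))
          \<le> C2 * (nrm E h)\<^sup>2 * prodnrm E vs * nrm Q k))"
      using D_taylor[OF y, of m] by blast
    obtain C3 where C3: "C3 > 0" and ev3: "\<forall>\<^sub>F h in small E. y \<oplus>\<^bsub>E\<^esub> h \<in> U \<and> (\<forall>vs\<in>lists (carrier EQ). length vs = m \<longrightarrow>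
        nrm (realify L) ((slot_sum (y \<oplus>\<^bsub>E\<^esub> h) [] vs \<ominus>\<^bsub>L\<^esub> slot_sum y [] vs) \<ominus>\<^bsub>L\<^esub> slot_sum y [h] vs) \<le> C3 * (nrm E h)\<^sup>2 * prodnrm EQ vs)"
      using slot_sum_taylor_estimate[OF y, of m] by blast
    have fst_small: "filterlim fst (small E) (small EQ)"
      unfolding filterlim_iff eventually_small
    proof (intro allI impI, elim exE conjE)
      fix P and d :: real assume d: "d > 0" and P: "\<forall>h\<in>carrier E. nrm E h < d \<longrightarrow> P h"
      have "P (fst x)" if "x \<in> carrier EQ" "nrm EQ x < d" for x
        using that P P.nrm_fst_le[of "fst x" "snd x"] by (cases x) (auto simp del: prod_space_simps(5))
      then show "\<exists>\<delta>>0. \<forall>x\<in>carrier EQ. nrm EQ x < \<delta> \<longrightarrow> P (fst x)" using d by blast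
    qed
    define K where "K = C2 * nrm Q k + (C2 + C1) + C3"
    have K: "K > 0" unfolding K_def using C1 C2 C3 k by (intro add_nonneg_pos add_nonneg_nonneg mult_nonneg_nonneg) auto
    have \<delta>: "min 1 (\<epsilon> / K) > 0" using K \<epsilon> by simp
    from ev2 ev3 have "\<forall>\<^sub>F d in small EQ. y \<oplus>\<^bsub>E\<^esub> fst d \<in> U \<and> (\<forall>vs\<in>lists (carrier E). length vs = m \<longrightarrow>
        (\<forall>k\<in>carrier Q. nrm (realify L) ((D k (y \<oplus>\<^bsub>E\<^esub> fst d) vs \<ominus>\<^bsub>L\<^esub> D k y vs) \<ominus>\<^bsub>L\<^esub> D k y (fst d # vs))
          \<le> C2 * (nrm E (fst d))\<^sup>2 * prodnrm E vs * nrm Q k))"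
      "\<forall>\<^sub>F d in small EQ. y \<oplus>\<^bsub>E\<^esub> fst d \<in> U \<and> (\<forall>vs\<in>lists (carrier EQ). length vs = m \<longrightarrow>
        nrm (realify L) ((slot_sum (y \<oplus>\<^bsub>E\<^esub> fst d) [] vs \<ominus>\<^bsub>L\<^esub> slot_sum y [] vs) \<ominus>\<^bsub>L\<^esub> slot_sum y [fst d] vs)
          \<le> C3 * (nrm E (fst d))\<^sup>2 * prodnrm EQ vs)"
      using fst_small unfolding filterlim_iff by blast+
    with eventually_small_carrier[of EQ] eventually_small_less[OF \<delta>, of EQ]
    show "\<forall>\<^sub>F d in small EQ. z \<oplus>\<^bsub>EQ\<^esub> d \<in> U \<times> carrier Q \<longrightarrow> (\<forall>vs\<in>lists (carrier EQ). length vs = m \<longrightarrow>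
        nrm (realify L) ((eval_deriv (z \<oplus>\<^bsub>EQ\<^esub> d) vs \<ominus>\<^bsub>realify L\<^esub> eval_deriv z vs) \<ominus>\<^bsub>realify L\<^esub> eval_deriv z (d # vs))
          \<le> \<epsilon> * nrm EQ d * prodnrm EQ vs)"
    proof eventually_elim
      case (elim d)
      obtain h l where d: "d = (h, l)" by (cases d)
      have h: "h \<in> carrier E" and l: "l \<in> carrier Q" using elim(1) by (auto simp: d)
      have yh: "y \<oplus>\<^bsub>E\<^esub> h \<in> U" using elim(3) by (simp add: d)
      define t where "t = nrm EQ d"
      have t: "nrm E h \<le> t" "nrm Q l \<le> t" "0 \<le> t" "t \<le> 1" "K * t \<le> \<epsilon>"
      proof -
        show "nrm E h \<le> t" "nrm Q l \<le> t" unfolding t_def d by (rule P.nrm_fst_le P.nrm_snd_le)+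
        then show "0 \<le> t" using B.E.nrm_nonneg[OF h] by linarith
        have "t < min 1 (\<epsilon> / K)" using elim(2) by (simp add: t_def)
        then show "t \<le> 1" "K * t \<le> \<epsilon>" using K by (auto simp: field_simps)
      qed
      have hsq: "(nrm E h)\<^sup>2 \<le> t * t" using t h by (simp add: power2_eq_square mult_mono)
      show ?case
      proof (intro impI ballI)
        fix vs assume vs: "vs \<in> lists (carrier EQ)" "length vs = m"
        note F = map_fst_lists[OF vs(1)]
        let ?F = "map fst vs" and ?P = "prodnrm EQ vs"
        have F0: "0 \<le> prodnrm E ?F" "prodnrm E ?F \<le> ?P" "0 \<le> ?P"
          using B.E.prodnrm_nonneg[OF F] prodnrm_map_fst[OF vs(1)] P.P.prodnrm_nonneg[OF vs(1)] by auto
        \<comment> \<open>The increment of \<open>k\<close> enters in \<open>e2\<close> only, where it multiplies an increment of the operator.\<close>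
        let ?e1 = "(D k (y \<oplus>\<^bsub>E\<^esub> h) ?F \<ominus>\<^bsub>L\<^esub> D k y ?F) \<ominus>\<^bsub>L\<^esub> D k y (h # ?F)"
        let ?e2 = "D l (y \<oplus>\<^bsub>E\<^esub> h) ?F \<ominus>\<^bsub>L\<^esub> D l y ?F"
        let ?e3 = "(slot_sum (y \<oplus>\<^bsub>E\<^esub> h) [] vs \<ominus>\<^bsub>L\<^esub> slot_sum y [] vs) \<ominus>\<^bsub>L\<^esub> slot_sum y [h] vs"
        have cl: "D k (y \<oplus>\<^bsub>E\<^esub> h) ?F \<in> carrier L" "D k y ?F \<in> carrier L" "D k y (h # ?F) \<in> carrier L"
          "D l (y \<oplus>\<^bsub>E\<^esub> h) ?F \<in> carrier L" "D l y ?F \<in> carrier L" "D l y (h # ?F) \<in> carrier L"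
          "slot_sum (y \<oplus>\<^bsub>E\<^esub> h) [] vs \<in> carrier L" "slot_sum y [] vs \<in> carrier L" "slot_sum y [h] vs \<in> carrier L"
          using D_closed[OF k] D_closed[OF l] y yh h F slot_sum_closed[OF y _ vs(1)] slot_sum_closed[OF yh _ vs(1)] by simp_all
        have taylor: "nrm (realify L) ((D k (y \<oplus>\<^bsub>E\<^esub> h) ?F \<ominus>\<^bsub>L\<^esub> D k y ?F) \<ominus>\<^bsub>L\<^esub> D k y (h # ?F)) \<le> C2 * (t * t) * ?P * nrm Q k"
          if k: "k \<in> carrier Q" for k
        proof -
          have "nrm (realify L) ((D k (y \<oplus>\<^bsub>E\<^esub> h) ?F \<ominus>\<^bsub>L\<^esub> D k y ?F) \<ominus>\<^bsub>L\<^esub> D k y (h # ?F))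
              \<le> C2 * (nrm E h)\<^sup>2 * prodnrm E ?F * nrm Q k"
            using elim(3)[THEN conjunct2, rule_format, OF F _ k] vs(2) by (simp add: d)
          also have "\<dots> \<le> C2 * (t * t) * ?P * nrm Q k"
            using C2 hsq F0 k by (intro mult_mono mult_right_mono mult_left_mono) auto
          finally show ?thesis .
        qed
        have e1: "nrm (realify L) ?e1 \<le> C2 * (t * t) * ?P * nrm Q k" by (rule taylor[OF k])
        have e2: "nrm (realify L) ?e2 \<le> (C2 + C1) * (t * t) * ?P"
        proof -
          have "nrm (realify L) ?e2 \<le> nrm (realify L) (D l y (h # ?F)) + nrm (realify L) (?e2 \<ominus>\<^bsub>L\<^esub> D l y (h # ?F))"
            using B.F.nrm_le_add_diff[of ?e2 "D l y (h # ?F)"] cl by simp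
          also have "nrm (realify L) (D l y (h # ?F)) \<le> C1 * (nrm E h * prodnrm E ?F) * nrm Q l"
            using C1(2)[of "h # ?F" l] F vs h l by simp
          also have "\<dots> \<le> C1 * (t * ?P) * t"
            using C1 t F0 h l by (intro mult_mono mult_left_mono mult_nonneg_nonneg) auto
          also have "nrm (realify L) (?e2 \<ominus>\<^bsub>L\<^esub> D l y (h # ?F)) \<le> C2 * (t * t) * ?P * nrm Q l"
            by (rule taylor[OF l])
          also have "\<dots> \<le> C2 * (t * t) * ?P * 1"
            using C2 t F0 l by (intro mult_left_mono) auto
          finally show ?thesis by (simp add: algebra_simps)
        qed
        have e3: "nrm (realify L) ?e3 \<le> C3 * (t * t) * ?P"
        proof -
          have "nrm (realify L) ?e3 \<le> C3 * (nrm E h)\<^sup>2 * ?P" using elim(4)[THEN conjunct2, rule_format, OF vs] by (simp add: d)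
          also have "\<dots> \<le> C3 * (t * t) * ?P"
            using C3 hsq F0 by (intro mult_right_mono mult_left_mono) auto
          finally show ?thesis .
        qed
        have eq: "(eval_deriv (z \<oplus>\<^bsub>EQ\<^esub> d) vs \<ominus>\<^bsub>L\<^esub> eval_deriv z vs) \<ominus>\<^bsub>L\<^esub> eval_deriv z (d # vs) = ?e1 \<oplus>\<^bsub>L\<^esub> (?e2 \<oplus>\<^bsub>L\<^esub> ?e3)"
          using cl D_add[OF yh k l F] by (simp add: eval_deriv_def z d minus_eq minus_add a_ac)
        have "nrm (realify L) (?e1 \<oplus>\<^bsub>L\<^esub> (?e2 \<oplus>\<^bsub>L\<^esub> ?e3)) \<le> nrm (realify L) ?e1 + (nrm (realify L) ?e2 + nrm (realify L) ?e3)"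
          using B.F.nrm_triangle[of ?e1 "?e2 \<oplus>\<^bsub>L\<^esub> ?e3"] B.F.nrm_triangle[of ?e2 ?e3] cl by simp
        then have "nrm (realify L) ((eval_deriv (z \<oplus>\<^bsub>EQ\<^esub> d) vs \<ominus>\<^bsub>L\<^esub> eval_deriv z vs) \<ominus>\<^bsub>L\<^esub> eval_deriv z (d # vs))
            \<le> C2 * (t * t) * ?P * nrm Q k + ((C2 + C1) * (t * t) * ?P + C3 * (t * t) * ?P)"
          unfolding eq using e1 e2 e3 by linarith
        also have "\<dots> = (K * t) * (t * ?P)" by (simp add: K_def algebra_simps)
        also have "\<dots> \<le> \<epsilon> * (t * ?P)" using t F0 by (intro mult_right_mono) auto
        finally show "nrm (realify L) ((eval_deriv (z \<oplus>\<^bsub>EQ\<^esub> d) vs \<ominus>\<^bsub>realify L\<^esub> eval_deriv z vs) \<ominus>\<^bsub>realify L\<^esub> eval_deriv z (d # vs))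
            \<le> \<epsilon> * nrm EQ d * ?P"
          by (simp add: t_def)
      qed
    qed
  qed
qed

end

text \<open>Strong smoothness implies smoothness for the operator norm, which is what differentiating in the
  second variable requires.\<close>

theorem smooth_on_eval:
  assumes E: "Banach E" and Q: "Banach Q" and L: "hilbert L" and U: "openin (vtop E) U"
    and A: "\<And>y. y \<in> U \<Longrightarrow> bounded_lin Q (realify L) (A y)"
    and smooth: "\<And>k. k \<in> carrier Q \<Longrightarrow> smooth_on E (realify L) U (\<lambda>y. A y k)"
  shows "smooth_on (prod_space E Q) (realify L) (U \<times> carrier Q) (\<lambda>(y, k). A y k)"
proof -
  interpret L: hilbert L by fact
  have "\<forall>k\<in>carrier Q. \<exists>D. (\<forall>y\<in>U. D y [] = A y k) \<and> smooth_derivs E (realify L) U D"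
    using smooth unfolding smooth_on_iff by blast
  then obtain D where D: "\<And>k y. k \<in> carrier Q \<Longrightarrow> y \<in> U \<Longrightarrow> D k y [] = A y k"
    "\<And>k. k \<in> carrier Q \<Longrightarrow> smooth_derivs E (realify L) U (D k)" by metis
  interpret evaluation Q E L U A D
    using E Q L U A D L.Banach_realify
    by (simp add: evaluation_def evaluation_axioms_def Banach_maps_def Banach_maps_axioms_def)
  have "openin (vtop EQ) (U \<times> carrier Q)"
    unfolding P.vtop_prod using U Q.openin_carrier by (simp add: openin_prod_Times_iff)
  then interpret C: Banach_maps EQ "realify L" "U \<times> carrier Q" by unfold_locales
  show ?thesis
  proof (rule C.smooth_onI[OF smooth_derivs_eval])
    fix z assume "z \<in> U \<times> carrier Q"
    then show "eval_deriv z [] = (case z of (y, k) \<Rightarrow> A y k)"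
      using D_closed[of "snd z" "fst z" "[]"] by (auto simp: eval_deriv_def D_Nil)
  qed
qed

section \<open>Unitary operators\<close>

locale unitary_map = H: hilbert H + K: hilbert K
  for H :: "'a hspace" and K :: "'b hspace" +
  fixes A :: "'a \<Rightarrow> 'b"
  assumes unitary: "unitary_operator H K A"
begin

lemma bij: "bij_betw A (carrier H) (carrier K)"
  and add: "x \<in> carrier H \<Longrightarrow> y \<in> carrier H \<Longrightarrow> A (x \<oplus>\<^bsub>H\<^esub> y) = A x \<oplus>\<^bsub>K\<^esub> A y"
  and smult: "x \<in> carrier H \<Longrightarrow> A (c \<odot>\<^bsub>H\<^esub> x) = c \<odot>\<^bsub>K\<^esub> A x"
  and inner: "x \<in> carrier H \<Longrightarrow> y \<in> carrier H \<Longrightarrow> cinner K (A x) (A y) = cinner H x y"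
  using unitary unfolding unitary_operator_def bounded_operator_def by blast+

lemma closed: "x \<in> carrier H \<Longrightarrow> A x \<in> carrier K"
  using bij by (auto simp: bij_betw_def)

lemma nrm: "x \<in> carrier H \<Longrightarrow> nrm (realify K) (A x) = nrm (realify H) x"
  by (simp add: nrm_realify_cinner inner)

lemma bounded_operator: "bounded_operator H K A"
  using unitary by (simp add: unitary_operator_def)

lemma bounded_lin: "bounded_lin (realify H) (realify K) A"
  unfolding bounded_lin_def by (auto simp: closed add smult nrm intro!: exI[of _ 1])

abbreviation adj :: "'b \<Rightarrow> 'a" where
  "adj \<equiv> adjoint_op H K A"

text \<open>The inverse satisfies the equation that characterises the adjoint, because inner products are preserved.\<close>

lemma adj_eq: "y \<in> carrier K \<Longrightarrow> adj y = inv_into (carrier H) A y"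
proof -
  assume y: "y \<in> carrier K"
  define x where "x = inv_into (carrier H) A y"
  have x: "x \<in> carrier H" "A x = y"
    using bij y by (auto simp: x_def bij_betw_def inv_into_into f_inv_into_f)
  have "adj y = x"
    unfolding adjoint_op_def
  proof (rule the_equality)
    show "x \<in> carrier H \<and> (\<forall>z\<in>carrier H. cinner K (A z) y = cinner H z x)"
      using x inner by force
  next
    fix x' assume x': "x' \<in> carrier H \<and> (\<forall>z\<in>carrier H. cinner K (A z) y = cinner H z x')"
    show "x' = x"
    proof (rule H.eq_by_rinner)
      fix w assume w: "w \<in> carrier H"
      have "cinner H w x' = cinner H w x" using x' x w inner by metis
      then have "H.rinner w x' = H.rinner w x" by (simp add: H.rinner_def)
      then show "H.rinner x' w = H.rinner x w"
        using x x' w by (simp add: H.rinner_commute[of w])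
    qed (use x x' in auto)
  qed
  then show ?thesis by (simp add: x_def)
qed

lemma adj_closed: "y \<in> carrier K \<Longrightarrow> adj y \<in> carrier H"
  and A_adj: "y \<in> carrier K \<Longrightarrow> A (adj y) = y"
  and adj_A: "x \<in> carrier H \<Longrightarrow> adj (A x) = x"
  using bij closed by (auto simp: adj_eq bij_betw_def inv_into_into f_inv_into_f)

lemma unitary_adj: "unitary_operator K H adj"
proof -
  have eqI: "a = b" if "A a = A b" "a \<in> carrier H" "b \<in> carrier H" for a b
    using bij that by (auto simp: bij_betw_def inj_on_def)
  have b: "bij_betw adj (carrier K) (carrier H)"
    by (rule bij_betw_byWitness[where f' = A]) (auto simp: A_adj adj_A adj_closed closed)
  have i: "cinner H (adj x) (adj y) = cinner K x y" if "x \<in> carrier K" "y \<in> carrier K" for x y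
    using inner[of "adj x" "adj y"] that by (simp add: adj_closed A_adj)
  have "bounded_operator K H adj"
    unfolding bounded_operator_def
  proof (intro conjI ballI allI exI[of _ 1])
    show "adj (x \<oplus>\<^bsub>K\<^esub> y) = adj x \<oplus>\<^bsub>H\<^esub> adj y" if "x \<in> carrier K" "y \<in> carrier K" for x y
      by (rule eqI) (use that in \<open>simp_all add: A_adj add adj_closed\<close>)
    show "adj (c \<odot>\<^bsub>K\<^esub> x) = c \<odot>\<^bsub>H\<^esub> adj x" if "x \<in> carrier K" for c x
      by (rule eqI) (use that in \<open>simp_all add: A_adj smult adj_closed\<close>)
  qed (auto simp: adj_closed nrm_realify_cinner i)
  then show ?thesis unfolding unitary_operator_def using b i by blast
qed

end

lemma unitary_comp:
  assumes K: "hilbert K" and H: "hilbert H" and L: "hilbert L"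
    and A: "unitary_operator K H A" and B: "unitary_operator H L B"
  shows "unitary_operator K L (B \<circ> A)"
proof -
  interpret A: unitary_map K H A using K H A by (simp add: unitary_map_def unitary_map_axioms_def)
  interpret B: unitary_map H L B using L H B by (simp add: unitary_map_def unitary_map_axioms_def)
  have "bounded_operator K L (B \<circ> A)"
    unfolding bounded_operator_def
    by (intro conjI ballI allI exI[of _ 1]) (auto simp: A.closed B.closed A.add B.add A.smult B.smult A.nrm B.nrm)
  then show ?thesis
    unfolding unitary_operator_def using bij_betw_trans[OF A.bij B.bij] A.closed A.inner B.inner by simp
qed

text \<open>Isometries are equicontinuous, so it is enough to control the parameter at a fixed vector.\<close>

lemma continuous_map_isometries:
  assumes Q: "Banach Q" and F: "Banach F"
    and lin: "\<And>q. q \<in> topspace Z \<Longrightarrow> bounded_lin Q F (A q)"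
    and iso: "\<And>q k. q \<in> topspace Z \<Longrightarrow> k \<in> carrier Q \<Longrightarrow> nrm F (A q k) = nrm Q k"
    and cont: "\<And>k. k \<in> carrier Q \<Longrightarrow> continuous_map Z (vtop F) (\<lambda>q. A q k)"
  shows "continuous_map (prod_topology Z (vtop Q)) (vtop F) (\<lambda>(q, k). A q k)"
proof -
  interpret Q: Banach Q by fact
  interpret F: Banach F by fact
  show ?thesis
    unfolding vtop_def[of F] F.metric.continuous_map_to_metric
  proof (intro ballI allI impI)
    fix z and \<epsilon> :: real assume z: "z \<in> topspace (prod_topology Z (vtop Q))" and \<epsilon>: "\<epsilon> > 0"
    then obtain q k where qk: "z = (q, k)" "q \<in> topspace Z" "k \<in> carrier Q" by auto
    define O1 where "O1 = {q' \<in> topspace Z. A q' k \<in> F.metric.mball (A q k) (\<epsilon> / 2)}"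
    have "openin Z O1"
      unfolding O1_def using cont[OF qk(3)] by (intro openin_continuous_map_preimage) (auto simp: vtop_def)
    moreover have "openin (vtop Q) (Q.metric.mball k (\<epsilon> / 2))" by (simp add: vtop_def)
    ultimately have "openin (prod_topology Z (vtop Q)) (O1 \<times> Q.metric.mball k (\<epsilon> / 2))"
      by (simp add: openin_prod_Times_iff)
    moreover have "z \<in> O1 \<times> Q.metric.mball k (\<epsilon> / 2)"
      using qk \<epsilon> bounded_linD(1)[OF lin[OF qk(2)] qk(3)] by (auto simp: O1_def)
    moreover have "(case y of (q, k) \<Rightarrow> A q k) \<in> F.metric.mball (case z of (q, k) \<Rightarrow> A q k) \<epsilon>"
      if y: "y \<in> O1 \<times> Q.metric.mball k (\<epsilon> / 2)" for y
    proof -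
      obtain q' k' where y: "y = (q', k')" "q' \<in> O1" "k' \<in> Q.metric.mball k (\<epsilon> / 2)" using y by auto
      have q': "q' \<in> topspace Z" and k': "k' \<in> carrier Q" using y by (auto simp: O1_def)
      note c = bounded_linD(1)[OF lin[OF q'] k'] bounded_linD(1)[OF lin[OF q'] qk(3)] bounded_linD(1)[OF lin[OF qk(2)] qk(3)]
      have "A q' k \<ominus>\<^bsub>F\<^esub> A q' k' = A q' (k \<ominus>\<^bsub>Q\<^esub> k')"
        using bounded_lin_diff[OF Q F lin[OF q'] qk(3) k'] by simp
      then have "vdist F (A q' k) (A q' k') = vdist Q k k'"
        using c iso[OF q'] qk k' by (simp add: vdist_def)
      then have "vdist F (A q k) (A q' k') < \<epsilon>"
        using F.metric.triangle[OF c(3,2,1)] y by (auto simp: O1_def)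
      then show ?thesis using c by (simp add: y qk)
    qed
    ultimately show "\<exists>W. openin (prod_topology Z (vtop Q)) W \<and> z \<in> W \<and>
        (\<forall>y\<in>W. (case y of (q, k) \<Rightarrow> A q k) \<in> F.metric.mball (case z of (q, k) \<Rightarrow> A q k) \<epsilon>)"
      by blast
  qed
qed

section \<open>Linear maps between products and copies\<close>

context Banach2
begin

lemma bounded_lin_fst: "bounded_lin (prod_space E F) E fst"
  unfolding bounded_lin_def by (auto simp del: prod_space_simps(5) intro!: exI[of _ 1] simp: nrm_fst_le)

lemma bounded_lin_snd: "bounded_lin (prod_space E F) F snd"
  unfolding bounded_lin_def by (auto simp del: prod_space_simps(5) intro!: exI[of _ 1] simp: nrm_snd_le)

lemma bounded_lin_Pair_zero: "bounded_lin E (prod_space E F) (\<lambda>x. (x, \<zero>\<^bsub>F\<^esub>))"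
  unfolding bounded_lin_def by (auto intro!: exI[of _ 1])

end

context pushed_Banach
begin

lemma bounded_lin_push: "bounded_lin E (push e E) e"
  unfolding bounded_lin_def by (auto intro!: exI[of _ 1])

lemma bounded_lin_unpush: "bounded_lin (push e E) E (inv_into UNIV e)"
  unfolding bounded_lin_def using inj by (auto intro!: exI[of _ 1])

lemma homeomorphic_map_push: "homeomorphic_map (vtop E) (vtop (push e E)) e"
proof (rule bijective_open_imp_homeomorphic_map)
  show "continuous_map (vtop E) (vtop (push e E)) e"
    unfolding continuous_map_def
  proof (intro conjI allI impI)
    fix W assume W: "openin (vtop (push e E)) W"
    have "W \<subseteq> e ` carrier E" using W P.openin_vtop by simp
    then have "W = e ` {x \<in> topspace (vtop E). e x \<in> W}" by auto
    then show "openin (vtop E) {x \<in> topspace (vtop E). e x \<in> W}"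
      using openin_push[of "{x \<in> topspace (vtop E). e x \<in> W}"] W by auto
  qed auto
  show "open_map (vtop E) (vtop (push e E)) e"
    unfolding open_map_def using openin_push openin_vtop by auto
  show "e ` topspace (vtop E) = topspace (vtop (push e E))" by simp
  show "inj_on e (topspace (vtop E))" using inj by (rule inj_on_subset) simp
qed

end

section \<open>Trivialisations and their transition functions\<close>

(* From here on the coordinate space enters only as a Banach space. *)
declare Rn_simps [simp del]

lemma smooth_on_cong_iff: "(\<And>x. x \<in> U \<Longrightarrow> f x = g x) \<Longrightarrow> smooth_on E F U f \<longleftrightarrow> smooth_on E F U g"
  by (metis smooth_on_cong)

locale hilbert_bundle_data =
  fixes N :: "('n, nat \<Rightarrow> real) mfd" and n :: nat and H :: "'h set" and p :: "'h \<Rightarrow> 'n"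
    and \<H> :: "'n \<Rightarrow> 'h hspace" and I :: "'i set" and U :: "'i \<Rightarrow> 'n set" and \<K> :: "'i \<Rightarrow> 'k hspace"
    and T :: "'i \<Rightarrow> 'n \<Rightarrow> 'h \<Rightarrow> 'k"
  assumes manifold: "smooth_manifold n N"
    and hfield: "hilbert_field H (topspace (mtop N)) p \<H>"
    and U_open: "\<And>i. i \<in> I \<Longrightarrow> openin (mtop N) (U i)"
    and U_cover: "(\<Union>i\<in>I. U i) = topspace (mtop N)"
    and fibres: "\<And>i. i \<in> I \<Longrightarrow> hilbert_space (\<K> i)"
    and T_unitary: "\<And>i q. i \<in> I \<Longrightarrow> q \<in> U i \<Longrightarrow> unitary_operator (\<H> q) (\<K> i) (T i q)"
begin

abbreviation "RK i \<equiv> prod_space (Rn n) (realify (\<K> i))"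

lemma hilbert_K: "i \<in> I \<Longrightarrow> hilbert (\<K> i)"
  using fibres by (simp add: hilbert_def)

lemma Banach_K: "i \<in> I \<Longrightarrow> Banach (realify (\<K> i))"
  using hilbert_K hilbert.Banach_realify by blast

lemma Banach2_RK: "i \<in> I \<Longrightarrow> Banach2 (Rn n) (realify (\<K> i))"
  using Banach_K Banach_Rn by (simp add: Banach2_def)

lemma Banach_RK: "i \<in> I \<Longrightarrow> Banach (RK i)"
  using Banach2_RK Banach2.Banach_prod by blast

lemma U_topspace: "i \<in> I \<Longrightarrow> q \<in> U i \<Longrightarrow> q \<in> topspace (mtop N)"
  using U_cover by blast

lemma carrier_fibre: "q \<in> topspace (mtop N) \<Longrightarrow> carrier (\<H> q) = {x \<in> H. p x = q}"
  using hfield by (simp add: hilbert_field_def)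

lemma p_topspace: "x \<in> H \<Longrightarrow> p x \<in> topspace (mtop N)"
  using hfield by (auto simp: hilbert_field_def)

lemma unitary_map: "i \<in> I \<Longrightarrow> q \<in> U i \<Longrightarrow> unitary_map (\<H> q) (\<K> i) (T i q)"
  using T_unitary U_topspace fibres hfield
  by (simp add: unitary_map_def unitary_map_axioms_def hilbert_def hilbert_field_def)

definition Tinv :: "'i \<Rightarrow> 'n \<Rightarrow> 'k \<Rightarrow> 'h" where
  "Tinv i q = adjoint_op (\<H> q) (\<K> i) (T i q)"

abbreviation "\<tau> \<equiv> transition \<H> \<K> T"

lemma \<tau>_eq: "\<tau> i j q k = T j q (Tinv i q k)"
  by (simp add: transition_def Tinv_def)

context
  fixes i q assumes i: "i \<in> I" and q: "q \<in> U i"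
begin

interpretation T: unitary_map "\<H> q" "\<K> i" "T i q"
  by (rule unitary_map[OF i q])

lemma Tinv_H: "k \<in> carrier (\<K> i) \<Longrightarrow> Tinv i q k \<in> H" "k \<in> carrier (\<K> i) \<Longrightarrow> p (Tinv i q k) = q"
  using T.adj_closed carrier_fibre[OF U_topspace[OF i q]] by (auto simp: Tinv_def)

lemma T_Tinv: "k \<in> carrier (\<K> i) \<Longrightarrow> T i q (Tinv i q k) = k"
  by (simp add: Tinv_def T.A_adj)

lemma T_closed: "x \<in> H \<Longrightarrow> p x = q \<Longrightarrow> T i q x \<in> carrier (\<K> i)"
  using T.closed carrier_fibre[OF U_topspace[OF i q]] by auto

lemma Tinv_T: "x \<in> H \<Longrightarrow> p x = q \<Longrightarrow> Tinv i q (T i q x) = x"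
  using T.adj_A carrier_fibre[OF U_topspace[OF i q]] by (auto simp: Tinv_def)

lemma unitary_Tinv: "unitary_operator (\<K> i) (\<H> q) (Tinv i q)"
  unfolding Tinv_def by (rule T.unitary_adj)

end

lemma unitary_\<tau>:
  assumes "i \<in> I" "j \<in> I" "q \<in> U i \<inter> U j"
  shows "unitary_map (\<K> i) (\<K> j) (\<tau> i j q)"
proof -
  interpret A: unitary_map "\<H> q" "\<K> j" "T j q" using assms by (intro unitary_map) auto
  have "unitary_operator (\<K> i) (\<K> j) (T j q \<circ> Tinv i q)"
    by (rule unitary_comp[OF hilbert_K A.H.hilbert_axioms hilbert_K]) (use assms unitary_Tinv A.unitary in auto)
  moreover have "\<tau> i j q = T j q \<circ> Tinv i q" by (auto simp: \<tau>_eq)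
  ultimately show ?thesis
    using assms hilbert_K by (simp add: unitary_map_def unitary_map_axioms_def)
qed

lemma \<tau>_\<tau>:
  assumes "i \<in> I" "j \<in> I" "q \<in> U i \<inter> U j" "k \<in> carrier (\<K> j)"
  shows "\<tau> i j q (\<tau> j i q k) = k"
  using assms Tinv_H[of j q k] Tinv_T[of i q "Tinv j q k"] T_Tinv[of j q k] by (simp add: \<tau>_eq)

lemma adjoint_\<tau>:
  assumes "i \<in> I" "j \<in> I" "q \<in> U i \<inter> U j" "k \<in> carrier (\<K> j)"
  shows "adjoint_op (\<K> i) (\<K> j) (\<tau> i j q) k = \<tau> j i q k"
proof -
  interpret A: unitary_map "\<K> i" "\<K> j" "\<tau> i j q" using assms by (intro unitary_\<tau>)
  interpret B: unitary_map "\<K> j" "\<K> i" "\<tau> j i q" using assms by (intro unitary_\<tau>) auto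
  show ?thesis
    using A.adj_A[OF B.closed[OF assms(4)]] \<tau>_\<tau>[OF assms] by simp
qed

context
  fixes W \<phi> E assumes chart: "(W, \<phi>, E) \<in> atlas N"
begin

lemma chart_model: "E = Rn n"
  using manifold chart unfolding smooth_manifold_def by blast

lemma chart_facts: "openin (mtop N) W \<and> openin (vtop (Rn n)) (\<phi> ` W) \<and>
    homeomorphic_map (subtopology (mtop N) W) (subtopology (vtop (Rn n)) (\<phi> ` W)) \<phi>"
  using manifold chart chart_model unfolding smooth_manifold_def banach_manifold_def by fast

lemma chart_open: "openin (mtop N) W" and chart_image: "openin (vtop (Rn n)) (\<phi> ` W)"
  and chart_homeo: "homeomorphic_map (subtopology (mtop N) W) (subtopology (vtop (Rn n)) (\<phi> ` W)) \<phi>"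
  using chart_facts by blast+

lemma chart_topspace: "W \<subseteq> topspace (mtop N)"
  using chart_open openin_subset by blast

lemma chart_inj: "inj_on \<phi> W"
  using homeomorphic_imp_injective_map[OF chart_homeo] chart_topspace by (simp add: Int_absorb1)

lemma chart_inv: "q \<in> W \<Longrightarrow> inv_into W \<phi> (\<phi> q) = q"
  using chart_inj by simp

lemma chart_open_image: "openin (mtop N) S \<Longrightarrow> S \<subseteq> W \<Longrightarrow> openin (vtop (Rn n)) (\<phi> ` S)"
proof -
  assume S: "openin (mtop N) S" "S \<subseteq> W"
  then have "openin (subtopology (mtop N) W) S"
    using chart_open by (simp add: openin_open_subtopology)
  then have "openin (subtopology (vtop (Rn n)) (\<phi> ` W)) (\<phi> ` S)"
    using homeomorphic_imp_open_map[OF chart_homeo] by (simp add: open_map_def)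
  then show ?thesis using chart_image by (simp add: openin_open_subtopology)
qed

lemma chart_carrier: "q \<in> W \<Longrightarrow> \<phi> q \<in> carrier (Rn n)"
  using Banach_Rn[of n] Normed.openin_vtop[of "Rn n" "\<phi> ` W"] chart_image by (auto simp: Banach_def)

lemma chart_transition:
  assumes "(W', \<phi>', E') \<in> atlas N"
  shows "smooth_on (Rn n) (Rn n) (\<phi> ` (W \<inter> W')) (\<lambda>y. \<phi>' (inv_into W \<phi> y))"
proof -
  have "E' = Rn n" using manifold assms unfolding smooth_manifold_def by blast
  moreover have "smooth_on E E' (\<phi> ` (W \<inter> W')) (\<phi>' \<circ> inv_into W \<phi>)"
    using manifold chart assms unfolding smooth_manifold_def banach_manifold_def by fast
  ultimately show ?thesis using chart_model by (simp add: comp_def)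
qed

end

lemma charts_cover: "q \<in> topspace (mtop N) \<Longrightarrow> \<exists>W \<phi>. (W, \<phi>, Rn n) \<in> atlas N \<and> q \<in> W"
proof -
  assume "q \<in> topspace (mtop N)"
  moreover have "(\<Union>(W, \<phi>, E)\<in>atlas N. W) = topspace (mtop N)"
    using manifold unfolding smooth_manifold_def banach_manifold_def by blast
  ultimately obtain W \<phi> E where "(W, \<phi>, E) \<in> atlas N" "q \<in> W" by blast
  then show ?thesis using chart_model by blast
qed

text \<open>The values of \<open>f\<close> on \<open>S\<close> lie in \<open>K\<close>, so its coordinate expression in a chart with domain \<open>W\<close> is defined on the
  whole image of \<open>W \<inter> S\<close>.\<close>

lemma Cinf_iff:
  assumes S: "openin (mtop N) S" and K: "hilbert K"
  shows "f \<in> Cinf N S K \<longleftrightarrow> continuous_map (subtopology (mtop N) S) (vtop (realify K)) f \<and>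
    (\<forall>W \<phi>. (W, \<phi>, Rn n) \<in> atlas N \<longrightarrow> smooth_on (Rn n) (realify K) (\<phi> ` (W \<inter> S)) (\<lambda>y. f (inv_into W \<phi> y)))"
proof -
  interpret K: hilbert K by fact
  have chartwise: "smooth_on E (realify K) (\<phi> ` (W \<inter> S \<inter> f -` carrier K)) (id \<circ> f \<circ> inv_into (W \<inter> S) \<phi>)
      \<longleftrightarrow> smooth_on (Rn n) (realify K) (\<phi> ` (W \<inter> S)) (\<lambda>y. f (inv_into W \<phi> y))"
    if c: "(W, \<phi>, E) \<in> atlas N" and cont: "continuous_map (subtopology (mtop N) S) (vtop (realify K)) f" for W \<phi> E
  proof -
    have "f q \<in> carrier K" if "q \<in> S" for q
      using continuous_map_image_subset_topspace[OF cont] openin_subset[OF S] that by auto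
    then have dom: "W \<inter> S \<inter> f -` carrier K = W \<inter> S" by auto
    have inv: "inv_into (W \<inter> S) \<phi> (\<phi> q) = inv_into W \<phi> (\<phi> q)" if "q \<in> W \<inter> S" for q
      using that chart_inj[OF c] by (simp add: inj_on_Int)
    have "smooth_on (Rn n) (realify K) (\<phi> ` (W \<inter> S)) (id \<circ> f \<circ> inv_into (W \<inter> S) \<phi>)
        \<longleftrightarrow> smooth_on (Rn n) (realify K) (\<phi> ` (W \<inter> S)) (\<lambda>y. f (inv_into W \<phi> y))"
    proof (rule smooth_on_cong_iff)
      fix y assume "y \<in> \<phi> ` (W \<inter> S)"
      then obtain q where "y = \<phi> q" "q \<in> W \<inter> S" by blast
      then show "(id \<circ> f \<circ> inv_into (W \<inter> S) \<phi>) y = f (inv_into W \<phi> y)" by (simp only: inv comp_apply id_apply)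
    qed
    then show ?thesis by (simp only: dom chart_model[OF c])
  qed
  have "f \<in> Cinf N S K \<longleftrightarrow> continuous_map (subtopology (mtop N) S) (vtop (realify K)) f \<and>
      (\<forall>c\<in>atlas N. case c of (W, \<phi>, E) \<Rightarrow>
        smooth_on E (realify K) (\<phi> ` (W \<inter> S \<inter> f -` carrier K)) (id \<circ> f \<circ> inv_into (W \<inter> S) \<phi>))"
    unfolding Cinf_def smooth_map_def open_submfd_def space_mfd_def by (simp add: case_prod_unfold)
  also have "\<dots> \<longleftrightarrow> continuous_map (subtopology (mtop N) S) (vtop (realify K)) f \<and>
    (\<forall>W \<phi>. (W, \<phi>, Rn n) \<in> atlas N \<longrightarrow> smooth_on (Rn n) (realify K) (\<phi> ` (W \<inter> S)) (\<lambda>y. f (inv_into W \<phi> y)))"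
  proof (intro conj_cong refl iffI allI impI ballI)
    fix W \<phi> assume cont: "continuous_map (subtopology (mtop N) S) (vtop (realify K)) f" and c: "(W, \<phi>, Rn n) \<in> atlas N"
      and *: "\<forall>c\<in>atlas N. case c of (W, \<phi>, E) \<Rightarrow>
        smooth_on E (realify K) (\<phi> ` (W \<inter> S \<inter> f -` carrier K)) (id \<circ> f \<circ> inv_into (W \<inter> S) \<phi>)"
    show "smooth_on (Rn n) (realify K) (\<phi> ` (W \<inter> S)) (\<lambda>y. f (inv_into W \<phi> y))"
      unfolding chartwise[OF c cont, symmetric] using *[rule_format, OF c] by simp
  next
    fix c assume cont: "continuous_map (subtopology (mtop N) S) (vtop (realify K)) f" and c: "c \<in> atlas N"
      and *: "\<forall>W \<phi>. (W, \<phi>, Rn n) \<in> atlas N \<longrightarrow> smooth_on (Rn n) (realify K) (\<phi> ` (W \<inter> S)) (\<lambda>y. f (inv_into W \<phi> y))"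
    obtain W \<phi> E where cc: "c = (W, \<phi>, E)" by (cases c)
    then have c': "(W, \<phi>, E) \<in> atlas N" using c by simp
    have "(W, \<phi>, Rn n) \<in> atlas N" using c' chart_model[OF c'] by simp
    then have "smooth_on (Rn n) (realify K) (\<phi> ` (W \<inter> S)) (\<lambda>y. f (inv_into W \<phi> y))" using * by blast
    then show "case c of (W, \<phi>, E) \<Rightarrow>
        smooth_on E (realify K) (\<phi> ` (W \<inter> S \<inter> f -` carrier K)) (id \<circ> f \<circ> inv_into (W \<inter> S) \<phi>)"
      unfolding cc prod.case chartwise[OF c' cont] .
  qed
  finally show ?thesis .
qed

lemma Cinf_closed:
  assumes S: "openin (mtop N) S" and K: "hilbert K" and f: "f \<in> Cinf N S K" and q: "q \<in> S"
  shows "f q \<in> carrier K"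
proof -
  interpret K: hilbert K by fact
  have "continuous_map (subtopology (mtop N) S) (vtop (realify K)) f"
    using f by (simp add: Cinf_iff[OF S K])
  then have "f \<in> topspace (subtopology (mtop N) S) \<rightarrow> topspace (vtop (realify K))"
    by (simp add: continuous_map_def)
  then show ?thesis using q openin_subset[OF S] by auto
qed

lemma Cinf_cong:
  assumes S: "openin (mtop N) S" and K: "hilbert K" and f: "f \<in> Cinf N S K" and eq: "\<And>q. q \<in> S \<Longrightarrow> f q = g q"
  shows "g \<in> Cinf N S K"
proof -
  have "smooth_on (Rn n) (realify K) (\<phi> ` (W \<inter> S)) (\<lambda>y. g (inv_into W \<phi> y))" if c: "(W, \<phi>, Rn n) \<in> atlas N" for W \<phi>
  proof (rule smooth_on_cong)
    show "smooth_on (Rn n) (realify K) (\<phi> ` (W \<inter> S)) (\<lambda>y. f (inv_into W \<phi> y))"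
      using f c by (simp add: Cinf_iff[OF S K])
  qed (use eq chart_inv[OF c] in auto)
  moreover have "continuous_map (subtopology (mtop N) S) (vtop (realify K)) g"
    using f eq by - (rule continuous_map_eq[of _ _ f], auto simp: Cinf_iff[OF S K])
  ultimately show ?thesis by (simp add: Cinf_iff[OF S K])
qed

lemma Cinf_const:
  assumes S: "openin (mtop N) S" and K: "hilbert K" and x: "x \<in> carrier K"
  shows "(\<lambda>_. x) \<in> Cinf N S K"
proof -
  interpret K: hilbert K by fact
  show ?thesis
    unfolding Cinf_iff[OF S K]
  proof (intro conjI allI impI)
    fix W \<phi> assume c: "(W, \<phi>, Rn n) \<in> atlas N"
    show "smooth_on (Rn n) (realify K) (\<phi> ` (W \<inter> S)) (\<lambda>y. x)"
      using x S chart_open[OF c] by (intro smooth_on_const Banach_Rn K.Banach_realify chart_open_image[OF c]) auto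
  qed (use x K.real.topspace_vtop in simp)
qed

definition strongly_smooth :: "'i \<Rightarrow> 'i \<Rightarrow> bool" where
  "strongly_smooth i j \<longleftrightarrow> (\<forall>x\<in>carrier (\<K> i). (\<lambda>q. \<tau> i j q x) \<in> Cinf N (U i \<inter> U j) (\<K> j))"

context
  fixes i j assumes i: "i \<in> I" and j: "j \<in> I"
begin

lemma overlap_open: "openin (mtop N) (U i \<inter> U j)"
  using U_open i j by blast

lemma \<tau>_continuous:
  assumes "strongly_smooth i j"
  shows "continuous_map (prod_topology (subtopology (mtop N) (U i \<inter> U j)) (vtop (realify (\<K> i))))
    (vtop (realify (\<K> j))) (\<lambda>(q, k). \<tau> i j q k)"
proof (rule continuous_map_isometries[OF Banach_K[OF i] Banach_K[OF j]])
  fix q assume "q \<in> topspace (subtopology (mtop N) (U i \<inter> U j))"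
  then interpret A: unitary_map "\<K> i" "\<K> j" "\<tau> i j q" using i j by (intro unitary_\<tau>) auto
  show "bounded_lin (realify (\<K> i)) (realify (\<K> j)) (\<tau> i j q)" by (rule A.bounded_lin)
  show "nrm (realify (\<K> j)) (\<tau> i j q k) = nrm (realify (\<K> i)) k" if "k \<in> carrier (realify (\<K> i))" for k
    using A.nrm that by simp
qed (use assms in \<open>auto simp: strongly_smooth_def Cinf_iff[OF overlap_open hilbert_K[OF j]]\<close>)

lemma \<tau>_smooth:
  assumes s: "strongly_smooth i j" and c: "(W, \<phi>, Rn n) \<in> atlas N" and S: "openin (mtop N) S" "S \<subseteq> W \<inter> (U i \<inter> U j)"
  shows "smooth_on (RK i) (realify (\<K> j)) (\<phi> ` S \<times> carrier (\<K> i)) (\<lambda>(y, k). \<tau> i j (inv_into W \<phi> y) k)"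
proof -
  have "smooth_on (RK i) (realify (\<K> j)) (\<phi> ` S \<times> carrier (realify (\<K> i))) (\<lambda>(y, k). \<tau> i j (inv_into W \<phi> y) k)"
  proof (rule smooth_on_eval[OF Banach_Rn Banach_K[OF i] hilbert_K[OF j]])
    show "openin (vtop (Rn n)) (\<phi> ` S)" using S by (intro chart_open_image[OF c]) auto
    fix y assume "y \<in> \<phi> ` S"
    then obtain q where q: "y = \<phi> q" "q \<in> W" "q \<in> U i \<inter> U j" using S by blast
    then have "inv_into W \<phi> y \<in> U i \<inter> U j" by (simp only: chart_inv[OF c])
    then interpret A: unitary_map "\<K> i" "\<K> j" "\<tau> i j (inv_into W \<phi> y)" using i j by (intro unitary_\<tau>)
    show "bounded_lin (realify (\<K> i)) (realify (\<K> j)) (\<tau> i j (inv_into W \<phi> y))" by (rule A.bounded_lin)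
  next
    fix k assume "k \<in> carrier (realify (\<K> i))"
    then have "smooth_on (Rn n) (realify (\<K> j)) (\<phi> ` (W \<inter> (U i \<inter> U j))) (\<lambda>y. \<tau> i j (inv_into W \<phi> y) k)"
      using s c by (simp add: strongly_smooth_def Cinf_iff[OF overlap_open hilbert_K[OF j]])
    then show "smooth_on (Rn n) (realify (\<K> j)) (\<phi> ` S) (\<lambda>y. \<tau> i j (inv_into W \<phi> y) k)"
      by (rule smooth_on_subset) (use S chart_open_image[OF c] in auto)
  qed
  then show ?thesis by simp
qed

text \<open>In a chart, \<open>q \<mapsto> \<tau>(q) (f q)\<close> is the composition of \<open>y \<mapsto> (y, f y)\<close> with the smooth evaluation map.\<close>

lemma \<tau>_apply_Cinf:
  assumes s: "strongly_smooth i j" and f: "f \<in> Cinf N (U i \<inter> U j) (\<K> i)"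
  shows "(\<lambda>q. \<tau> i j q (f q)) \<in> Cinf N (U i \<inter> U j) (\<K> j)"
  unfolding Cinf_iff[OF overlap_open hilbert_K[OF j]]
proof (intro conjI allI impI)
  have fc: "continuous_map (subtopology (mtop N) (U i \<inter> U j)) (vtop (realify (\<K> i))) f"
    using f by (simp add: Cinf_iff[OF overlap_open hilbert_K[OF i]])
  have "continuous_map (subtopology (mtop N) (U i \<inter> U j))
      (prod_topology (subtopology (mtop N) (U i \<inter> U j)) (vtop (realify (\<K> i)))) (\<lambda>q. (q, f q))"
    using fc by (simp add: continuous_map_paired)
  from continuous_map_compose[OF this \<tau>_continuous[OF s]]
  show "continuous_map (subtopology (mtop N) (U i \<inter> U j)) (vtop (realify (\<K> j))) (\<lambda>q. \<tau> i j q (f q))"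
    by (simp add: comp_def)
  fix W \<phi> assume c: "(W, \<phi>, Rn n) \<in> atlas N"
  let ?S = "W \<inter> (U i \<inter> U j)"
  have S: "openin (mtop N) ?S" using chart_open[OF c] overlap_open by blast
  have fs: "smooth_on (Rn n) (realify (\<K> i)) (\<phi> ` ?S) (\<lambda>y. f (inv_into W \<phi> y))"
    using f c by (simp add: Cinf_iff[OF overlap_open hilbert_K[OF i]])
  \<comment> \<open>The identity is smooth, being the transition from a chart to itself.\<close>
  have "smooth_on (Rn n) (Rn n) (\<phi> ` (W \<inter> W)) (\<lambda>y. \<phi> (inv_into W \<phi> y))"
    by (rule chart_transition[OF c c])
  then have "smooth_on (Rn n) (Rn n) (\<phi> ` ?S) (\<lambda>y. \<phi> (inv_into W \<phi> y))"
    by (rule smooth_on_subset) (use chart_open_image[OF c S] in auto)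
  then have "smooth_on (Rn n) (Rn n) (\<phi> ` ?S) (\<lambda>y. y)"
    by (rule smooth_on_cong) (use chart_inv[OF c] in auto)
  note pair = smooth_on_Pair[OF Banach_Rn Banach_Rn Banach_K[OF i] this fs]
  have "f q \<in> carrier (\<K> i)" if "q \<in> U i \<inter> U j" for q
    by (rule Cinf_closed[OF overlap_open hilbert_K[OF i] f that])
  then have "smooth_on (Rn n) (realify (\<K> j)) (\<phi> ` ?S)
      (\<lambda>y. case (y, f (inv_into W \<phi> y)) of (y, k) \<Rightarrow> \<tau> i j (inv_into W \<phi> y) k)"
    by (intro smooth_on_comp[OF Banach_Rn Banach_RK[OF i] hilbert_K[OF j] pair \<tau>_smooth[OF s c S]])
      (use chart_inv[OF c] in auto)
  then show "smooth_on (Rn n) (realify (\<K> j)) (\<phi> ` ?S) (\<lambda>y. \<tau> i j (inv_into W \<phi> y) (f (inv_into W \<phi> y)))"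
    by simp
qed

text \<open>A constant function lies in \<^const>\<open>Pinf\<close>: it is one vector with the coefficient \<open>1\<close>.\<close>

lemma strongly_smooth_if_Ainf:
  assumes A: "\<tau> i j \<in> Ainf N (U i \<inter> U j) (\<K> i) (\<K> j)"
  shows "strongly_smooth i j"
  unfolding strongly_smooth_def
proof
  fix x assume x: "x \<in> carrier (\<K> i)"
  interpret K: hilbert "\<K> i" by (rule hilbert_K[OF i])
  have "(\<lambda>_. x) \<in> Pinf N (U i \<inter> U j) (\<K> i)"
    unfolding Pinf_def
  proof (intro CollectI conjI exI[of _ "1 :: nat"] exI[of _ "\<lambda>_ _. 1"] exI[of _ "\<lambda>_. x"] ballI)
    show "(\<lambda>_. x) \<in> Cinf N (U i \<inter> U j) (\<K> i)" by (rule Cinf_const[OF overlap_open hilbert_K[OF i] x])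
    show "(\<lambda>_. 1) \<in> Cinf N (U i \<inter> U j) complex_hspace"
      by (rule Cinf_const[OF overlap_open hilbert_complex]) (simp add: complex_hspace_def)
    show "x = (\<Oplus>\<^bsub>\<K> i\<^esub>l\<in>{1..1::nat}. 1 \<odot>\<^bsub>\<K> i\<^esub> x)"
      using x K.smult_one[of x] by (simp add: K.finsum_insert)
  qed (rule x)
  show "(\<lambda>q. \<tau> i j q x) \<in> Cinf N (U i \<inter> U j) (\<K> j)"
  proof -
    have "\<forall>f\<in>Pinf N (U i \<inter> U j) (\<K> i). (\<lambda>q. \<tau> i j q (f q)) \<in> Cinf N (U i \<inter> U j) (\<K> j)"
      using A unfolding Ainf_def by blast
    from bspec[OF this \<open>(\<lambda>_. x) \<in> Pinf N (U i \<inter> U j) (\<K> i)\<close>] show ?thesis by simp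
  qed
qed

end

text \<open>The adjoint of \<open>\<tau> i j q\<close> is \<open>\<tau> j i q\<close>, so the condition on adjoints is the first one with \<open>i\<close> and \<open>j\<close>
  exchanged.\<close>

lemma Ainf_if_strongly_smooth:
  assumes i: "i \<in> I" and j: "j \<in> I" and ij: "strongly_smooth i j" and ji: "strongly_smooth j i"
  shows "\<tau> i j \<in> Ainf N (U i \<inter> U j) (\<K> i) (\<K> j)"
  unfolding Ainf_def
proof (intro CollectI conjI ballI)
  show "bounded_operator (\<K> i) (\<K> j) (\<tau> i j q)" if "q \<in> U i \<inter> U j" for q
    using unitary_map.bounded_operator[OF unitary_\<tau>[OF i j that]] .
  show "(\<lambda>q. \<tau> i j q (f q)) \<in> Cinf N (U i \<inter> U j) (\<K> j)" if "f \<in> Pinf N (U i \<inter> U j) (\<K> i)" for f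
    using that by (intro \<tau>_apply_Cinf[OF i j ij]) (simp add: Pinf_def)
  fix g assume "g \<in> Pinf N (U i \<inter> U j) (\<K> j)"
  then have g: "g \<in> Cinf N (U i \<inter> U j) (\<K> j)" by (simp add: Pinf_def)
  have gc: "g q \<in> carrier (\<K> j)" if "q \<in> U i \<inter> U j" for q
    by (rule Cinf_closed[OF overlap_open[OF i j] hilbert_K[OF j] g that])
  have "(\<lambda>q. \<tau> j i q (g q)) \<in> Cinf N (U i \<inter> U j) (\<K> i)"
    using \<tau>_apply_Cinf[OF j i ji, of g] g by (simp add: Int_commute)
  then show "(\<lambda>q. adjoint_op (\<K> i) (\<K> j) (\<tau> i j q) (g q)) \<in> Cinf N (U i \<inter> U j) (\<K> i)"
    by (rule Cinf_cong[OF overlap_open[OF i j] hilbert_K[OF i]]) (simp add: adjoint_\<tau>[OF i j] gc)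
qed

end

section \<open>From a bundle to its transition functions\<close>

lemma inv_into_map_prod_id:
  "inj_on \<phi> W \<Longrightarrow> q \<in> W \<Longrightarrow> k \<in> C \<Longrightarrow> inv_into (W \<times> C) (map_prod \<phi> id) (\<phi> q, k) = (q, k)"
  by (rule inv_into_f_eq) (auto intro!: map_prod_inj_on)

lemma smooth_mapD:
  assumes "smooth_map M M' f" "(W, \<phi>, E) \<in> atlas M" "(W', \<phi>', E') \<in> atlas M'"
  shows "smooth_on E E' (\<phi> ` (W \<inter> f -` W')) (\<phi>' \<circ> f \<circ> inv_into W \<phi>)"
  using assms unfolding smooth_map_def by fast

lemma atlas_open_submfd: "(W, \<phi>, E) \<in> atlas M \<Longrightarrow> (W \<inter> S, \<phi>, E) \<in> atlas (open_submfd M S)"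
  unfolding open_submfd_def by force

lemma atlas_prod_space_mfd:
  "(W, \<phi>, E) \<in> atlas M \<Longrightarrow> (W \<times> carrier F, map_prod \<phi> id, prod_space E F) \<in> atlas (prod_mfd M (space_mfd F))"
  unfolding prod_mfd_def space_mfd_def by auto

context hilbert_bundle_data
begin

definition above :: "'n set \<Rightarrow> 'h set" where
  "above S = {x \<in> H. p x \<in> S}"

definition triv :: "'i \<Rightarrow> 'h \<Rightarrow> 'n \<times> 'k" where
  "triv i = (\<lambda>x. (p x, T i (p x) x))"

definition cyl :: "'i \<Rightarrow> ('n \<times> 'k) topology" where
  "cyl i = prod_topology (subtopology (mtop N) (U i)) (vtop (realify (\<K> i)))"

lemma topspace_cyl: "i \<in> I \<Longrightarrow> topspace (cyl i) = U i \<times> carrier (\<K> i)"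
  using Banach.axioms(1)[OF Banach_K[of i]] U_topspace
  by (auto simp: cyl_def Normed.topspace_vtop)

lemma triv_closed: "i \<in> I \<Longrightarrow> x \<in> above (U i) \<Longrightarrow> triv i x \<in> U i \<times> carrier (\<K> i)"
  by (auto simp: triv_def above_def T_closed)

lemma triv_Tinv: "i \<in> I \<Longrightarrow> q \<in> U i \<Longrightarrow> k \<in> carrier (\<K> i) \<Longrightarrow> triv i (Tinv i q k) = (q, k)"
  by (simp add: triv_def Tinv_H T_Tinv)

lemma Tinv_above: "i \<in> I \<Longrightarrow> q \<in> U i \<Longrightarrow> q \<in> S \<Longrightarrow> k \<in> carrier (\<K> i) \<Longrightarrow> Tinv i q k \<in> above S"
  by (simp add: above_def Tinv_H)

lemma Tinv_triv: "i \<in> I \<Longrightarrow> x \<in> above (U i) \<Longrightarrow> (case triv i x of (q, k) \<Rightarrow> Tinv i q k) = x"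
  by (simp add: triv_def above_def Tinv_T)

lemma triv_inj: "i \<in> I \<Longrightarrow> inj_on (triv i) (above (U i))"
  by (metis Tinv_triv inj_onI)

lemma triv_image: "i \<in> I \<Longrightarrow> triv i ` above (U i) = U i \<times> carrier (\<K> i)"
proof (intro equalityI subsetI)
  fix z assume i: "i \<in> I" and "z \<in> U i \<times> carrier (\<K> i)"
  then obtain q k where z: "z = (q, k)" "q \<in> U i" "k \<in> carrier (\<K> i)" by auto
  then have "z = triv i (Tinv i q k)" using triv_Tinv[OF i] by simp
  then show "z \<in> triv i ` above (U i)" using Tinv_above[OF i z(2,2,3)] by blast
qed (use triv_closed in blast)

lemma inv_triv:
  "i \<in> I \<Longrightarrow> q \<in> U i \<Longrightarrow> k \<in> carrier (\<K> i) \<Longrightarrow> inv_into (above (U i)) (triv i) (q, k) = Tinv i q k"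
  using inv_into_f_eq[OF triv_inj Tinv_above triv_Tinv] by blast

text \<open>For fixed \<open>x\<close> the point \<open>\<tau> i j q x\<close> is obtained from \<open>(q, x)\<close> by the inverse of one trivialisation,
  followed by another one and by the second projection. Near a given point this passes through a single
  chart of the total space, where the chain rule applies.\<close>

lemma strongly_smooth_if_bundle:
  fixes M :: "('h, 'm) mfd"
  assumes M: "smooth_hilbert_bundle M N H p I U \<K> T" and i: "i \<in> I" and j: "j \<in> I"
  shows "strongly_smooth i j"
  unfolding strongly_smooth_def
proof
  fix x assume x: "x \<in> carrier (\<K> i)"
  let ?S = "U i \<inter> U j"
  have S: "openin (mtop N) ?S" by (rule overlap_open[OF i j])
  interpret Ki: Banach "realify (\<K> i)" by (rule Banach_K[OF i])
  interpret Kj: Banach2 "Rn n" "realify (\<K> j)" by (rule Banach2_RK[OF j])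
  interpret Ri: Banach2 "Rn n" "realify (\<K> i)" by (rule Banach2_RK[OF i])
  have bm: "banach_manifold M" and top: "topspace (mtop M) = H"
    and diff: "\<And>i. i \<in> I \<Longrightarrow> diffeomorphism (open_submfd M (above (U i)))
        (prod_mfd (open_submfd N (U i)) (space_mfd (realify (\<K> i)))) (triv i)"
    using M unfolding smooth_hilbert_bundle_def above_def triv_def by blast+
  have top_above: "topspace (mtop (open_submfd M (above (U i)))) = above (U i)" for i
    using top by (auto simp: open_submfd_def above_def)
  define g where "g = inv_into (above (U i)) (triv i)"
  have g: "smooth_map (prod_mfd (open_submfd N (U i)) (space_mfd (realify (\<K> i)))) (open_submfd M (above (U i))) g"
    using diff[OF i] unfolding diffeomorphism_def top_above g_def by blast
  have f: "smooth_map (open_submfd M (above (U j))) (prod_mfd (open_submfd N (U j)) (space_mfd (realify (\<K> j)))) (triv j)"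
    using diff[OF j] unfolding diffeomorphism_def by blast
  have gq: "g (q, x) = Tinv i q x" if "q \<in> U i" for q
    using inv_triv[OF i that x] by (simp add: g_def)
  have "continuous_map (subtopology (mtop N) ?S) (cyl i) (\<lambda>q. (q, x))"
    unfolding cyl_def using x by (auto simp: continuous_map_paired continuous_map_in_subtopology)
  moreover have "continuous_map (cyl i) (mtop M) g"
    using g by (simp add: smooth_map_def prod_mfd_def open_submfd_def space_mfd_def cyl_def continuous_map_in_subtopology)
  ultimately have "continuous_map (subtopology (mtop N) ?S) (mtop M) (g \<circ> (\<lambda>q. (q, x)))"
    by (rule continuous_map_compose)
  then have cont_Tinv: "continuous_map (subtopology (mtop N) ?S) (mtop M) (\<lambda>q. Tinv i q x)"
    by (rule continuous_map_eq) (simp add: gq)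
  then have cont_Tinv': "continuous_map (subtopology (mtop N) ?S) (subtopology (mtop M) (above (U j))) (\<lambda>q. Tinv i q x)"
    using Tinv_above[OF i _ _ x] by (simp add: continuous_map_in_subtopology)
  have "continuous_map (subtopology (mtop M) (above (U j))) (cyl j) (triv j)"
    using f by (simp add: smooth_map_def prod_mfd_def open_submfd_def space_mfd_def cyl_def)
  from continuous_map_compose[OF cont_Tinv' this]
  have "continuous_map (subtopology (mtop N) ?S) (vtop (realify (\<K> j))) (snd \<circ> (triv j \<circ> (\<lambda>q. Tinv i q x)))"
    unfolding cyl_def by (rule continuous_map_snd_of)
  then have cont: "continuous_map (subtopology (mtop N) ?S) (vtop (realify (\<K> j))) (\<lambda>q. \<tau> i j q x)"
    by (rule continuous_map_eq) (simp add: triv_def \<tau>_eq Tinv_H[OF i _ x])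
  show "(\<lambda>q. \<tau> i j q x) \<in> Cinf N ?S (\<K> j)"
    unfolding Cinf_iff[OF S hilbert_K[OF j]]
  proof (intro conjI allI impI cont smooth_on_local Banach_Rn Banach_K[OF j])
    fix W \<phi> y0 assume c: "(W, \<phi>, Rn n) \<in> atlas N" and "y0 \<in> \<phi> ` (W \<inter> ?S)"
    then obtain q0 where q0: "y0 = \<phi> q0" "q0 \<in> W" "q0 \<in> ?S" by blast
    have "Tinv i q0 x \<in> topspace (mtop M)" using Tinv_H[OF i _ x] q0 top by simp
    then obtain V \<psi> E where V: "(V, \<psi>, E) \<in> atlas M" "Tinv i q0 x \<in> V"
      using bm unfolding banach_manifold_def by blast
    have VM: "banach_space E" "openin (mtop M) V" "homeomorphic_map (subtopology (mtop M) V) (subtopology (vtop E) (\<psi> ` V)) \<psi>"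
      using bm V unfolding banach_manifold_def by fast+
    then have E: "Banach E" by (simp add: banach_space_iff)
    have \<psi>_inj: "inj_on \<psi> V"
      using homeomorphic_imp_injective_map[OF VM(3)] openin_subset[OF VM(2)] by (simp add: Int_absorb1)
    \<comment> \<open>the points that are sent to the domain of the chart \<open>\<psi>\<close>\<close>
    define O' where "O' = {q \<in> W \<inter> ?S. Tinv i q x \<in> V}"
    have O'_sub: "O' \<subseteq> W" "O' \<subseteq> ?S" by (auto simp: O'_def)
    have O': "openin (mtop N) O'"
    proof -
      have "openin (subtopology (mtop N) ?S) {q \<in> topspace (subtopology (mtop N) ?S). Tinv i q x \<in> V}"
        by (rule openin_continuous_map_preimage[OF cont_Tinv VM(2)])
      then have "openin (mtop N) {q \<in> topspace (subtopology (mtop N) ?S). Tinv i q x \<in> V}"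
        using S by (simp add: openin_open_subtopology)
      moreover have "O' = W \<inter> {q \<in> topspace (subtopology (mtop N) ?S). Tinv i q x \<in> V}"
        using openin_subset[OF S] by (auto simp: O'_def)
      ultimately show ?thesis using chart_open[OF c] by auto
    qed
    have \<phi>O': "openin (vtop (Rn n)) (\<phi> ` O')" by (rule chart_open_image[OF c O' O'_sub(1)])
    have inj_i: "inj_on \<phi> (W \<inter> U i)" and inj_j: "inj_on \<phi> (W \<inter> U j)"
      using chart_inj[OF c] by (auto simp: inj_on_Int)
    let ?A = "(W \<inter> U i) \<times> carrier (realify (\<K> i))"
    have "smooth_on (RK i) E (map_prod \<phi> id ` (?A \<inter> g -` (V \<inter> above (U i)))) (\<psi> \<circ> g \<circ> inv_into ?A (map_prod \<phi> id))"
      by (rule smooth_mapD[OF g atlas_prod_space_mfd[OF atlas_open_submfd[OF c]] atlas_open_submfd[OF V(1)]])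
    then have "smooth_on (Rn n) E (\<phi> ` O') (\<lambda>y. (\<psi> \<circ> g \<circ> inv_into ?A (map_prod \<phi> id)) (y, x))"
    proof (rule smooth_on_comp_affine[OF Banach_Rn Banach_RK[OF i] E _ Ri.bounded_lin_Pair_zero \<phi>O'])
      fix y assume "y \<in> \<phi> ` O'"
      then obtain q where q: "y = \<phi> q" "q \<in> O'" by blast
      then have "(q, x) \<in> ?A \<inter> g -` (V \<inter> above (U i))"
        using x gq[of q] Tinv_above[OF i, of q "U i" x] by (auto simp: O'_def)
      then show "(y, x) \<in> map_prod \<phi> id ` (?A \<inter> g -` (V \<inter> above (U i)))"
        using q(1) by (metis map_prod_simp id_apply rev_image_eqI)
    next
      fix y h assume "y \<in> \<phi> ` O'" "h \<in> carrier (Rn n)"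
      then show "(y \<oplus>\<^bsub>Rn n\<^esub> h, x) = (y, x) \<oplus>\<^bsub>RK i\<^esub> (h, \<zero>\<^bsub>realify (\<K> i)\<^esub>)"
        using x Ki.r_zero[of x] by simp
    qed
    then have s1: "smooth_on (Rn n) E (\<phi> ` O') (\<lambda>y. \<psi> (Tinv i (inv_into W \<phi> y) x))"
    proof (rule smooth_on_cong)
      fix y assume "y \<in> \<phi> ` O'"
      then obtain q where q: "y = \<phi> q" "q \<in> O'" by blast
      have "inv_into ?A (map_prod \<phi> id) (\<phi> q, x) = (q, x)"
        using q x by (intro inv_into_map_prod_id[OF inj_i]) (auto simp: O'_def)
      moreover have "inv_into W \<phi> y = q" using q chart_inv[OF c] by (auto simp: O'_def)
      ultimately show "(\<psi> \<circ> g \<circ> inv_into ?A (map_prod \<phi> id)) (y, x) = \<psi> (Tinv i (inv_into W \<phi> y) x)"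
        using q gq by (auto simp: O'_def)
    qed
    let ?B = "(W \<inter> U j) \<times> carrier (realify (\<K> j))"
    let ?D = "\<psi> ` ((V \<inter> above (U j)) \<inter> triv j -` ?B)"
    have "smooth_on E (RK j) ?D (map_prod \<phi> id \<circ> triv j \<circ> inv_into (V \<inter> above (U j)) \<psi>)"
      by (rule smooth_mapD[OF f atlas_open_submfd[OF V(1)] atlas_prod_space_mfd[OF atlas_open_submfd[OF c]]])
    from smooth_on_bounded_lin_comp[OF E Banach_RK[OF j] Banach_K[OF j] this Kj.bounded_lin_snd]
    have s2: "smooth_on E (realify (\<K> j)) ?D (\<lambda>z. snd ((map_prod \<phi> id \<circ> triv j \<circ> inv_into (V \<inter> above (U j)) \<psi>) z))" .
    have Tinv_V: "Tinv i q x \<in> V \<inter> above (U j) \<and> triv j (Tinv i q x) = (q, \<tau> i j q x) \<and> \<tau> i j q x \<in> carrier (\<K> j)" if "q \<in> O'" for q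
      using that Tinv_above[OF i _ _ x, of q "U j"] Tinv_H[OF i _ x, of q] T_closed[OF j, of q "Tinv i q x"]
      by (auto simp: O'_def triv_def \<tau>_eq)
    have "smooth_on (Rn n) (realify (\<K> j)) (\<phi> ` O')
        (\<lambda>y. snd ((map_prod \<phi> id \<circ> triv j \<circ> inv_into (V \<inter> above (U j)) \<psi>) (\<psi> (Tinv i (inv_into W \<phi> y) x))))"
    proof (rule smooth_on_comp[OF Banach_Rn E hilbert_K[OF j] s1 s2])
      fix y assume "y \<in> \<phi> ` O'"
      then obtain q where q: "y = \<phi> q" "q \<in> O'" by blast
      have inv: "inv_into W \<phi> y = q" using q chart_inv[OF c] by (auto simp: O'_def)
      show "\<psi> (Tinv i (inv_into W \<phi> y) x) \<in> ?D"
        unfolding inv by (rule imageI) (use Tinv_V[OF q(2)] q O'_sub in auto)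
    qed
    then have "smooth_on (Rn n) (realify (\<K> j)) (\<phi> ` O') (\<lambda>y. \<tau> i j (inv_into W \<phi> y) x)"
    proof (rule smooth_on_cong)
      fix y assume "y \<in> \<phi> ` O'"
      then obtain q where q: "y = \<phi> q" "q \<in> O'" by blast
      have 1: "inv_into W \<phi> y = q" using q chart_inv[OF c] by (auto simp: O'_def)
      have 2: "inv_into (V \<inter> above (U j)) \<psi> (\<psi> (Tinv i q x)) = Tinv i q x"
        by (rule inv_into_f_f) (use Tinv_V[OF q(2)] \<psi>_inj in \<open>auto simp: inj_on_Int\<close>)
      show "snd ((map_prod \<phi> id \<circ> triv j \<circ> inv_into (V \<inter> above (U j)) \<psi>) (\<psi> (Tinv i (inv_into W \<phi> y) x))) = \<tau> i j (inv_into W \<phi> y) x"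
        unfolding 1 using 2 Tinv_V[OF q(2)] by simp
    qed
    moreover have "y0 \<in> \<phi> ` O'" using q0 V by (auto simp: O'_def)
    moreover have "\<phi> ` O' \<subseteq> \<phi> ` (W \<inter> ?S)" by (auto simp: O'_def)
    ultimately show "\<exists>V. y0 \<in> V \<and> V \<subseteq> \<phi> ` (W \<inter> ?S) \<and>
        smooth_on (Rn n) (realify (\<K> j)) V (\<lambda>y. \<tau> i j (inv_into W \<phi> y) x)" by blast
  qed
qed

end

section \<open>From transition functions to a bundle\<close>

locale bundle_construction = hilbert_bundle_data N n H p \<H> I U \<K> T
  for N :: "('n, nat \<Rightarrow> real) mfd" and n :: nat and H :: "'h set" and p :: "'h \<Rightarrow> 'n"
    and \<H> :: "'n \<Rightarrow> 'h hspace" and I :: "'i set" and U :: "'i \<Rightarrow> 'n set" and \<K> :: "'i \<Rightarrow> 'k hspace"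
    and T :: "'i \<Rightarrow> 'n \<Rightarrow> 'h \<Rightarrow> 'k" +
  fixes e :: "(nat \<Rightarrow> real) \<times> 'k \<Rightarrow> 'm"
  assumes inj_e: "inj e" and all_strongly_smooth: "\<And>i j. i \<in> I \<Longrightarrow> j \<in> I \<Longrightarrow> strongly_smooth i j"
begin

definition untriv :: "'i \<Rightarrow> 'n \<times> 'k \<Rightarrow> 'h" where
  "untriv i = (\<lambda>(q, k). Tinv i q k)"

lemma untriv_triv: "i \<in> I \<Longrightarrow> x \<in> above (U i) \<Longrightarrow> untriv i (triv i x) = x"
  using Tinv_triv by (simp add: untriv_def)

lemma triv_untriv: "i \<in> I \<Longrightarrow> z \<in> U i \<times> carrier (\<K> i) \<Longrightarrow> triv i (untriv i z) = z"
  by (auto simp: untriv_def triv_Tinv)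

lemma untriv_closed: "i \<in> I \<Longrightarrow> z \<in> U i \<times> carrier (\<K> i) \<Longrightarrow> untriv i z \<in> above (U i)"
  by (auto simp: untriv_def Tinv_above)

lemma p_untriv: "i \<in> I \<Longrightarrow> z \<in> U i \<times> carrier (\<K> i) \<Longrightarrow> p (untriv i z) = fst z"
  by (auto simp: untriv_def Tinv_H)

lemma above_H: "above S \<subseteq> H"
  by (auto simp: above_def)

text \<open>The topology of the total space is the finest one for which all inverse trivialisations are
  continuous. They are open maps by continuity of the transition functions, hence embeddings.\<close>

definition topH :: "'h topology" where
  "topH = topology (\<lambda>S. S \<subseteq> H \<and> (\<forall>i\<in>I. openin (cyl i) {z \<in> topspace (cyl i). untriv i z \<in> S}))"

lemma openin_topH:
  "openin topH S \<longleftrightarrow> S \<subseteq> H \<and> (\<forall>i\<in>I. openin (cyl i) {z \<in> topspace (cyl i). untriv i z \<in> S})"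
proof -
  have "istopology (\<lambda>S. S \<subseteq> H \<and> (\<forall>i\<in>I. openin (cyl i) {z \<in> topspace (cyl i). untriv i z \<in> S}))"
    unfolding istopology_def
  proof (intro conjI allI impI ballI)
    fix S S' i assume S: "S \<subseteq> H \<and> (\<forall>i\<in>I. openin (cyl i) {z \<in> topspace (cyl i). untriv i z \<in> S})"
      and S': "S' \<subseteq> H \<and> (\<forall>i\<in>I. openin (cyl i) {z \<in> topspace (cyl i). untriv i z \<in> S'})" and i: "i \<in> I"
    have "{z \<in> topspace (cyl i). untriv i z \<in> S \<inter> S'}
        = {z \<in> topspace (cyl i). untriv i z \<in> S} \<inter> {z \<in> topspace (cyl i). untriv i z \<in> S'}" by auto
    then show "openin (cyl i) {z \<in> topspace (cyl i). untriv i z \<in> S \<inter> S'}"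
      using S S' i by auto
  next
    fix \<S> i assume S: "\<forall>S\<in>\<S>. S \<subseteq> H \<and> (\<forall>i\<in>I. openin (cyl i) {z \<in> topspace (cyl i). untriv i z \<in> S})" and i: "i \<in> I"
    have "{z \<in> topspace (cyl i). untriv i z \<in> \<Union>\<S>} = (\<Union>S\<in>\<S>. {z \<in> topspace (cyl i). untriv i z \<in> S})" by auto
    moreover have "openin (cyl i) (\<Union>S\<in>\<S>. {z \<in> topspace (cyl i). untriv i z \<in> S})"
      by (rule openin_Union) (use S i in auto)
    ultimately show "openin (cyl i) {z \<in> topspace (cyl i). untriv i z \<in> \<Union>\<S>}" by simp
  qed auto
  then show ?thesis by (simp add: topH_def topology_inverse')
qed

lemma topspace_topH: "topspace topH = H"
proof -
  have "{z \<in> topspace (cyl i). untriv i z \<in> H} = topspace (cyl i)" if "i \<in> I" for i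
    using untriv_closed[OF that] above_H unfolding topspace_cyl[OF that] by blast
  then have "openin topH H" unfolding openin_topH by simp
  moreover have "topspace topH \<subseteq> H" using openin_topH[of "topspace topH"] by simp
  ultimately show ?thesis using openin_subset by blast
qed

lemma change_triv_continuous:
  assumes i: "i \<in> I" and j: "j \<in> I"
  shows "continuous_map (subtopology (cyl j) ((U i \<inter> U j) \<times> carrier (\<K> j))) (cyl i) (\<lambda>(q, k). (q, \<tau> j i q k))"
proof -
  interpret Kj: Banach "realify (\<K> j)" by (rule Banach_K[OF j])
  let ?Y = "prod_topology (subtopology (mtop N) (U j \<inter> U i)) (vtop (realify (\<K> j)))"
  have vt: "subtopology (vtop (realify (\<K> j))) (carrier (\<K> j)) = vtop (realify (\<K> j))"
    using Kj.topspace_vtop by (metis realify_simps(1) subtopology_topspace)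
  have Y: "subtopology (cyl j) ((U i \<inter> U j) \<times> carrier (\<K> j)) = ?Y"
    unfolding cyl_def subtopology_Times subtopology_subtopology vt
    by (simp add: Int_ac)
  have "continuous_map ?Y (vtop (realify (\<K> i))) (\<lambda>z. case z of (q, k) \<Rightarrow> \<tau> j i q k)"
    by (rule \<tau>_continuous[OF j i all_strongly_smooth[OF j i]])
  moreover have "continuous_map ?Y (subtopology (mtop N) (U i)) fst"
    using continuous_map_fst[of "subtopology (mtop N) (U j \<inter> U i)" "vtop (realify (\<K> j))"]
    by (auto simp: continuous_map_in_subtopology)
  ultimately have "continuous_map ?Y (cyl i) (\<lambda>z. (fst z, case z of (q, k) \<Rightarrow> \<tau> j i q k))"
    unfolding cyl_def by (rule continuous_map_pairedI[rotated])
  then show ?thesis unfolding Y by (simp add: case_prod_unfold)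
qed

lemma untriv_image: "i \<in> I \<Longrightarrow> O' \<subseteq> topspace (cyl i) \<Longrightarrow> untriv i ` O' = {x \<in> above (U i). triv i x \<in> O'}"
proof (intro equalityI subsetI)
  fix x assume i: "i \<in> I" and O': "O' \<subseteq> topspace (cyl i)" and "x \<in> untriv i ` O'"
  then obtain z where z: "z \<in> O'" "x = untriv i z" by blast
  then have "z \<in> U i \<times> carrier (\<K> i)" using O' topspace_cyl[OF i] by blast
  then show "x \<in> {x \<in> above (U i). triv i x \<in> O'}" using z untriv_closed[OF i] triv_untriv[OF i] by simp
next
  fix x assume "i \<in> I" and "x \<in> {x \<in> above (U i). triv i x \<in> O'}"
  then show "x \<in> untriv i ` O'" using untriv_triv by (metis (mono_tags, lifting) image_eqI mem_Collect_eq)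
qed

text \<open>Seen in the trivialisation \<open>j\<close>, the image of an open set under the inverse trivialisation \<open>i\<close> is a
  preimage under the change of trivialisation.\<close>

lemma openin_untriv_image:
  assumes i: "i \<in> I" and O': "openin (cyl i) O'"
  shows "openin topH (untriv i ` O')"
  unfolding openin_topH
proof (intro conjI ballI)
  have sub: "O' \<subseteq> topspace (cyl i)" using O' openin_subset by blast
  show "untriv i ` O' \<subseteq> H" unfolding untriv_image[OF i sub] using above_H by blast
  fix j assume j: "j \<in> I"
  let ?Z = "(U i \<inter> U j) \<times> carrier (\<K> j)"
  have Z: "openin (cyl j) ?Z"
  proof -
    interpret Kj: Banach "realify (\<K> j)" by (rule Banach_K[OF j])
    have "openin (subtopology (mtop N) (U j)) (U i \<inter> U j)"
      using U_open[OF i] by (auto simp: openin_subtopology)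
    then show ?thesis unfolding cyl_def using Kj.openin_carrier by (simp add: openin_prod_Times_iff)
  qed
  have "openin (subtopology (cyl j) ?Z) {z \<in> topspace (subtopology (cyl j) ?Z). (case z of (q, k) \<Rightarrow> (q, \<tau> j i q k)) \<in> O'}"
    by (rule openin_continuous_map_preimage[OF change_triv_continuous[OF i j] O'])
  then have "openin (cyl j) {z \<in> topspace (subtopology (cyl j) ?Z). (case z of (q, k) \<Rightarrow> (q, \<tau> j i q k)) \<in> O'}"
    using Z by (simp add: openin_open_subtopology)
  moreover have "{z \<in> topspace (subtopology (cyl j) ?Z). (case z of (q, k) \<Rightarrow> (q, \<tau> j i q k)) \<in> O'}
      = {z \<in> topspace (cyl j). untriv j z \<in> untriv i ` O'}"
  proof (intro equalityI subsetI)
    fix z assume z: "z \<in> {z \<in> topspace (subtopology (cyl j) ?Z). (case z of (q, k) \<Rightarrow> (q, \<tau> j i q k)) \<in> O'}"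
    then obtain q k where qk: "z = (q, k)" "q \<in> U i" "q \<in> U j" "k \<in> carrier (\<K> j)" "(q, \<tau> j i q k) \<in> O'" by auto
    have "triv i (Tinv j q k) = (q, \<tau> j i q k)" using Tinv_H[OF j qk(3,4)] by (simp add: triv_def \<tau>_eq)
    moreover have "Tinv j q k \<in> above (U i)" by (rule Tinv_above[OF j qk(3,2,4)])
    ultimately show "z \<in> {z \<in> topspace (cyl j). untriv j z \<in> untriv i ` O'}"
      unfolding untriv_image[OF i sub] using z qk by (simp add: untriv_def)
  next
    fix z assume z: "z \<in> {z \<in> topspace (cyl j). untriv j z \<in> untriv i ` O'}"
    then obtain q k where qk: "z = (q, k)" "q \<in> U j" "k \<in> carrier (\<K> j)" using topspace_cyl[OF j] by auto
    have "Tinv j q k \<in> above (U i)" "triv i (Tinv j q k) \<in> O'"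
      using z unfolding untriv_image[OF i sub] by (auto simp: untriv_def qk)
    then show "z \<in> {z \<in> topspace (subtopology (cyl j) ?Z). (case z of (q, k) \<Rightarrow> (q, \<tau> j i q k)) \<in> O'}"
      using z qk Tinv_H[OF j qk(2,3)] by (simp add: triv_def \<tau>_eq above_def)
  qed
  ultimately show "openin (cyl j) {z \<in> topspace (cyl j). untriv j z \<in> untriv i ` O'}" by simp
qed

lemma homeomorphic_maps_triv:
  assumes i: "i \<in> I"
  shows "homeomorphic_maps (subtopology topH (above (U i))) (cyl i) (triv i) (untriv i)"
proof -
  have top: "topspace (subtopology topH (above (U i))) = above (U i)"
    using topspace_topH above_H by auto
  have "continuous_map (subtopology topH (above (U i))) (cyl i) (triv i)"
    unfolding continuous_map_def
  proof (intro conjI allI impI)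
    show "triv i \<in> topspace (subtopology topH (above (U i))) \<rightarrow> topspace (cyl i)"
      unfolding top topspace_cyl[OF i] using triv_closed[OF i] by blast
    fix O' assume O': "openin (cyl i) O'"
    then have "openin topH {x \<in> above (U i). triv i x \<in> O'}"
      using openin_untriv_image[OF i O'] untriv_image[OF i openin_subset[OF O']] by simp
    then show "openin (subtopology topH (above (U i))) {x \<in> topspace (subtopology topH (above (U i))). triv i x \<in> O'}"
      unfolding top openin_subtopology by (intro exI[of _ "{x \<in> above (U i). triv i x \<in> O'}"]) auto
  qed
  moreover have "continuous_map (cyl i) (subtopology topH (above (U i))) (untriv i)"
    unfolding continuous_map_in_subtopology
  proof
    show "untriv i \<in> topspace (cyl i) \<rightarrow> above (U i)"
      unfolding topspace_cyl[OF i] using untriv_closed[OF i] by blast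
    then show "continuous_map (cyl i) topH (untriv i)"
      unfolding continuous_map_def topspace_topH using above_H openin_topH i by blast
  qed
  ultimately show ?thesis
    unfolding homeomorphic_maps_def top topspace_cyl[OF i] using triv_untriv[OF i] untriv_triv[OF i] by blast
qed

lemma openin_above: "openin (mtop N) S \<Longrightarrow> openin topH (above S)"
  unfolding openin_topH
proof (intro conjI ballI above_H)
  fix i assume S: "openin (mtop N) S" and i: "i \<in> I"
  interpret Ki: Banach "realify (\<K> i)" by (rule Banach_K[OF i])
  have "openin (cyl i) ((U i \<inter> S) \<times> carrier (\<K> i))"
    unfolding cyl_def using S Ki.openin_carrier by (auto simp: openin_prod_Times_iff openin_subtopology)
  moreover have "{z \<in> topspace (cyl i). untriv i z \<in> above S} = (U i \<inter> S) \<times> carrier (\<K> i)"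
    unfolding topspace_cyl[OF i] using p_untriv[OF i] untriv_closed[OF i] above_H by (auto simp: above_def)
  ultimately show "openin (cyl i) {z \<in> topspace (cyl i). untriv i z \<in> above S}" by simp
qed

lemma continuous_p: "continuous_map topH (mtop N) p"
  unfolding continuous_map_def topspace_topH
  using p_topspace openin_above by (auto simp: above_def)

text \<open>Points in different fibres are separated by \<open>p\<close>, points in the same fibre inside one trivialisation.\<close>

lemma Hausdorff_topH: "Hausdorff_space topH"
  unfolding Hausdorff_space_def topspace_topH
proof (intro allI impI, elim conjE)
  fix x y assume x: "x \<in> H" and y: "y \<in> H" and ne: "x \<noteq> y"
  have N_Hausdorff: "Hausdorff_space (mtop N)"
    using manifold by (simp add: smooth_manifold_def banach_manifold_def)
  show "\<exists>A B. openin topH A \<and> openin topH B \<and> x \<in> A \<and> y \<in> B \<and> disjnt A B"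
  proof (cases "p x = p y")
    case False
    then obtain A B where AB: "openin (mtop N) A" "openin (mtop N) B" "p x \<in> A" "p y \<in> B" "disjnt A B"
      using N_Hausdorff p_topspace x y unfolding Hausdorff_space_def by metis
    moreover have "disjnt (above A) (above B)" using AB(5) by (auto simp: disjnt_def above_def)
    ultimately show ?thesis
      using x y by (intro exI[of _ "above A"] exI[of _ "above B"]) (auto simp: openin_above, auto simp: above_def)
  next
    case True
    obtain i where i: "i \<in> I" "p x \<in> U i" using p_topspace[OF x] U_cover by blast
    interpret Ki: Banach "realify (\<K> i)" by (rule Banach_K[OF i(1)])
    have "Hausdorff_space (cyl i)"
      unfolding cyl_def Hausdorff_space_prod_topology
      using N_Hausdorff Ki.Hausdorff_vtop Hausdorff_space_subtopology by blast
    then have "Hausdorff_space (subtopology topH (above (U i)))"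
      using homeomorphic_maps_triv[OF i(1)] homeomorphic_Hausdorff_space homeomorphic_space_def by blast
    moreover have "x \<in> topspace (subtopology topH (above (U i)))" "y \<in> topspace (subtopology topH (above (U i)))"
      using x y i True by (auto simp: topspace_topH above_def)
    ultimately obtain A B where "openin (subtopology topH (above (U i))) A" "openin (subtopology topH (above (U i))) B"
        "x \<in> A" "y \<in> B" "disjnt A B"
      using ne unfolding Hausdorff_space_def by metis
    then show ?thesis
      using openin_above[OF U_open[OF i(1)]] by (auto simp: openin_open_subtopology)
  qed
qed

definition chart_map :: "'i \<Rightarrow> ('n \<Rightarrow> nat \<Rightarrow> real) \<Rightarrow> 'h \<Rightarrow> 'm" where
  "chart_map i \<phi> = (\<lambda>x. e (\<phi> (p x), T i (p x) x))"

abbreviation model :: "'i \<Rightarrow> 'm nspace" where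
  "model i \<equiv> push e (RK i)"

definition total :: "('h, 'm) mfd" where
  "total = \<lparr>mtop = topH,
     atlas = {(above (U i \<inter> W), chart_map i \<phi>, model i) | i W \<phi>. i \<in> I \<and> (W, \<phi>, Rn n) \<in> atlas N}\<rparr>"

lemma mtop_total [simp]: "mtop total = topH"
  by (simp add: total_def)

lemma atlas_totalE:
  assumes "(V, \<psi>, E) \<in> atlas total"
  obtains i W \<phi> where "i \<in> I" "(W, \<phi>, Rn n) \<in> atlas N" "V = above (U i \<inter> W)" "\<psi> = chart_map i \<phi>" "E = model i"
  using assms by (auto simp: total_def)

lemma pushed: "i \<in> I \<Longrightarrow> pushed_Banach (RK i) e"
  using Banach_RK inj_e by (simp add: pushed_Banach_def pushed_Banach_axioms_def)

lemma Banach_model: "i \<in> I \<Longrightarrow> Banach (model i)"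
  using pushed pushed_Banach.Banach_push by blast

context
  fixes i W \<phi> assumes i: "i \<in> I" and c: "(W, \<phi>, Rn n) \<in> atlas N"
begin

interpretation Ri: Banach2 "Rn n" "realify (\<K> i)" by (rule Banach2_RK[OF i])
interpretation push: pushed_Banach "RK i" e by (rule pushed[OF i])

lemma chart_map_inj: "inj_on (chart_map i \<phi>) (above (U i \<inter> W))"
proof (rule inj_onI)
  fix x y assume x: "x \<in> above (U i \<inter> W)" and y: "y \<in> above (U i \<inter> W)" and eq: "chart_map i \<phi> x = chart_map i \<phi> y"
  have "\<phi> (p x) = \<phi> (p y)" "T i (p x) x = T i (p y) y"
    using eq inj_e by (auto simp: chart_map_def inj_eq)
  then have "triv i x = triv i y"
    using x y chart_inj[OF c] by (auto simp: triv_def above_def inj_on_def)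
  moreover have "x \<in> above (U i)" "y \<in> above (U i)" using x y by (auto simp: above_def)
  ultimately show "x = y" using triv_inj[OF i] by (auto simp: inj_on_def)
qed

lemma chart_map_Tinv: "q \<in> U i \<Longrightarrow> k \<in> carrier (\<K> i) \<Longrightarrow> chart_map i \<phi> (Tinv i q k) = e (\<phi> q, k)"
  by (simp add: chart_map_def Tinv_H[OF i] T_Tinv[OF i])

lemma chart_map_image:
  assumes S: "S \<subseteq> U i \<inter> W"
  shows "chart_map i \<phi> ` above S = e ` (\<phi> ` S \<times> carrier (\<K> i))"
proof (intro equalityI subsetI)
  fix z assume "z \<in> chart_map i \<phi> ` above S"
  then obtain x where x: "x \<in> H" "p x \<in> S" "z = e (\<phi> (p x), T i (p x) x)" by (auto simp: chart_map_def above_def)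
  then show "z \<in> e ` (\<phi> ` S \<times> carrier (\<K> i))" using T_closed[OF i, of "p x" x] S by blast
next
  fix z assume "z \<in> e ` (\<phi> ` S \<times> carrier (\<K> i))"
  then obtain q k where qk: "q \<in> S" "k \<in> carrier (\<K> i)" "z = e (\<phi> q, k)" by blast
  then have "z = chart_map i \<phi> (Tinv i q k)" using chart_map_Tinv S by auto
  then show "z \<in> chart_map i \<phi> ` above S" using Tinv_above[OF i, of q S k] qk S by blast
qed

lemma inv_chart_map:
  assumes "S \<subseteq> U i \<inter> W" "q \<in> S" "k \<in> carrier (\<K> i)"
  shows "inv_into (above S) (chart_map i \<phi>) (e (\<phi> q, k)) = Tinv i q k"
proof (rule inv_into_f_eq)
  show "inj_on (chart_map i \<phi>) (above S)"
    by (rule inj_on_subset[OF chart_map_inj]) (use assms in \<open>auto simp: above_def\<close>)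
  show "Tinv i q k \<in> above S" by (rule Tinv_above[OF i]) (use assms in auto)
  show "chart_map i \<phi> (Tinv i q k) = e (\<phi> q, k)" using assms by (intro chart_map_Tinv) auto
qed

lemma chart_domain_open:
  assumes "openin (mtop N) S" "S \<subseteq> U i \<inter> W"
  shows "openin (vtop (RK i)) (\<phi> ` S \<times> carrier (\<K> i))"
  unfolding Ri.vtop_prod using chart_open_image[OF c assms(1)] assms(2) Ri.F.openin_carrier
  by (auto simp: openin_prod_Times_iff)

lemma chart_domain_subset: "S \<subseteq> W \<Longrightarrow> \<phi> ` S \<times> carrier (\<K> i) \<subseteq> carrier (RK i)"
  using chart_carrier[OF c] by auto

text \<open>A chart of the total space is a trivialisation followed by \<open>\<phi> \<times> id\<close> and by the copying map \<open>e\<close>.\<close>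

lemma homeomorphic_chart_map:
  "homeomorphic_map (subtopology topH (above (U i \<inter> W))) (subtopology (vtop (model i)) (chart_map i \<phi> ` above (U i \<inter> W))) (chart_map i \<phi>)"
proof -
  let ?S = "U i \<inter> W"
  have S: "openin (mtop N) ?S" using U_open[OF i] chart_open[OF c] by blast
  have topS: "topspace (mtop N) \<inter> ?S = ?S" using openin_subset[OF S] by blast
  have "homeomorphic_map (subtopology topH (above (U i))) (cyl i) (triv i)"
    using homeomorphic_maps_triv[OF i] homeomorphic_maps_imp_map by blast
  then have "homeomorphic_map (subtopology (subtopology topH (above (U i))) (above ?S))
      (subtopology (cyl i) (?S \<times> carrier (\<K> i))) (triv i)"
  proof (rule homeomorphic_map_subtopologies)
    have "triv i ` above ?S = ?S \<times> carrier (\<K> i)"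
    proof (intro equalityI subsetI)
      fix z assume "z \<in> ?S \<times> carrier (\<K> i)"
      then obtain q k where qk: "z = (q, k)" "q \<in> ?S" "k \<in> carrier (\<K> i)" by auto
      then have "z = triv i (Tinv i q k)" using triv_Tinv[OF i] by simp
      then show "z \<in> triv i ` above ?S" using Tinv_above[OF i _ qk(2,3)] qk by blast
    qed (auto simp: triv_def above_def T_closed[OF i])
    moreover have "topspace (subtopology topH (above (U i))) \<inter> above ?S = above ?S"
      using topspace_topH by (auto simp: above_def)
    moreover have "topspace (cyl i) \<inter> ?S \<times> carrier (\<K> i) = ?S \<times> carrier (\<K> i)"
      unfolding topspace_cyl[OF i] by auto
    ultimately show "triv i ` (topspace (subtopology topH (above (U i))) \<inter> above ?S) = topspace (cyl i) \<inter> ?S \<times> carrier (\<K> i)" by simp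
  qed
  moreover have "subtopology (subtopology topH (above (U i))) (above ?S) = subtopology topH (above ?S)"
    unfolding subtopology_subtopology by (rule arg_cong[of _ _ "subtopology topH"]) (auto simp: above_def)
  moreover have cyl_S: "subtopology (cyl i) (?S \<times> carrier (\<K> i)) = prod_topology (subtopology (mtop N) ?S) (vtop (realify (\<K> i)))"
  proof -
    have "subtopology (vtop (realify (\<K> i))) (carrier (\<K> i)) = vtop (realify (\<K> i))"
      using Ri.F.topspace_vtop by (metis realify_simps(1) subtopology_topspace)
    then show ?thesis unfolding cyl_def subtopology_Times subtopology_subtopology by (simp add: Int_assoc[symmetric])
  qed
  ultimately have h1: "homeomorphic_map (subtopology topH (above ?S))
      (prod_topology (subtopology (mtop N) ?S) (vtop (realify (\<K> i)))) (triv i)" by simp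
  have "homeomorphic_map (subtopology (subtopology (mtop N) W) ?S) (subtopology (subtopology (vtop (Rn n)) (\<phi> ` W)) (\<phi> ` ?S)) \<phi>"
  proof (rule homeomorphic_map_subtopologies[OF chart_homeo[OF c]])
    have "topspace (subtopology (mtop N) W) \<inter> ?S = ?S" using topS by auto
    moreover have "topspace (subtopology (vtop (Rn n)) (\<phi> ` W)) \<inter> \<phi> ` ?S = \<phi> ` ?S"
      using chart_carrier[OF c] Ri.E.topspace_vtop by auto
    ultimately show "\<phi> ` (topspace (subtopology (mtop N) W) \<inter> ?S) = topspace (subtopology (vtop (Rn n)) (\<phi> ` W)) \<inter> \<phi> ` ?S"
      by simp
  qed
  moreover have "subtopology (subtopology (mtop N) W) ?S = subtopology (mtop N) ?S"
    unfolding subtopology_subtopology by (rule arg_cong[of _ _ "subtopology (mtop N)"]) auto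
  moreover have "subtopology (subtopology (vtop (Rn n)) (\<phi> ` W)) (\<phi> ` ?S) = subtopology (vtop (Rn n)) (\<phi> ` ?S)"
    unfolding subtopology_subtopology by (rule arg_cong[of _ _ "subtopology (vtop (Rn n))"]) auto
  ultimately have "homeomorphic_map (subtopology (mtop N) ?S) (subtopology (vtop (Rn n)) (\<phi> ` ?S)) \<phi>" by simp
  then obtain \<phi>' where "homeomorphic_maps (subtopology (mtop N) ?S) (subtopology (vtop (Rn n)) (\<phi> ` ?S)) \<phi> \<phi>'"
    unfolding homeomorphic_map_maps by blast
  moreover have "homeomorphic_maps (vtop (realify (\<K> i))) (vtop (realify (\<K> i))) (\<lambda>k. k) (\<lambda>k. k)"
    by (simp add: homeomorphic_maps_def)
  ultimately have "homeomorphic_maps (prod_topology (subtopology (mtop N) ?S) (vtop (realify (\<K> i))))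
      (prod_topology (subtopology (vtop (Rn n)) (\<phi> ` ?S)) (vtop (realify (\<K> i)))) (\<lambda>(q, k). (\<phi> q, k)) (\<lambda>(q, k). (\<phi>' q, k))"
    unfolding homeomorphic_maps_prod by blast
  then have h2: "homeomorphic_map (prod_topology (subtopology (mtop N) ?S) (vtop (realify (\<K> i))))
      (prod_topology (subtopology (vtop (Rn n)) (\<phi> ` ?S)) (vtop (realify (\<K> i)))) (\<lambda>(q, k). (\<phi> q, k))"
    by (rule homeomorphic_maps_imp_map)
  have prod_eq: "prod_topology (subtopology (vtop (Rn n)) (\<phi> ` ?S)) (vtop (realify (\<K> i)))
      = subtopology (vtop (RK i)) (\<phi> ` ?S \<times> carrier (\<K> i))"
    unfolding Ri.vtop_prod prod_topology_subtopology(1) Ri.F.topspace_vtop realify_simps ..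
  have "homeomorphic_map (subtopology (vtop (RK i)) (\<phi> ` ?S \<times> carrier (\<K> i))) (subtopology (vtop (model i)) (e ` (\<phi> ` ?S \<times> carrier (\<K> i)))) e"
  proof (rule homeomorphic_map_subtopologies[OF push.homeomorphic_map_push])
    have "topspace (vtop (RK i)) \<inter> \<phi> ` ?S \<times> carrier (\<K> i) = \<phi> ` ?S \<times> carrier (\<K> i)"
      using chart_domain_subset[of ?S] Ri.P.topspace_vtop by auto
    moreover have "topspace (vtop (model i)) \<inter> e ` (\<phi> ` ?S \<times> carrier (\<K> i)) = e ` (\<phi> ` ?S \<times> carrier (\<K> i))"
      using chart_domain_subset[of ?S] push.P.topspace_vtop push.push_simps(1) by blast
    ultimately show "e ` (topspace (vtop (RK i)) \<inter> \<phi> ` ?S \<times> carrier (\<K> i)) = topspace (vtop (model i)) \<inter> e ` (\<phi> ` ?S \<times> carrier (\<K> i))" by simp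
  qed
  with homeomorphic_map_compose[OF h1 h2[unfolded prod_eq]]
  have "homeomorphic_map (subtopology topH (above ?S)) (subtopology (vtop (model i)) (e ` (\<phi> ` ?S \<times> carrier (\<K> i))))
      (e \<circ> ((\<lambda>(q, k). (\<phi> q, k)) \<circ> triv i))"
    by (rule homeomorphic_map_compose)
  moreover have "e \<circ> ((\<lambda>(q, k). (\<phi> q, k)) \<circ> triv i) = chart_map i \<phi>"
    by (auto simp: chart_map_def triv_def)
  ultimately show ?thesis by (simp add: chart_map_image[of ?S])
qed

text \<open>All coordinate expressions of maps from the total space come from smooth maps on
  \<open>\<phi> ` S \<times> \<K> i\<close>, moved along the copy \<open>e\<close>.\<close>

lemma smooth_on_unpush:
  assumes F: "Banach F" and S: "openin (mtop N) S" "S \<subseteq> U i \<inter> W"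
    and f: "smooth_on (RK i) F (\<phi> ` S \<times> carrier (\<K> i)) f"
    and f': "\<And>q k. q \<in> S \<Longrightarrow> k \<in> carrier (\<K> i) \<Longrightarrow> f' (e (\<phi> q, k)) = f (\<phi> q, k)"
  shows "smooth_on (model i) F (chart_map i \<phi> ` above S) f'"
proof -
  have sub: "\<phi> ` S \<times> carrier (\<K> i) \<subseteq> carrier (RK i)" using S by (intro chart_domain_subset) auto
  have "openin (vtop (model i)) (e ` (\<phi> ` S \<times> carrier (\<K> i)))"
    using push.openin_push[OF sub] chart_domain_open[OF S] by simp
  then have "smooth_on (model i) F (e ` (\<phi> ` S \<times> carrier (\<K> i))) (\<lambda>z. f (inv_into UNIV e z))"
  proof (rule smooth_on_comp_affine[OF Banach_model[OF i] Banach_RK[OF i] F f push.bounded_lin_unpush])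
    fix z assume z: "z \<in> e ` (\<phi> ` S \<times> carrier (\<K> i))"
    then show "inv_into UNIV e z \<in> \<phi> ` S \<times> carrier (\<K> i)" using inj_e by auto
    fix h assume h: "h \<in> carrier (model i)"
    have "z \<in> carrier (model i)" using z sub push.push_simps(1) by blast
    then show "inv_into UNIV e (z \<oplus>\<^bsub>model i\<^esub> h) = inv_into UNIV e z \<oplus>\<^bsub>RK i\<^esub> inv_into UNIV e h"
      using bounded_linD(2)[OF push.bounded_lin_unpush _ h] by blast
  qed
  then show ?thesis
    unfolding chart_map_image[OF S(2)]
    by (rule smooth_on_cong) (use inj_e f' in auto)
qed

end

text \<open>The second component is the evaluation map of a strongly smooth family of operators.\<close>

lemma smooth_on_transition:
  assumes i: "i \<in> I" and j: "j \<in> I" and c: "(W, \<phi>, Rn n) \<in> atlas N" and c': "(W', \<phi>', Rn n) \<in> atlas N"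
    and S: "openin (mtop N) S" "S \<subseteq> (U i \<inter> W) \<inter> (U j \<inter> W')"
  shows "smooth_on (RK i) (Rn n) (\<phi> ` S \<times> carrier (\<K> i)) (\<lambda>(y, k). \<phi>' (inv_into W \<phi> y))"
    and "smooth_on (RK i) (RK j) (\<phi> ` S \<times> carrier (\<K> i)) (\<lambda>(y, k). (\<phi>' (inv_into W \<phi> y), \<tau> i j (inv_into W \<phi> y) k))"
proof -
  interpret Ri: Banach2 "Rn n" "realify (\<K> i)" by (rule Banach2_RK[OF i])
  have "smooth_on (Rn n) (Rn n) (\<phi> ` S) (\<lambda>y. \<phi>' (inv_into W \<phi> y))"
    by (rule smooth_on_subset[OF chart_transition[OF c c']]) (use S chart_open_image[OF c] in auto)
  then have "smooth_on (RK i) (Rn n) (\<phi> ` S \<times> carrier (\<K> i)) (\<lambda>z. \<phi>' (inv_into W \<phi> (fst z)))"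
  proof (rule smooth_on_comp_affine[OF Banach_RK[OF i] Banach_Rn Banach_Rn _ Ri.bounded_lin_fst])
    show "openin (vtop (RK i)) (\<phi> ` S \<times> carrier (\<K> i))"
      using S by (intro chart_domain_open[OF i c]) auto
  qed auto
  then have 1: "smooth_on (RK i) (Rn n) (\<phi> ` S \<times> carrier (\<K> i)) (\<lambda>z. case z of (y, k) \<Rightarrow> \<phi>' (inv_into W \<phi> y))"
    by (rule smooth_on_cong) auto
  have 2: "smooth_on (RK i) (realify (\<K> j)) (\<phi> ` S \<times> carrier (\<K> i)) (\<lambda>z. case z of (y, k) \<Rightarrow> \<tau> i j (inv_into W \<phi> y) k)"
    using S by (intro \<tau>_smooth[OF i j all_strongly_smooth[OF i j] c]) auto
  from smooth_on_Pair[OF Banach_RK[OF i] Banach_Rn Banach_K[OF j] 1 2]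
  have 3: "smooth_on (RK i) (RK j) (\<phi> ` S \<times> carrier (\<K> i)) (\<lambda>(y, k). (\<phi>' (inv_into W \<phi> y), \<tau> i j (inv_into W \<phi> y) k))"
    by (rule smooth_on_cong) auto
  show "smooth_on (RK i) (Rn n) (\<phi> ` S \<times> carrier (\<K> i)) (\<lambda>(y, k). \<phi>' (inv_into W \<phi> y))" by (rule 1)
  show "smooth_on (RK i) (RK j) (\<phi> ` S \<times> carrier (\<K> i)) (\<lambda>(y, k). (\<phi>' (inv_into W \<phi> y), \<tau> i j (inv_into W \<phi> y) k))" by (rule 3)
qed

lemma smooth_on_transition_push:
  assumes i: "i \<in> I" and j: "j \<in> I" and c: "(W, \<phi>, Rn n) \<in> atlas N" and c': "(W', \<phi>', Rn n) \<in> atlas N"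
    and S: "openin (mtop N) S" "S \<subseteq> (U i \<inter> W) \<inter> (U j \<inter> W')"
  shows "smooth_on (RK i) (model j) (\<phi> ` S \<times> carrier (\<K> i)) (\<lambda>(y, k). e (\<phi>' (inv_into W \<phi> y), \<tau> i j (inv_into W \<phi> y) k))"
proof -
  interpret push: pushed_Banach "RK j" e by (rule pushed[OF j])
  from smooth_on_bounded_lin_comp[OF Banach_RK[OF i] Banach_RK[OF j] Banach_model[OF j]
      smooth_on_transition(2)[OF assms] push.bounded_lin_push]
  show ?thesis by (rule smooth_on_cong) auto
qed

lemma banach_manifold_total: "banach_manifold total"
  unfolding banach_manifold_def mtop_total
proof (intro conjI)
  show "Hausdorff_space topH" by (rule Hausdorff_topH)
  show "(\<Union>(W, \<phi>, E)\<in>atlas total. W) = topspace topH"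
    unfolding topspace_topH
  proof (intro equalityI subsetI)
    fix x assume x: "x \<in> H"
    obtain i where i: "i \<in> I" "p x \<in> U i" using p_topspace[OF x] U_cover by blast
    obtain W \<phi> where c: "(W, \<phi>, Rn n) \<in> atlas N" "p x \<in> W" using charts_cover[OF p_topspace[OF x]] by blast
    have "(above (U i \<inter> W), chart_map i \<phi>, model i) \<in> atlas total" using i c by (auto simp: total_def)
    moreover have "x \<in> above (U i \<inter> W)" using x i c by (simp add: above_def)
    ultimately show "x \<in> (\<Union>(W, \<phi>, E)\<in>atlas total. W)" by fast
  qed (use above_H in \<open>auto simp: total_def\<close>)
  show "\<forall>(W, \<phi>, E)\<in>atlas total. banach_space E \<and> openin topH W \<and> openin (vtop E) (\<phi> ` W) \<and>
      homeomorphic_map (subtopology topH W) (subtopology (vtop E) (\<phi> ` W)) \<phi>"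
  proof safe
    fix V \<psi> E assume "(V, \<psi>, E) \<in> atlas total"
    then obtain i W \<phi> where i: "i \<in> I" and c: "(W, \<phi>, Rn n) \<in> atlas N" and [simp]: "V = above (U i \<inter> W)" "\<psi> = chart_map i \<phi>" "E = model i"
      by (rule atlas_totalE)
    interpret push: pushed_Banach "RK i" e by (rule pushed[OF i])
    have S: "openin (mtop N) (U i \<inter> W)" using U_open[OF i] chart_open[OF c] by blast
    show "banach_space E" using Banach_model[OF i] by (simp add: banach_space_iff)
    show "openin topH V" using openin_above[OF S] by simp
    show "openin (vtop E) (\<psi> ` V)"
      using chart_map_image[OF i c order_refl] push.openin_push[OF chart_domain_subset[OF i c]] chart_domain_open[OF i c S] by simp
    show "homeomorphic_map (subtopology topH V) (subtopology (vtop E) (\<psi> ` V)) \<psi>"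
      using homeomorphic_chart_map[OF i c] by simp
  qed
  show "\<forall>(W, \<phi>, E)\<in>atlas total. \<forall>(W', \<phi>', E')\<in>atlas total. smooth_on E E' (\<phi> ` (W \<inter> W')) (\<phi>' \<circ> inv_into W \<phi>)"
  proof safe
    fix V \<psi> E V' \<psi>' E' assume "(V, \<psi>, E) \<in> atlas total" "(V', \<psi>', E') \<in> atlas total"
    then obtain i W \<phi> j W' \<phi>' where i: "i \<in> I" and c: "(W, \<phi>, Rn n) \<in> atlas N" and [simp]: "V = above (U i \<inter> W)" "\<psi> = chart_map i \<phi>" "E = model i"
      and j: "j \<in> I" and c': "(W', \<phi>', Rn n) \<in> atlas N" and [simp]: "V' = above (U j \<inter> W')" "\<psi>' = chart_map j \<phi>'" "E' = model j"
      by (elim atlas_totalE) blast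
    let ?S = "(U i \<inter> W) \<inter> (U j \<inter> W')"
    have S: "openin (mtop N) ?S" using U_open[OF i] U_open[OF j] chart_open[OF c] chart_open[OF c'] by blast
    have "smooth_on (model i) (model j) (chart_map i \<phi> ` above ?S) (chart_map j \<phi>' \<circ> inv_into (above (U i \<inter> W)) (chart_map i \<phi>))"
    proof (rule smooth_on_unpush[OF i c Banach_model[OF j] S _ smooth_on_transition_push[OF i j c c' S order_refl]])
      fix q k assume q: "q \<in> ?S" and k: "k \<in> carrier (\<K> i)"
      have "inv_into (above (U i \<inter> W)) (chart_map i \<phi>) (e (\<phi> q, k)) = Tinv i q k"
        using q k by (intro inv_chart_map[OF i c order_refl]) auto
      then show "(chart_map j \<phi>' \<circ> inv_into (above (U i \<inter> W)) (chart_map i \<phi>)) (e (\<phi> q, k))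
          = (case (\<phi> q, k) of (y, k) \<Rightarrow> e (\<phi>' (inv_into W \<phi> y), \<tau> i j (inv_into W \<phi> y) k))"
        using q Tinv_H[OF i _ k, of q] chart_inv[OF c, of q] by (simp add: chart_map_def \<tau>_eq)
    qed auto
    moreover have "V \<inter> V' = above ?S" by (auto simp: above_def)
    ultimately show "smooth_on E E' (\<psi> ` (V \<inter> V')) (\<psi>' \<circ> inv_into V \<psi>)" by simp
  qed
qed

lemma smooth_map_p: "smooth_map total N p"
  unfolding smooth_map_def mtop_total
proof (intro conjI continuous_p, safe)
  fix V \<psi> E W' \<phi>' E' assume "(V, \<psi>, E) \<in> atlas total" and c': "(W', \<phi>', E') \<in> atlas N"
  then obtain i W \<phi> where i: "i \<in> I" and c: "(W, \<phi>, Rn n) \<in> atlas N" and [simp]: "V = above (U i \<inter> W)" "\<psi> = chart_map i \<phi>" "E = model i"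
    by (elim atlas_totalE)
  have [simp]: "E' = Rn n" by (rule chart_model[OF c'])
  let ?S = "(U i \<inter> W) \<inter> (U i \<inter> W')"
  have S: "openin (mtop N) ?S" using U_open[OF i] chart_open[OF c] chart_open[OF c'] by blast
  have "smooth_on (model i) (Rn n) (chart_map i \<phi> ` above ?S) (\<phi>' \<circ> p \<circ> inv_into (above (U i \<inter> W)) (chart_map i \<phi>))"
  proof (rule smooth_on_unpush[OF i c Banach_Rn S _ smooth_on_transition(1)[OF i i c c'[simplified] S order_refl]])
    fix q k assume q: "q \<in> ?S" and k: "k \<in> carrier (\<K> i)"
    have "inv_into (above (U i \<inter> W)) (chart_map i \<phi>) (e (\<phi> q, k)) = Tinv i q k"
      using q k by (intro inv_chart_map[OF i c order_refl]) auto
    then show "(\<phi>' \<circ> p \<circ> inv_into (above (U i \<inter> W)) (chart_map i \<phi>)) (e (\<phi> q, k))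
        = (case (\<phi> q, k) of (y, k) \<Rightarrow> \<phi>' (inv_into W \<phi> y))"
      using q Tinv_H[OF i _ k, of q] chart_inv[OF c, of q] by simp
  qed auto
  moreover have "V \<inter> p -` W' = above ?S" by (auto simp: above_def)
  ultimately show "smooth_on E E' (\<psi> ` (V \<inter> p -` W')) (\<phi>' \<circ> p \<circ> inv_into V \<psi>)" by simp
qed

lemma atlas_open_submfdE:
  assumes "(V, \<psi>, E) \<in> atlas (open_submfd M S)"
  obtains V' where "(V', \<psi>, E) \<in> atlas M" "V = V' \<inter> S"
  using assms by (auto simp: open_submfd_def)

lemma atlas_prod_space_mfdE:
  assumes "(V, \<psi>, E) \<in> atlas (prod_mfd M (space_mfd F))"
  obtains W \<phi> E' where "(W, \<phi>, E') \<in> atlas M" "V = W \<times> carrier F" "\<psi> = map_prod \<phi> id" "E = prod_space E' F"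
  using assms by (auto simp: prod_mfd_def space_mfd_def)

lemma mtop_cylinder: "mtop (prod_mfd (open_submfd N (U j)) (space_mfd (realify (\<K> j)))) = cyl j"
  by (simp add: prod_mfd_def open_submfd_def space_mfd_def cyl_def)

lemma diffeomorphism_triv:
  assumes j: "j \<in> I"
  shows "diffeomorphism (open_submfd total (above (U j))) (prod_mfd (open_submfd N (U j)) (space_mfd (realify (\<K> j)))) (triv j)"
    (is "diffeomorphism ?M ?P _")
proof -
  have mtopM: "mtop ?M = subtopology topH (above (U j))" by (simp add: open_submfd_def)
  have topM: "topspace (mtop ?M) = above (U j)" using topspace_topH above_H by (auto simp: mtopM)
  have homeo: "homeomorphic_maps (mtop ?M) (mtop ?P) (triv j) (untriv j)"
    unfolding mtopM mtop_cylinder by (rule homeomorphic_maps_triv[OF j])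
  define g where "g = inv_into (above (U j)) (triv j)"
  have g: "g (q, k) = Tinv j q k" if "q \<in> U j" "k \<in> carrier (\<K> j)" for q k
    using inv_triv[OF j that] by (simp add: g_def)
  have bij: "bij_betw (triv j) (topspace (mtop ?M)) (topspace (mtop ?P))"
    unfolding topM mtop_cylinder topspace_cyl[OF j] bij_betw_def using triv_inj[OF j] triv_image[OF j] by blast
  have "smooth_map ?M ?P (triv j)"
    unfolding smooth_map_def
  proof (intro conjI, goal_cases)
    case 1
    show ?case using homeo by (simp add: homeomorphic_maps_def)
  next
    case 2
    show ?case
    proof safe
      fix V \<psi> E V' \<psi>' E' assume V: "(V, \<psi>, E) \<in> atlas ?M" and V': "(V', \<psi>', E') \<in> atlas ?P"
      from V obtain V0 where V0: "(V0, \<psi>, E) \<in> atlas total" and [simp]: "V = V0 \<inter> above (U j)"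
        by (rule atlas_open_submfdE)
      from V0 obtain i W \<phi> where i: "i \<in> I" and c: "(W, \<phi>, Rn n) \<in> atlas N"
        and [simp]: "V0 = above (U i \<inter> W)" "\<psi> = chart_map i \<phi>" "E = model i"
        by (rule atlas_totalE)
      from V' obtain W0 \<phi>' E0 where W0: "(W0, \<phi>', E0) \<in> atlas (open_submfd N (U j))"
        and [simp]: "V' = W0 \<times> carrier (realify (\<K> j))" "\<psi>' = map_prod \<phi>' id" "E' = prod_space E0 (realify (\<K> j))"
        by (rule atlas_prod_space_mfdE)
      from W0 obtain W' where c': "(W', \<phi>', E0) \<in> atlas N" and [simp]: "W0 = W' \<inter> U j"
        by (rule atlas_open_submfdE)
      have [simp]: "E0 = Rn n" by (rule chart_model[OF c'])
      let ?S = "(U i \<inter> W) \<inter> (U j \<inter> W')"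
      have S: "openin (mtop N) ?S" using U_open[OF i] U_open[OF j] chart_open[OF c] chart_open[OF c'] by blast
      have Veq: "V = above ((U i \<inter> W) \<inter> U j)" by (auto simp: above_def)
      have "smooth_on (model i) (RK j) (chart_map i \<phi> ` above ?S) (map_prod \<phi>' id \<circ> triv j \<circ> inv_into V (chart_map i \<phi>))"
      proof (rule smooth_on_unpush[OF i c Banach_RK[OF j] S _ smooth_on_transition(2)[OF i j c c'[simplified] S order_refl]])
        fix q k assume q: "q \<in> ?S" and k: "k \<in> carrier (\<K> i)"
        have "inv_into V (chart_map i \<phi>) (e (\<phi> q, k)) = Tinv i q k"
          unfolding Veq using q k by (intro inv_chart_map[OF i c]) auto
        then show "(map_prod \<phi>' id \<circ> triv j \<circ> inv_into V (chart_map i \<phi>)) (e (\<phi> q, k))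
            = (case (\<phi> q, k) of (y, k) \<Rightarrow> (\<phi>' (inv_into W \<phi> y), \<tau> i j (inv_into W \<phi> y) k))"
          using q Tinv_H[OF i _ k, of q] chart_inv[OF c, of q] by (simp add: triv_def \<tau>_eq)
      qed auto
      moreover have "V \<inter> triv j -` V' = above ?S"
        using triv_closed[OF j] by (auto simp: above_def triv_def)
      ultimately show "smooth_on E E' (\<psi> ` (V \<inter> triv j -` V')) (\<psi>' \<circ> triv j \<circ> inv_into V \<psi>)" by simp
    qed
  qed
  moreover have "smooth_map ?P ?M g"
    unfolding smooth_map_def
  proof (intro conjI, goal_cases)
    case 1
    have "continuous_map (mtop ?P) (mtop ?M) (untriv j)" using homeo by (simp add: homeomorphic_maps_def)
    then show ?case
      by (rule continuous_map_eq) (auto simp: mtop_cylinder topspace_cyl[OF j] untriv_def g)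
  next
    case 2
    show ?case
    proof safe
      fix V \<psi> E V' \<psi>' E' assume V: "(V, \<psi>, E) \<in> atlas ?M" and V': "(V', \<psi>', E') \<in> atlas ?P"
      from V obtain V0 where V0: "(V0, \<psi>, E) \<in> atlas total" and [simp]: "V = V0 \<inter> above (U j)"
        by (rule atlas_open_submfdE)
      from V0 obtain i W \<phi> where i: "i \<in> I" and c: "(W, \<phi>, Rn n) \<in> atlas N"
        and [simp]: "V0 = above (U i \<inter> W)" "\<psi> = chart_map i \<phi>" "E = model i"
        by (rule atlas_totalE)
      from V' obtain W0 \<phi>' E0 where W0: "(W0, \<phi>', E0) \<in> atlas (open_submfd N (U j))"
        and [simp]: "V' = W0 \<times> carrier (realify (\<K> j))" "\<psi>' = map_prod \<phi>' id" "E' = prod_space E0 (realify (\<K> j))"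
        by (rule atlas_prod_space_mfdE)
      from W0 obtain W' where c': "(W', \<phi>', E0) \<in> atlas N" and [simp]: "W0 = W' \<inter> U j"
        by (rule atlas_open_submfdE)
      have [simp]: "E0 = Rn n" by (rule chart_model[OF c'])
      let ?S = "(U j \<inter> W') \<inter> (U i \<inter> W)"
      have S: "openin (mtop N) ?S" using U_open[OF i] U_open[OF j] chart_open[OF c] chart_open[OF c'] by blast
      have inj: "inj_on \<phi>' (W' \<inter> U j)" using chart_inj[OF c'] by (auto simp: inj_on_Int)
      have "smooth_on (RK j) (model i) (\<phi>' ` ?S \<times> carrier (\<K> j)) (\<lambda>(y, k). e (\<phi> (inv_into W' \<phi>' y), \<tau> j i (inv_into W' \<phi>' y) k))"
        by (rule smooth_on_transition_push[OF j i c'[simplified] c S order_refl])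
      then have "smooth_on (RK j) (model i) (\<phi>' ` ?S \<times> carrier (\<K> j)) (chart_map i \<phi> \<circ> g \<circ> inv_into V' (map_prod \<phi>' id))"
      proof (rule smooth_on_cong)
        fix z assume "z \<in> \<phi>' ` ?S \<times> carrier (\<K> j)"
        then obtain q k where z: "z = (\<phi>' q, k)" and q: "q \<in> ?S" and k: "k \<in> carrier (\<K> j)" by auto
        have "inv_into V' (map_prod \<phi>' id) (\<phi>' q, k) = (q, k)"
          using q k inv_into_map_prod_id[OF inj, of q k "carrier (\<K> j)"] by simp
        then show "(case z of (y, k) \<Rightarrow> e (\<phi> (inv_into W' \<phi>' y), \<tau> j i (inv_into W' \<phi>' y) k))
            = (chart_map i \<phi> \<circ> g \<circ> inv_into V' (map_prod \<phi>' id)) z"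
          using q k g[of q k] Tinv_H[OF j _ k, of q] chart_inv[OF c', of q] by (simp add: z chart_map_def \<tau>_eq)
      qed
      moreover have "map_prod \<phi>' id ` (V' \<inter> g -` V) = \<phi>' ` ?S \<times> carrier (\<K> j)"
      proof -
        have "z \<in> V' \<inter> g -` V \<longleftrightarrow> z \<in> ?S \<times> carrier (\<K> j)" for z
        proof (cases z)
          case (Pair q k)
          show ?thesis
          proof (cases "q \<in> U j \<and> k \<in> carrier (\<K> j)")
            case True
            then show ?thesis using g[of q k] Tinv_H[OF j, of q k] by (auto simp: Pair above_def)
          qed (auto simp: Pair)
        qed
        then have "V' \<inter> g -` V = ?S \<times> carrier (\<K> j)" by blast
        then show ?thesis unfolding \<open>V' \<inter> g -` V = ?S \<times> carrier (\<K> j)\<close>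
          using map_prod_surj_on[of \<phi>' ?S "\<phi>' ` ?S" id "carrier (\<K> j)" "carrier (\<K> j)"] by simp
      qed
      ultimately show "smooth_on E' E (\<psi>' ` (V' \<inter> g -` V)) (\<psi> \<circ> g \<circ> inv_into V' \<psi>')" by simp
    qed
  qed
  ultimately show ?thesis
    unfolding diffeomorphism_def topM g_def using bij by (simp add: topM)
qed

lemma smooth_hilbert_bundle_total: "smooth_hilbert_bundle total N H p I U \<K> T"
  unfolding smooth_hilbert_bundle_def
  using banach_manifold_total topspace_topH smooth_map_p diffeomorphism_triv
  by (auto simp: above_def triv_def)

end

theorem proposition2p1:
  fixes N :: "('n, nat \<Rightarrow> real) mfd"
    and n :: nat
    and H :: "'h set"
    and p :: "'h \<Rightarrow> 'n"
    and \<H> :: "'n \<Rightarrow> 'h hspace"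
    and I :: "'i set"
    and U :: "'i \<Rightarrow> 'n set"
    and \<K> :: "'i \<Rightarrow> 'k hspace"
    and T :: "'i \<Rightarrow> 'n \<Rightarrow> 'h \<Rightarrow> 'k"
  assumes manifold: "smooth_manifold n N"
    and "field": "hilbert_field H (topspace (mtop N)) p \<H>"
    and cover: "\<forall>i\<in>I. openin (mtop N) (U i)" "(\<Union>i\<in>I. U i) = topspace (mtop N)"
    and fibres: "\<forall>i\<in>I. hilbert_space (\<K> i)"
    and unitary: "\<forall>i\<in>I. \<forall>q\<in>U i. unitary_operator (\<H> q) (\<K> i) (T i q)"
    and universe: "\<exists>e :: (nat \<Rightarrow> real) \<times> 'k \<Rightarrow> 'm. inj e"
  shows "((\<exists>M :: ('h, 'm) mfd. smooth_hilbert_bundle M N H p I U \<K> T) \<longleftrightarrow>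
           (\<forall>i\<in>I. \<forall>j\<in>I. \<forall>x\<in>carrier (\<K> i). (\<lambda>q. transition \<H> \<K> T i j q x) \<in> Cinf N (U i \<inter> U j) (\<K> j))) \<and>
         ((\<forall>i\<in>I. \<forall>j\<in>I. \<forall>x\<in>carrier (\<K> i). (\<lambda>q. transition \<H> \<K> T i j q x) \<in> Cinf N (U i \<inter> U j) (\<K> j)) \<longleftrightarrow>
           (\<forall>i\<in>I. \<forall>j\<in>I. transition \<H> \<K> T i j \<in> Ainf N (U i \<inter> U j) (\<K> i) (\<K> j)))"
proof -
  interpret hilbert_bundle_data N n H p \<H> I U \<K> T
    using assms by unfold_locales auto
  obtain e :: "(nat \<Rightarrow> real) \<times> 'k \<Rightarrow> 'm" where e: "inj e" using universe by blast
  have b: "(\<forall>i\<in>I. \<forall>j\<in>I. \<forall>x\<in>carrier (\<K> i). (\<lambda>q. transition \<H> \<K> T i j q x) \<in> Cinf N (U i \<inter> U j) (\<K> j))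
      \<longleftrightarrow> (\<forall>i\<in>I. \<forall>j\<in>I. strongly_smooth i j)"
    by (simp add: strongly_smooth_def)
  have "\<exists>M :: ('h, 'm) mfd. smooth_hilbert_bundle M N H p I U \<K> T" if strong: "\<forall>i\<in>I. \<forall>j\<in>I. strongly_smooth i j"
  proof -
    interpret bundle_construction N n H p \<H> I U \<K> T e
      using e strong by unfold_locales auto
    show ?thesis using smooth_hilbert_bundle_total by blast
  qed
  moreover have "\<forall>i\<in>I. \<forall>j\<in>I. strongly_smooth i j" if "\<exists>M :: ('h, 'm) mfd. smooth_hilbert_bundle M N H p I U \<K> T"
    using that strongly_smooth_if_bundle by blast
  moreover have "(\<forall>i\<in>I. \<forall>j\<in>I. strongly_smooth i j) \<longleftrightarrow> (\<forall>i\<in>I. \<forall>j\<in>I. \<tau> i j \<in> Ainf N (U i \<inter> U j) (\<K> i) (\<K> j))"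
    using Ainf_if_strongly_smooth strongly_smooth_if_Ainf by meson
  ultimately show ?thesis unfolding b by meson
qed

end
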